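(* Let $n\ge2$, let $M=S^n$ be the unit sphere with the round metric, let $\gamma,\varepsilon>0$ and let $\Omega\subset M$ be a set of finite perimeter. Then $$E_{\gamma,\varepsilon}(\Omega)=\Big(1-\frac{\gamma}{\gamma_\varepsilon}\Big)\operatorname{Per}(\Omega)+2\gamma\int_0^\pi\Phi_\varepsilon(r)\,\big(c_\Omega'(r)-c_\Omega'(0)\big)\,dr ,$$ where $$E_{\gamma,\varepsilon}(\Omega)=\operatorname{Per}(\Omega)-\frac\gamma\varepsilon\int_{M\times M}K_\varepsilon(x,y)\,|\chi_\Omega(x)-\chi_\Omega(y)|\,dx\,dy .$$
   Context: $d$ is the geodesic distance, $dx$, $dy$ the Riemannian volume, and $\Delta$ the Laplace–Beltrami operator of the round metric. For $f\in L^1(M)$, $V[f]=\sup\{\int_Mf\operatorname{div}(X)\,dx: X$ a smooth vector field with $\|X(x)\|_{g_x}\le1$ for all $x\in M\}$; a measurable $\Omega\subset M$ has finite perimeter if $V[\chi_\Omega]<\infty$, and then $\operatorname{Per}(\Omega)=V[\chi_\Omega]$. The Helmholtz kernel $K_\varepsilon:M\times M\to\mathbb{R}$ is the unique distributional solution of $K_\varepsilon(\cdot,y)-\varepsilon^2\Delta K_\varepsilon(\cdot,y)=\delta_y$ in $M$ for each $y\in M$; it is smooth outside the diagonal and depends only on the distance, and one writes $K_\varepsilon(x,y)=K_\varepsilon(d(x,y))$. $\sigma_k$ is the $k$-dimensional volume of the Euclidean unit sphere $S^k$, and $k_n=\frac{2}{n-1}\frac{\sigma_{n-2}}{\sigma_{n-1}}$.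 The number $\gamma_\varepsilon$ is defined by $\frac1{\gamma_\varepsilon}=k_n\int_M\frac{d(x,y)}\varepsilon K_\varepsilon(x,y)\,dx$ for some $y\in M$ (the value does not depend on $y$). The integrated kernel is $\Phi_\varepsilon(r)=\frac{\sigma_{n-1}}\varepsilon\int_r^\pi K_\varepsilon(s)\sin(s)^{n-1}\,ds$ for $r\in(0,\pi)$. The autocorrelation function is $$c_\Omega(r)=\int_M\frac1{\sigma_{n-1}}\int_{S_xM}\chi_\Omega(x)\,\chi_\Omega(\exp_x(rw))\,dS_x(w)\,dx,$$ where $S_xM$ is the unit sphere in $T_xM$ with its surface measure $dS_x$. For $\Omega$ of finite perimeter $c_\Omega$ is Lipschitz; $c_\Omega'(r)$ is its almost everywhere defined derivative, and $c_\Omega'(0)$ its right-sided derivative at $0$ (which exists). *)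

theory Defs
  imports "HOL-Analysis.Analysis"
begin

text \<open>
  The sphere \<open>M = S\<^sup>n\<close> is \<^term>\<open>sphere 0 1\<close> in a Euclidean space \<open>'a\<close> of dimension \<open>n + 1\<close>,
  with the metric induced by the inner product of \<open>'a\<close>.
\<close>

abbreviation unit_sphere :: "'a::euclidean_space set" where
  "unit_sphere \<equiv> sphere 0 1"

definition tangent_space :: "'a::euclidean_space \<Rightarrow> 'a set" where
  "tangent_space x = {v. x \<bullet> v = 0}"

definition orthonormal_basis_of :: "'a::euclidean_space set \<Rightarrow> 'a set" where
  "orthonormal_basis_of V =
     (SOME B. B \<subseteq> V \<and> pairwise orthogonal B \<and> (\<forall>b\<in>B. norm b = 1) \<and> span B = V)"

text \<open>
  The exponential map and the geodesic distance of the round metric. Since \<^term>\<open>sgn v\<close> is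
  \<open>v / \<parallel>v\<parallel>\<close> for \<open>v \<noteq> 0\<close> and \<open>0\<close> for \<open>v = 0\<close>, the curve \<open>t \<mapsto> sphere_exp x (t v)\<close> is the great
  circle starting at \<open>x\<close> with velocity \<open>v\<close>.
\<close>

definition sphere_exp :: "'a::euclidean_space \<Rightarrow> 'a \<Rightarrow> 'a" where
  "sphere_exp x v = cos (norm v) *\<^sub>R x + sin (norm v) *\<^sub>R sgn v"

definition geodesic_dist :: "'a::euclidean_space \<Rightarrow> 'a \<Rightarrow> real" where
  "geodesic_dist x y = arccos (x \<bullet> y)"


subsection \<open>Volume measures\<close>

text \<open>Lebesgue measure of a linear subspace, transported from \<open>\<real>\<^sup>B\<close> along an orthonormal basis \<open>B\<close>
  (as \<^term>\<open>lborel\<close> itself is); it does not depend on the choice of the basis.\<close>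

definition subspace_lborel :: "'a::euclidean_space set \<Rightarrow> 'a measure" where
  "subspace_lborel V =
     distr (\<Pi>\<^sub>M b\<in>orthonormal_basis_of V. lborel) borel
       (\<lambda>f. \<Sum>b\<in>orthonormal_basis_of V. f b *\<^sub>R b)"

text \<open>
  The surface measure of the unit sphere of a linear subspace \<open>V\<close> of dimension \<open>m\<close>, in polar
  coordinates: the surface measure of \<open>A\<close> is \<open>m\<close> times the volume of the cone
  \<open>{t a | a \<in> A, 0 < t \<le> 1}\<close>. The measure is completed, so that the measurable sets are the
  Lebesgue measurable ones.
\<close>

definition surface_measure :: "'a::euclidean_space set \<Rightarrow> 'a measure" where
  "surface_measure V =
     completion (scale_measure (of_nat (dim V))
       (distr (restrict_space (subspace_lborel V) (V \<inter> cball 0 1 - {0}))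
          (restrict_space borel (V \<inter> unit_sphere)) sgn))"

text \<open>\<open>dx\<close> on \<open>M\<close>, and \<open>dS\<^sub>x\<close> on \<open>S\<^sub>xM\<close>.\<close>

definition sphere_vol :: "'a::euclidean_space measure" where
  "sphere_vol = surface_measure UNIV"

definition unit_tangent_vol :: "'a::euclidean_space \<Rightarrow> 'a measure" where
  "unit_tangent_vol x = surface_measure (tangent_space x)"

text \<open>\<open>\<sigma>\<^sub>k\<close>, the \<open>k\<close>-dimensional volume of \<open>S\<^sup>k\<close>, is \<open>k + 1\<close> times the volume of the unit ball
  of \<open>\<real>\<^sup>k\<^sup>+\<^sup>1\<close>.\<close>

definition sigma :: "nat \<Rightarrow> real" where
  "sigma k = real (k + 1) * unit_ball_vol (real (k + 1))"

definition k_const :: "nat \<Rightarrow> real" where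
  "k_const n = 2 / (real n - 1) * (sigma (n - 2) / sigma (n - 1))"


subsection \<open>Smoothness and differential operators\<close>

text \<open>\<open>C\<^sup>k\<close> on an open set, and smoothness on an arbitrary subset of a Euclidean space: existence
  of a \<open>C\<^sup>\<infinity>\<close> extension to an open neighbourhood. On an embedded submanifold the latter is the
  usual intrinsic smoothness.\<close>

primrec Ck_on_open ::
  "nat \<Rightarrow> 'a::euclidean_space set \<Rightarrow> ('a \<Rightarrow> 'b::euclidean_space) \<Rightarrow> bool" where
  "Ck_on_open 0 U f \<longleftrightarrow> continuous_on U f"
| "Ck_on_open (Suc k) U f \<longleftrightarrow>
     (\<forall>x\<in>U. f differentiable (at x)) \<and>
     (\<forall>v. Ck_on_open k U (\<lambda>x. frechet_derivative f (at x) v))"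

definition smooth_on :: "'a::euclidean_space set \<Rightarrow> ('a \<Rightarrow> 'b::euclidean_space) \<Rightarrow> bool" where
  "smooth_on A f \<longleftrightarrow>
     (\<exists>U g. open U \<and> A \<subseteq> U \<and> (\<forall>k. Ck_on_open k U g) \<and> (\<forall>x\<in>A. g x = f x))"

definition smooth_vector_field :: "('a::euclidean_space \<Rightarrow> 'a) \<Rightarrow> bool" where
  "smooth_vector_field X \<longleftrightarrow>
     smooth_on unit_sphere X \<and> (\<forall>x\<in>unit_sphere. X x \<in> tangent_space x)"

text \<open>The covariant derivative of the Levi-Civita connection is the tangential part of the
  derivative in the ambient space.\<close>

definition cov_deriv :: "('a::euclidean_space \<Rightarrow> 'a) \<Rightarrow> 'a \<Rightarrow> 'a \<Rightarrow> 'a" where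
  "cov_deriv X x v =
     (let D = vector_derivative (\<lambda>t. X (sphere_exp x (t *\<^sub>R v))) (at 0) in D - (D \<bullet> x) *\<^sub>R x)"

definition divergence :: "('a::euclidean_space \<Rightarrow> 'a) \<Rightarrow> 'a \<Rightarrow> real" where
  "divergence X x = (\<Sum>b\<in>orthonormal_basis_of (tangent_space x). cov_deriv X x b \<bullet> b)"

definition gradient :: "('a::euclidean_space \<Rightarrow> real) \<Rightarrow> 'a \<Rightarrow> 'a" where
  "gradient f x =
     (\<Sum>b\<in>orthonormal_basis_of (tangent_space x). deriv (\<lambda>t. f (sphere_exp x (t *\<^sub>R b))) 0 *\<^sub>R b)"

definition laplace_beltrami :: "('a::euclidean_space \<Rightarrow> real) \<Rightarrow> 'a \<Rightarrow> real" where
  "laplace_beltrami f = divergence (gradient f)"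


subsection \<open>Perimeter\<close>

definition variation :: "('a::euclidean_space \<Rightarrow> real) \<Rightarrow> ereal" where
  "variation f =
     (SUP X\<in>{X. smooth_vector_field X \<and> (\<forall>x\<in>unit_sphere. norm (X x) \<le> 1)}.
        ereal (\<integral>x. f x * divergence X x \<partial>sphere_vol))"

definition finite_perimeter :: "'a::euclidean_space set \<Rightarrow> bool" where
  "finite_perimeter \<Omega> \<longleftrightarrow> \<Omega> \<in> sets sphere_vol \<and> variation (indicator \<Omega>) < \<infinity>"

definition perimeter :: "'a::euclidean_space set \<Rightarrow> real" where
  "perimeter \<Omega> = real_of_ereal (variation (indicator \<Omega>))"


subsection \<open>Helmholtz kernel\<close>

text \<open>
  The distributional equation \<open>K(\<cdot>,y) - \<epsilon>\<^sup>2 \<Delta>K(\<cdot>,y) = \<delta>\<^sub>y\<close>, tested against smooth functions.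
  Smoothness off the diagonal selects the pointwise representative of the solution; the values on
  the diagonal are irrelevant.
\<close>

definition helmholtz_kernel :: "real \<Rightarrow> ('a::euclidean_space \<Rightarrow> 'a \<Rightarrow> real) \<Rightarrow> bool" where
  "helmholtz_kernel \<epsilon> K \<longleftrightarrow>
     (\<forall>y\<in>unit_sphere.
        integrable sphere_vol (\<lambda>x. K x y) \<and>
        (\<forall>\<phi>. smooth_on unit_sphere \<phi> \<longrightarrow>
           (\<integral>x. K x y * (\<phi> x - \<epsilon>\<^sup>2 * laplace_beltrami \<phi> x) \<partial>sphere_vol) = \<phi> y)) \<and>
     smooth_on {(x, y). x \<in> unit_sphere \<and> y \<in> unit_sphere \<and> x \<noteq> y} (\<lambda>(x, y). K x y)"

text \<open>The integral defining \<open>1 / \<gamma>\<^sub>\<epsilon>\<close> is taken with respect to an arbitrary base point, on which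
  it does not depend.\<close>

definition gamma_eps :: "nat \<Rightarrow> real \<Rightarrow> ('a::euclidean_space \<Rightarrow> 'a \<Rightarrow> real) \<Rightarrow> real" where
  "gamma_eps n \<epsilon> K =
     (let y = (SOME y. y \<in> unit_sphere) in
        1 / (k_const n * (\<integral>x. geodesic_dist x y / \<epsilon> * K x y \<partial>sphere_vol)))"

text \<open>Here \<open>\<kappa>\<close> is the kernel as a function of the distance, \<open>K(x,y) = \<kappa>(d(x,y))\<close>.\<close>

definition integrated_kernel :: "nat \<Rightarrow> real \<Rightarrow> (real \<Rightarrow> real) \<Rightarrow> real \<Rightarrow> real" where
  "integrated_kernel n \<epsilon> \<kappa> r =
     sigma (n - 1) / \<epsilon> * (LINT s:{r<..<pi}|lebesgue. \<kappa> s * sin s ^ (n - 1))"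


subsection \<open>Autocorrelation function and energy\<close>

definition autocorrelation :: "nat \<Rightarrow> 'a::euclidean_space set \<Rightarrow> real \<Rightarrow> real" where
  "autocorrelation n \<Omega> r =
     (\<integral>x. 1 / sigma (n - 1) *
        (\<integral>w. indicator \<Omega> x * indicator \<Omega> (sphere_exp x (r *\<^sub>R w)) \<partial>unit_tangent_vol x)
      \<partial>sphere_vol)"

definition energy ::
  "real \<Rightarrow> real \<Rightarrow> ('a::euclidean_space \<Rightarrow> 'a \<Rightarrow> real) \<Rightarrow> 'a set \<Rightarrow> real" where
  "energy \<gamma> \<epsilon> K \<Omega> =
     perimeter \<Omega> -
     \<gamma> / \<epsilon> * (\<integral>(x, y). K x y * \<bar>indicator \<Omega> x - indicator \<Omega> y\<bar> \<partial>(sphere_vol \<Otimes>\<^sub>M sphere_vol))"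

end

theory Submission
  imports Defs
begin

text \<open>
  Let \<open>\<mu>\<close> be the measure on the pairs \<open>(x, w)\<close> of orthogonal unit vectors, fibred over the sphere, and
  \<open>\<phi>\<^sub>r(x, w) = (cos r x + sin r w, cos r w - sin r x)\<close> the geodesic flow. It preserves \<open>\<mu>\<close>, because \<open>\<mu>\<close>
  is the only measure of its mass that is invariant under the orthogonal group, which acts transitively.
  In polar coordinates the double integral of the energy becomes
  \<open>\<integral> \<kappa>(r) sin(r)\<^bsup>n-1\<^esup> D(r) dr\<close>, where \<open>D(r) = \<integral> |\<chi>(\<phi>\<^sub>r p) - \<chi>(p)| d\<mu>(p) = 2 \<sigma>\<^sub>n\<^sub>-\<^sub>1 (c(0) - c(r))\<close> and
  \<open>\<chi>\<close> and \<open>c\<close> are the indicator and the autocorrelation function of \<open>\<Omega>\<close>.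

  For a polynomial \<open>\<eta>\<close> on the pairs, the vector field \<open>X\<^sub>\<eta>(x) = \<integral> \<eta>(x, w) w dw\<close> is smooth, its divergence is the
  fibre integral of the derivative of \<open>\<eta>\<close> along the flow, and \<open>|X\<^sub>\<eta>| \<le> k\<^sub>n \<sigma>\<^sub>n\<^sub>-\<^sub>1 sup |\<eta>|\<close>. Hence
  \<open>|(d/dt) \<integral> \<chi>(x) \<eta>(\<phi>\<^sub>-\<^sub>t(x, w)) d\<mu>| \<le> k\<^sub>n \<sigma>\<^sub>n\<^sub>-\<^sub>1 Per(\<Omega>)\<close> if \<open>|\<eta>| \<le> 1\<close>, and by duality
  \<open>D(r) \<le> k\<^sub>n \<sigma>\<^sub>n\<^sub>-\<^sub>1 Per(\<Omega>) r\<close>. Conversely, a field \<open>Y\<close> that almost attains the perimeter is approximated by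
  \<open>X\<^sub>\<eta> / (k\<^sub>n \<sigma>\<^sub>n\<^sub>-\<^sub>1)\<close> with \<open>\<eta>\<close> close to the sign of \<open>w \<bullet> Y(x)\<close>. So \<open>c\<close> is Lipschitz with
  \<open>c'(0) = - k\<^sub>n Per(\<Omega>) / 2\<close>. Exchanging the integrals turns \<open>\<integral> \<Phi>(r) (c'(r) - c'(0)) dr\<close> into a multiple of
  \<open>\<integral> \<kappa>(s) sin(s)\<^bsup>n-1\<^esup> (c(s) - c(0) - s c'(0)) ds\<close>, whose last term is the multiple \<open>\<gamma> / \<gamma>\<^sub>\<epsilon>\<close> of the perimeter.
\<close>

text \<open>The perimeter is given only as a supremum over smooth vector fields, so nothing is known
  about \<chi> itself, and its difference quotients are accessible only through test functions.
  Polynomials suit this for two reasons: the flow is the restriction of a linear map of the ambient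
  pairs, so composing with it yields polynomials again; and their fibre integrals agree on the
  sphere with polynomials in x, which settles smoothness of the fields. The factor
  \<open>k_const n * sigma (n - 1)\<close> is the integral of \<bar>w \<bullet> e\<bar> over the
  unit tangent sphere for a unit tangent vector e, that is, twice the volume of the unit ball of
  dimension n - 1. As the derivative of c exists only almost everywhere, the exchange of integrals
  requires that a Lipschitz function is the integral of its derivative. Finally, \<Omega> is merely
  Lebesgue measurable. It is replaced by a Borel set up to a null set, and invariance of \<mu> under
  the flow ensures that the far endpoints of geodesics also avoid this null set almost
  surely.\<close>

section \<open>Uniqueness of translation-invariant measures and orthogonal invariance of Lebesgue
  measure\<close>

lemma lborel_distr_minus: "distr lborel borel (\<lambda>y. x - y) = (lborel :: 'a::euclidean_space measure)"
proof -
  have "lborel = density (distr lborel borel (\<lambda>y::'a. x + (-1) *\<^sub>R y)) (\<lambda>_. ennreal (\<bar>-1\<bar>^DIM('a)))"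
    using lborel_affine[of "-1" x] by simp
  then show ?thesis by (simp add: density_1)
qed

text \<open>Uniqueness of Haar measure on a Euclidean space. The product measure of the pairs (x, y)
  with x in A and y + x in B is evaluated in two ways: shifting x by invariance of M and then
  reflecting y by invariance of \<open>lborel\<close> exchanges the roles of A and B. The unit ball,
  of positive finite volume, fixes the scale.\<close>

lemma translation_invariant_measure_unique:
  fixes M :: "'a::euclidean_space measure"
  assumes sets_M [measurable_cong]: "sets M = sets borel" and "sigma_finite_measure M"
    and inv: "\<And>c. distr M borel ((+) c) = M"
    and ball: "emeasure M (ball 0 1) = emeasure lborel (ball 0 1 :: 'a set)"
  shows "M = lborel"
proof -
  interpret M: sigma_finite_measure M by fact
  interpret P: pair_sigma_finite M lborel ..
  have shift: "(\<integral>\<^sup>+x. g (y + x) \<partial>M) = (\<integral>\<^sup>+x. g x \<partial>M)" if [measurable]: "g \<in> borel_measurable borel" for g y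
  proof -
    have "(\<integral>\<^sup>+x. g x \<partial>M) = (\<integral>\<^sup>+x. g x \<partial>distr M borel ((+) y))" by (simp add: inv)
    also have "\<dots> = (\<integral>\<^sup>+x. g (y + x) \<partial>M)" by (intro nn_integral_distr) measurable
    finally show ?thesis ..
  qed
  have refl: "(\<integral>\<^sup>+y. g (x - y) \<partial>lborel) = (\<integral>\<^sup>+y. g y \<partial>lborel)"
    if [measurable]: "g \<in> borel_measurable borel" for g and x :: 'a
  proof -
    have "(\<integral>\<^sup>+y. g y \<partial>lborel) = (\<integral>\<^sup>+y. g y \<partial>distr lborel borel (\<lambda>y. x - y))" by (simp add: lborel_distr_minus)
    also have "\<dots> = (\<integral>\<^sup>+y. g (x - y) \<partial>lborel)" by (intro nn_integral_distr) measurable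
    finally show ?thesis ..
  qed
  have lshift: "(\<integral>\<^sup>+y. g (y + x) \<partial>lborel) = (\<integral>\<^sup>+y. g y \<partial>lborel)"
    if [measurable]: "g \<in> borel_measurable borel" for g and x :: 'a
  proof -
    have "(\<integral>\<^sup>+y. g y \<partial>lborel) = (\<integral>\<^sup>+y. g y \<partial>distr lborel borel ((+) x))" by (simp add: lborel_distr_plus)
    also have "\<dots> = (\<integral>\<^sup>+y. g (x + y) \<partial>lborel)" by (intro nn_integral_distr) measurable
    finally show ?thesis by (simp add: add.commute)
  qed
  have key: "emeasure M A * emeasure lborel B = emeasure M B * emeasure lborel A"
    if [measurable]: "A \<in> sets borel" "B \<in> sets borel" for A B
  proof -
    have "emeasure M A * emeasure lborel B = (\<integral>\<^sup>+x. indicator A x * emeasure lborel B \<partial>M)"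
      by (simp add: nn_integral_multc)
    also have "\<dots> = (\<integral>\<^sup>+x. \<integral>\<^sup>+y. indicator A x * indicator B (y + x) \<partial>lborel \<partial>M)"
      using lshift[of "indicator B"] by (simp add: nn_integral_cmult)
    also have "\<dots> = (\<integral>\<^sup>+y. \<integral>\<^sup>+x. indicator A x * indicator B (y + x) \<partial>M \<partial>lborel)"
      by (rule P.Fubini'[symmetric]) measurable
    also have "\<dots> = (\<integral>\<^sup>+y. \<integral>\<^sup>+x. indicator A (x - y) * indicator B x \<partial>M \<partial>lborel)"
    proof (rule nn_integral_cong)
      fix y
      show "(\<integral>\<^sup>+x. indicator A x * indicator B (y + x) \<partial>M) = (\<integral>\<^sup>+x. indicator A (x - y) * indicator B x \<partial>M)"
        using shift[where g="\<lambda>x. indicator A (x - y) * indicator B x" and y=y] by simp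
    qed
    also have "\<dots> = (\<integral>\<^sup>+x. \<integral>\<^sup>+y. indicator A (x - y) * indicator B x \<partial>lborel \<partial>M)"
      by (rule P.Fubini') measurable
    also have "\<dots> = (\<integral>\<^sup>+x. emeasure lborel A * indicator B x \<partial>M)"
      using refl[of "indicator A"] by (simp add: nn_integral_multc)
    also have "\<dots> = emeasure lborel A * emeasure M B"
      by (simp add: nn_integral_cmult)
    also have "\<dots> = emeasure M B * emeasure lborel A" by (rule mult.commute)
    finally show ?thesis .
  qed
  have pos: "emeasure lborel (ball 0 1 :: 'a set) \<noteq> 0"
    using unit_ball_vol_pos[OF of_nat_0_le_iff, of "DIM('a)"]
    by (metis emeasure_ball ennreal_eq_0_iff mult.right_neutral not_le power_one zero_le_one)
  have fin: "emeasure lborel (ball 0 1 :: 'a set) \<noteq> \<infinity>"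
    using emeasure_lborel_ball_finite[of "0::'a" 1] by simp
  show ?thesis
  proof (rule measure_eqI)
    fix A assume "A \<in> sets M"
    then have "emeasure M A * emeasure lborel (ball 0 1 :: 'a set) = emeasure lborel A * emeasure lborel (ball 0 1 :: 'a set)"
      using key[of A "ball 0 1"] ball by (simp add: sets_M mult.commute)
    then show "emeasure M A = emeasure lborel A"
      using pos fin by (metis ennreal_mult_cancel_left mult.commute infinity_ennreal_def)
  qed (simp add: sets_M)
qed

text \<open>Translating by c after f is the same as applying f after translating by the preimage of
  c. So the image measure is translation invariant, and f preserves the unit ball.\<close>

lemma lborel_distr_orthogonal:
  fixes f :: "'a::euclidean_space \<Rightarrow> 'a"
  assumes f: "orthogonal_transformation f"
  shows "distr lborel borel f = lborel"
proof (rule translation_invariant_measure_unique)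
  have lin: "linear f" and bij: "bij f"
    using f by (auto simp: orthogonal_transformation_linear orthogonal_transformation_bij)
  have [measurable]: "f \<in> borel_measurable borel"
    using lin by (intro borel_measurable_continuous_onI linear_continuous_on) (simp add: linear_conv_bounded_linear)
  obtain g where g: "orthogonal_transformation g" "\<And>x. f (g x) = x" "\<And>x. g (f x) = x"
    using orthogonal_transformation_inv[OF f] bij
    by (metis bij_is_inj bij_is_surj inv_f_f surj_f_inv_f)
  have [measurable]: "g \<in> borel_measurable borel"
    using orthogonal_transformation_linear[OF g(1)]
    by (intro borel_measurable_continuous_onI linear_continuous_on) (simp add: linear_conv_bounded_linear)
  show "sigma_finite_measure (distr lborel borel f)"
  proof
    show "\<exists>A. countable A \<and> A \<subseteq> sets (distr lborel borel f) \<and> \<Union>A = space (distr lborel borel f)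
       \<and> (\<forall>a\<in>A. emeasure (distr lborel borel f) a \<noteq> \<infinity>)"
    proof (intro exI conjI ballI)
      show "countable (range (\<lambda>n::nat. ball 0 (real n) :: 'a set))" by simp
      show "\<Union>(range (\<lambda>n::nat. ball 0 (real n) :: 'a set)) = space (distr lborel borel f)"
        by (auto simp: reals_Archimedean2)
      fix a assume "a \<in> range (\<lambda>n::nat. ball 0 (real n) :: 'a set)"
      then obtain n :: nat where "a = ball 0 n" by auto
      moreover have "f -` ball 0 n = ball 0 n"
        by (auto simp: orthogonal_transformation_norm[OF f])
      ultimately show "emeasure (distr lborel borel f) a \<noteq> \<infinity>"
        using emeasure_lborel_ball_finite[of "0::'a" n] by (simp add: emeasure_distr)
    qed auto
  qed
  show "distr (distr lborel borel f) borel ((+) c) = distr lborel borel f" for c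
  proof -
    have "(+) c \<circ> f = f \<circ> (+) (g c)"
      by (auto simp: linear_add[OF lin] g)
    then have "distr (distr lborel borel f) borel ((+) c) = distr (distr lborel borel ((+) (g c))) borel f"
      by (simp add: distr_distr)
    then show ?thesis by (simp add: lborel_distr_plus)
  qed
  have "f -` ball 0 1 = ball 0 1"
    by (auto simp: orthogonal_transformation_norm[OF f])
  then show "emeasure (distr lborel borel f) (ball 0 1) = emeasure lborel (ball 0 1 :: 'a set)"
    by (simp add: emeasure_distr)
qed simp

subsection \<open>Lebesgue measure on the span of an orthonormal set\<close>

definition orthonormal :: "'a::euclidean_space set \<Rightarrow> bool" where
  "orthonormal B \<longleftrightarrow> finite B \<and> pairwise orthogonal B \<and> (\<forall>b\<in>B. norm b = 1)"

text \<open>This is \<open>subspace_lborel\<close> with the basis as a parameter, so that a basis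
  adapted to given unit vectors can replace the one picked by choice.\<close>

definition onb_lborel :: "'a::euclidean_space set \<Rightarrow> 'a measure" where
  "onb_lborel B = distr (\<Pi>\<^sub>M b\<in>B. lborel) borel (\<lambda>f. \<Sum>b\<in>B. f b *\<^sub>R b)"

lemma space_onb_lborel [simp]: "space (onb_lborel B) = UNIV"
  and sets_onb_lborel [simp, measurable_cong]: "sets (onb_lborel B) = sets borel"
  by (simp_all add: onb_lborel_def)

interpretation lborels: product_sigma_finite "\<lambda>_::'a::euclidean_space. lborel :: real measure"
  by standard

lemma nn_integral_onb_lborel:
  assumes [measurable]: "h \<in> borel_measurable borel"
  shows "(\<integral>\<^sup>+v. h v \<partial>onb_lborel B) = (\<integral>\<^sup>+f. h (\<Sum>b\<in>B. f b *\<^sub>R b) \<partial>(\<Pi>\<^sub>M b\<in>B. lborel))"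
  unfolding onb_lborel_def by (rule nn_integral_distr) measurable

lemma sum_if_distinct: "finite B \<Longrightarrow> x \<notin> B \<Longrightarrow> (\<Sum>b\<in>B. (if b = x then t else f b) *\<^sub>R b) = (\<Sum>b\<in>B. f b *\<^sub>R b)"
  by (rule sum.cong) auto

lemma norm_onb_sum:
  assumes "orthonormal B"
  shows "norm (\<Sum>b\<in>B. f b *\<^sub>R b) = sqrt (\<Sum>b\<in>B. (f b)\<^sup>2)"
proof -
  have "(norm (\<Sum>b\<in>B. f b *\<^sub>R b))\<^sup>2 = (\<Sum>b\<in>B. (f b)\<^sup>2)"
    using assms norm_sum_Pythagorean[of B "\<lambda>b. f b *\<^sub>R b"]
    by (auto simp: orthonormal_def power_mult_distrib pairwise_def orthogonal_def)
  then show ?thesis by (metis norm_ge_zero real_sqrt_unique)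
qed

lemma emeasure_onb_lborel_cball:
  assumes B: "orthonormal B" and "r > 0"
  shows "emeasure (onb_lborel B) (cball 0 r) = ennreal (unit_ball_vol (real (card B)) * r ^ card B)"
proof -
  have "emeasure (onb_lborel B) (cball 0 r) =
      emeasure (\<Pi>\<^sub>M b\<in>B. lborel) ({f. sqrt (\<Sum>b\<in>B. (f b)\<^sup>2) \<le> r} \<inter> space (\<Pi>\<^sub>M b\<in>B. lborel))"
    unfolding onb_lborel_def
    by (subst emeasure_distr) (auto simp: norm_onb_sum[OF B] intro!: arg_cong[where f="emeasure _"])
  also have "\<dots> = ennreal (unit_ball_vol (real (card B)) * r ^ card B)"
    by (rule emeasure_cball_aux) (use assms in \<open>auto simp: orthonormal_def\<close>)
  finally show ?thesis .
qed

lemma sigma_finite_onb_lborel: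
  assumes B: "orthonormal B"
  shows "sigma_finite_measure (onb_lborel B)"
proof -
  have fin: "finite B" using B by (simp add: orthonormal_def)
  show ?thesis
  proof
    show "\<exists>A. countable A \<and> A \<subseteq> sets (onb_lborel B) \<and> \<Union>A = space (onb_lborel B)
       \<and> (\<forall>a\<in>A. emeasure (onb_lborel B) a \<noteq> \<infinity>)"
    proof (intro exI conjI ballI)
      show "countable (range (\<lambda>n::nat. cball 0 (real (Suc n)) :: 'a set))" by simp
      show "\<Union>(range (\<lambda>n::nat. cball 0 (real (Suc n)) :: 'a set)) = space (onb_lborel B)"
      proof -
        have "\<exists>n. norm x \<le> real (Suc n)" for x :: 'a
          using real_arch_simple[of "norm x"] by (metis dual_order.trans of_nat_le_iff le_SucI order_refl)
        then show ?thesis by (auto simp del: of_nat_Suc)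
      qed
      fix a assume "a \<in> range (\<lambda>n::nat. cball 0 (real (Suc n)) :: 'a set)"
      then obtain n :: nat where a: "a = cball 0 (real (Suc n))" by auto
      have "emeasure (onb_lborel B) a = ennreal (unit_ball_vol (real (card B)) * real (Suc n) ^ card B)"
        unfolding a by (rule emeasure_onb_lborel_cball[OF B]) simp
      then show "emeasure (onb_lborel B) a \<noteq> \<infinity>" by simp
    qed auto
  qed
qed

text \<open>Fubini in the coordinate of one basis vector. It splits the axis x off the whole space,
  and later one tangent direction off a tangent space.\<close>

lemma nn_integral_onb_lborel_insert:
  assumes B: "orthonormal (insert x B)" and x: "x \<notin> B" and [measurable]: "h \<in> borel_measurable borel"
  shows "(\<integral>\<^sup>+z. h z \<partial>onb_lborel (insert x B)) = (\<integral>\<^sup>+t. \<integral>\<^sup>+v. h (t *\<^sub>R x + v) \<partial>onb_lborel B \<partial>lborel)"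
proof -
  have fin: "finite B" using B by (simp add: orthonormal_def)
  have "(\<integral>\<^sup>+z. h z \<partial>onb_lborel (insert x B)) =
    (\<integral>\<^sup>+f. h (\<Sum>b\<in>insert x B. f b *\<^sub>R b) \<partial>(\<Pi>\<^sub>M b\<in>insert x B. lborel))"
    by (rule nn_integral_onb_lborel) measurable
  also have "\<dots> = (\<integral>\<^sup>+t. \<integral>\<^sup>+f. h (\<Sum>b\<in>insert x B. (f(x := t)) b *\<^sub>R b) \<partial>(\<Pi>\<^sub>M b\<in>B. lborel) \<partial>lborel)"
    using fin x by (intro lborels.product_nn_integral_insert_rev) measurable
  also have "\<dots> = (\<integral>\<^sup>+t. \<integral>\<^sup>+v. h (t *\<^sub>R x + v) \<partial>onb_lborel B \<partial>lborel)"
    using fin x by (simp add: nn_integral_onb_lborel sum_if_distinct)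
  finally show ?thesis .
qed

lemma AE_onb_lborel_span: "finite B \<Longrightarrow> AE v in onb_lborel B. v \<in> span B"
  unfolding onb_lborel_def
  by (subst AE_distr_iff) (measurable, intro AE_I2 span_sum span_scale span_base)

lemma onb_lborel_translate:
  assumes B: "orthonormal B"
  shows "distr (onb_lborel B) borel ((+) (\<Sum>b\<in>B. c b *\<^sub>R b)) = onb_lborel B"
proof -
  have fin: "finite B" using B by (simp add: orthonormal_def)
  \<comment> \<open>Translation in coordinates; restricting the function to B keeps it in the
    product space.\<close>
  define T where "T f = (\<lambda>b\<in>B. c b + f b)" for f :: "'a \<Rightarrow> real"
  have [measurable]: "T \<in> (\<Pi>\<^sub>M b\<in>B. lborel) \<rightarrow>\<^sub>M (\<Pi>\<^sub>M b\<in>B. lborel)"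
    unfolding T_def by measurable
  have T: "distr (\<Pi>\<^sub>M b\<in>B. lborel) (\<Pi>\<^sub>M b\<in>B. lborel) T = (\<Pi>\<^sub>M b\<in>B. lborel)"
  proof (rule lborels.PiM_eqI)
    fix A :: "'a \<Rightarrow> real set" assume A: "\<And>i. i \<in> B \<Longrightarrow> A i \<in> sets lborel"
    have "T -` (Pi\<^sub>E B A) \<inter> space (\<Pi>\<^sub>M b\<in>B. lborel) = Pi\<^sub>E B (\<lambda>b. (+) (c b) -` A b)"
      by (auto simp: T_def space_PiM PiE_iff)
    moreover have [measurable]: "(+) (c b) -` A b \<in> sets lborel" if "b \<in> B" for b
      using measurable_sets[of "(+) (c b)" borel borel "A b"] A[OF that] by simp
    moreover have "emeasure lborel ((+) (c b) -` A b) = emeasure lborel (A b)" if "b \<in> B" for b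
      using A[OF that] emeasure_distr[of "(+) (c b)" lborel borel "A b"] by (simp add: lborel_distr_plus)
    ultimately show "emeasure (distr (\<Pi>\<^sub>M b\<in>B. lborel) (\<Pi>\<^sub>M b\<in>B. lborel) T) (Pi\<^sub>E B A)
        = (\<Prod>i\<in>B. emeasure lborel (A i))"
      using A fin by (subst emeasure_distr) (auto intro!: sets_PiM_I_finite simp: lborels.emeasure_PiM)
  qed (use fin in auto)
  have "distr (onb_lborel B) borel ((+) (\<Sum>b\<in>B. c b *\<^sub>R b)) =
      distr (\<Pi>\<^sub>M b\<in>B. lborel) borel (\<lambda>f. (\<Sum>b\<in>B. T f b *\<^sub>R b))"
    unfolding onb_lborel_def
    by (subst distr_distr) (auto simp: o_def T_def scaleR_add_left sum.distrib intro!: distr_cong)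
  also have "\<dots> = distr (distr (\<Pi>\<^sub>M b\<in>B. lborel) (\<Pi>\<^sub>M b\<in>B. lborel) T) borel (\<lambda>f. (\<Sum>b\<in>B. f b *\<^sub>R b))"
    by (subst distr_distr) (auto simp: o_def)
  finally show ?thesis by (simp add: T onb_lborel_def)
qed

text \<open>The image measure is translation invariant, so its value on the open unit ball decides.
  Volumes are known for closed balls, which therefore exhaust the open one.\<close>

lemma onb_lborel_eq_lborel:
  fixes B :: "'a::euclidean_space set"
  assumes B: "orthonormal B" and "span B = UNIV"
  shows "onb_lborel B = lborel"
proof (rule translation_invariant_measure_unique)
  have fin: "finite B" using B by (simp add: orthonormal_def)
  show "sigma_finite_measure (onb_lborel B)" by (rule sigma_finite_onb_lborel[OF B])
  have "independent B"
    using B pairwise_orthogonal_independent[of B] by (force simp: orthonormal_def)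
  then have card: "card B = DIM('a)"
    using assms(2) by (metis dim_UNIV dim_eq_card_independent dim_span)
  show "distr (onb_lborel B) borel ((+) c) = onb_lborel B" for c
  proof -
    have "c = (\<Sum>b\<in>B. (c \<bullet> b) *\<^sub>R b)"
      using orthonormal_basis_expand[of B c] B assms(2) by (simp add: orthonormal_def)
    then show ?thesis using onb_lborel_translate[OF B, of "\<lambda>b. c \<bullet> b"] by simp
  qed
  have cb: "emeasure (onb_lborel B) (cball 0 r) = emeasure lborel (cball 0 r :: 'a set)" if "r > 0" for r
    using that by (simp add: emeasure_onb_lborel_cball[OF B] card emeasure_cball)
  \<comment> \<open>The offset 2 makes the radius positive already for n = 0, as the volume formula
    demands.\<close>
  have "(\<Union>n. cball 0 (1 - 1 / real (Suc (Suc n)))) = (ball 0 1 :: 'a set)"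
  proof safe
    fix x :: 'a assume "x \<in> ball 0 1"
    then obtain n where "1 / real (Suc n) < 1 - norm x"
      by (metis diff_gt_0_iff_gt mem_ball_0 nat_approx_posE)
    moreover have "1 / real (Suc (Suc n)) \<le> 1 / real (Suc n)" by (simp add: frac_le)
    ultimately show "x \<in> (\<Union>n. cball 0 (1 - 1 / real (Suc (Suc n))))"
      by (intro UN_I[of n]) auto
  next
    fix x :: 'a and n :: nat assume "x \<in> cball 0 (1 - 1 / real (Suc (Suc n)))"
    then have "norm x \<le> 1 - 1 / real (Suc (Suc n))" by simp
    moreover have "1 / real (Suc (Suc n)) > 0" by simp
    ultimately show "x \<in> ball 0 1" unfolding mem_ball_0 by linarith
  qed
  moreover have "incseq (\<lambda>n. cball 0 (1 - 1 / real (Suc (Suc n))) :: 'a set)"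
    by (intro incseq_SucI) (auto intro!: subset_cball simp: frac_le simp del: of_nat_Suc)
  moreover have "emeasure (onb_lborel B) (cball 0 (1 - 1 / real (Suc (Suc n)))) = emeasure lborel (cball 0 (1 - 1 / real (Suc (Suc n))) :: 'a set)" for n
    by (rule cb) simp
  ultimately show "emeasure (onb_lborel B) (ball 0 1) = emeasure lborel (ball 0 1 :: 'a set)"
    using SUP_emeasure_incseq[of "\<lambda>n. cball 0 (1 - 1 / real (Suc (Suc n)))" "onb_lborel B"]
      SUP_emeasure_incseq[of "\<lambda>n. cball 0 (1 - 1 / real (Suc (Suc n))) :: 'a set" lborel]
    by (simp add: image_subset_iff del: of_nat_Suc)
qed simp

text \<open>
  The sphere measures are images of Lebesgue measure on the whole space; for the unit tangent sphere
  at \<open>x\<close> the ball of the tangent space is thickened to a cylinder of height 1 around the axis \<open>x\<close>.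
  No basis of the tangent space is chosen, so integrals over the unit tangent sphere are Borel
  functions of \<open>x\<close>.
\<close>

definition proj_perp :: "'a::euclidean_space \<Rightarrow> 'a \<Rightarrow> 'a" where
  "proj_perp x z = z - (z \<bullet> x) *\<^sub>R x"

definition cyl :: "'a::euclidean_space \<Rightarrow> 'a set" where
  "cyl x = {z. \<bar>z \<bullet> x\<bar> \<le> 1 / 2 \<and> proj_perp x z \<noteq> 0 \<and> norm (proj_perp x z) \<le> 1}"

definition sphV :: "'a::euclidean_space measure" where
  "sphV = distr (density lborel (\<lambda>z. of_nat DIM('a) * indicator {z. z \<noteq> 0 \<and> norm z \<le> 1} z)) borel sgn"

definition tangV :: "'a::euclidean_space \<Rightarrow> 'a measure" where
  "tangV x = distr (density lborel (\<lambda>z. of_nat (DIM('a) - 1) * indicator (cyl x) z)) borel (\<lambda>z. sgn (proj_perp x z))"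

lemma proj_perp_measurable [measurable]:
  "(\<lambda>p. proj_perp (fst p) (snd p)) \<in> borel_measurable (borel \<Otimes>\<^sub>M borel)"
  "proj_perp x \<in> borel_measurable borel"
  unfolding proj_perp_def by measurable

lemma proj_perp_measurable2 [measurable (raw)]:
  assumes [measurable]: "f \<in> borel_measurable M" "g \<in> borel_measurable M"
  shows "(\<lambda>x. proj_perp (f x) (g x)) \<in> borel_measurable M"
  unfolding proj_perp_def by measurable

lemma sgn_measurable [measurable]: "(sgn :: 'a::euclidean_space \<Rightarrow> 'a) \<in> borel_measurable borel"
proof -
  have "(sgn :: 'a \<Rightarrow> 'a) = (\<lambda>x. x /\<^sub>R norm x)" by (auto simp: sgn_div_norm)
  then show ?thesis by simp
qed

lemma cyl_measurable [measurable]: "cyl x \<in> sets borel"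
  unfolding cyl_def by measurable

lemma cyl_measurable2 [measurable (raw)]:
  assumes [measurable]: "f \<in> borel_measurable M" "g \<in> borel_measurable M"
  shows "Measurable.pred M (\<lambda>x. g x \<in> cyl (f x))"
  unfolding cyl_def mem_Collect_eq by measurable

lemma space_sphV [simp]: "space sphV = UNIV" and sets_sphV [simp, measurable_cong]: "sets sphV = sets borel"
  and space_tangV [simp]: "space (tangV x) = UNIV" and sets_tangV [simp, measurable_cong]: "sets (tangV x) = sets borel"
  by (simp_all add: sphV_def tangV_def)

lemma nn_integral_sphV:
  assumes [measurable]: "g \<in> borel_measurable borel"
  shows "(\<integral>\<^sup>+y. g y \<partial>sphV) =
    (\<integral>\<^sup>+z. of_nat DIM('a) * indicator {z. z \<noteq> 0 \<and> norm z \<le> 1} z * g (sgn z) \<partial>(lborel :: 'a::euclidean_space measure))"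
  unfolding sphV_def by (subst nn_integral_distr) (auto simp: nn_integral_density)

lemma nn_integral_tangV:
  assumes [measurable]: "g \<in> borel_measurable borel"
  shows "(\<integral>\<^sup>+w. g w \<partial>tangV x) =
    (\<integral>\<^sup>+z. of_nat (DIM('a) - 1) * indicator (cyl x) z * g (sgn (proj_perp x z)) \<partial>(lborel :: 'a::euclidean_space measure))"
  unfolding tangV_def by (subst nn_integral_distr) (auto simp: nn_integral_density)

lemma orthonormal_basis_of:
  assumes "subspace S"
  shows "orthonormal (orthonormal_basis_of S)" "span (orthonormal_basis_of S) = S"
    "card (orthonormal_basis_of S) = dim S" "orthonormal_basis_of S \<subseteq> S"
proof -
  obtain B where B: "B \<subseteq> S" "pairwise orthogonal B" "\<And>x. x \<in> B \<Longrightarrow> norm x = 1"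
     "independent B" "card B = dim S" "span B = S"
    using orthonormal_basis_subspace[OF assms] by metis
  let ?P = "\<lambda>B. B \<subseteq> S \<and> pairwise orthogonal B \<and> (\<forall>b\<in>B. norm b = 1) \<and> span B = S"
  have "?P B" using B by auto
  then have P: "?P (orthonormal_basis_of S)"
    unfolding orthonormal_basis_of_def by (rule someI[where P="?P"])
  then have ind: "independent (orthonormal_basis_of S)"
    using pairwise_orthogonal_independent[of "orthonormal_basis_of S"] by force
  then show "orthonormal (orthonormal_basis_of S)"
    using P by (auto simp: orthonormal_def independent_imp_finite)
  show "span (orthonormal_basis_of S) = S" "orthonormal_basis_of S \<subseteq> S" using P by auto
  show "card (orthonormal_basis_of S) = dim S"
    using ind P by (metis dim_eq_card_independent dim_span)
qed

lemma subspace_tangent_space: "subspace (tangent_space x)"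
  by (auto simp: tangent_space_def subspace_def inner_add_right)

lemma orthonormal_insert_tangent:
  fixes x :: "'a::euclidean_space"
  assumes x: "norm x = 1" and B: "orthonormal B" "span B = tangent_space x"
  shows "orthonormal (insert x B)" "span (insert x B) = UNIV" "x \<notin> B" "card B = DIM('a) - 1"
proof -
  have perp: "x \<bullet> b = 0" if "b \<in> B" for b
    using B(2) span_base[OF that] by (auto simp: tangent_space_def)
  show xB: "x \<notin> B" using perp[of x] x by auto
  show o: "orthonormal (insert x B)"
    using B(1) x perp by (auto simp: orthonormal_def pairwise_insert orthogonal_def inner_commute)
  have "y \<in> span (insert x B)" for y
  proof -
    have "proj_perp x y \<in> tangent_space x"
      using x by (simp add: tangent_space_def proj_perp_def inner_diff_right inner_commute norm_eq_1)
    then have "proj_perp x y \<in> span (insert x B)"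
      using B(2) span_mono[of B "insert x B"] by blast
    then have "proj_perp x y + (y \<bullet> x) *\<^sub>R x \<in> span (insert x B)"
      by (rule span_add) (intro span_scale span_base, simp)
    then show ?thesis by (simp add: proj_perp_def)
  qed
  then show s: "span (insert x B) = UNIV" by auto
  have "independent (insert x B)"
    using o pairwise_orthogonal_independent[of "insert x B"] by (force simp: orthonormal_def)
  then have "card (insert x B) = DIM('a)"
    using s by (metis dim_UNIV dim_eq_card_independent dim_span)
  then show "card B = DIM('a) - 1"
    using xB B(1) by (simp add: orthonormal_def)
qed

lemma nn_integral_lborel_perp:
  fixes x :: "'a::euclidean_space"
  assumes x: "norm x = 1" and B: "orthonormal B" "span B = tangent_space x"
    and [measurable]: "h \<in> borel_measurable borel"
  shows "(\<integral>\<^sup>+z. h z \<partial>lborel) = (\<integral>\<^sup>+t. \<integral>\<^sup>+v. h (t *\<^sub>R x + v) \<partial>onb_lborel B \<partial>lborel)"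
  using orthonormal_insert_tangent[OF x B] nn_integral_onb_lborel_insert[of x B h]
  by (simp add: onb_lborel_eq_lborel)

lemma proj_perp_decomp:
  assumes "norm x = 1" "x \<bullet> v = 0"
  shows "proj_perp x (t *\<^sub>R x + v) = v" "(t *\<^sub>R x + v) \<bullet> x = t"
  using assms by (simp_all add: proj_perp_def inner_add_left inner_commute[of v] norm_eq_1)

lemma AE_onb_lborel_tangent:
  assumes B: "orthonormal B" "span B = tangent_space x"
  shows "AE v in onb_lborel B. x \<bullet> v = 0"
  using AE_onb_lborel_span[of B] B by (auto simp: orthonormal_def tangent_space_def)

text \<open>The cone construction of \<open>surface_measure\<close> without completion and as a
  measure on all Borel sets of the ambient space. It mediates between \<open>surface_measure\<close>
  and the basis-free \<open>sphV\<close> and \<open>tangV\<close>.\<close>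

definition onb_sphere :: "'a::euclidean_space set \<Rightarrow> 'a measure" where
  "onb_sphere B = distr (density (onb_lborel B) (\<lambda>v. of_nat (card B) * indicator {v. v \<noteq> 0 \<and> norm v \<le> 1} v)) borel sgn"

lemma nn_integral_onb_sphere:
  assumes [measurable]: "g \<in> borel_measurable borel"
  shows "(\<integral>\<^sup>+w. g w \<partial>onb_sphere B) =
    of_nat (card B) * (\<integral>\<^sup>+v. indicator {v. v \<noteq> 0 \<and> norm v \<le> 1} v * g (sgn v) \<partial>onb_lborel B)"
  unfolding onb_sphere_def
  by (subst nn_integral_distr) (auto simp: nn_integral_density mult.assoc nn_integral_cmult)

text \<open>For z = t x + v with v orthogonal to x, the cylinder is the product of the interval
  {-1/2..1/2} for t and the punctured unit ball for v. The interval has length 1 and drops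
  out.\<close>

lemma tangV_eq_onb_sphere:
  fixes x :: "'a::euclidean_space"
  assumes x: "norm x = 1" and B: "orthonormal B" "span B = tangent_space x"
  shows "tangV x = onb_sphere B"
proof (rule measure_eqI)
  fix A assume "A \<in> sets (tangV x)"
  then have [measurable]: "A \<in> sets borel" by simp
  have card: "card B = DIM('a) - 1" by (rule orthonormal_insert_tangent[OF x B])
  have "emeasure (tangV x) A = (\<integral>\<^sup>+w. indicator A w \<partial>tangV x)" by simp
  also have "\<dots> = (\<integral>\<^sup>+z. of_nat (DIM('a) - 1) * (indicator (cyl x) z * indicator A (sgn (proj_perp x z))) \<partial>lborel)"
    by (subst nn_integral_tangV) (auto simp: mult.assoc)
  also have "\<dots> = of_nat (card B) * (\<integral>\<^sup>+z. indicator (cyl x) z * indicator A (sgn (proj_perp x z)) \<partial>lborel)"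
    unfolding card by (rule nn_integral_cmult) measurable
  also have "(\<integral>\<^sup>+z. indicator (cyl x) z * indicator A (sgn (proj_perp x z)) \<partial>lborel) =
    (\<integral>\<^sup>+t. \<integral>\<^sup>+v. indicator (cyl x) (t *\<^sub>R x + v) * indicator A (sgn (proj_perp x (t *\<^sub>R x + v))) \<partial>onb_lborel B \<partial>lborel)"
    by (rule nn_integral_lborel_perp[OF x B]) measurable
  also have "\<dots> = (\<integral>\<^sup>+t. \<integral>\<^sup>+v. indicator {-1/2..1/2::real} t * (indicator {v. v \<noteq> 0 \<and> norm v \<le> 1} v * indicator A (sgn v)) \<partial>onb_lborel B \<partial>lborel)"
  proof (rule nn_integral_cong, rule nn_integral_cong_AE)
    fix t :: real
    show "AE v in onb_lborel B. indicator (cyl x) (t *\<^sub>R x + v) * indicator A (sgn (proj_perp x (t *\<^sub>R x + v))) =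
      (indicator {-1/2..1/2::real} t * (indicator {v. v \<noteq> 0 \<and> norm v \<le> 1} v * indicator A (sgn v)) :: ennreal)"
      using AE_onb_lborel_tangent[OF B]
      by eventually_elim (auto simp: cyl_def proj_perp_decomp[OF x] indicator_def)
  qed
  also have "\<dots> = (\<integral>\<^sup>+v. indicator {v. v \<noteq> 0 \<and> norm v \<le> 1} v * indicator A (sgn v) \<partial>onb_lborel B)"
    by (simp add: nn_integral_cmult nn_integral_multc)
  also have "of_nat (card B) * \<dots> = emeasure (onb_sphere B) A"
    using nn_integral_onb_sphere[of "indicator A" B] by (simp add: onb_sphere_def)
  finally show "emeasure (tangV x) A = emeasure (onb_sphere B) A" .
qed (simp add: onb_sphere_def)

lemma sphV_eq_onb_sphere:
  fixes B :: "'a::euclidean_space set"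
  assumes B: "orthonormal B" "span B = UNIV"
  shows "sphV = onb_sphere B"
proof -
  have "independent B"
    using B pairwise_orthogonal_independent[of B] by (force simp: orthonormal_def)
  then have "card B = DIM('a)"
    using B(2) by (metis dim_UNIV dim_eq_card_independent dim_span)
  then show ?thesis by (simp add: sphV_def onb_sphere_def onb_lborel_eq_lborel[OF B])
qed

subsection \<open>Comparison with the completed surface measures\<close>

definition pre_surface :: "'a::euclidean_space set \<Rightarrow> 'a measure" where
  "pre_surface V = scale_measure (of_nat (dim V))
       (distr (restrict_space (subspace_lborel V) (V \<inter> cball 0 1 - {0}))
          (restrict_space borel (V \<inter> unit_sphere)) sgn)"

lemma surface_measure_eq: "surface_measure V = completion (pre_surface V)"
  by (simp add: surface_measure_def pre_surface_def)

lemma subspace_lborel_eq: "subspace_lborel V = onb_lborel (orthonormal_basis_of V)"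
  by (simp add: subspace_lborel_def onb_lborel_def)

lemma sets_pre_surface: "sets (pre_surface V) = sets (restrict_space borel (V \<inter> unit_sphere))"
  and space_pre_surface: "space (pre_surface V) = V \<inter> unit_sphere"
proof -
  show *: "sets (pre_surface V) = sets (restrict_space borel (V \<inter> unit_sphere))" by (simp add: pre_surface_def)
  show "space (pre_surface V) = V \<inter> unit_sphere"
    using sets_eq_imp_space_eq[OF *] by (simp add: space_restrict_space)
qed

lemma measurable_pre_surface: "f \<in> borel_measurable borel \<Longrightarrow> f \<in> borel_measurable (pre_surface V)"
  by (subst measurable_cong_sets[OF sets_pre_surface refl]) (rule measurable_restrict_space1)

text \<open>\<open>pre_surface\<close> lives on the trace of the Borel sets on the unit sphere of V.
  Its push-forward along the identity is comparable with the other Borel measures, since vectors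
  outside V are null for the Lebesgue measure of V.\<close>

lemma distr_pre_surface:
  fixes V :: "'a::euclidean_space set"
  assumes V: "subspace V"
  shows "distr (pre_surface V) borel (\<lambda>w. w) = onb_sphere (orthonormal_basis_of V)"
proof (rule measure_eqI)
  fix A assume "A \<in> sets (distr (pre_surface V) borel (\<lambda>w. w))"
  then have [measurable]: "A \<in> sets borel" by simp
  let ?B = "orthonormal_basis_of V"
  note B = orthonormal_basis_of[OF V]
  have [measurable]: "V \<in> sets borel" using closed_subspace[OF V] by simp
  have [measurable]: "(\<lambda>w. w) \<in> measurable (pre_surface V) borel"
    by (rule measurable_pre_surface) simp
  let ?R = "restrict_space (subspace_lborel V) (V \<inter> cball 0 1 - {0})"
  have S [measurable]: "V \<inter> cball 0 1 - {0} \<in> sets borel" "V \<inter> unit_sphere \<in> sets borel" by auto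
  have m [measurable]: "sgn \<in> measurable ?R (restrict_space borel (V \<inter> unit_sphere))"
  proof (rule measurable_restrict_space2)
    show "sgn \<in> space ?R \<rightarrow> V \<inter> unit_sphere"
      using V by (auto simp: space_restrict_space subspace_lborel_eq sgn_div_norm subspace_scale)
    show "sgn \<in> borel_measurable ?R"
      unfolding subspace_lborel_eq by (rule measurable_restrict_space1, subst measurable_cong_sets[OF sets_onb_lborel refl], rule sgn_measurable)
  qed
  have AS: "A \<inter> (V \<inter> unit_sphere) \<in> sets (restrict_space borel (V \<inter> unit_sphere))"
    by (subst sets_restrict_space_iff) auto
  have "emeasure (distr (pre_surface V) borel (\<lambda>w. w)) A = emeasure (pre_surface V) (A \<inter> (V \<inter> unit_sphere))"
    by (subst emeasure_distr) (auto simp: space_pre_surface)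
  also have "\<dots> = of_nat (card ?B) * emeasure ?R (sgn -` (A \<inter> (V \<inter> unit_sphere)) \<inter> space ?R)"
    unfolding pre_surface_def B(3)
    by (subst emeasure_scale_measure, subst emeasure_distr[OF m]) (rule AS refl)+
  also have "emeasure ?R (sgn -` (A \<inter> (V \<inter> unit_sphere)) \<inter> space ?R) =
      emeasure (onb_lborel ?B) (sgn -` A \<inter> (V \<inter> cball 0 1 - {0}))"
  proof (subst emeasure_restrict_space)
    show "emeasure (subspace_lborel V) (sgn -` (A \<inter> (V \<inter> unit_sphere)) \<inter> space ?R) =
      emeasure (onb_lborel ?B) (sgn -` A \<inter> (V \<inter> cball 0 1 - {0}))"
      using V by (intro arg_cong2[where f=emeasure])
        (auto simp: space_restrict_space subspace_lborel_eq sgn_div_norm subspace_scale)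
  qed (auto simp: space_restrict_space subspace_lborel_eq)
  also have "\<dots> = (\<integral>\<^sup>+v. indicator (sgn -` A \<inter> (V \<inter> cball 0 1 - {0})) v \<partial>onb_lborel ?B)"
    using measurable_sets[OF sgn_measurable, of A] by (subst nn_integral_indicator) auto
  also have "\<dots> = (\<integral>\<^sup>+v. indicator {v. v \<noteq> 0 \<and> norm v \<le> 1} v * indicator A (sgn v) \<partial>onb_lborel ?B)"
  proof (rule nn_integral_cong_AE)
    have "AE v in onb_lborel ?B. v \<in> span ?B"
      by (rule AE_onb_lborel_span) (use B in \<open>auto simp: orthonormal_def\<close>)
    then show "AE v in onb_lborel ?B. (indicator (sgn -` A \<inter> (V \<inter> cball 0 1 - {0})) v :: ennreal) =
        indicator {v. v \<noteq> 0 \<and> norm v \<le> 1} v * indicator A (sgn v)"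
      by eventually_elim (auto simp: B indicator_def)
  qed
  also have "of_nat (card ?B) * \<dots> = emeasure (onb_sphere ?B) A"
    using nn_integral_onb_sphere[of "indicator A" ?B] by (simp add: onb_sphere_def)
  finally show "emeasure (distr (pre_surface V) borel (\<lambda>w. w)) A = emeasure (onb_sphere ?B) A" .
qed (simp add: onb_sphere_def)

lemma sphV_onb: "onb_sphere (orthonormal_basis_of UNIV) = sphV"
  by (intro sphV_eq_onb_sphere[symmetric] orthonormal_basis_of subspace_UNIV)

lemma tangV_onb: "norm x = 1 \<Longrightarrow> onb_sphere (orthonormal_basis_of (tangent_space x)) = tangV x"
  using orthonormal_basis_of[OF subspace_tangent_space, of x] by (simp add: tangV_eq_onb_sphere)

lemma AE_tangV:
  fixes x :: "'a::euclidean_space"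
  assumes x: "norm x = 1"
  shows "AE w in tangV x. norm w = 1 \<and> x \<bullet> w = 0"
  unfolding tangV_def
proof (subst AE_distr_iff)
  show "AE z in density lborel (\<lambda>z. of_nat (DIM('a) - 1) * indicator (cyl x) z). norm (sgn (proj_perp x z)) = 1 \<and> x \<bullet> sgn (proj_perp x z) = 0"
  proof (subst AE_density)
    have "x \<bullet> proj_perp x z = 0" for z
      using x by (simp add: proj_perp_def inner_diff_right inner_commute norm_eq_1)
    then have "x \<bullet> sgn (proj_perp x z) = 0" for z
      by (simp add: sgn_div_norm)
    then show "AE z in lborel. (0::ennreal) < of_nat (DIM('a) - 1) * indicator (cyl x) z \<longrightarrow> norm (sgn (proj_perp x z)) = 1 \<and> x \<bullet> sgn (proj_perp x z) = 0"
      by (intro AE_I2) (auto simp: norm_sgn cyl_def indicator_def split: if_splits)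
  qed auto
qed (auto intro!: borel_measurable_eq)

lemma AE_sphV: "AE y in (sphV :: 'a::euclidean_space measure). norm y = 1"
  unfolding sphV_def
  by (subst AE_distr_iff) (auto simp: AE_density norm_sgn intro!: borel_measurable_eq AE_I2 split: split_indicator)

text \<open>Small balls around 0 have volume proportional to a positive power of the radius. For
  empty B the measure would be a point mass at 0.\<close>

lemma emeasure_onb_lborel_zero:
  assumes B: "orthonormal B" and "B \<noteq> {}"
  shows "emeasure (onb_lborel B) {0} = 0"
proof -
  have pos: "card B > 0" using assms by (simp add: orthonormal_def card_gt_0_iff)
    have "emeasure (onb_lborel B) {0} \<le> ennreal e" if "e > 0" for e
    proof -
      \<comment> \<open>The bound by 1 makes every positive power of r at most r.\<close>
      define r where "r = min 1 (e / unit_ball_vol (card B))"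
      have v: "unit_ball_vol (card B) > 0" by simp
      have r: "0 < r" "r \<le> 1" "r \<le> e / unit_ball_vol (card B)" using v \<open>e > 0\<close> by (auto simp: r_def)
      have "emeasure (onb_lborel B) {0} \<le> emeasure (onb_lborel B) (cball 0 r)"
        using r by (intro emeasure_mono) auto
      also have "\<dots> = ennreal (unit_ball_vol (card B) * r ^ card B)"
        using r by (simp add: emeasure_onb_lborel_cball[OF B])
      also have "\<dots> \<le> ennreal e"
      proof (rule ennreal_leI)
        have "r ^ card B \<le> r ^ 1" using r pos by (intro power_decreasing) auto
        then have "unit_ball_vol (card B) * r ^ card B \<le> unit_ball_vol (card B) * r" using v by simp
        also have "\<dots> \<le> e" using r v by (simp add: field_simps)
        finally show "unit_ball_vol (card B) * r ^ card B \<le> e" .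
      qed
      finally show ?thesis .
    qed
    then show ?thesis
      by (metis ennreal_le_epsilon add_0 le_zero_eq)
qed

lemma emeasure_onb_sphere:
  assumes B: "orthonormal B"
  shows "emeasure (onb_sphere B) UNIV \<le> ennreal (card B * unit_ball_vol (card B))"
    "B \<noteq> {} \<Longrightarrow> emeasure (onb_sphere B) UNIV = ennreal (card B * unit_ball_vol (card B))"
proof -
  have "emeasure (onb_sphere B) UNIV = of_nat (card B) * (\<integral>\<^sup>+v. indicator {v. v \<noteq> 0 \<and> norm v \<le> 1} v \<partial>onb_lborel B)"
    using nn_integral_onb_sphere[of "indicator UNIV" B] by (simp add: onb_sphere_def)
  also have "(\<integral>\<^sup>+v. indicator {v. v \<noteq> 0 \<and> norm v \<le> 1} v \<partial>onb_lborel B) = emeasure (onb_lborel B) (cball 0 1 - {0})"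
    by (subst nn_integral_indicator) (auto intro!: arg_cong[where f="emeasure _"])
  finally have e: "emeasure (onb_sphere B) UNIV = of_nat (card B) * emeasure (onb_lborel B) (cball 0 1 - {0})" .
  also have "\<dots> \<le> of_nat (card B) * emeasure (onb_lborel B) (cball 0 1)"
    by (intro mult_left_mono emeasure_mono) auto
  also have "\<dots> = ennreal (card B * unit_ball_vol (card B))"
    by (simp add: emeasure_onb_lborel_cball[OF B] ennreal_mult ennreal_of_nat_eq_real_of_nat)
  finally show "emeasure (onb_sphere B) UNIV \<le> ennreal (card B * unit_ball_vol (card B))" .
  show "emeasure (onb_sphere B) UNIV = ennreal (card B * unit_ball_vol (card B))" if "B \<noteq> {}"
  proof -
    have "emeasure (onb_lborel B) (cball 0 1 - {0}) = emeasure (onb_lborel B) (cball 0 1)"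
      using emeasure_onb_lborel_zero[OF B that] by (intro emeasure_Diff_null_set) (auto intro!: null_setsI)
    then show ?thesis
      by (simp add: e emeasure_onb_lborel_cball[OF B] ennreal_mult ennreal_of_nat_eq_real_of_nat)
  qed
qed

lemma finite_measure_onb_sphere: "orthonormal B \<Longrightarrow> finite_measure (onb_sphere B)"
  using emeasure_onb_sphere(1)[of B]
  by (intro finite_measureI) (auto simp: onb_sphere_def top.extremum_unique)

lemma finite_measure_sphV: "finite_measure sphV"
  using orthonormal_basis_of[OF subspace_UNIV] sphV_onb finite_measure_onb_sphere by metis

lemma finite_measure_tangV: "norm x = 1 \<Longrightarrow> finite_measure (tangV x)"
  using orthonormal_basis_of[OF subspace_tangent_space, of x] tangV_onb[of x] finite_measure_onb_sphere by metis

text \<open>The unit tangent sphere has dimension \<open>DIM('a) - 2\<close>, so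
  \<open>sigma\<close> at this index is the \<open>\<sigma>\<^sub>n\<^sub>-\<^sub>1\<close> of the
  theorem wherever it occurs below.\<close>

lemma emeasure_tangV:
  fixes x :: "'a::euclidean_space"
  assumes x: "norm x = 1" and "DIM('a) \<ge> 2"
  shows "emeasure (tangV x) UNIV = ennreal (sigma (DIM('a) - 2))"
proof -
  let ?B = "orthonormal_basis_of (tangent_space x)"
  note B = orthonormal_basis_of[OF subspace_tangent_space, of x]
  have c: "card ?B = DIM('a) - 1" by (rule orthonormal_insert_tangent[OF x B(1,2)])
  then have "?B \<noteq> {}" using assms by auto
  then show ?thesis
    using emeasure_onb_sphere(2)[OF B(1)] c assms(2) tangV_onb[OF x]
    by (simp add: sigma_def Suc_diff_Suc numeral_2_eq_2 of_nat_diff)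
qed

subsection \<open>Rotations\<close>

lemma orthogonal_transformation_inner: "orthogonal_transformation f \<Longrightarrow> f x \<bullet> f y = x \<bullet> y"
  by (simp add: orthogonal_transformation_def)

lemma orthogonal_transformation_sgn:
  "orthogonal_transformation f \<Longrightarrow> sgn (f x) = f (sgn x)"
  by (simp add: sgn_div_norm orthogonal_transformation_norm linear_scale[OF orthogonal_transformation_linear])

lemma orthogonal_transformation_proj_perp:
  "orthogonal_transformation f \<Longrightarrow> proj_perp (f x) (f z) = f (proj_perp x z)"
  using orthogonal_transformation_linear[of f]
  by (simp add: proj_perp_def orthogonal_transformation_inner linear_diff linear_scale)

lemma orthogonal_transformation_measurable:
  fixes f :: "'a::euclidean_space \<Rightarrow> 'a"
  assumes "orthogonal_transformation f"
  shows "f \<in> borel_measurable borel"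
  using orthogonal_transformation_linear[OF assms]
  by (intro borel_measurable_continuous_onI linear_continuous_on) (simp add: linear_conv_bounded_linear)

lemma nn_integral_lborel_orthogonal:
  fixes f :: "'a::euclidean_space \<Rightarrow> 'a"
  assumes f: "orthogonal_transformation f" and [measurable]: "g \<in> borel_measurable borel"
  shows "(\<integral>\<^sup>+z. g (f z) \<partial>lborel) = (\<integral>\<^sup>+z. g z \<partial>lborel)"
proof -
  have [measurable]: "f \<in> borel_measurable borel" by (rule orthogonal_transformation_measurable[OF f])
  have "(\<integral>\<^sup>+z. g z \<partial>lborel) = (\<integral>\<^sup>+z. g z \<partial>distr lborel borel f)"
    by (simp add: lborel_distr_orthogonal[OF f])
  also have "\<dots> = (\<integral>\<^sup>+z. g (f z) \<partial>lborel)" by (rule nn_integral_distr) measurable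
  finally show ?thesis ..
qed

text \<open>Cylinder and projection are equivariant under f and \<open>lborel\<close> is invariant;
  no basis of the tangent space has to be transported.\<close>

lemma tangV_orthogonal:
  fixes f :: "'a::euclidean_space \<Rightarrow> 'a"
  assumes f: "orthogonal_transformation f"
  shows "tangV (f x) = distr (tangV x) borel f"
proof (rule measure_eqI)
  have [measurable]: "f \<in> borel_measurable borel" by (rule orthogonal_transformation_measurable[OF f])
  fix A assume "A \<in> sets (tangV (f x))"
  then have [measurable]: "A \<in> sets borel" by simp
  have "emeasure (tangV (f x)) A = (\<integral>\<^sup>+w. indicator A w \<partial>tangV (f x))" by simp
  also have "\<dots> = (\<integral>\<^sup>+z. of_nat (DIM('a) - 1) * indicator (cyl (f x)) z * indicator A (sgn (proj_perp (f x) z)) \<partial>lborel)"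
    by (rule nn_integral_tangV) measurable
  also have "\<dots> = (\<integral>\<^sup>+z. of_nat (DIM('a) - 1) * indicator (cyl (f x)) (f z) * indicator A (sgn (proj_perp (f x) (f z))) \<partial>lborel)"
    by (rule nn_integral_lborel_orthogonal[OF f, symmetric]) measurable
  also have "\<dots> = (\<integral>\<^sup>+z. of_nat (DIM('a) - 1) * indicator (cyl x) z * indicator A (f (sgn (proj_perp x z))) \<partial>lborel)"
    using linear_injective_0[OF orthogonal_transformation_linear[OF f]] orthogonal_transformation_inj[OF f]
      linear_0[OF orthogonal_transformation_linear[OF f]]
    by (intro nn_integral_cong arg_cong2[where f="(*)"] refl)
      (auto simp: cyl_def orthogonal_transformation_proj_perp[OF f] orthogonal_transformation_sgn[OF f]
        orthogonal_transformation_inner[OF f] orthogonal_transformation_norm[OF f] indicator_def)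
  also have "\<dots> = (\<integral>\<^sup>+w. indicator A (f w) \<partial>tangV x)"
    by (rule nn_integral_tangV[symmetric]) measurable
  also have "\<dots> = (\<integral>\<^sup>+w. indicator A w \<partial>distr (tangV x) borel f)"
    by (rule nn_integral_distr[symmetric]) measurable
  also have "\<dots> = emeasure (distr (tangV x) borel f) A" by simp
  finally show "emeasure (tangV (f x)) A = emeasure (distr (tangV x) borel f) A" .
qed simp

lemma sphV_orthogonal:
  fixes f :: "'a::euclidean_space \<Rightarrow> 'a"
  assumes f: "orthogonal_transformation f"
  shows "distr sphV borel f = sphV"
proof (rule measure_eqI)
  have [measurable]: "f \<in> borel_measurable borel" by (rule orthogonal_transformation_measurable[OF f])
  fix A assume "A \<in> sets (distr sphV borel f)"
  then have [measurable]: "A \<in> sets borel" by simp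
  have "emeasure (distr sphV borel f) A = (\<integral>\<^sup>+w. indicator A w \<partial>distr sphV borel f)" by simp
  also have "\<dots> = (\<integral>\<^sup>+w. indicator A (f w) \<partial>sphV)"
    by (rule nn_integral_distr) measurable
  also have "\<dots> = (\<integral>\<^sup>+z. of_nat DIM('a) * indicator {z. z \<noteq> 0 \<and> norm z \<le> 1} z * indicator A (f (sgn z)) \<partial>lborel)"
    by (rule nn_integral_sphV) measurable
  also have "\<dots> = (\<integral>\<^sup>+z. of_nat DIM('a) * indicator {z. z \<noteq> 0 \<and> norm z \<le> 1} (f z) * indicator A (sgn (f z)) \<partial>lborel)"
    using linear_injective_0[OF orthogonal_transformation_linear[OF f]] orthogonal_transformation_inj[OF f]
      linear_0[OF orthogonal_transformation_linear[OF f]]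
    by (intro nn_integral_cong arg_cong2[where f="(*)"] refl)
      (auto simp: orthogonal_transformation_sgn[OF f] orthogonal_transformation_norm[OF f] indicator_def)
  also have "\<dots> = (\<integral>\<^sup>+z. of_nat DIM('a) * indicator {z. z \<noteq> 0 \<and> norm z \<le> 1} z * indicator A (sgn z) \<partial>lborel)"
    by (rule nn_integral_lborel_orthogonal[OF f]) measurable
  also have "\<dots> = (\<integral>\<^sup>+w. indicator A w \<partial>sphV)"
    by (rule nn_integral_sphV[symmetric]) measurable
  also have "\<dots> = emeasure sphV A" by simp
  finally show "emeasure (distr sphV borel f) A = emeasure sphV A" .
qed simp

subsection \<open>The measure on orthonormal frames\<close>

text \<open>The unit tangent bundle of the sphere, also the Stiefel manifold of orthonormal
  pairs.\<close>

definition frames :: "('a::euclidean_space \<times> 'a) set" where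
  "frames = {(x, w). norm x = 1 \<and> norm w = 1 \<and> x \<bullet> w = 0}"

text \<open>The Liouville measure of the unit tangent bundle. Being the image of a product of
  Lebesgue measures, it inherits the disintegration over the sphere from Fubini for
  \<open>lborel\<close>.\<close>

definition frameV :: "('a::euclidean_space \<times> 'a) measure" where
  "frameV = distr (density (lborel \<Otimes>\<^sub>M lborel)
      (\<lambda>(X, z). of_nat DIM('a) * indicator {z. z \<noteq> 0 \<and> norm z \<le> 1} X *
        (of_nat (DIM('a) - 1) * indicator (cyl (sgn X)) z)))
    borel (\<lambda>(X, z). (sgn X, sgn (proj_perp (sgn X) z)))"

lemma space_frameV [simp]: "space frameV = UNIV" and sets_frameV [simp, measurable_cong]: "sets frameV = sets borel"
  by (simp_all add: frameV_def)

lemma borel_measurable_nn_integral_tangV: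
  fixes F :: "'a::euclidean_space \<times> 'a \<Rightarrow> ennreal"
  assumes [measurable]: "F \<in> borel_measurable (borel \<Otimes>\<^sub>M borel)"
  shows "(\<lambda>x. \<integral>\<^sup>+w. F (x, w) \<partial>tangV x) \<in> borel_measurable borel"
proof -
  have "(\<lambda>x. \<integral>\<^sup>+w. F (x, w) \<partial>tangV x) = (\<lambda>x.
    \<integral>\<^sup>+z. of_nat (DIM('a) - 1) * indicator (cyl x) z * F (x, sgn (proj_perp x z)) \<partial>lborel)"
    by (intro ext nn_integral_tangV) measurable
  also have "\<dots> \<in> borel_measurable borel"
    unfolding indicator_def by measurable
  finally show ?thesis .
qed

lemma nn_integral_frameV:
  fixes F :: "'a::euclidean_space \<times> 'a \<Rightarrow> ennreal"
  assumes F [measurable]: "F \<in> borel_measurable borel"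
  shows "(\<integral>\<^sup>+p. F p \<partial>frameV) = (\<integral>\<^sup>+x. \<integral>\<^sup>+w. F (x, w) \<partial>tangV x \<partial>sphV)"
proof -
  have F' [measurable]: "F \<in> borel_measurable (borel \<Otimes>\<^sub>M borel)" using F by (simp add: borel_prod)
  have F'' [measurable]: "(\<lambda>w. F (x, w)) \<in> borel_measurable borel" for x by measurable
  define G where "G x = (\<integral>\<^sup>+w. F (x, w) \<partial>tangV x)" for x
  have [measurable]: "G \<in> borel_measurable borel"
    unfolding G_def by (rule borel_measurable_nn_integral_tangV) measurable
  let ?a = "\<lambda>X::'a. of_nat DIM('a) * indicator {z. z \<noteq> 0 \<and> norm z \<le> 1} X :: ennreal"
  let ?b = "\<lambda>X z::'a. of_nat (DIM('a) - 1) * indicator (cyl (sgn X)) z :: ennreal"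
  have [measurable]: "(\<lambda>(X, z). ?a X * ?b X z) \<in> borel_measurable (borel \<Otimes>\<^sub>M borel)"
    unfolding indicator_def by measurable
  have m [measurable]: "(\<lambda>(X, z). (sgn X, sgn (proj_perp (sgn X) z))) \<in> borel \<Otimes>\<^sub>M borel \<rightarrow>\<^sub>M (borel :: ('a \<times> 'a) measure)"
    unfolding borel_prod[symmetric] by measurable
  have [measurable]: "(\<lambda>p. F ((\<lambda>(X, z). (sgn X, sgn (proj_perp (sgn X) z))) p)) \<in> borel_measurable (lborel \<Otimes>\<^sub>M lborel)"
    by (rule measurable_compose[OF _ F]) measurable
  have H: "(\<lambda>p. (\<lambda>(X, z). ?a X * ?b X z) p * F ((\<lambda>(X, z). (sgn X, sgn (proj_perp (sgn X) z))) p))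
      \<in> borel_measurable (lborel \<Otimes>\<^sub>M lborel)"
    by measurable
  have "(\<integral>\<^sup>+p. F p \<partial>frameV) = (\<integral>\<^sup>+p. F ((\<lambda>(X, z). (sgn X, sgn (proj_perp (sgn X) z))) p)
     \<partial>density (lborel \<Otimes>\<^sub>M lborel) (\<lambda>(X, z). ?a X * ?b X z))"
    unfolding frameV_def by (rule nn_integral_distr) measurable
  also have "\<dots> = (\<integral>\<^sup>+p. (\<lambda>(X, z). ?a X * ?b X z) p * F ((\<lambda>(X, z). (sgn X, sgn (proj_perp (sgn X) z))) p)
     \<partial>(lborel \<Otimes>\<^sub>M lborel))"
    by (rule nn_integral_density) measurable
  also have "\<dots> = (\<integral>\<^sup>+X. \<integral>\<^sup>+z. ?a X * ?b X z * F (sgn X, sgn (proj_perp (sgn X) z)) \<partial>lborel \<partial>lborel)"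
    by (subst lborel.nn_integral_fst[OF H, symmetric]) simp
  also have "\<dots> = (\<integral>\<^sup>+X. ?a X * G (sgn X) \<partial>lborel)"
  proof (rule nn_integral_cong)
    fix X :: 'a
    have "(\<integral>\<^sup>+z. ?a X * ?b X z * F (sgn X, sgn (proj_perp (sgn X) z)) \<partial>lborel) =
      (\<integral>\<^sup>+z. ?a X * (?b X z * F (sgn X, sgn (proj_perp (sgn X) z))) \<partial>lborel)"
      by (simp add: mult.assoc)
    also have "\<dots> = ?a X * (\<integral>\<^sup>+z. ?b X z * F (sgn X, sgn (proj_perp (sgn X) z)) \<partial>lborel)"
      by (rule nn_integral_cmult) measurable
    also have "(\<integral>\<^sup>+z. ?b X z * F (sgn X, sgn (proj_perp (sgn X) z)) \<partial>lborel) = G (sgn X)"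
      unfolding G_def by (rule nn_integral_tangV[symmetric]) measurable
    finally show "(\<integral>\<^sup>+z. ?a X * ?b X z * F (sgn X, sgn (proj_perp (sgn X) z)) \<partial>lborel) = ?a X * G (sgn X)" .
  qed
  also have "\<dots> = (\<integral>\<^sup>+x. G x \<partial>sphV)"
    by (rule nn_integral_sphV[symmetric]) measurable
  finally show ?thesis by (simp add: G_def)
qed

lemma frames_measurable [measurable]: "frames \<in> sets borel"
proof -
  have "frames = {p :: 'a \<times> 'a. norm (fst p) = 1} \<inter> {p. norm (snd p) = 1} \<inter> {p. fst p \<bullet> snd p = 0}"
    by (auto simp: frames_def)
  moreover have "closed \<dots>" by (intro closed_Int closed_Collect_eq continuous_intros)
  ultimately show ?thesis by simp
qed

lemma compact_frames: "compact (frames :: ('a::euclidean_space \<times> 'a) set)"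
proof -
  have "frames = (sphere 0 1 \<times> sphere 0 1) \<inter> {p :: 'a \<times> 'a. fst p \<bullet> snd p = 0}"
    by (auto simp: frames_def)
  moreover have "closed {p :: 'a \<times> 'a. fst p \<bullet> snd p = 0}" by (intro closed_Collect_eq continuous_intros)
  ultimately show ?thesis by (metis compact_Int_closed compact_Times compact_sphere)
qed

lemma AE_frameV: "AE p in (frameV :: ('a::euclidean_space \<times> 'a) measure). p \<in> frames"
proof (rule AE_I)
  show "{p \<in> space frameV. p \<notin> frames} \<subseteq> - frames" by auto
  have "emeasure frameV (- frames :: ('a \<times> 'a) set) = (\<integral>\<^sup>+p. indicator (- frames) p \<partial>(frameV :: ('a \<times> 'a) measure))"
    by (rule nn_integral_indicator[symmetric]) simp
  also have "\<dots> = (\<integral>\<^sup>+x. \<integral>\<^sup>+w. indicator (- frames) (x, w) \<partial>tangV x \<partial>(sphV :: 'a measure))"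
    by (rule nn_integral_frameV) simp
  also have "\<dots> = (\<integral>\<^sup>+x. 0 \<partial>(sphV :: 'a measure))"
  proof (rule nn_integral_cong_AE)
    show "AE x in (sphV :: 'a measure). (\<integral>\<^sup>+w. indicator (- frames) (x, w) \<partial>tangV x) = 0"
      using AE_sphV
    proof eventually_elim
      fix x :: 'a assume x: "norm x = 1"
      have "(\<integral>\<^sup>+w. indicator (- frames) (x, w) \<partial>tangV x) = (\<integral>\<^sup>+w. 0 \<partial>tangV x)"
      proof (rule nn_integral_cong_AE)
        show "AE w in tangV x. indicator (- frames) (x, w) = (0 :: ennreal)"
          using AE_tangV[OF x] by eventually_elim (simp add: frames_def x)
      qed
      then show "(\<integral>\<^sup>+w. indicator (- frames) (x, w) \<partial>tangV x) = 0" by simp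
    qed
  qed
  finally show "emeasure frameV (- frames :: ('a \<times> 'a) set) = 0" by simp
  show "- frames \<in> sets frameV" by simp
qed

lemma emeasure_sphV_finite: "emeasure (sphV :: 'a::euclidean_space measure) UNIV < \<infinity>"
  using finite_measure.emeasure_finite[OF finite_measure_sphV, where A=UNIV] by (simp add: less_top)

lemma emeasure_frameV:
  assumes "DIM('a::euclidean_space) \<ge> 2"
  shows "emeasure (frameV :: ('a \<times> 'a) measure) UNIV = ennreal (sigma (DIM('a) - 2)) * emeasure (sphV :: 'a measure) UNIV"
proof -
  have "emeasure (frameV :: ('a \<times> 'a) measure) UNIV = (\<integral>\<^sup>+p. 1 \<partial>(frameV :: ('a \<times> 'a) measure))"
    by simp
  also have "\<dots> = (\<integral>\<^sup>+x. \<integral>\<^sup>+w. 1 \<partial>tangV x \<partial>(sphV :: 'a measure))"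
    by (rule nn_integral_frameV) simp
  also have "\<dots> = (\<integral>\<^sup>+x. ennreal (sigma (DIM('a) - 2)) \<partial>(sphV :: 'a measure))"
  proof (rule nn_integral_cong_AE)
    show "AE x in (sphV :: 'a measure). (\<integral>\<^sup>+w. 1 \<partial>tangV x) = ennreal (sigma (DIM('a) - 2))"
      using AE_sphV by eventually_elim (simp add: emeasure_tangV assms)
  qed
  finally show ?thesis by simp
qed

lemma finite_measure_frameV:
  assumes "DIM('a::euclidean_space) \<ge> 2"
  shows "finite_measure (frameV :: ('a \<times> 'a) measure)"
  using emeasure_sphV_finite[where 'a='a]
  by (intro finite_measureI) (auto simp: emeasure_frameV[OF assms] ennreal_mult_eq_top_iff)

subsection \<open>Uniqueness of measures invariant under a transitive group of isometries\<close>

text \<open>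
  As \<open>G\<close> is transitive, all balls of the same radius with centre in \<open>S\<close> have the same measure. Fubini on the
  pairs at distance less than \<open>r\<close> then compares \<open>M\<close> on \<open>C\<close> with \<open>N\<close> on the \<open>r\<close>-neighbourhood of \<open>C\<close>.
\<close>

lemma invariant_measure_le:
  fixes M N :: "'b::{metric_space, second_countable_topology} measure"
  assumes sM [measurable_cong]: "sets M = sets borel" and sN [measurable_cong]: "sets N = sets borel"
    and fM: "finite_measure M" and fN: "finite_measure N"
    and S: "compact S" and AM: "AE x in M. x \<in> S" and AN: "AE x in N. x \<in> S"
    and G: "\<And>g x y. g \<in> G \<Longrightarrow> dist (g x) (g y) = dist x y"
      "\<And>g. g \<in> G \<Longrightarrow> distr M borel g = M" "\<And>g. g \<in> G \<Longrightarrow> distr N borel g = N"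
    and trans: "\<And>x y. x \<in> S \<Longrightarrow> y \<in> S \<Longrightarrow> \<exists>g\<in>G. g x = y"
    and mass: "emeasure M UNIV = emeasure N UNIV"
    and C: "closed C"
  shows "emeasure M C \<le> emeasure N C"
proof (cases "emeasure M UNIV = 0")
  case True
  have "emeasure M C \<le> emeasure M UNIV" by (rule emeasure_mono) (auto simp: sM)
  then show ?thesis using True by simp
next
  case False
  interpret M: finite_measure M by fact
  interpret N: finite_measure N by fact
  interpret P: pair_sigma_finite M N ..
  have [measurable]: "C \<in> sets borel" using C by simp
  have spM: "space M = UNIV" and spN: "space N = UNIV"
    using sets_eq_imp_space_eq[OF sM] sets_eq_imp_space_eq[OF sN] by auto
  have inv: "emeasure L (ball (g x) d) = emeasure L (ball x d)"
    if L: "sets L = sets borel" "distr L borel g = L" and g: "g \<in> G" for L g x d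
  proof -
    have sp: "space L = UNIV" using sets_eq_imp_space_eq[OF L(1)] by simp
    have "continuous_on UNIV g"
      unfolding continuous_on_iff using G(1)[OF g] by metis
    then have "g \<in> borel_measurable borel" by (rule borel_measurable_continuous_onI)
    then have gm: "g \<in> borel_measurable L" by (simp cong: measurable_cong_sets add: measurable_cong_sets[OF L(1) refl])
    have "emeasure L (ball (g x) d) = emeasure (distr L borel g) (ball (g x) d)" using L(2) by simp
    also have "\<dots> = emeasure L (g -` ball (g x) d \<inter> space L)" by (rule emeasure_distr[OF gm]) simp
    also have "g -` ball (g x) d \<inter> space L = ball x d" by (auto simp: sp G(1)[OF g])
    finally show ?thesis .
  qed
  have "S \<noteq> {}"
  proof
    assume "S = {}"
    then have "AE x in M. False" using AM by simp
    then show False using False AE_iff_null_sets[of UNIV M] by (auto simp: sM)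
  qed
  then obtain p where p: "p \<in> S" by auto
  define a where "a d = emeasure M (ball p d)" for d
  define b where "b d = emeasure N (ball p d)" for d
  have a: "emeasure M (ball x d) = a d" and b: "emeasure N (ball x d) = b d" if "x \<in> S" for x d
    using trans[OF p that] inv[OF sM G(2)] inv[OF sN G(3)] unfolding a_def b_def by metis+
  have swap: "(\<integral>\<^sup>+x. indicator A x * emeasure N (ball x d) \<partial>M) = (\<integral>\<^sup>+y. emeasure M (A \<inter> ball y d) \<partial>N)"
    if [measurable]: "A \<in> sets borel" for A d
  proof -
    have [measurable]: "Measurable.pred (borel \<Otimes>\<^sub>M borel) (\<lambda>p::'b \<times> 'b. dist (fst p) (snd p) < d)"
      by measurable
    have "(\<integral>\<^sup>+x. indicator A x * emeasure N (ball x d) \<partial>M) = (\<integral>\<^sup>+x. \<integral>\<^sup>+y. indicator A x * indicator {p. dist (fst p) (snd p) < d} (x, y) \<partial>N \<partial>M)"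
    proof (rule nn_integral_cong)
      fix x
      have "(\<integral>\<^sup>+y. indicator A x * indicator {p. dist (fst p) (snd p) < d} (x, y) \<partial>N) =
          (\<integral>\<^sup>+y. indicator A x * indicator (ball x d) y \<partial>N)"
        by (intro nn_integral_cong) (auto simp: indicator_def)
      also have "\<dots> = indicator A x * emeasure N (ball x d)" by (rule nn_integral_cmult_indicator) (simp add: sN)
      finally show "indicator A x * emeasure N (ball x d) = (\<integral>\<^sup>+y. indicator A x * indicator {p. dist (fst p) (snd p) < d} (x, y) \<partial>N)" ..
    qed
    also have "\<dots> = (\<integral>\<^sup>+y. \<integral>\<^sup>+x. indicator A x * indicator {p. dist (fst p) (snd p) < d} (x, y) \<partial>M \<partial>N)"
      by (rule P.Fubini'[symmetric]) measurable
    also have "\<dots> = (\<integral>\<^sup>+y. \<integral>\<^sup>+x. indicator (A \<inter> ball y d) x \<partial>M \<partial>N)"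
      by (intro nn_integral_cong) (auto simp: indicator_def dist_commute)
    finally show ?thesis by simp
  qed
  \<comment> \<open>Counting all pairs at distance less than d gives b d times the mass of M, and a
    d times the mass of N; the common mass is finite and nonzero.\<close>
  have ab: "a d = b d" for d
  proof -
    have "b d * emeasure M UNIV = (\<integral>\<^sup>+x. b d \<partial>M)" by (simp add: spM)
    also have "\<dots> = (\<integral>\<^sup>+x. indicator UNIV x * emeasure N (ball x d) \<partial>M)"
      by (intro nn_integral_cong_AE eventually_mono[OF AM]) (simp add: b)
    also have "\<dots> = (\<integral>\<^sup>+y. emeasure M (UNIV \<inter> ball y d) \<partial>N)" by (rule swap) simp
    also have "\<dots> = (\<integral>\<^sup>+y. a d \<partial>N)"
      by (intro nn_integral_cong_AE eventually_mono[OF AN]) (simp add: a)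
    also have "\<dots> = a d * emeasure M UNIV" by (simp add: spN mass)
    finally show ?thesis
      using False M.emeasure_finite[of UNIV] by (metis ennreal_mult_cancel_left mult.commute infinity_ennreal_def)
  qed
  \<comment> \<open>By compactness finitely many of these balls cover S; if they were null, M would
    vanish.\<close>
  have pos: "a d \<noteq> 0" if d: "d > 0" for d
  proof
    assume 0: "a d = 0"
    obtain T where T: "T \<subseteq> S" "finite T" "S \<subseteq> (\<Union>x\<in>T. ball x d)"
      using compactE_image[OF S, of S "\<lambda>x. ball x d"] d by (metis UN_I centre_in_ball open_ball subsetI)
    have "(\<Union>x\<in>T. ball x d) \<in> null_sets M"
      using T a 0 by (intro null_sets_UN' countable_finite) (auto intro!: null_setsI simp: sM)
    then have "AE x in M. x \<notin> (\<Union>x\<in>T. ball x d)" by (rule AE_not_in)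
    then have "AE x in M. False" by (rule eventually_mono[OF eventually_conj[OF _ AM]]) (use T(3) in blast)
    then show False using False AE_iff_null_sets[of UNIV M] by (auto simp: sM)
  qed
  \<comment> \<open>The open neighbourhood of C of radius 1/(n + 1). A ball of this radius around a
    point outside it does not meet C, which is what bounds the double integral.\<close>
  define U where "U n = (\<Union>x\<in>C. ball x (1 / real (Suc n)))" for n
  have opU [measurable]: "U n \<in> sets borel" for n by (auto simp: U_def intro!: borel_open)
  have le: "emeasure M C \<le> emeasure N (U n)" for n
  proof -
    let ?d = "1 / real (Suc n)"
    have "emeasure M C * a ?d = (\<integral>\<^sup>+x. indicator C x * a ?d \<partial>M)" by (simp add: nn_integral_multc)
    also have "\<dots> = (\<integral>\<^sup>+x. indicator C x * emeasure N (ball x ?d) \<partial>M)"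
      by (intro nn_integral_cong_AE eventually_mono[OF AM]) (simp add: b ab)
    also have "\<dots> = (\<integral>\<^sup>+y. emeasure M (C \<inter> ball y ?d) \<partial>N)" by (rule swap) simp
    also have "\<dots> \<le> (\<integral>\<^sup>+y. a ?d * indicator (U n) y \<partial>N)"
    proof (rule nn_integral_mono_AE)
      show "AE y in N. emeasure M (C \<inter> ball y ?d) \<le> a ?d * indicator (U n) y"
        using AN
      proof eventually_elim
        fix y assume y: "y \<in> S"
        show "emeasure M (C \<inter> ball y ?d) \<le> a ?d * indicator (U n) y"
        proof (cases "y \<in> U n")
          case True
          then show ?thesis using a[OF y, of ?d] emeasure_mono[of "C \<inter> ball y ?d" "ball y ?d" M] by (simp add: sM)
        next
          case False
          then have "C \<inter> ball y ?d = {}" by (auto simp: U_def dist_commute)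
          then show ?thesis by simp
        qed
      qed
    qed
    also have "\<dots> = a ?d * emeasure N (U n)" by (rule nn_integral_cmult_indicator) (simp add: sN)
    finally have *: "a ?d * emeasure M C \<le> a ?d * emeasure N (U n)" by (simp add: mult.commute)
    have "a ?d \<noteq> \<infinity>" by (simp add: a_def)
    moreover have "a ?d > 0" using pos[of ?d] by (simp add: zero_less_iff_neq_zero)
    ultimately show ?thesis using * by (subst (asm) ennreal_mult_le_mult_iff) (auto simp: zero_less_iff_neq_zero less_top)
  qed
  have "(\<Inter>n. U n) = C"
  proof
    show "C \<subseteq> (\<Inter>n. U n)" by (force simp: U_def)
    show "(\<Inter>n. U n) \<subseteq> C"
    proof
      fix y assume y: "y \<in> (\<Inter>n. U n)"
      have "y \<in> closure C"
        unfolding closure_approachable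
      proof (intro allI impI)
        fix e :: real assume "e > 0"
        then obtain n where "1 / real (Suc n) < e" using nat_approx_posE by blast
        moreover obtain x where "x \<in> C" "dist x y < 1 / real (Suc n)" using y by (force simp: U_def)
        ultimately show "\<exists>x\<in>C. dist x y < e" by (auto intro: less_trans)
      qed
      then show "y \<in> C" using C by simp
    qed
  qed
  moreover have "(\<lambda>n. emeasure N (U n)) \<longlonglongrightarrow> emeasure N (\<Inter>n. U n)"
  proof (rule Lim_emeasure_decseq)
    show "decseq U"
      unfolding decseq_Suc_iff U_def
      by (intro allI UN_mono subset_ball) (auto simp: frac_le simp del: of_nat_Suc)
  qed (auto simp: sN)
  ultimately have "(\<lambda>n. emeasure N (U n)) \<longlonglongrightarrow> emeasure N C" by simp
  then show ?thesis by (rule Lim_bounded2) (use le in auto)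
qed

text \<open>The inequality, applied in both directions, gives equality on closed sets, and these
  form an intersection-stable generator of the Borel sets.\<close>

lemma invariant_measure_unique:
  fixes M N :: "'b::{metric_space, second_countable_topology} measure"
  assumes sM: "sets M = sets borel" and sN: "sets N = sets borel"
    and fM: "finite_measure M" and fN: "finite_measure N"
    and S: "compact S" and AM: "AE x in M. x \<in> S" and AN: "AE x in N. x \<in> S"
    and G: "\<And>g x y. g \<in> G \<Longrightarrow> dist (g x) (g y) = dist x y"
      "\<And>g. g \<in> G \<Longrightarrow> distr M borel g = M" "\<And>g. g \<in> G \<Longrightarrow> distr N borel g = N"
    and trans: "\<And>x y. x \<in> S \<Longrightarrow> y \<in> S \<Longrightarrow> \<exists>g\<in>G. g x = y"
    and mass: "emeasure M UNIV = emeasure N UNIV"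
  shows "M = N"
proof (rule measure_eqI_generator_eq[where E="Collect closed" and \<Omega>=UNIV and A="\<lambda>_. UNIV"])
  show "Int_stable (Collect (closed :: 'b set \<Rightarrow> bool))" by (auto simp: Int_stable_def)
  show "emeasure M X = emeasure N X" if "X \<in> Collect closed" for X
    using invariant_measure_le[OF sM sN fM fN S AM AN G trans mass, where C=X]
      invariant_measure_le[OF sN sM fN fM S AN AM G(1,3,2) trans mass[symmetric], where C=X] that
    by (intro antisym) auto
  show "sets M = sigma_sets UNIV (Collect closed)" "sets N = sigma_sets UNIV (Collect closed)"
    by (simp_all add: sM sN borel_eq_closed sets_measure_of)
  show "emeasure M UNIV \<noteq> \<infinity>" for i :: nat using finite_measure.emeasure_finite[OF fM, of UNIV] by simp
qed auto

subsection \<open>Transitivity on frames and the geodesic flow\<close>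

text \<open>The reflection in the hyperplane orthogonal to a - b, or the identity if a = b. Fixing
  this hyperplane is what lets a second reflection preserve what a first one has achieved.\<close>

lemma reflection_exists:
  fixes a b :: "'a::euclidean_space"
  assumes "norm a = norm b"
  obtains f where "orthogonal_transformation f" "f a = b" "\<And>z. z \<bullet> a = z \<bullet> b \<Longrightarrow> f z = z"
proof (cases "a = b")
  case True
  then show ?thesis using that[of "\<lambda>z. z"] by simp
next
  case False
  define u where "u = a - b"
  have uu: "u \<bullet> u \<noteq> 0" using False by (simp add: u_def)
  define f where "f z = z - (2 * (z \<bullet> u) / (u \<bullet> u)) *\<^sub>R u" for z
  have "linear f"
    by (rule linearI) (auto simp: f_def inner_add_left algebra_simps add_divide_distrib)
  moreover have "f v \<bullet> f w = v \<bullet> w" for v w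
  proof -
    have "f v \<bullet> f w = v \<bullet> w - (2 * (w \<bullet> u) / (u \<bullet> u)) * (v \<bullet> u) - (2 * (v \<bullet> u) / (u \<bullet> u)) * (u \<bullet> w)
       + (2 * (v \<bullet> u) / (u \<bullet> u)) * (2 * (w \<bullet> u) / (u \<bullet> u)) * (u \<bullet> u)"
      by (simp add: f_def inner_diff_left inner_diff_right algebra_simps)
    also have "\<dots> = v \<bullet> w" using uu by (simp add: inner_commute field_simps)
    finally show ?thesis .
  qed
  ultimately have "orthogonal_transformation f" by (simp add: orthogonal_transformation_def)
  moreover have "f a = b"
  proof -
    have "u \<bullet> u = 2 * (a \<bullet> u)"
      using assms by (simp add: u_def inner_diff_left inner_diff_right inner_commute norm_eq)
    then show ?thesis using uu by (simp add: f_def) (simp add: u_def)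
  qed
  moreover have "f z = z" if "z \<bullet> a = z \<bullet> b" for z
    using that by (simp add: f_def u_def inner_diff_right)
  ultimately show ?thesis using that by blast
qed

text \<open>One reflection takes x to y, a second one takes the image of w to v. Both of these
  vectors are orthogonal to y, so y is fixed by the second reflection.\<close>

lemma frames_transitive:
  fixes p q :: "'a::euclidean_space \<times> 'a"
  assumes "p \<in> frames" "q \<in> frames"
  obtains f where "orthogonal_transformation f" "map_prod f f p = q"
proof -
  obtain x w y v where pq: "p = (x, w)" "q = (y, v)" by fastforce
  have *: "norm x = 1" "norm w = 1" "x \<bullet> w = 0" "norm y = 1" "norm v = 1" "y \<bullet> v = 0"
    using assms by (auto simp: pq frames_def)
  obtain f where f: "orthogonal_transformation f" "f x = y"
    using reflection_exists[of x y] * by metis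
  have fw: "norm (f w) = 1" "y \<bullet> f w = 0"
    using f * orthogonal_transformation_inner[OF f(1), of x w] orthogonal_transformation_norm[OF f(1), of w] by auto
  obtain g where g: "orthogonal_transformation g" "g (f w) = v" "\<And>z. z \<bullet> f w = z \<bullet> v \<Longrightarrow> g z = z"
    using reflection_exists[of "f w" v] * fw by metis
  have "orthogonal_transformation (g \<circ> f)" using f g by (intro orthogonal_transformation_compose)
  moreover have "map_prod (g \<circ> f) (g \<circ> f) p = q"
    using f g fw * by (simp add: pq)
  ultimately show ?thesis using that by blast
qed

lemma frameV_orthogonal:
  fixes f :: "'a::euclidean_space \<Rightarrow> 'a"
  assumes f: "orthogonal_transformation f"
  shows "distr frameV borel (map_prod f f) = frameV"
proof (rule measure_eqI)
  have [measurable]: "f \<in> borel_measurable borel" by (rule orthogonal_transformation_measurable[OF f])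
  have [measurable]: "map_prod f f \<in> (borel :: ('a \<times> 'a) measure) \<rightarrow>\<^sub>M borel"
    unfolding borel_prod[symmetric] map_prod_def by measurable
  fix A assume "A \<in> sets (distr frameV borel (map_prod f f))"
  then have A [measurable]: "A \<in> sets borel" by simp
  have [measurable]: "A \<in> sets (borel \<Otimes>\<^sub>M borel)" unfolding borel_prod by (rule A)
  define G :: "'a \<Rightarrow> ennreal" where "G x = (\<integral>\<^sup>+w. indicator A (x, w) \<partial>tangV x)" for x
  have [measurable]: "G \<in> borel_measurable borel"
    unfolding G_def by (rule borel_measurable_nn_integral_tangV) measurable
  have "emeasure (distr frameV borel (map_prod f f)) A = (\<integral>\<^sup>+p. indicator A p \<partial>distr frameV borel (map_prod f f))" by simp
  also have "\<dots> = (\<integral>\<^sup>+p. indicator A (map_prod f f p) \<partial>frameV)"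
    by (rule nn_integral_distr) measurable
  also have "\<dots> = (\<integral>\<^sup>+x. \<integral>\<^sup>+w. indicator A (map_prod f f (x, w)) \<partial>tangV x \<partial>sphV)"
    by (rule nn_integral_frameV) measurable
  also have "\<dots> = (\<integral>\<^sup>+x. G (f x) \<partial>sphV)"
  proof (rule nn_integral_cong)
    fix x
    have "G (f x) = (\<integral>\<^sup>+w. indicator A (f x, w) \<partial>distr (tangV x) borel f)"
      by (simp add: G_def tangV_orthogonal[OF f])
    also have "\<dots> = (\<integral>\<^sup>+w. indicator A (f x, f w) \<partial>tangV x)"
      by (rule nn_integral_distr) measurable
    finally show "(\<integral>\<^sup>+w. indicator A (map_prod f f (x, w)) \<partial>tangV x) = G (f x)" by simp
  qed
  also have "\<dots> = (\<integral>\<^sup>+x. G x \<partial>distr sphV borel f)"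
    by (rule nn_integral_distr[symmetric]) measurable
  also have "\<dots> = (\<integral>\<^sup>+x. G x \<partial>sphV)" by (simp add: sphV_orthogonal[OF f])
  also have "\<dots> = (\<integral>\<^sup>+p. indicator A p \<partial>frameV)"
    unfolding G_def by (rule nn_integral_frameV[symmetric]) measurable
  also have "\<dots> = emeasure frameV A" by simp
  finally show "emeasure (distr frameV borel (map_prod f f)) A = emeasure frameV A" .
qed simp

text \<open>On \<open>frames\<close> this is position and velocity at time r on the great circle. It
  is defined as a linear map of all pairs, so that it preserves polynomials under composition and is
  its own derivative.\<close>

definition geo_flow :: "real \<Rightarrow> 'a::euclidean_space \<times> 'a \<Rightarrow> 'a \<times> 'a" where
  "geo_flow r p = (cos r *\<^sub>R fst p + sin r *\<^sub>R snd p, cos r *\<^sub>R snd p - sin r *\<^sub>R fst p)"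

lemma continuous_on_geo_flow: "continuous_on S (geo_flow r)"
  unfolding geo_flow_def by (intro continuous_intros)

lemma geo_flow_measurable [measurable]: "geo_flow r \<in> borel_measurable borel"
  by (intro borel_measurable_continuous_onI continuous_on_geo_flow)

lemma geo_flow_frames: "p \<in> frames \<Longrightarrow> geo_flow r p \<in> frames"
proof -
  assume p: "p \<in> frames"
  obtain x w where xw: "p = (x, w)" by fastforce
  have *: "x \<bullet> x = 1" "w \<bullet> w = 1" "x \<bullet> w = 0" "w \<bullet> x = 0"
    using p by (auto simp: xw frames_def norm_eq_1 inner_commute)
  have "cos r * cos r + sin r * sin r = 1" using sin_cos_squared_add3[of r] by simp
  then show ?thesis
    by (simp add: xw frames_def geo_flow_def norm_eq_1 inner_add_left inner_add_right inner_diff_left inner_diff_right * algebra_simps)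
qed

lemma geo_flow_add: "geo_flow r (geo_flow s p) = geo_flow (r + s) p"
  by (simp add: geo_flow_def cos_add sin_add algebra_simps)

lemma geo_flow_0 [simp]: "geo_flow 0 p = p"
  by (simp add: geo_flow_def)

lemma geo_flow_orthogonal:
  assumes "orthogonal_transformation f"
  shows "geo_flow r (map_prod f f p) = map_prod f f (geo_flow r p)"
  using orthogonal_transformation_linear[OF assms]
  by (cases p) (simp add: geo_flow_def linear_add linear_diff linear_scale)

text \<open>The flow commutes with orthogonal maps acting on both components, so the image measure
  inherits their invariance and the uniqueness result applies.\<close>

lemma frameV_geo_flow:
  assumes dim: "DIM('a::euclidean_space) \<ge> 2"
  shows "distr frameV borel (geo_flow r) = (frameV :: ('a \<times> 'a) measure)"
proof (rule invariant_measure_unique[where S=frames and G="{map_prod f f | f. orthogonal_transformation f}"])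
  interpret F: finite_measure "frameV :: ('a \<times> 'a) measure" by (rule finite_measure_frameV[OF dim])
  show "finite_measure (frameV :: ('a \<times> 'a) measure)" by (rule finite_measure_frameV[OF dim])
  show "finite_measure (distr (frameV :: ('a \<times> 'a) measure) borel (geo_flow r))" by (rule F.finite_measure_distr) simp
  show "AE p in frameV :: ('a \<times> 'a) measure. p \<in> frames" by (rule AE_frameV)
  show "AE p in distr (frameV :: ('a \<times> 'a) measure) borel (geo_flow r). p \<in> frames"
    using AE_frameV by (subst AE_distr_iff) (auto elim!: eventually_mono intro: geo_flow_frames)
  show "emeasure (distr (frameV :: ('a \<times> 'a) measure) borel (geo_flow r)) UNIV = emeasure (frameV :: ('a \<times> 'a) measure) UNIV"
    by (subst emeasure_distr) auto
  fix g :: "'a \<times> 'a \<Rightarrow> 'a \<times> 'a" assume "g \<in> {map_prod f f | f. orthogonal_transformation f}"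
  then obtain f :: "'a \<Rightarrow> 'a" where f: "orthogonal_transformation f" and g: "g = map_prod f f" by auto
  have [measurable]: "f \<in> borel_measurable borel" by (rule orthogonal_transformation_measurable[OF f])
  have [measurable]: "g \<in> (borel :: ('a \<times> 'a) measure) \<rightarrow>\<^sub>M borel"
    unfolding g borel_prod[symmetric] map_prod_def by measurable
  show inv: "distr frameV borel g = frameV" using frameV_orthogonal[OF f] by (simp add: g)
  have "distr (distr frameV borel (geo_flow r)) borel g = distr frameV borel (g \<circ> geo_flow r)"
    by (rule distr_distr) measurable
  also have "g \<circ> geo_flow r = geo_flow r \<circ> g" by (rule ext) (simp add: g geo_flow_orthogonal[OF f])
  also have "distr frameV borel (geo_flow r \<circ> g) = distr (distr frameV borel g) borel (geo_flow r)"
    by (rule distr_distr[symmetric]) measurable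
  finally show "distr (distr frameV borel (geo_flow r)) borel g = distr frameV borel (geo_flow r)"
    by (simp add: inv)
  have "dist (f a) (f b) = dist a b" for a b
    using linear_diff[OF orthogonal_transformation_linear[OF f]] orthogonal_transformation_norm[OF f]
    by (metis dist_norm)
  then show "dist (g x) (g y) = dist x y" for x y
    by (cases x; cases y) (simp add: g dist_prod_def)
next
  fix p q :: "'a \<times> 'a" assume "p \<in> frames" "q \<in> frames"
  then show "\<exists>g\<in>{map_prod f f | f. orthogonal_transformation f}. g p = q"
    using frames_transitive[of p q] by blast
qed (auto simp: compact_frames)

subsection \<open>Polar coordinates\<close>

lemma nn_integral_lborel_scale:
  fixes h :: "'a::euclidean_space \<Rightarrow> ennreal"
  assumes c: "c > 0" and [measurable]: "h \<in> borel_measurable borel"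
  shows "(\<integral>\<^sup>+z. h z \<partial>lborel) = ennreal (c ^ DIM('a)) * (\<integral>\<^sup>+z. h (c *\<^sub>R z) \<partial>lborel)"
proof -
  have "(\<integral>\<^sup>+z. h z \<partial>lborel) = (\<integral>\<^sup>+z. h z \<partial>density (distr lborel borel (\<lambda>z::'a. 0 + c *\<^sub>R z)) (\<lambda>_. ennreal (\<bar>c\<bar> ^ DIM('a))))"
    using lborel_affine[of c "0::'a"] c by simp
  also have "\<dots> = (\<integral>\<^sup>+z. ennreal (\<bar>c\<bar> ^ DIM('a)) * h (0 + c *\<^sub>R z) \<partial>lborel)"
    by (subst nn_integral_density, simp, measurable, subst nn_integral_distr) auto
  also have "\<dots> = ennreal (c ^ DIM('a)) * (\<integral>\<^sup>+z. h (c *\<^sub>R z) \<partial>lborel)"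
    using c by (subst nn_integral_cmult) auto
  finally show ?thesis .
qed

context
  fixes x :: "'a::euclidean_space" and B :: "'a set"
  assumes x: "norm x = 1" and B: "orthonormal B" "span B = tangent_space x"
begin

text \<open>Thickening by an interval of length c expresses integrals over the hyperplane orthogonal
  to x through \<open>lborel\<close>, whose scaling behaviour is known.\<close>

lemma nn_integral_slab:
  assumes c: "c > 0" and [measurable]: "h \<in> borel_measurable borel"
  shows "(\<integral>\<^sup>+z. indicator {0..c} (z \<bullet> x) * h (proj_perp x z) \<partial>lborel) = ennreal c * (\<integral>\<^sup>+v. h v \<partial>onb_lborel B)"
proof -
  have "(\<integral>\<^sup>+z. indicator {0..c} (z \<bullet> x) * h (proj_perp x z) \<partial>lborel) =
    (\<integral>\<^sup>+t. \<integral>\<^sup>+v. indicator {0..c} ((t *\<^sub>R x + v) \<bullet> x) * h (proj_perp x (t *\<^sub>R x + v)) \<partial>onb_lborel B \<partial>lborel)"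
    by (rule nn_integral_lborel_perp[OF x B]) measurable
  also have "\<dots> = (\<integral>\<^sup>+t. \<integral>\<^sup>+v. indicator {0..c} t * h v \<partial>onb_lborel B \<partial>lborel)"
    by (intro nn_integral_cong nn_integral_cong_AE eventually_mono[OF AE_onb_lborel_tangent[OF B]])
      (simp add: proj_perp_decomp[OF x])
  also have "\<dots> = ennreal c * (\<integral>\<^sup>+v. h v \<partial>onb_lborel B)"
    using c by (simp add: nn_integral_cmult nn_integral_multc)
  finally show ?thesis .
qed

lemma card_tangent: "card B = DIM('a) - 1" "DIM('a) = Suc (card B)"
  using orthonormal_insert_tangent(4)[OF x B] by auto

text \<open>Scaling a slab produces the ambient factor \<open>c ^ DIM('a)\<close>, of which one
  power is the thickness c.\<close>

lemma nn_integral_onb_scale: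
  assumes c: "c > 0" and [measurable]: "h \<in> borel_measurable borel"
  shows "(\<integral>\<^sup>+v. h v \<partial>onb_lborel B) = ennreal (c ^ card B) * (\<integral>\<^sup>+v. h (c *\<^sub>R v) \<partial>onb_lborel B)"
proof -
  have pc: "proj_perp x (c *\<^sub>R z) = c *\<^sub>R proj_perp x z" for z
    by (simp add: proj_perp_def algebra_simps)
  have "ennreal c * (\<integral>\<^sup>+v. h v \<partial>onb_lborel B) = (\<integral>\<^sup>+z. indicator {0..c} (z \<bullet> x) * h (proj_perp x z) \<partial>lborel)"
    by (rule nn_integral_slab[OF c, symmetric]) measurable
  also have "\<dots> = ennreal (c ^ DIM('a)) * (\<integral>\<^sup>+z. indicator {0..c} ((c *\<^sub>R z) \<bullet> x) * h (proj_perp x (c *\<^sub>R z)) \<partial>lborel)"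
    by (rule nn_integral_lborel_scale[OF c]) measurable
  also have "\<dots> = ennreal (c ^ DIM('a)) * (\<integral>\<^sup>+z. indicator {0..1} (z \<bullet> x) * h (c *\<^sub>R proj_perp x z) \<partial>lborel)"
    using c by (intro arg_cong[where f="(*) (ennreal _)"] nn_integral_cong) (auto simp: pc indicator_def zero_le_mult_iff)
  also have "(\<integral>\<^sup>+z. indicator {0..1} (z \<bullet> x) * h (c *\<^sub>R proj_perp x z) \<partial>lborel) = (\<integral>\<^sup>+v. h (c *\<^sub>R v) \<partial>onb_lborel B)"
    using nn_integral_slab[of 1 "\<lambda>v. h (c *\<^sub>R v)"] by simp
  also have "ennreal (c ^ DIM('a)) * (\<integral>\<^sup>+v. h (c *\<^sub>R v) \<partial>onb_lborel B) =
      ennreal c * (ennreal (c ^ card B) * (\<integral>\<^sup>+v. h (c *\<^sub>R v) \<partial>onb_lborel B))"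
    using c by (simp add: card_tangent(2) ennreal_mult mult.assoc)
  finally show ?thesis using c by (simp add: ennreal_mult_cancel_left)
qed

lemma radial_indicator:
  assumes R: "R > 0" and [measurable]: "W \<in> sets borel"
  shows "(\<integral>\<^sup>+v. indicator {v. v \<noteq> 0 \<and> norm v \<le> R} v * indicator W (sgn v) \<partial>onb_lborel B) =
    ennreal (R ^ card B) * (\<integral>\<^sup>+v. indicator {v. v \<noteq> 0 \<and> norm v \<le> 1} v * indicator W (sgn v) \<partial>onb_lborel B)"
proof -
  have "(\<integral>\<^sup>+v. indicator {v. v \<noteq> 0 \<and> norm v \<le> R} v * indicator W (sgn v) \<partial>onb_lborel B) =
    ennreal (R ^ card B) * (\<integral>\<^sup>+v. indicator {v. v \<noteq> 0 \<and> norm v \<le> R} (R *\<^sub>R v) * indicator W (sgn (R *\<^sub>R v)) \<partial>onb_lborel B)"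
    by (rule nn_integral_onb_scale[OF R]) measurable
  also have "(\<integral>\<^sup>+v. indicator {v. v \<noteq> 0 \<and> norm v \<le> R} (R *\<^sub>R v) * indicator W (sgn (R *\<^sub>R v)) \<partial>onb_lborel B) =
    (\<integral>\<^sup>+v. indicator {v. v \<noteq> 0 \<and> norm v \<le> 1} v * indicator W (sgn v) \<partial>onb_lborel B)"
    using R by (intro nn_integral_cong) (auto simp: indicator_def sgn_scaleR)
  finally show ?thesis .
qed

text \<open>Write 1 - norm v as the length of the interval from norm v to 1 and exchange the
  integrals. The cone of radius s has volume proportional to \<open>s ^ card B\<close>, so the
  complementary weight contributes the fraction 1/(card B + 1) of the cone volume m. What remains is
  card B * m / (card B + 1), and card B * m is the measure of W.\<close>

lemma radial_norm_unit:
  assumes [measurable]: "W \<in> sets borel"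
  shows "(\<integral>\<^sup>+v. ennreal (norm v) * (indicator {v. v \<noteq> 0 \<and> norm v \<le> 1} v * indicator W (sgn v)) \<partial>onb_lborel B) =
    ennreal (1 / real DIM('a)) * emeasure (tangV x) W"
proof -
  let ?n = "card B"
  interpret sigma_finite_measure "onb_lborel B" by (rule sigma_finite_onb_lborel[OF B(1)])
  interpret P: pair_sigma_finite "onb_lborel B" "lborel :: real measure" ..
  define q :: "'a \<Rightarrow> ennreal" where "q v = indicator {v. v \<noteq> 0 \<and> norm v \<le> 1} v * indicator W (sgn v)" for v
  have [measurable]: "q \<in> borel_measurable borel" unfolding q_def by measurable
  define m where "m = (\<integral>\<^sup>+v. q v \<partial>onb_lborel B)"
  define M where "M = (\<integral>\<^sup>+v. ennreal (norm v) * q v \<partial>onb_lborel B)"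
  have tang: "emeasure (tangV x) W = of_nat ?n * m"
    using nn_integral_onb_sphere[of "indicator W" B]
    by (simp add: m_def q_def tangV_eq_onb_sphere[OF x B, symmetric])
  have "m \<le> (\<integral>\<^sup>+v. indicator (cball 0 1) v \<partial>onb_lborel B)"
    unfolding m_def q_def by (intro nn_integral_mono) (auto simp: indicator_def)
  also have "\<dots> = emeasure (onb_lborel B) (cball 0 1)"
    by (rule nn_integral_indicator) simp
  also have "\<dots> < \<infinity>" by (simp add: emeasure_onb_lborel_cball[OF B(1)])
  finally have mfin: "m < \<infinity>" .
  have "(\<integral>\<^sup>+v. ennreal (1 - norm v) * q v \<partial>onb_lborel B) =
      (\<integral>\<^sup>+v. \<integral>\<^sup>+s. q v * indicator {p. norm (fst p) \<le> snd p \<and> snd p \<le> 1} (v, s) \<partial>lborel \<partial>onb_lborel B)"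
  proof (rule nn_integral_cong)
    fix v
    have "(\<integral>\<^sup>+s. q v * indicator {p. norm (fst p) \<le> snd p \<and> snd p \<le> 1} (v, s) \<partial>lborel) = (\<integral>\<^sup>+s. q v * indicator {norm v..1} s \<partial>lborel)"
      by (intro nn_integral_cong) (auto simp: indicator_def)
    also have "\<dots> = q v * emeasure lborel {norm v..1}" by (rule nn_integral_cmult_indicator) simp
    also have "\<dots> = ennreal (1 - norm v) * q v"
      by (cases "norm v \<le> 1") (auto simp: q_def mult.commute)
    finally show "ennreal (1 - norm v) * q v = (\<integral>\<^sup>+s. q v * indicator {p. norm (fst p) \<le> snd p \<and> snd p \<le> 1} (v, s) \<partial>lborel)" ..
  qed
  also have "\<dots> = (\<integral>\<^sup>+s. \<integral>\<^sup>+v. q v * indicator {p. norm (fst p) \<le> snd p \<and> snd p \<le> 1} (v, s) \<partial>onb_lborel B \<partial>lborel)"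
    by (rule P.Fubini'[symmetric]) measurable
  also have "\<dots> = (\<integral>\<^sup>+s. (ennreal (s ^ ?n) * indicator {0..1} s) * m \<partial>lborel)"
  proof (rule nn_integral_cong_AE)
    show "AE s in lborel. (\<integral>\<^sup>+v. q v * indicator {p. norm (fst p) \<le> snd p \<and> snd p \<le> 1} (v, s) \<partial>onb_lborel B)
      = (ennreal (s ^ ?n) * indicator {0..1} s) * m"
      using AE_lborel_singleton[of 0]
    proof eventually_elim
      fix s :: real assume "s \<noteq> 0"
      show "(\<integral>\<^sup>+v. q v * indicator {p. norm (fst p) \<le> snd p \<and> snd p \<le> 1} (v, s) \<partial>onb_lborel B)
      = (ennreal (s ^ ?n) * indicator {0..1} s) * m"
      proof (cases "0 < s \<and> s \<le> 1")
        case True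
        have "(\<integral>\<^sup>+v. q v * indicator {p. norm (fst p) \<le> snd p \<and> snd p \<le> 1} (v, s) \<partial>onb_lborel B) =
          (\<integral>\<^sup>+v. indicator {v. v \<noteq> 0 \<and> norm v \<le> s} v * indicator W (sgn v) \<partial>onb_lborel B)"
          using True by (intro nn_integral_cong) (auto simp: q_def indicator_def)
        also have "\<dots> = ennreal (s ^ ?n) * m"
          unfolding m_def q_def using True by (intro radial_indicator) auto
        finally show ?thesis using True by simp
      next
        case False
        have "(\<integral>\<^sup>+v. q v * indicator {p. norm (fst p) \<le> snd p \<and> snd p \<le> 1} (v, s) \<partial>onb_lborel B) = (\<integral>\<^sup>+v. 0 \<partial>onb_lborel B)"
        proof (rule nn_integral_cong)
          fix v
          show "q v * indicator {p. norm (fst p) \<le> snd p \<and> snd p \<le> 1} (v, s) = 0"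
          proof (cases "v = 0")
            case nz: False
            then have "norm v > 0" by simp
            then have "\<not> (norm v \<le> s \<and> s \<le> 1)" using False by linarith
            then show ?thesis by (auto simp: indicator_def)
          qed (simp add: q_def)
        qed
        then show ?thesis using False \<open>s \<noteq> 0\<close> by (auto simp: indicator_def)
      qed
    qed
  qed
  also have "\<dots> = (\<integral>\<^sup>+s. ennreal (s ^ ?n) * indicator {0..1} s \<partial>lborel) * m"
    by (rule nn_integral_multc) measurable
  also have "(\<integral>\<^sup>+s. ennreal (s ^ ?n) * indicator {0..1} s \<partial>lborel) = ennreal (1 / real (Suc ?n))"
  proof -
    have "((\<lambda>s::real. s ^ ?n) has_integral (1 ^ Suc ?n / real (Suc ?n) - 0 ^ Suc ?n / real (Suc ?n))) {0..1}"
    proof (rule fundamental_theorem_of_calculus)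
      fix s :: real
      have "((\<lambda>s::real. s ^ Suc ?n / real (Suc ?n)) has_real_derivative s ^ ?n) (at s within {0..1})"
        by (rule derivative_eq_intros refl | simp)+
      then show "((\<lambda>s::real. s ^ Suc ?n / real (Suc ?n)) has_vector_derivative s ^ ?n) (at s within {0..1})"
        by (simp add: has_real_derivative_iff_has_vector_derivative)
    qed simp
    then show ?thesis by (subst nn_integral_has_integral_lebesgue') auto
  qed
  finally have A: "(\<integral>\<^sup>+v. ennreal (1 - norm v) * q v \<partial>onb_lborel B) = ennreal (1 / real (Suc ?n)) * m" .
  have "m = (\<integral>\<^sup>+v. ennreal (1 - norm v) * q v + ennreal (norm v) * q v \<partial>onb_lborel B)"
    unfolding m_def
  proof (rule nn_integral_cong)
    fix v
    have "q v = 0 \<or> norm v \<le> 1" by (auto simp: q_def)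
    then show "q v = ennreal (1 - norm v) * q v + ennreal (norm v) * q v"
    proof
      assume "norm v \<le> 1"
      then have "ennreal (1 - norm v) + ennreal (norm v) = 1"
        by (simp add: ennreal_plus[symmetric] del: ennreal_plus)
      then show ?thesis by (metis distrib_right mult_1)
    qed simp
  qed
  also have "\<dots> = ennreal (1 / real (Suc ?n)) * m + M"
    by (subst nn_integral_add) (auto simp: A M_def)
  finally have eq: "m = ennreal (1 / real (Suc ?n)) * m + M" .
  then have "M < \<infinity>" using mfin by (metis ennreal_add_eq_top infinity_ennreal_def less_top)
  then obtain M' m' where r: "M = ennreal M'" "M' \<ge> 0" "m = ennreal m'" "m' \<ge> 0"
    using mfin by (metis ennreal_cases less_irrefl infinity_ennreal_def)
  have "m' = 1 / real (Suc ?n) * m' + M'"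
    using eq r by (simp add: ennreal_mult[symmetric] ennreal_plus[symmetric] del: ennreal_plus of_nat_Suc)
  then have "real (Suc ?n) * m' = m' + real (Suc ?n) * M'"
    by (simp add: field_simps)
  then have "M' = 1 / real (Suc ?n) * (real ?n * m')"
    by (simp add: field_simps)
  then have "M = ennreal (1 / real (Suc ?n)) * (of_nat ?n * m)"
  proof -
    have "ennreal (1 / real (Suc ?n) * (real ?n * m')) = ennreal (1 / real (Suc ?n)) * (ennreal (real ?n) * ennreal m')"
      using r by (subst ennreal_mult, simp, simp, subst ennreal_mult, simp_all)
    then show ?thesis using \<open>M' = _\<close> r by (simp only: ennreal_of_nat_eq_real_of_nat)
  qed
  then show ?thesis by (simp add: tang M_def q_def card_tangent(2) del: of_nat_Suc)
qed

text \<open>Scaling extends the previous result to radius R for sets W; comparing the image measure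
  with a multiple of \<open>tangV x\<close> then covers all g at once.\<close>

lemma radial_norm:
  assumes R: "R > 0" and g [measurable]: "g \<in> borel_measurable borel"
  shows "(\<integral>\<^sup>+v. ennreal (norm v) * indicator {v. v \<noteq> 0 \<and> norm v \<le> R} v * g (sgn v) \<partial>onb_lborel B) =
    ennreal (R ^ DIM('a) / real DIM('a)) * (\<integral>\<^sup>+w. g w \<partial>tangV x)"
proof -
  let ?d = "\<lambda>v. ennreal (norm v) * indicator {v. v \<noteq> 0 \<and> norm v \<le> R} v"
  let ?L = "distr (density (onb_lborel B) ?d) borel sgn"
  have "?L = scale_measure (ennreal (R ^ DIM('a) / real DIM('a))) (tangV x)"
  proof (rule measure_eqI)
    fix W assume "W \<in> sets ?L"
    then have W [measurable]: "W \<in> sets borel" by simp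
    have "emeasure ?L W = (\<integral>\<^sup>+v. indicator W v \<partial>?L)" by simp
    also have "\<dots> = (\<integral>\<^sup>+v. ?d v * indicator W (sgn v) \<partial>onb_lborel B)"
      by (subst nn_integral_distr, measurable, subst nn_integral_density) auto
    also have "\<dots> = ennreal (R ^ card B) * (\<integral>\<^sup>+v. ?d (R *\<^sub>R v) * indicator W (sgn (R *\<^sub>R v)) \<partial>onb_lborel B)"
      by (rule nn_integral_onb_scale[OF R]) measurable
    also have "(\<integral>\<^sup>+v. ?d (R *\<^sub>R v) * indicator W (sgn (R *\<^sub>R v)) \<partial>onb_lborel B) =
        (\<integral>\<^sup>+v. ennreal R * (ennreal (norm v) * (indicator {v. v \<noteq> 0 \<and> norm v \<le> 1} v * indicator W (sgn v))) \<partial>onb_lborel B)"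
      using R by (intro nn_integral_cong) (auto simp: indicator_def sgn_scaleR ennreal_mult)
    also have "\<dots> = ennreal R * (ennreal (1 / real DIM('a)) * emeasure (tangV x) W)"
      by (subst nn_integral_cmult) (auto simp: radial_norm_unit[OF W])
    also have "ennreal (R ^ card B) * \<dots> = ennreal (R ^ card B * (R * (1 / real DIM('a)))) * emeasure (tangV x) W"
    proof -
      have "ennreal (R ^ card B * (R * (1 / real DIM('a)))) = ennreal (R ^ card B) * (ennreal R * ennreal (1 / real DIM('a)))"
        using R by (subst ennreal_mult, simp, simp, subst ennreal_mult, simp_all)
      then show ?thesis by (simp only: mult.assoc)
    qed
    also have "R ^ card B * (R * (1 / real DIM('a))) = R ^ DIM('a) / real DIM('a)"
      by (simp add: card_tangent(2))
    finally show "emeasure ?L W = emeasure (scale_measure (ennreal (R ^ DIM('a) / real DIM('a))) (tangV x)) W"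
      by simp
  qed simp
  then have "(\<integral>\<^sup>+v. g v \<partial>?L) = ennreal (R ^ DIM('a) / real DIM('a)) * (\<integral>\<^sup>+w. g w \<partial>tangV x)"
    by (simp add: nn_integral_scale_measure)
  moreover have "(\<integral>\<^sup>+v. g v \<partial>?L) = (\<integral>\<^sup>+v. ?d v * g (sgn v) \<partial>onb_lborel B)"
    by (subst nn_integral_distr, measurable, subst nn_integral_density) auto
  ultimately show ?thesis by simp
qed

end

text \<open>The substitution t = s cot r, under which the point (t, s) has polar angle r and radius
  s / sin r. The condition that the radius is at most 1 thus becomes s \<le> sin r.\<close>

lemma nn_integral_cot_substitution:
  fixes F :: "real \<Rightarrow> ennreal"
  assumes s: "s > 0" and [measurable]: "F \<in> borel_measurable borel"
  shows "(\<integral>\<^sup>+t. indicator {t. t\<^sup>2 + s\<^sup>2 \<le> 1} t * F t \<partial>lborel) =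
    (\<integral>\<^sup>+r. indicator {0<..<pi} r * (indicator {r. s \<le> sin r} r * ennreal (s / (sin r)\<^sup>2)) * F (s * cot r) \<partial>lborel)"
proof -
  consider "s < 1" | "s = 1" | "s > 1" by linarith
  then show ?thesis
  proof cases
    case 1
    \<comment> \<open>The angles with sine at least s form the interval from a to pi - a.\<close>
    define a where "a = arcsin s"
    have a: "0 < a" "a < pi / 2" "sin a = s" "cos a = sqrt (1 - s\<^sup>2)"
      using s 1 arcsin_less_arcsin[of 0 s] arcsin_less_arcsin[of s 1] by (auto simp: a_def cos_arcsin)
    have mem: "s \<le> sin r \<longleftrightarrow> r \<in> {a..pi - a}" if r: "0 < r" "r < pi" for r
    proof -
      have "s \<le> sin r \<longleftrightarrow> a \<le> r \<and> r \<le> pi - a"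
      proof (cases "r \<le> pi / 2")
        case True
        then have "s \<le> sin r \<longleftrightarrow> a \<le> r" using a r by (subst a(3)[symmetric], subst sin_mono_le_eq) auto
        then show ?thesis using True a by auto
      next
        case False
        then have "s \<le> sin (pi - r) \<longleftrightarrow> a \<le> pi - r" using a r by (subst a(3)[symmetric], subst sin_mono_le_eq) auto
        then show ?thesis using False a by auto
      qed
      then show ?thesis by simp
    qed
    have pos: "0 < sin r" if "r \<in> {a..pi - a}" for r using that a by (auto intro!: sin_gt_zero)
    \<comment> \<open>The cotangent decreases, whereas the substitution rule expects an increasing
      map. Hence the sign, compensated by reflecting t below.\<close>
    define g where "g r = - s * cot r" for r
    have ga: "g a = - sqrt (1 - s\<^sup>2)" "g (pi - a) = sqrt (1 - s\<^sup>2)"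
      using s a by (simp_all add: g_def cot_def)
    have sq: "t\<^sup>2 + s\<^sup>2 \<le> 1 \<longleftrightarrow> t \<in> {- sqrt (1 - s\<^sup>2)..sqrt (1 - s\<^sup>2)}" for t
    proof -
      have "t\<^sup>2 + s\<^sup>2 \<le> 1 \<longleftrightarrow> t\<^sup>2 \<le> 1 - s\<^sup>2" by linarith
      also have "\<dots> \<longleftrightarrow> \<bar>t\<bar> \<le> sqrt (1 - s\<^sup>2)"
        by (metis real_sqrt_abs real_sqrt_le_iff)
      finally show ?thesis by auto
    qed
    have "(\<integral>\<^sup>+t. indicator {t. t\<^sup>2 + s\<^sup>2 \<le> 1} t * F t \<partial>lborel) =
        (\<integral>\<^sup>+t. indicator {t. t\<^sup>2 + s\<^sup>2 \<le> 1} t * F t \<partial>distr lborel borel uminus)"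
      by (simp add: lborel_distr_uminus)
    also have "\<dots> = (\<integral>\<^sup>+t. indicator {t. t\<^sup>2 + s\<^sup>2 \<le> 1} (- t) * F (- t) \<partial>lborel)"
      by (rule nn_integral_distr) measurable
    also have "\<dots> = (\<integral>\<^sup>+t. F (- t) * indicator {g a..g (pi - a)} t \<partial>lborel)"
      by (intro nn_integral_cong) (auto simp: ga sq indicator_def mult.commute)
    also have "\<dots> = (\<integral>\<^sup>+r. F (- g r) * ennreal (s / (sin r)\<^sup>2) * indicator {a..pi - a} r \<partial>lborel)"
    proof (rule nn_integral_substitution_aux)
      show "a < pi - a" using a by simp
      show "(g has_real_derivative s / (sin r)\<^sup>2) (at r)" if "r \<in> {a..pi - a}" for r
        unfolding g_def using pos[OF that]
        by (auto intro!: derivative_eq_intros DERIV_cot[THEN DERIV_cong] simp: divide_inverse)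
      show "continuous_on {a..pi - a} (\<lambda>r. s / (sin r)\<^sup>2)"
        using pos by (intro continuous_intros) force
      show "0 \<le> s / (sin r)\<^sup>2" for r using s by simp
    qed simp_all
    also have "\<dots> = (\<integral>\<^sup>+r. indicator {0<..<pi} r * (indicator {r. s \<le> sin r} r * ennreal (s / (sin r)\<^sup>2)) * F (s * cot r) \<partial>lborel)"
    proof (rule nn_integral_cong)
      fix r
      have "r \<in> {a..pi - a} \<longleftrightarrow> r \<in> {0<..<pi} \<and> s \<le> sin r" using mem[of r] a by auto
      then show "F (- g r) * ennreal (s / (sin r)\<^sup>2) * indicator {a..pi - a} r =
        indicator {0<..<pi} r * (indicator {r. s \<le> sin r} r * ennreal (s / (sin r)\<^sup>2)) * F (s * cot r)"
        by (auto simp: indicator_def g_def mult_ac)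
    qed
    finally show ?thesis .
  next
    \<comment> \<open>The range of t shrinks to 0 and that of r to pi/2, so both integrals
      vanish.\<close>
    case 2
    have "(\<integral>\<^sup>+t. indicator {t. t\<^sup>2 + s\<^sup>2 \<le> 1} t * F t \<partial>lborel) = (\<integral>\<^sup>+t. 0 \<partial>(lborel :: real measure))"
      by (intro nn_integral_cong_AE eventually_mono[OF AE_lborel_singleton[of 0]]) (auto simp: 2 indicator_def)
    moreover have "(\<integral>\<^sup>+r. indicator {0<..<pi} r * (indicator {r. s \<le> sin r} r * ennreal (s / (sin r)\<^sup>2)) * F (s * cot r) \<partial>lborel)
      = (\<integral>\<^sup>+t. 0 \<partial>(lborel :: real measure))"
    proof (intro nn_integral_cong_AE eventually_mono[OF AE_lborel_singleton[of "pi/2"]])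
      fix r :: real assume r: "r \<noteq> pi / 2"
      have "\<not> 1 \<le> sin r" if "0 < r" "r < pi"
      proof
        assume "1 \<le> sin r"
        then have "sin r = 1" using sin_le_one[of r] by linarith
        then have "cos r = 0" using sin_cos_squared_add[of r] by simp
        then show False using cos_inj_pi[of r "pi/2"] that r by auto
      qed
      then show "indicator {0<..<pi} r * (indicator {r. s \<le> sin r} r * ennreal (s / (sin r)\<^sup>2)) * F (s * cot r) = 0"
        by (auto simp: 2 indicator_def)
    qed
    ultimately show ?thesis by simp
  next
    case 3
    have "s\<^sup>2 > 1" using 3 by simp
    then have "\<not> t\<^sup>2 + s\<^sup>2 \<le> 1" for t using zero_le_power2[of t] by linarith
    moreover have "\<not> s \<le> sin r" for r using 3 sin_le_one[of r] by linarith
    ultimately show ?thesis by simp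
  qed
qed

text \<open>
  Write a point of the ball as \<open>t x + v\<close> with \<open>v\<close> orthogonal to \<open>x\<close>. For fixed \<open>v\<close> its angle \<open>r\<close> with \<open>x\<close> is
  given by \<open>t = |v| cot r\<close>; after this substitution only the radial integral over \<open>v\<close> is left.
\<close>

lemma nn_integral_sphV_polar:
  fixes x :: "'a::euclidean_space"
  assumes dim: "DIM('a) \<ge> 2" and x: "norm x = 1" and g [measurable]: "g \<in> borel_measurable borel"
  shows "(\<integral>\<^sup>+y. g y \<partial>sphV) =
    (\<integral>\<^sup>+r. indicator {0<..<pi} r * ennreal (sin r ^ (DIM('a) - 2)) * (\<integral>\<^sup>+w. g (cos r *\<^sub>R x + sin r *\<^sub>R w) \<partial>tangV x) \<partial>lborel)"
proof -
  define B where "B = orthonormal_basis_of (tangent_space x)"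
  have B: "orthonormal B" "span B = tangent_space x"
    using orthonormal_basis_of[OF subspace_tangent_space, of x] by (auto simp: B_def)
  have ne: "B \<noteq> {}" using card_tangent[OF x B] dim by auto
  interpret sigma_finite_measure "onb_lborel B" by (rule sigma_finite_onb_lborel[OF B(1)])
  interpret P: pair_sigma_finite "lborel :: real measure" "onb_lborel B" ..
  let ?N = "real DIM('a)"
  have AE0: "AE v in onb_lborel B. v \<noteq> 0"
    using AE_iff_null_sets[of "{0}" "onb_lborel B"] emeasure_onb_lborel_zero[OF B(1) ne] by (auto intro: null_setsI)
  define H where "H = (\<lambda>z::'a. indicator {z. z \<noteq> 0 \<and> norm z \<le> 1} z * g (sgn z))"
  have [measurable]: "H \<in> borel_measurable borel" unfolding H_def by measurable
  have "(\<integral>\<^sup>+y. g y \<partial>sphV) = (\<integral>\<^sup>+z. of_nat DIM('a) * H z \<partial>lborel)"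
    by (simp add: nn_integral_sphV H_def mult.assoc)
  also have "\<dots> = ennreal ?N * (\<integral>\<^sup>+z. H z \<partial>lborel)"
    by (subst nn_integral_cmult) (auto simp: ennreal_of_nat_eq_real_of_nat)
  also have "(\<integral>\<^sup>+z. H z \<partial>lborel) = (\<integral>\<^sup>+t. \<integral>\<^sup>+v. H (t *\<^sub>R x + v) \<partial>onb_lborel B \<partial>lborel)"
    by (rule nn_integral_lborel_perp[OF x B]) measurable
  also have "\<dots> = (\<integral>\<^sup>+v. \<integral>\<^sup>+t. H (t *\<^sub>R x + v) \<partial>lborel \<partial>onb_lborel B)"
    by (rule P.Fubini'[symmetric]) measurable
  \<comment> \<open>The factor norm v / (sin r)^2 is the Jacobian of t = norm v * cot r. It is split
    so that norm v stays with the integral over v.\<close>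
  also have "\<dots> = (\<integral>\<^sup>+v. \<integral>\<^sup>+r. indicator {0<..<pi} r * (ennreal (1 / (sin r)\<^sup>2) * (ennreal (norm v) * indicator {v. v \<noteq> 0 \<and> norm v \<le> sin r} v))
      * g (cos r *\<^sub>R x + sin r *\<^sub>R sgn v) \<partial>lborel \<partial>onb_lborel B)"
  proof (rule nn_integral_cong_AE)
    show "AE v in onb_lborel B. (\<integral>\<^sup>+t. H (t *\<^sub>R x + v) \<partial>lborel) =
       (\<integral>\<^sup>+r. indicator {0<..<pi} r * (ennreal (1 / (sin r)\<^sup>2) * (ennreal (norm v) * indicator {v. v \<noteq> 0 \<and> norm v \<le> sin r} v))
      * g (cos r *\<^sub>R x + sin r *\<^sub>R sgn v) \<partial>lborel)"
      using AE0 AE_onb_lborel_tangent[OF B]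
    proof eventually_elim
      fix v assume v0: "v \<noteq> 0" and xv: "x \<bullet> v = 0"
      define s where "s = norm v"
      have s: "s > 0" using v0 by (simp add: s_def)
      have nrm: "norm (t *\<^sub>R x + v) = sqrt (t\<^sup>2 + s\<^sup>2)" for t
      proof -
        have "(t *\<^sub>R x + v) \<bullet> (t *\<^sub>R x + v) = t * t + v \<bullet> v"
          using xv x by (simp add: inner_add_left inner_add_right inner_commute[of v x] norm_eq_1)
        then have "(norm (t *\<^sub>R x + v))\<^sup>2 = t\<^sup>2 + s\<^sup>2"
          by (simp add: power2_norm_eq_inner s_def power2_eq_square[of t])
        then show ?thesis by (metis norm_ge_zero real_sqrt_unique)
      qed
      have pos: "t\<^sup>2 + s\<^sup>2 > 0" for t using s by (simp add: add_nonneg_pos)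
      have nz: "t *\<^sub>R x + v \<noteq> 0" for t
        using nrm[of t] pos[of t] by (metis norm_zero real_sqrt_gt_zero less_irrefl)
      have "(\<integral>\<^sup>+t. H (t *\<^sub>R x + v) \<partial>lborel) = (\<integral>\<^sup>+t. indicator {t. t\<^sup>2 + s\<^sup>2 \<le> 1} t * g ((t *\<^sub>R x + v) /\<^sub>R sqrt (t\<^sup>2 + s\<^sup>2)) \<partial>lborel)"
        using nz by (intro nn_integral_cong) (auto simp: H_def nrm indicator_def sgn_div_norm)
      also have "\<dots> = (\<integral>\<^sup>+r. indicator {0<..<pi} r * (indicator {r. s \<le> sin r} r * ennreal (s / (sin r)\<^sup>2)) *
           g (((s * cot r) *\<^sub>R x + v) /\<^sub>R sqrt ((s * cot r)\<^sup>2 + s\<^sup>2)) \<partial>lborel)"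
        by (rule nn_integral_cot_substitution[OF s]) measurable
      also have "\<dots> = (\<integral>\<^sup>+r. indicator {0<..<pi} r * (ennreal (1 / (sin r)\<^sup>2) * (ennreal (norm v) * indicator {v. v \<noteq> 0 \<and> norm v \<le> sin r} v))
      * g (cos r *\<^sub>R x + sin r *\<^sub>R sgn v) \<partial>lborel)"
      proof (rule nn_integral_cong)
        fix r
        show "indicator {0<..<pi} r * (indicator {r. s \<le> sin r} r * ennreal (s / (sin r)\<^sup>2)) *
           g (((s * cot r) *\<^sub>R x + v) /\<^sub>R sqrt ((s * cot r)\<^sup>2 + s\<^sup>2)) =
           indicator {0<..<pi} r * (ennreal (1 / (sin r)\<^sup>2) * (ennreal (norm v) * indicator {v. v \<noteq> 0 \<and> norm v \<le> sin r} v))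
              * g (cos r *\<^sub>R x + sin r *\<^sub>R sgn v)"
        proof (cases "r \<in> {0<..<pi}")
          case True
          then have sp: "sin r > 0" by (auto intro: sin_gt_zero)
          \<comment> \<open>The point at angle r has norm s / sin r, so normalising it yields
            coefficients cos r and sin r.\<close>
          have "(s * (C / S))\<^sup>2 + s\<^sup>2 = s\<^sup>2 * (C\<^sup>2 + S\<^sup>2) / S\<^sup>2" if "S \<noteq> 0" for C S :: real
            using that by (simp add: field_simps power2_eq_square)
          from this[of "sin r" "cos r"] have "(s * cot r)\<^sup>2 + s\<^sup>2 = (s / sin r)\<^sup>2"
            using sp by (simp add: cot_def power_divide)
          then have "sqrt ((s * cot r)\<^sup>2 + s\<^sup>2) = s / sin r" using s sp by (simp add: real_sqrt_unique)
          then have "((s * cot r) *\<^sub>R x + v) /\<^sub>R sqrt ((s * cot r)\<^sup>2 + s\<^sup>2) = ((s * cot r) *\<^sub>R x + v) /\<^sub>R (s / sin r)"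
            by (simp only:)
          also have "\<dots> = (sin r / s * (s * cot r)) *\<^sub>R x + (sin r / s) *\<^sub>R v"
            by (simp add: scaleR_add_right)
          also have "sin r / s * (s * cot r) = cos r" using s sp by (simp add: cot_def)
          also have "(sin r / s) *\<^sub>R v = sin r *\<^sub>R sgn v" by (simp add: sgn_div_norm s_def divide_inverse)
          finally have e: "((s * cot r) *\<^sub>R x + v) /\<^sub>R sqrt ((s * cot r)\<^sup>2 + s\<^sup>2) = cos r *\<^sub>R x + sin r *\<^sub>R sgn v" .
          have "ennreal (s / (sin r)\<^sup>2) = ennreal (1 / (sin r)\<^sup>2) * ennreal s"
            using s by (simp add: ennreal_mult[symmetric])
          then show ?thesis using v0 by (simp add: e s_def[symmetric] indicator_def)
        qed simp
      qed
      finally show "(\<integral>\<^sup>+t. H (t *\<^sub>R x + v) \<partial>lborel) =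
       (\<integral>\<^sup>+r. indicator {0<..<pi} r * (ennreal (1 / (sin r)\<^sup>2) * (ennreal (norm v) * indicator {v. v \<noteq> 0 \<and> norm v \<le> sin r} v))
      * g (cos r *\<^sub>R x + sin r *\<^sub>R sgn v) \<partial>lborel)" .
    qed
  qed
  also have "\<dots> = (\<integral>\<^sup>+r. \<integral>\<^sup>+v. indicator {0<..<pi} r * (ennreal (1 / (sin r)\<^sup>2) * (ennreal (norm v) * indicator {v. v \<noteq> 0 \<and> norm v \<le> sin r} v))
      * g (cos r *\<^sub>R x + sin r *\<^sub>R sgn v) \<partial>onb_lborel B \<partial>lborel)"
    unfolding indicator_def by (rule P.Fubini') measurable
  \<comment> \<open>The v-integral runs over the cone of radius sin r and gives sin r to the power
    \<open>DIM('a)\<close>, divided by the dimension; the Jacobian removes two powers. The factor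
    1/\<open>DIM('a)\<close> cancels the one in \<open>sphV\<close>.\<close>
  also have "\<dots> = (\<integral>\<^sup>+r. ennreal (1 / ?N) * (indicator {0<..<pi} r * ennreal (sin r ^ (DIM('a) - 2)) * (\<integral>\<^sup>+w. g (cos r *\<^sub>R x + sin r *\<^sub>R w) \<partial>tangV x)) \<partial>lborel)"
  proof (rule nn_integral_cong)
    fix r
    show "(\<integral>\<^sup>+v. indicator {0<..<pi} r * (ennreal (1 / (sin r)\<^sup>2) * (ennreal (norm v) * indicator {v. v \<noteq> 0 \<and> norm v \<le> sin r} v))
      * g (cos r *\<^sub>R x + sin r *\<^sub>R sgn v) \<partial>onb_lborel B) =
      ennreal (1 / ?N) * (indicator {0<..<pi} r * ennreal (sin r ^ (DIM('a) - 2)) * (\<integral>\<^sup>+w. g (cos r *\<^sub>R x + sin r *\<^sub>R w) \<partial>tangV x))"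
    proof (cases "r \<in> {0<..<pi}")
      case True
      then have sp: "sin r > 0" by (auto intro: sin_gt_zero)
      have "(\<integral>\<^sup>+v. indicator {0<..<pi} r * (ennreal (1 / (sin r)\<^sup>2) * (ennreal (norm v) * indicator {v. v \<noteq> 0 \<and> norm v \<le> sin r} v))
        * g (cos r *\<^sub>R x + sin r *\<^sub>R sgn v) \<partial>onb_lborel B) =
        (\<integral>\<^sup>+v. ennreal (1 / (sin r)\<^sup>2) * (ennreal (norm v) * indicator {v. v \<noteq> 0 \<and> norm v \<le> sin r} v * g (cos r *\<^sub>R x + sin r *\<^sub>R sgn v)) \<partial>onb_lborel B)"
        using True by (simp add: mult.assoc)
      also have "\<dots> = ennreal (1 / (sin r)\<^sup>2) * (\<integral>\<^sup>+v. ennreal (norm v) * indicator {v. v \<noteq> 0 \<and> norm v \<le> sin r} v * g (cos r *\<^sub>R x + sin r *\<^sub>R sgn v) \<partial>onb_lborel B)"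
        by (rule nn_integral_cmult) measurable
      also have "(\<integral>\<^sup>+v. ennreal (norm v) * indicator {v. v \<noteq> 0 \<and> norm v \<le> sin r} v * g (cos r *\<^sub>R x + sin r *\<^sub>R sgn v) \<partial>onb_lborel B)
        = ennreal (sin r ^ DIM('a) / ?N) * (\<integral>\<^sup>+w. g (cos r *\<^sub>R x + sin r *\<^sub>R w) \<partial>tangV x)"
        by (rule radial_norm[OF x B sp]) measurable
      also have "ennreal (1 / (sin r)\<^sup>2) * (ennreal (sin r ^ DIM('a) / ?N) * (\<integral>\<^sup>+w. g (cos r *\<^sub>R x + sin r *\<^sub>R w) \<partial>tangV x)) =
        ennreal (1 / (sin r)\<^sup>2 * (sin r ^ DIM('a) / ?N)) * (\<integral>\<^sup>+w. g (cos r *\<^sub>R x + sin r *\<^sub>R w) \<partial>tangV x)"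
        using sp by (subst ennreal_mult, simp, simp, simp only: mult.assoc)
      also have "1 / (sin r)\<^sup>2 * (sin r ^ DIM('a) / ?N) = 1 / ?N * sin r ^ (DIM('a) - 2)"
        using sp dim by (simp add: power_diff)
      also have "ennreal (1 / ?N * sin r ^ (DIM('a) - 2)) = ennreal (1 / ?N) * ennreal (sin r ^ (DIM('a) - 2))"
        using sp by (subst ennreal_mult) simp_all
      finally show ?thesis using True by (simp only: mult.assoc indicator_simps mult_1)
    qed simp
  qed
  also have "\<dots> = ennreal (1 / ?N) * (\<integral>\<^sup>+r. indicator {0<..<pi} r * ennreal (sin r ^ (DIM('a) - 2)) * (\<integral>\<^sup>+w. g (cos r *\<^sub>R x + sin r *\<^sub>R w) \<partial>tangV x) \<partial>lborel)"
  proof (rule nn_integral_cmult)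
    interpret T: finite_measure "tangV x" by (rule finite_measure_tangV[OF x])
    show "(\<lambda>r. indicator {0<..<pi} r * ennreal (sin r ^ (DIM('a) - 2)) * (\<integral>\<^sup>+w. g (cos r *\<^sub>R x + sin r *\<^sub>R w) \<partial>tangV x)) \<in> borel_measurable lborel"
      by measurable
  qed
  also have "ennreal ?N * \<dots> = (\<integral>\<^sup>+r. indicator {0<..<pi} r * ennreal (sin r ^ (DIM('a) - 2)) * (\<integral>\<^sup>+w. g (cos r *\<^sub>R x + sin r *\<^sub>R w) \<partial>tangV x) \<partial>lborel)"
    using dim by (simp add: mult.assoc[symmetric] ennreal_mult[symmetric])
  finally show ?thesis .
qed

subsection \<open>The mean of a coordinate over the unit tangent sphere\<close>

text \<open>The value of the integral of \<bar>w \<bullet> e\<bar> over the unit tangent sphere: the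
  two hemispheres cut out by e both project onto a unit ball of dimension
  \<open>DIM('a) - 2\<close>. The type argument only carries the dimension.\<close>

definition abs_mean :: "'a::euclidean_space itself \<Rightarrow> real" where
  "abs_mean _ = 2 * unit_ball_vol (real (DIM('a) - 2))"

text \<open>On [0, 1] the primitive is the negative power m + 2 of the square root, divided by m +
  2; the other half is symmetric.\<close>

lemma has_integral_abs_sqrt_power:
  "((\<lambda>t::real. \<bar>t\<bar> * sqrt (1 - t\<^sup>2) ^ m) has_integral (2 / real (m + 2))) {-1..1}"
proof -
  define F where "F t = - (sqrt (1 - t\<^sup>2) ^ (m + 2) / real (m + 2))" for t :: real
  have D: "(F has_real_derivative t * sqrt (1 - t\<^sup>2) ^ m) (at t)" if t: "-1 < t" "t < 1" for t
  proof -
    have "t\<^sup>2 < 1" using t by (simp add: abs_square_less_1)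
    then have pos: "1 - t\<^sup>2 > 0" by simp
    then have sp: "sqrt (1 - t\<^sup>2) > 0" by simp
    have q: "((\<lambda>t. sqrt (1 - t\<^sup>2)) has_real_derivative - (t / sqrt (1 - t\<^sup>2))) (at t)"
    proof -
      have "((\<lambda>t::real. 1 - t\<^sup>2) has_real_derivative - (2 * t)) (at t)"
        by (rule derivative_eq_intros refl | simp)+
      from DERIV_chain2[where f=sqrt and g="\<lambda>t. 1 - t\<^sup>2" and x=t, OF DERIV_real_sqrt[OF pos] this]
      have d: "((\<lambda>t. sqrt (1 - t\<^sup>2)) has_real_derivative inverse (sqrt (1 - t\<^sup>2)) / 2 * - (2 * t)) (at t)" .
      have "inverse q / 2 * - (2 * t) = - (t / q)" for q :: real by (simp add: field_simps)
      then show ?thesis using d by (simp only:)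
    qed
    have "- (N * (- (t / q) * q ^ Suc m) / N) = t * q ^ m" if "q > 0" "N > 0" for q N :: real
      using that by simp
    moreover have "m + 2 - Suc 0 = Suc m" "real (m + 2) > 0" by simp_all
    ultimately have e: "- (real (m + 2) * (- (t / sqrt (1 - t\<^sup>2)) * sqrt (1 - t\<^sup>2) ^ (m + 2 - Suc 0)) / real (m + 2)) = t * sqrt (1 - t\<^sup>2) ^ m"
      using sp by metis
    show ?thesis
      unfolding F_def
      by (rule DERIV_cong[OF DERIV_minus[OF DERIV_cdivide[OF DERIV_power[OF q, of "m + 2"]]]]) (rule e)
  qed
  have cont: "continuous_on S F" for S unfolding F_def by (intro continuous_intros) auto
  \<comment> \<open>The chain rule through \<open>sqrt\<close> breaks down at 1 and -1, so only
    interior derivatives and continuity are used.\<close>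
  have "((\<lambda>t. t * sqrt (1 - t\<^sup>2) ^ m) has_integral (F 1 - F 0)) {0..1}"
    using D by (intro fundamental_theorem_of_calculus_interior cont)
      (auto simp: has_real_derivative_iff_has_vector_derivative[symmetric])
  then have 1: "((\<lambda>t. \<bar>t\<bar> * sqrt (1 - t\<^sup>2) ^ m) has_integral (1 / real (m + 2))) {0..1}"
    by (rule has_integral_eq_rhs[OF has_integral_eq[rotated]]) (auto simp: F_def)
  have "((\<lambda>t. - (t * sqrt (1 - t\<^sup>2) ^ m)) has_integral (- F 0 - - F (-1))) {-1..0}"
    using D by (intro fundamental_theorem_of_calculus_interior continuous_on_minus cont)
      (auto simp: has_real_derivative_iff_has_vector_derivative[symmetric] intro!: DERIV_minus)
  then have 2: "((\<lambda>t. \<bar>t\<bar> * sqrt (1 - t\<^sup>2) ^ m) has_integral (1 / real (m + 2))) {-1..0}"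
    by (rule has_integral_eq_rhs[OF has_integral_eq[rotated]]) (auto simp: F_def)
  have "((\<lambda>t. \<bar>t\<bar> * sqrt (1 - t\<^sup>2) ^ m) has_integral (1 / real (m + 2) + 1 / real (m + 2))) {-1..1}"
    by (rule has_integral_combine[OF _ _ 2 1]) auto
  then show ?thesis by (rule has_integral_eq_rhs) simp
qed

text \<open>By homogeneity the sphere integral is \<open>DIM('a)\<close> times the integral of
  \<bar>v \<bullet> e\<bar> over the unit ball of the tangent space. The slice of that ball at
  height t along e is a ball of radius sqrt (1 - t^2) in dimension
  \<open>DIM('a) - 2\<close>.\<close>

lemma nn_integral_abs_tangV:
  fixes x e :: "'a::euclidean_space"
  assumes dim: "DIM('a) \<ge> 3" and x: "norm x = 1" and e: "norm e = 1" and xe: "x \<bullet> e = 0"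
  shows "(\<integral>\<^sup>+w. ennreal \<bar>w \<bullet> e\<bar> \<partial>tangV x) = ennreal (abs_mean TYPE('a))"
proof -
  define V where "V = {v. x \<bullet> v = 0 \<and> e \<bullet> v = 0}"
  have V: "subspace V" by (auto simp: V_def subspace_def inner_add_right)
  define C where "C = orthonormal_basis_of V"
  have C: "orthonormal C" "span C = V" "C \<subseteq> V" using orthonormal_basis_of[OF V] by (auto simp: C_def)
  have eC: "e \<notin> C" using C(3) e by (auto simp: V_def norm_eq_1)
  define B where "B = insert e C"
  have B: "orthonormal B"
    using C(1,3) e by (auto simp: B_def orthonormal_def pairwise_insert orthogonal_def V_def inner_commute)
  have "span B = tangent_space x"
  proof
    have "B \<subseteq> tangent_space x" using C(3) xe by (auto simp: B_def tangent_space_def V_def)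
    then show "span B \<subseteq> tangent_space x" by (rule span_minimal) (rule subspace_tangent_space)
    show "tangent_space x \<subseteq> span B"
    proof
      fix v assume v: "v \<in> tangent_space x"
      have "v - (v \<bullet> e) *\<^sub>R e \<in> V"
        using v xe e by (simp add: V_def tangent_space_def inner_diff_right norm_eq_1 inner_commute)
      then have "v - (v \<bullet> e) *\<^sub>R e \<in> span B" using C(2) span_mono[of C B] by (auto simp: B_def)
      then have "v - (v \<bullet> e) *\<^sub>R e + (v \<bullet> e) *\<^sub>R e \<in> span B"
        by (rule span_add) (intro span_scale span_base, simp add: B_def)
      then show "v \<in> span B" by simp
    qed
  qed
  note B = B this
  have fin: "finite C" using C(1) by (simp add: orthonormal_def)
  have cC: "card C = DIM('a) - 2" "card C > 0"
    using card_tangent[OF x B] eC fin dim by (auto simp: B_def)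
  have AC: "AE u in onb_lborel C. e \<bullet> u = 0"
    using AE_onb_lborel_span[OF fin] C(2) by (auto simp: V_def)
  let ?N = "real DIM('a)"
  have m: "(\<lambda>w. ennreal \<bar>w \<bullet> e\<bar>) \<in> borel_measurable borel" by measurable
  have "ennreal (1 / ?N) * (\<integral>\<^sup>+w. ennreal \<bar>w \<bullet> e\<bar> \<partial>tangV x) =
     (\<integral>\<^sup>+v. ennreal (norm v) * indicator {v. v \<noteq> 0 \<and> norm v \<le> 1} v * ennreal \<bar>sgn v \<bullet> e\<bar> \<partial>onb_lborel B)"
    using radial_norm[OF x B zero_less_one m] by simp
  also have "\<dots> = (\<integral>\<^sup>+v. indicator {v. norm v \<le> 1} v * ennreal \<bar>v \<bullet> e\<bar> \<partial>onb_lborel B)"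
    by (intro nn_integral_cong) (auto simp: indicator_def sgn_div_norm ennreal_mult[symmetric] abs_mult)
  also have "\<dots> = (\<integral>\<^sup>+t. \<integral>\<^sup>+u. indicator {v. norm v \<le> 1} (t *\<^sub>R e + u) * ennreal \<bar>(t *\<^sub>R e + u) \<bullet> e\<bar> \<partial>onb_lborel C \<partial>lborel)"
    unfolding B_def by (rule nn_integral_onb_lborel_insert[OF B(1)[unfolded B_def] eC]) measurable
  also have "\<dots> = (\<integral>\<^sup>+t. ennreal (unit_ball_vol (real (DIM('a) - 2))) * (ennreal (\<bar>t\<bar> * sqrt (1 - t\<^sup>2) ^ card C) * indicator {-1..1} t) \<partial>lborel)"
  proof (rule nn_integral_cong_AE)
    show "AE t in lborel. (\<integral>\<^sup>+u. indicator {v. norm v \<le> 1} (t *\<^sub>R e + u) * ennreal \<bar>(t *\<^sub>R e + u) \<bullet> e\<bar> \<partial>onb_lborel C) =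
      ennreal (unit_ball_vol (real (DIM('a) - 2))) * (ennreal (\<bar>t\<bar> * sqrt (1 - t\<^sup>2) ^ card C) * indicator {-1..1} t)"
      using AE_lborel_singleton[of 1] AE_lborel_singleton[of "-1"]
    proof eventually_elim
      fix t :: real assume t: "t \<noteq> 1" "t \<noteq> -1"
      have nrm: "norm (t *\<^sub>R e + u) \<le> 1 \<longleftrightarrow> norm u \<le> sqrt (1 - t\<^sup>2)"
         "\<bar>t\<bar> \<ge> 1 \<Longrightarrow> \<not> norm (t *\<^sub>R e + u) \<le> 1" if eu: "e \<bullet> u = 0" for u
      proof -
        have "(t *\<^sub>R e + u) \<bullet> (t *\<^sub>R e + u) = t * t + u \<bullet> u"
          using eu e by (simp add: inner_add_left inner_add_right inner_commute[of u e] norm_eq_1)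
        then have sq: "(norm (t *\<^sub>R e + u))\<^sup>2 = t\<^sup>2 + (norm u)\<^sup>2"
          by (simp add: power2_norm_eq_inner power2_eq_square[of t])
        have i: "norm (t *\<^sub>R e + u) \<le> 1 \<longleftrightarrow> t\<^sup>2 + (norm u)\<^sup>2 \<le> 1"
          using sq by (metis abs_norm_cancel abs_square_le_1)
        have j: "norm u \<le> sqrt (1 - t\<^sup>2) \<longleftrightarrow> (norm u)\<^sup>2 \<le> 1 - t\<^sup>2"
          using real_sqrt_le_iff[of "(norm u)\<^sup>2" "1 - t\<^sup>2"] by simp
        show "\<bar>t\<bar> \<ge> 1 \<Longrightarrow> \<not> norm (t *\<^sub>R e + u) \<le> 1"
        proof -
          assume "\<bar>t\<bar> \<ge> 1"
          then have "\<bar>t\<bar> > 1" using t by linarith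
          then have "t\<^sup>2 > 1" by (metis abs_square_le_1 linorder_not_le)
          then show ?thesis using i by (smt (verit) zero_le_power2)
        qed
        show "norm (t *\<^sub>R e + u) \<le> 1 \<longleftrightarrow> norm u \<le> sqrt (1 - t\<^sup>2)"
          unfolding i j by linarith
      qed
      have te: "(t *\<^sub>R e + u) \<bullet> e = t" if "e \<bullet> u = 0" for u
        using that e by (simp add: inner_add_left inner_commute[of u e] norm_eq_1)
      show "(\<integral>\<^sup>+u. indicator {v. norm v \<le> 1} (t *\<^sub>R e + u) * ennreal \<bar>(t *\<^sub>R e + u) \<bullet> e\<bar> \<partial>onb_lborel C) =
        ennreal (unit_ball_vol (real (DIM('a) - 2))) * (ennreal (\<bar>t\<bar> * sqrt (1 - t\<^sup>2) ^ card C) * indicator {-1..1} t)"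
      proof (cases "\<bar>t\<bar> < 1")
        case True
        then have sp: "sqrt (1 - t\<^sup>2) > 0" by (simp add: abs_square_less_1)
        have "(\<integral>\<^sup>+u. indicator {v. norm v \<le> 1} (t *\<^sub>R e + u) * ennreal \<bar>(t *\<^sub>R e + u) \<bullet> e\<bar> \<partial>onb_lborel C) =
          (\<integral>\<^sup>+u. ennreal \<bar>t\<bar> * indicator (cball 0 (sqrt (1 - t\<^sup>2))) u \<partial>onb_lborel C)"
          using True by (intro nn_integral_cong_AE eventually_mono[OF AC]) (auto simp: te nrm(1) indicator_def)
        also have "\<dots> = ennreal \<bar>t\<bar> * emeasure (onb_lborel C) (cball 0 (sqrt (1 - t\<^sup>2)))"
          by (rule nn_integral_cmult_indicator) simp
        also have "\<dots> = ennreal (\<bar>t\<bar> * (unit_ball_vol (real (card C)) * sqrt (1 - t\<^sup>2) ^ card C))"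
          using sp by (simp add: emeasure_onb_lborel_cball[OF C(1) sp] ennreal_mult)
        also have "\<dots> = ennreal (unit_ball_vol (real (DIM('a) - 2)) * (\<bar>t\<bar> * sqrt (1 - t\<^sup>2) ^ card C))"
          by (simp add: cC(1) mult_ac)
        moreover have "t \<in> {-1..1}" using True by auto
        ultimately show ?thesis using sp by (simp add: ennreal_mult)
      next
        case False
        have "(\<integral>\<^sup>+u. indicator {v. norm v \<le> 1} (t *\<^sub>R e + u) * ennreal \<bar>(t *\<^sub>R e + u) \<bullet> e\<bar> \<partial>onb_lborel C) =
          (\<integral>\<^sup>+u. 0 \<partial>onb_lborel C)"
          using False nrm(2) by (intro nn_integral_cong_AE eventually_mono[OF AC]) (auto simp: indicator_def)
        then show ?thesis using False t by (auto simp: indicator_def)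
      qed
    qed
  qed
  also have "\<dots> = ennreal (unit_ball_vol (real (DIM('a) - 2))) * (\<integral>\<^sup>+t. ennreal (\<bar>t\<bar> * sqrt (1 - t\<^sup>2) ^ card C) * indicator {-1..1} t \<partial>lborel)"
    by (rule nn_integral_cmult) measurable
  also have "(\<integral>\<^sup>+t. ennreal (\<bar>t\<bar> * sqrt (1 - t\<^sup>2) ^ card C) * indicator {-1..1} t \<partial>lborel) = ennreal (2 / real (card C + 2))"
    by (rule nn_integral_has_integral_lebesgue'[OF _ has_integral_abs_sqrt_power])
      (auto simp: abs_square_le_1)
  also have "real (card C + 2) = ?N" using dim cC by simp
  also have "ennreal (unit_ball_vol (real (DIM('a) - 2))) * ennreal (2 / ?N) = ennreal (1 / ?N) * ennreal (abs_mean TYPE('a))"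
    by (subst (1 2) ennreal_mult[symmetric]) (auto simp: abs_mean_def)
  finally show ?thesis
    using dim by (subst (asm) ennreal_mult_cancel_left) auto
qed

text \<open>\<open>sigma (n - 2)\<close> is n - 1 times the volume of the unit ball of dimension n -
  1, and this factor cancels the one in \<open>k_const\<close>.\<close>

lemma k_const_sigma:
  assumes dim: "DIM('a::euclidean_space) = n + 1" and n: "n \<ge> 2"
  shows "k_const n * sigma (n - 1) = abs_mean TYPE('a)" "sigma (n - 1) > 0"
proof -
  show pos: "sigma (n - 1) > 0" using n by (simp add: sigma_def)
  have "sigma (n - 2) = (real n - 1) * unit_ball_vol (real (n - 1))"
    using n by (simp add: sigma_def Suc_diff_Suc numeral_2_eq_2 of_nat_diff)
  then show "k_const n * sigma (n - 1) = abs_mean TYPE('a)"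
    using n pos by (simp add: k_const_def abs_mean_def dim)
qed

subsection \<open>Bochner integrals over frames\<close>

lemma measure_tangV:
  fixes x :: "'a::euclidean_space"
  assumes "norm x = 1" and "DIM('a) \<ge> 2"
  shows "measure (tangV x) UNIV = sigma (DIM('a) - 2)"
  using emeasure_tangV[OF assms] by (simp add: measure_def sigma_def)

lemma borel_measurable_integral_tangV:
  fixes F :: "'a::euclidean_space \<times> 'a \<Rightarrow> real"
  assumes F [measurable]: "F \<in> borel_measurable borel"
  shows "(\<lambda>x. \<integral>w. F (x, w) \<partial>tangV x) \<in> borel_measurable borel"
proof -
  have F' [measurable]: "F \<in> borel_measurable (borel \<Otimes>\<^sub>M borel)" using F by (simp add: borel_prod)
    have "(\<lambda>x. \<integral>w. F (x, w) \<partial>tangV x) =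
       (\<lambda>x. (LINT z|lborel. real (DIM('a) - 1) * indicator (cyl x) z * F (x, sgn (proj_perp x z))))"
    proof
      fix x :: 'a
      have "tangV x = distr (density lborel (\<lambda>z. ennreal (real (DIM('a) - 1) * indicator (cyl x) z))) borel (\<lambda>z. sgn (proj_perp x z))"
        unfolding tangV_def
        by (intro arg_cong[where f="\<lambda>M. distr M borel _"] arg_cong[where f="density lborel"] ext)
          (auto simp: indicator_def ennreal_of_nat_eq_real_of_nat)
      then have "(\<integral>w. F (x, w) \<partial>tangV x) = (\<integral>w. F (x, w) \<partial>distr (density lborel (\<lambda>z. ennreal (real (DIM('a) - 1) * indicator (cyl x) z))) borel (\<lambda>z. sgn (proj_perp x z)))"
        by simp
      also have "\<dots> = (\<integral>z. F (x, sgn (proj_perp x z)) \<partial>density lborel (\<lambda>z. ennreal (real (DIM('a) - 1) * indicator (cyl x) z)))"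
        by (rule integral_distr) measurable
      also have "\<dots> = (LINT z|lborel. (real (DIM('a) - 1) * indicator (cyl x) z) *\<^sub>R F (x, sgn (proj_perp x z)))"
      proof (rule integral_density)
        have "cyl x \<in> sets lborel" using cyl_measurable[of x] by simp
        then show "(\<lambda>z. real (DIM('a) - 1) * indicator (cyl x) z) \<in> borel_measurable lborel" by measurable
        show "(\<lambda>z. F (x, sgn (proj_perp x z))) \<in> borel_measurable lborel" by measurable
      qed simp
      finally show "(\<integral>w. F (x, w) \<partial>tangV x) = (LINT z|lborel. real (DIM('a) - 1) * indicator (cyl x) z * F (x, sgn (proj_perp x z)))"
        by simp
    qed
    also have "\<dots> \<in> borel_measurable borel"
      unfolding indicator_def by measurable
    finally show ?thesis .
qed

text \<open>Adding the bound C makes the integrand nonnegative, so that the disintegration of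
  nonnegative integrals applies; the constant is subtracted afterwards, as all masses are
  finite.\<close>

lemma integral_frameV:
  fixes F :: "'a::euclidean_space \<times> 'a \<Rightarrow> real"
  assumes dim: "DIM('a) \<ge> 2" and F [measurable]: "F \<in> borel_measurable borel" and C: "\<And>p. \<bar>F p\<bar> \<le> C"
  shows "integrable frameV F"
    "(\<lambda>x. \<integral>w. F (x, w) \<partial>tangV x) \<in> borel_measurable sphV"
    "integral\<^sup>L frameV F = (\<integral>x. (\<integral>w. F (x, w) \<partial>tangV x) \<partial>sphV)"
proof -
  interpret f: finite_measure "frameV :: ('a \<times> 'a) measure" by (rule finite_measure_frameV[OF dim])
  interpret s: finite_measure "sphV :: 'a measure" by (rule finite_measure_sphV)
  have F' [measurable]: "F \<in> borel_measurable (borel \<Otimes>\<^sub>M borel)" using F by (simp add: borel_prod)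
  show intF: "integrable frameV F"
    by (rule f.integrable_const_bound[where B=C]) (use C in auto)
  define G where "G p = F p + C" for p
  have G0: "G p \<ge> 0" and GC: "\<bar>G p\<bar> \<le> 2 * C" for p using C[of p] by (auto simp: G_def)
  have C0: "C \<ge> 0" using C[of undefined] by linarith
  have [measurable]: "G \<in> borel_measurable borel" "G \<in> borel_measurable (borel \<Otimes>\<^sub>M borel)"
    unfolding G_def by measurable
  have Gx [measurable]: "(\<lambda>w. G (x, w)) \<in> borel_measurable borel" "(\<lambda>w. F (x, w)) \<in> borel_measurable borel" for x
    by measurable
  have intT: "integrable (tangV x) (\<lambda>w. G (x, w))" "integrable (tangV x) (\<lambda>w. F (x, w))" if "norm x = 1" for x
  proof -
    interpret t: finite_measure "tangV x" by (rule finite_measure_tangV[OF that])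
    show "integrable (tangV x) (\<lambda>w. G (x, w))" by (rule t.integrable_const_bound[where B="2 * C"]) (use GC in auto)
    show "integrable (tangV x) (\<lambda>w. F (x, w))" by (rule t.integrable_const_bound[where B=C]) (use C in auto)
  qed
  have GF: "(\<integral>w. G (x, w) \<partial>tangV x) = (\<integral>w. F (x, w) \<partial>tangV x) + C * sigma (DIM('a) - 2)" if "norm x = 1" for x
  proof -
    interpret t: finite_measure "tangV x" by (rule finite_measure_tangV[OF that])
    show ?thesis using intT[OF that] by (simp add: G_def measure_tangV[OF that dim])
  qed
  define g where "g x = enn2real (\<integral>\<^sup>+w. ennreal (G (x, w)) \<partial>tangV x)" for x
  have [measurable]: "g \<in> borel_measurable borel"
    using borel_measurable_nn_integral_tangV[of "\<lambda>p. ennreal (G p)"] unfolding g_def by simp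
  have g: "g x = (\<integral>w. G (x, w) \<partial>tangV x)" for x
    unfolding g_def by (rule integral_eq_nn_integral[symmetric]) (auto simp: G0)
  have gm: "(\<lambda>x. \<integral>w. G (x, w) \<partial>tangV x) \<in> borel_measurable borel"
    using \<open>g \<in> borel_measurable borel\<close> unfolding g[abs_def] .
  have meas: "(\<lambda>x. \<integral>w. F (x, w) \<partial>tangV x) \<in> borel_measurable borel"
    by (rule borel_measurable_integral_tangV[OF F])
  then show "(\<lambda>x. \<integral>w. F (x, w) \<partial>tangV x) \<in> borel_measurable sphV" by simp
  have gb: "g x \<le> 2 * C * sigma (DIM('a) - 2)" if "norm x = 1" for x
  proof -
    interpret t: finite_measure "tangV x" by (rule finite_measure_tangV[OF that])
    have "g x \<le> (\<integral>w. 2 * C \<partial>tangV x)"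
      unfolding g using GC by (intro integral_mono intT that) (auto intro: order_trans[OF abs_ge_self])
    then show ?thesis by (simp add: measure_tangV[OF that dim] mult.commute)
  qed
  have intg: "integrable sphV g"
  proof (rule s.integrable_const_bound)
    show "AE x in sphV. norm (g x) \<le> 2 * C * sigma (DIM('a) - 2)"
      by (rule eventually_mono[OF AE_sphV]) (use gb in \<open>simp add: g_def\<close>)
  qed simp
  have "(\<integral>p. G p \<partial>frameV) = enn2real (\<integral>\<^sup>+p. ennreal (G p) \<partial>frameV)"
    by (rule integral_eq_nn_integral) (auto simp: G0)
  also have "(\<integral>\<^sup>+p. ennreal (G p) \<partial>frameV) = (\<integral>\<^sup>+x. \<integral>\<^sup>+w. ennreal (G (x, w)) \<partial>tangV x \<partial>sphV)"
    by (rule nn_integral_frameV) measurable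
  also have "\<dots> = (\<integral>\<^sup>+x. ennreal (g x) \<partial>sphV)"
  proof (intro nn_integral_cong_AE eventually_mono[OF AE_sphV])
    fix x :: 'a assume x: "norm x = 1"
    show "(\<integral>\<^sup>+w. ennreal (G (x, w)) \<partial>tangV x) = ennreal (g x)"
      unfolding g by (rule nn_integral_eq_integral) (auto simp: intT x G0)
  qed
  also have "enn2real \<dots> = (\<integral>x. g x \<partial>sphV)"
    by (rule integral_eq_nn_integral[symmetric]) (measurable, simp add: g_def)
  finally have "(\<integral>p. G p \<partial>frameV) = (\<integral>x. g x \<partial>sphV)" .
  also have "\<dots> = (\<integral>x. (\<integral>w. F (x, w) \<partial>tangV x) + C * sigma (DIM('a) - 2) \<partial>sphV)"
    using meas gm by (intro integral_cong_AE eventually_mono[OF AE_sphV]) (auto simp: g GF)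
  also have "\<dots> = (\<integral>x. (\<integral>w. F (x, w) \<partial>tangV x) \<partial>sphV) + C * sigma (DIM('a) - 2) * measure (sphV :: 'a measure) UNIV"
  proof (subst Bochner_Integration.integral_add)
    have "integrable sphV (\<lambda>x. g x - C * sigma (DIM('a) - 2))" using intg by simp
    then show "integrable sphV (\<lambda>x. \<integral>w. F (x, w) \<partial>tangV x)"
      by (rule Bochner_Integration.integrable_cong_AE_imp)
        (use meas gm in \<open>auto intro!: eventually_mono[OF AE_sphV] simp: g GF\<close>)
  qed auto
  finally have "(\<integral>p. G p \<partial>frameV) = (\<integral>x. (\<integral>w. F (x, w) \<partial>tangV x) \<partial>sphV) + C * sigma (DIM('a) - 2) * measure (sphV :: 'a measure) UNIV" .
  moreover have "(\<integral>p. G p \<partial>frameV) = (\<integral>p. F p \<partial>frameV) + C * measure (frameV :: ('a \<times> 'a) measure) UNIV"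
    using intF by (simp add: G_def)
  moreover have "measure (frameV :: ('a \<times> 'a) measure) UNIV = sigma (DIM('a) - 2) * measure (sphV :: 'a measure) UNIV"
    by (simp add: measure_def emeasure_frameV[OF dim] enn2real_mult sigma_def)
  ultimately show "integral\<^sup>L frameV F = (\<integral>x. (\<integral>w. F (x, w) \<partial>tangV x) \<partial>sphV)"
    by (simp add: algebra_simps)
qed

lemma AE_tangV_frames: "norm x = 1 \<Longrightarrow> AE w in tangV x. (x, w) \<in> frames"
  by (rule eventually_mono[OF AE_tangV]) (auto simp: frames_def)

text \<open>Off \<open>frames\<close> the integrand may be unbounded. Cutting it off there changes
  it only on null sets of \<open>frameV\<close> and of the fibres over unit vectors.\<close>

lemma integral_frameV_bounded:
  fixes F :: "'a::euclidean_space \<times> 'a \<Rightarrow> real"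
  assumes dim: "DIM('a) \<ge> 2" and F [measurable]: "F \<in> borel_measurable borel" and C: "\<And>p. p \<in> frames \<Longrightarrow> \<bar>F p\<bar> \<le> C"
  shows "integrable frameV F"
    "integral\<^sup>L frameV F = (\<integral>x. (\<integral>w. F (x, w) \<partial>tangV x) \<partial>sphV)"
proof -
  define F1 where "F1 p = indicator frames p * F p" for p
  have [measurable]: "F1 \<in> borel_measurable borel" unfolding F1_def by measurable
  have ae: "AE p in frameV. F1 p = F p"
    by (rule eventually_mono[OF AE_frameV]) (simp add: F1_def)
  have b: "\<bar>F1 p\<bar> \<le> max C 0" for p using C[of p] by (auto simp: F1_def indicator_def)
  note F1 = integral_frameV[OF dim \<open>F1 \<in> borel_measurable borel\<close> b]
  show "integrable frameV F"
    by (rule Bochner_Integration.integrable_cong_AE_imp[OF F1(1)]) (use ae in \<open>auto elim: eventually_mono\<close>)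
  have "integral\<^sup>L frameV F = integral\<^sup>L frameV F1"
    by (rule integral_cong_AE) (use ae in \<open>auto elim: eventually_mono\<close>)
  also have "\<dots> = (\<integral>x. (\<integral>w. F1 (x, w) \<partial>tangV x) \<partial>sphV)" by (rule F1(3))
  also have "\<dots> = (\<integral>x. (\<integral>w. F (x, w) \<partial>tangV x) \<partial>sphV)"
  proof (rule integral_cong_AE, goal_cases)
    case 3
    show ?case
    proof (rule eventually_mono[OF AE_sphV])
    fix x :: 'a assume x: "norm x = 1"
    have [measurable]: "F \<in> borel_measurable (borel \<Otimes>\<^sub>M borel)" "F1 \<in> borel_measurable (borel \<Otimes>\<^sub>M borel)"
      by (simp_all add: borel_prod)
    show "(\<integral>w. F1 (x, w) \<partial>tangV x) = (\<integral>w. F (x, w) \<partial>tangV x)"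
    proof (rule integral_cong_AE)
      show "AE w in tangV x. F1 (x, w) = F (x, w)"
        by (rule eventually_mono[OF AE_tangV_frames[OF x]]) (simp add: F1_def)
    qed measurable
    qed
  next
    case 1
    show ?case using borel_measurable_integral_tangV[OF \<open>F1 \<in> borel_measurable borel\<close>] by simp
  next
    case 2
    show ?case using borel_measurable_integral_tangV[OF F] by simp
  qed
  finally show "integral\<^sup>L frameV F = (\<integral>x. (\<integral>w. F (x, w) \<partial>tangV x) \<partial>sphV)" .
qed

subsection \<open>Distances\<close>

lemma geodesic_dist_frame:
  assumes "(x, w) \<in> frames" "0 \<le> r" "r \<le> pi"
  shows "geodesic_dist x (cos r *\<^sub>R x + sin r *\<^sub>R w) = r" "geodesic_dist (cos r *\<^sub>R x + sin r *\<^sub>R w) x = r"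
  using assms by (auto simp: frames_def geodesic_dist_def inner_add_right inner_add_left inner_commute[of w x] norm_eq_1 arccos_cos)

lemma arccos_measurable [measurable]: "arccos \<in> borel_measurable borel"
proof -
  \<comment> \<open>Outside [-1, 1] the description defining \<open>arccos\<close> has no witness,
    so all these arguments share one default value.\<close>
  have o: "arccos y = (THE x::real. False)" if "y \<notin> {-1..1}" for y
  proof -
    have "(\<lambda>x. 0 \<le> x \<and> x \<le> pi \<and> cos x = y) = (\<lambda>x. False)"
      using that cos_ge_minus_one cos_le_one by auto
    then show ?thesis unfolding arccos_def by (rule arg_cong)
  qed
  have "arccos = (\<lambda>y. if y \<in> {-1..1} then arccos y else (THE x::real. False))"
    using o by auto
  also have "\<dots> \<in> borel_measurable borel"
    by (rule borel_measurable_continuous_on_if) (auto intro: continuous_on_arccos')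
  finally show ?thesis .
qed

lemma geodesic_dist_measurable [measurable (raw)]:
  assumes [measurable]: "f \<in> borel_measurable M" "g \<in> borel_measurable M"
  shows "(\<lambda>z. geodesic_dist (f z) (g z)) \<in> borel_measurable M"
  unfolding geodesic_dist_def by measurable

text \<open>In polar coordinates around x the distance is the radial variable, and the fibre
  contributes only its total mass.\<close>

lemma distr_geodesic_dist:
  fixes x :: "'a::euclidean_space"
  assumes dim: "DIM('a) \<ge> 2" and x: "norm x = 1"
  shows "distr sphV borel (geodesic_dist x) =
    density lborel (\<lambda>r. indicator {0<..<pi} r * ennreal (sigma (DIM('a) - 2) * sin r ^ (DIM('a) - 2)))"
proof (rule measure_eqI)
  fix A assume "A \<in> sets (distr sphV borel (geodesic_dist x))"
  then have A [measurable]: "A \<in> sets borel" by simp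
  have "emeasure (distr sphV borel (geodesic_dist x)) A = (\<integral>\<^sup>+r. indicator A r \<partial>distr sphV borel (geodesic_dist x))" by simp
  also have "\<dots> = (\<integral>\<^sup>+y. indicator A (geodesic_dist x y) \<partial>sphV)"
    by (rule nn_integral_distr) measurable
  also have "\<dots> = (\<integral>\<^sup>+r. indicator {0<..<pi} r * ennreal (sin r ^ (DIM('a) - 2)) *
       (\<integral>\<^sup>+w. indicator A (geodesic_dist x (cos r *\<^sub>R x + sin r *\<^sub>R w)) \<partial>tangV x) \<partial>lborel)"
    by (rule nn_integral_sphV_polar[OF dim x]) measurable
  also have "\<dots> = (\<integral>\<^sup>+r. indicator {0<..<pi} r * ennreal (sigma (DIM('a) - 2) * sin r ^ (DIM('a) - 2)) * indicator A r \<partial>lborel)"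
  proof (rule nn_integral_cong)
    fix r
    show "indicator {0<..<pi} r * ennreal (sin r ^ (DIM('a) - 2)) *
       (\<integral>\<^sup>+w. indicator A (geodesic_dist x (cos r *\<^sub>R x + sin r *\<^sub>R w)) \<partial>tangV x) =
       indicator {0<..<pi} r * ennreal (sigma (DIM('a) - 2) * sin r ^ (DIM('a) - 2)) * indicator A r"
    proof (cases "r \<in> {0<..<pi}")
      case True
      then have sp: "sin r > 0" by (auto intro: sin_gt_zero)
      have "(\<integral>\<^sup>+w. indicator A (geodesic_dist x (cos r *\<^sub>R x + sin r *\<^sub>R w)) \<partial>tangV x) = (\<integral>\<^sup>+w. indicator A r \<partial>tangV x)"
        using True by (intro nn_integral_cong_AE eventually_mono[OF AE_tangV_frames[OF x]]) (simp add: geodesic_dist_frame)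
      also have "\<dots> = indicator A r * ennreal (sigma (DIM('a) - 2))"
        by (simp add: emeasure_tangV[OF x dim])
      finally show ?thesis using True sp by (simp add: ennreal_mult mult_ac sigma_def)
    qed simp
  qed
  also have "\<dots> = (\<integral>\<^sup>+r. indicator A r \<partial>density lborel (\<lambda>r. indicator {0<..<pi} r * ennreal (sigma (DIM('a) - 2) * sin r ^ (DIM('a) - 2))))"
    by (rule nn_integral_density[symmetric]) measurable
  also have "\<dots> = emeasure (density lborel (\<lambda>r. indicator {0<..<pi} r * ennreal (sigma (DIM('a) - 2) * sin r ^ (DIM('a) - 2)))) A"
    by simp
  finally show "emeasure (distr sphV borel (geodesic_dist x)) A = emeasure (density lborel (\<lambda>r. indicator {0<..<pi} r * ennreal (sigma (DIM('a) - 2) * sin r ^ (DIM('a) - 2)))) A" .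
qed simp

lemma fst_borel_measurable [measurable]: "fst \<in> (borel :: ('a::euclidean_space \<times> 'a) measure) \<rightarrow>\<^sub>M borel"
  and snd_borel_measurable [measurable]: "snd \<in> (borel :: ('a::euclidean_space \<times> 'a) measure) \<rightarrow>\<^sub>M borel"
  by (auto intro!: borel_measurable_continuous_onI continuous_intros)

lemma fst_geo_flow: "fst (geo_flow r (x, w)) = cos r *\<^sub>R x + sin r *\<^sub>R w"
  by (simp add: geo_flow_def)

lemma fst_geo_flow_measurable [measurable]:
  "(\<lambda>q. fst (geo_flow (fst q) (snd q))) \<in> (borel \<Otimes>\<^sub>M (borel :: ('a::euclidean_space \<times> 'a) measure)) \<rightarrow>\<^sub>M borel"
  unfolding geo_flow_def by measurable

text \<open>Stated as an equality of measures so that signed integrands can be transferred directly: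
  the first point is x, the second is reached from the frame (x, w) in time r.\<close>

lemma sphV_pair_polar:
  assumes dim: "DIM('a::euclidean_space) \<ge> 2"
  shows "(sphV :: 'a measure) \<Otimes>\<^sub>M (sphV :: 'a measure) = distr (density (lborel \<Otimes>\<^sub>M frameV)
      (\<lambda>q. indicator {0<..<pi} (fst q) * ennreal (sin (fst q) ^ (DIM('a) - 2))))
      (borel \<Otimes>\<^sub>M borel) (\<lambda>q. (fst (snd q), fst (geo_flow (fst q) (snd q))))"
    (is "_ = distr (density ?L ?d) _ ?f")
proof (rule measure_eqI)
  interpret s: finite_measure "sphV :: 'a measure" by (rule finite_measure_sphV)
  interpret f: finite_measure "frameV :: ('a \<times> 'a) measure" by (rule finite_measure_frameV[OF dim])
  interpret P: pair_sigma_finite "sphV :: 'a measure" "lborel :: real measure" ..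
  show "sets ((sphV :: 'a measure) \<Otimes>\<^sub>M (sphV :: 'a measure)) = sets (distr (density ?L ?d) (borel \<Otimes>\<^sub>M borel) ?f)"
    by (simp cong: sets_pair_measure_cong)
  have L: "sets ?L = sets (borel \<Otimes>\<^sub>M borel)" by (simp cong: sets_pair_measure_cong)
  have [measurable]: "?d \<in> borel_measurable ?L" unfolding indicator_def by measurable
  have [measurable]: "?f \<in> ?L \<rightarrow>\<^sub>M (borel \<Otimes>\<^sub>M borel)" by measurable
  fix A assume "A \<in> sets ((sphV :: 'a measure) \<Otimes>\<^sub>M (sphV :: 'a measure))"
  then have A [measurable]: "A \<in> sets (borel \<Otimes>\<^sub>M borel)" "A \<in> sets (sphV \<Otimes>\<^sub>M sphV)" by (simp_all cong: sets_pair_measure_cong)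
  define J :: "'a \<Rightarrow> real \<Rightarrow> ennreal" where "J x r = (\<integral>\<^sup>+w. indicator A (x, cos r *\<^sub>R x + sin r *\<^sub>R w) \<partial>tangV x)" for x r
  have Jeq: "J x r = (\<integral>\<^sup>+z. of_nat (DIM('a) - 1) * indicator (cyl x) z * indicator A (x, cos r *\<^sub>R x + sin r *\<^sub>R sgn (proj_perp x z)) \<partial>lborel)" for x r
    unfolding J_def by (rule nn_integral_tangV) measurable
  have Jm [measurable]: "(\<lambda>p. J (fst p) (snd p)) \<in> borel_measurable (borel \<Otimes>\<^sub>M borel)"
    unfolding Jeq indicator_def by measurable
  have Jr [measurable]: "J x \<in> borel_measurable borel" for x
    using measurable_Pair2[OF Jm, of x] by simp
  define S :: "real \<Rightarrow> ennreal" where "S r = indicator {0<..<pi} r * ennreal (sin r ^ (DIM('a) - 2))" for r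
  have [measurable]: "S \<in> borel_measurable borel" unfolding S_def by measurable
  have "emeasure (sphV \<Otimes>\<^sub>M sphV) A = (\<integral>\<^sup>+x. \<integral>\<^sup>+y. indicator A (x, y) \<partial>sphV \<partial>sphV)"
    by (rule s.emeasure_pair_measure) measurable
  also have "\<dots> = (\<integral>\<^sup>+x. \<integral>\<^sup>+r. S r * J x r \<partial>lborel \<partial>sphV)"
    unfolding S_def J_def
    by (intro nn_integral_cong_AE eventually_mono[OF AE_sphV] nn_integral_sphV_polar[OF dim]) measurable
  also have "\<dots> = (\<integral>\<^sup>+r. \<integral>\<^sup>+x. S r * J x r \<partial>sphV \<partial>lborel)"
    by (rule P.Fubini'[symmetric]) (unfold case_prod_beta, measurable)
  also have "\<dots> = (\<integral>\<^sup>+r. S r * (\<integral>\<^sup>+p. indicator A (fst p, fst (geo_flow r p)) \<partial>frameV) \<partial>lborel)"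
  proof (rule nn_integral_cong)
    fix r
    have "(\<lambda>x. J x r) \<in> borel_measurable borel" using measurable_Pair1[OF Jm, of r] by simp
    then have "(\<integral>\<^sup>+x. S r * J x r \<partial>sphV) = S r * (\<integral>\<^sup>+x. J x r \<partial>sphV)"
      by (intro nn_integral_cmult) simp
    also have "(\<integral>\<^sup>+x. J x r \<partial>sphV) = (\<integral>\<^sup>+p. indicator A (fst p, fst (geo_flow r p)) \<partial>frameV)"
      unfolding J_def by (subst nn_integral_frameV) (measurable, simp add: fst_geo_flow)
    finally show "(\<integral>\<^sup>+x. S r * J x r \<partial>sphV) = S r * (\<integral>\<^sup>+p. indicator A (fst p, fst (geo_flow r p)) \<partial>frameV)" .
  qed
  also have "\<dots> = (\<integral>\<^sup>+r. \<integral>\<^sup>+p. S r * indicator A (fst p, fst (geo_flow r p)) \<partial>frameV \<partial>lborel)"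
    by (intro nn_integral_cong nn_integral_cmult[symmetric]) measurable
  also have "\<dots> = (\<integral>\<^sup>+q. ?d q * indicator A (?f q) \<partial>?L)"
    by (subst f.nn_integral_fst[symmetric]) (measurable, simp add: S_def)
  also have "\<dots> = emeasure (distr (density ?L ?d) (borel \<Otimes>\<^sub>M borel) ?f) A"
    by (subst nn_integral_indicator[symmetric], simp, subst nn_integral_distr, measurable, subst nn_integral_density) auto
  finally show "emeasure (sphV \<Otimes>\<^sub>M sphV) A = emeasure (distr (density ?L ?d) (borel \<Otimes>\<^sub>M borel) ?f) A" .
qed

subsection \<open>Differentiation under the integral sign\<close>

text \<open>Leibniz rule by dominated convergence, where the mean value inequality bounds all
  difference quotients by C. Differentiability is asked on a set S of full measure because the
  integrands below are controlled on \<open>frames\<close>.\<close>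

lemma has_vector_derivative_integral:
  fixes f :: "real \<Rightarrow> 'b \<Rightarrow> 'c::euclidean_space"
  assumes M: "finite_measure M" and S: "AE w in M. w \<in> S"
    and D: "\<And>t w. w \<in> S \<Longrightarrow> ((\<lambda>t. f t w) has_vector_derivative f' t w) (at t)"
    and C: "\<And>t w. w \<in> S \<Longrightarrow> norm (f' t w) \<le> C"
    and int: "\<And>t. integrable M (f t)" and meas: "f' t0 \<in> borel_measurable M"
  shows "((\<lambda>t. \<integral>w. f t w \<partial>M) has_vector_derivative (\<integral>w. f' t0 w \<partial>M)) (at t0)"
proof -
  interpret finite_measure M by fact
  have lip: "norm (f t w - f s w) \<le> C * \<bar>t - s\<bar>" if w: "w \<in> S" for s t w
  proof -
    have "norm (f t w - f s w) \<le> C * norm (t - s)"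
    proof (rule differentiable_bound[where S=UNIV and f="\<lambda>t. f t w" and f'="\<lambda>t h. h *\<^sub>R f' t w"])
      show "((\<lambda>t. f t w) has_derivative (\<lambda>h. h *\<^sub>R f' t w)) (at t within UNIV)" for t
        using D[OF w, of t] by (simp add: has_vector_derivative_def)
      show "onorm (\<lambda>h. h *\<^sub>R f' t w) \<le> C" for t
        by (rule onorm_le) (simp add: mult.commute[of C] mult_left_mono C[OF w])
    qed auto
    then show ?thesis by simp
  qed
  have "((\<lambda>t. ((\<integral>w. f t w \<partial>M) - (\<integral>w. f t0 w \<partial>M)) /\<^sub>R (t - t0)) \<longlongrightarrow> (\<integral>w. f' t0 w \<partial>M)) (at t0)"
    unfolding tendsto_at_iff_sequentially comp_def
  proof (intro allI impI)
    fix X :: "nat \<Rightarrow> real" assume X0: "\<forall>i. X i \<in> UNIV - {t0}" and X: "X \<longlonglongrightarrow> t0"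
    have "(\<lambda>i. \<integral>w. (f (X i) w - f t0 w) /\<^sub>R (X i - t0) \<partial>M) \<longlonglongrightarrow> (\<integral>w. f' t0 w \<partial>M)"
    proof (rule integral_dominated_convergence[where w="\<lambda>_. C"])
      show "(\<lambda>w. (f (X i) w - f t0 w) /\<^sub>R (X i - t0)) \<in> borel_measurable M" for i
        using int[THEN borel_measurable_integrable] by measurable
      show "AE w in M. (\<lambda>i. (f (X i) w - f t0 w) /\<^sub>R (X i - t0)) \<longlonglongrightarrow> f' t0 w"
        using S
      proof eventually_elim
        fix w assume w: "w \<in> S"
        have "((\<lambda>t. (f t w - f t0 w) /\<^sub>R (t - t0)) \<longlongrightarrow> f' t0 w) (at t0)"
        proof -
          have "((\<lambda>y. ((f y w - f t0 w) - (y - t0) *\<^sub>R f' t0 w) /\<^sub>R norm (y - t0)) \<longlongrightarrow> 0) (at t0)"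
            using D[OF w, of t0] by (simp add: has_vector_derivative_def has_derivative_at_within divide_inverse)
          then have "((\<lambda>y. norm (((f y w - f t0 w) - (y - t0) *\<^sub>R f' t0 w) /\<^sub>R norm (y - t0))) \<longlongrightarrow> 0) (at t0)"
            by (rule tendsto_norm_zero)
          then have "((\<lambda>y. norm ((f y w - f t0 w) /\<^sub>R (y - t0) - f' t0 w)) \<longlongrightarrow> 0) (at t0)"
          proof (rule Lim_transform_eventually)
            show "\<forall>\<^sub>F y in at t0. norm (((f y w - f t0 w) - (y - t0) *\<^sub>R f' t0 w) /\<^sub>R norm (y - t0)) =
               norm ((f y w - f t0 w) /\<^sub>R (y - t0) - f' t0 w)"
              unfolding eventually_at_filter
            proof (intro always_eventually allI impI)
              fix y assume "y \<noteq> t0"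
              then have "(f y w - f t0 w) /\<^sub>R (y - t0) - f' t0 w = ((f y w - f t0 w) - (y - t0) *\<^sub>R f' t0 w) /\<^sub>R (y - t0)"
                by (simp add: scaleR_diff_right)
              then show "norm (((f y w - f t0 w) - (y - t0) *\<^sub>R f' t0 w) /\<^sub>R norm (y - t0)) =
               norm ((f y w - f t0 w) /\<^sub>R (y - t0) - f' t0 w)" by simp
            qed
          qed
          then show ?thesis by (metis LIM_zero_cancel tendsto_norm_zero_cancel)
        qed
        then show "(\<lambda>i. (f (X i) w - f t0 w) /\<^sub>R (X i - t0)) \<longlonglongrightarrow> f' t0 w"
          using X0 X unfolding tendsto_at_iff_sequentially comp_def by auto
      qed
      show "AE w in M. norm ((f (X i) w - f t0 w) /\<^sub>R (X i - t0)) \<le> C" for i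
        using S
      proof eventually_elim
        fix w assume "w \<in> S"
        moreover have "X i \<noteq> t0" using X0 by auto
        ultimately show "norm ((f (X i) w - f t0 w) /\<^sub>R (X i - t0)) \<le> C"
          using lip[of w "X i" t0] by (simp add: divide_inverse[symmetric] mult.commute[of "inverse _"] pos_divide_le_eq)
      qed
    qed (use meas in auto)
    moreover have "(\<integral>w. (f (X i) w - f t0 w) /\<^sub>R (X i - t0) \<partial>M) = ((\<integral>w. f (X i) w \<partial>M) - (\<integral>w. f t0 w \<partial>M)) /\<^sub>R (X i - t0)" for i
      by (simp add: int)
    ultimately show "(\<lambda>i. ((\<integral>w. f (X i) w \<partial>M) - (\<integral>w. f t0 w \<partial>M)) /\<^sub>R (X i - t0)) \<longlonglongrightarrow> (\<integral>w. f' t0 w \<partial>M)"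
      by (simp only:)
  qed
  then have T: "((\<lambda>t. norm (((\<integral>w. f t w \<partial>M) - (\<integral>w. f t0 w \<partial>M)) /\<^sub>R (t - t0) - (\<integral>w. f' t0 w \<partial>M))) \<longlongrightarrow> 0) (at t0)"
    by (intro tendsto_norm_zero LIM_zero)
  show ?thesis
    unfolding has_vector_derivative_def has_derivative_at_within
  proof
    show "bounded_linear (\<lambda>x. x *\<^sub>R (\<integral>w. f' t0 w \<partial>M))" by (rule bounded_linear_scaleR_left)
    have "((\<lambda>t. norm (((\<integral>w. f t w \<partial>M) - (\<integral>w. f t0 w \<partial>M) - (t - t0) *\<^sub>R (\<integral>w. f' t0 w \<partial>M)) /\<^sub>R norm (t - t0))) \<longlongrightarrow> 0) (at t0)"
    proof (rule Lim_transform_eventually[OF T])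
      show "\<forall>\<^sub>F t in at t0. norm (((\<integral>w. f t w \<partial>M) - (\<integral>w. f t0 w \<partial>M)) /\<^sub>R (t - t0) - (\<integral>w. f' t0 w \<partial>M)) =
        norm (((\<integral>w. f t w \<partial>M) - (\<integral>w. f t0 w \<partial>M) - (t - t0) *\<^sub>R (\<integral>w. f' t0 w \<partial>M)) /\<^sub>R norm (t - t0))"
        unfolding eventually_at_filter
      proof (intro always_eventually allI impI)
        fix t assume "t \<noteq> t0"
        then have "((\<integral>w. f t w \<partial>M) - (\<integral>w. f t0 w \<partial>M)) /\<^sub>R (t - t0) - (\<integral>w. f' t0 w \<partial>M) =
          ((\<integral>w. f t w \<partial>M) - (\<integral>w. f t0 w \<partial>M) - (t - t0) *\<^sub>R (\<integral>w. f' t0 w \<partial>M)) /\<^sub>R (t - t0)"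
          by (simp add: scaleR_diff_right)
        then show "norm (((\<integral>w. f t w \<partial>M) - (\<integral>w. f t0 w \<partial>M)) /\<^sub>R (t - t0) - (\<integral>w. f' t0 w \<partial>M)) =
          norm (((\<integral>w. f t w \<partial>M) - (\<integral>w. f t0 w \<partial>M) - (t - t0) *\<^sub>R (\<integral>w. f' t0 w \<partial>M)) /\<^sub>R norm (t - t0))"
          by simp
      qed
    qed
    then show "((\<lambda>t. ((\<integral>w. f t w \<partial>M) - (\<integral>w. f t0 w \<partial>M) - (t - t0) *\<^sub>R (\<integral>w. f' t0 w \<partial>M)) /\<^sub>R norm (t - t0)) \<longlongrightarrow> 0) (at t0)"
      by (rule tendsto_norm_zero_cancel)
  qed
qed

subsection \<open>Polynomials\<close>

lemmas real_polynomial_linear = real_polynomial_function.intros(1)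
  and real_polynomial_const = real_polynomial_function.intros(2)
  and real_polynomial_add = real_polynomial_function.intros(3)
  and real_polynomial_mult = real_polynomial_function.intros(4)

lemma real_polynomial_inner:
  fixes f g :: "'c::real_normed_vector \<Rightarrow> 'b::euclidean_space"
  assumes "polynomial_function f" "polynomial_function g"
  shows "real_polynomial_function (\<lambda>x. f x \<bullet> g x)"
proof -
  have "real_polynomial_function (\<lambda>x. \<Sum>b\<in>Basis. (f x \<bullet> b) * (g x \<bullet> b))"
    using assms by (intro real_polynomial_function_sum real_polynomial_mult) (auto simp: real_polynomial_function_eq)
  then show ?thesis by (simp add: euclidean_inner[symmetric])
qed

text \<open>Joint polynomiality in point and direction gives joint continuity of the derivative;
  with the direction fixed it allows iteration, hence derivatives of all orders.\<close>

lemma real_polynomial_function_has_derivative: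
  fixes p :: "'c::real_normed_vector \<Rightarrow> real"
  assumes "real_polynomial_function p"
  obtains p' where "\<And>x. (p has_derivative p' x) (at x)"
    "real_polynomial_function (\<lambda>z. p' (fst z) (snd z))"
proof -
  have "\<exists>p'. (\<forall>x. (p has_derivative p' x) (at x)) \<and> real_polynomial_function (\<lambda>z. p' (fst z) (snd z))"
    using assms
  proof induction
    case (linear f)
    have "real_polynomial_function (\<lambda>z::'c \<times> 'c. f (snd z))"
      by (rule real_polynomial_linear, rule bounded_linear_compose[OF linear bounded_linear_snd])
    then show ?case using bounded_linear.has_derivative[OF linear has_derivative_ident]
      by (intro exI[of _ "\<lambda>_. f"]) auto
  next
    case (const c)
    show ?case by (intro exI[of _ "\<lambda>_ _. 0"]) (auto intro: real_polynomial_const)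
  next
    case (add f g)
    then obtain f' g' where f': "\<And>x. (f has_derivative f' x) (at x)" "real_polynomial_function (\<lambda>z. f' (fst z) (snd z))"
      and g': "\<And>x. (g has_derivative g' x) (at x)" "real_polynomial_function (\<lambda>z. g' (fst z) (snd z))" by blast
    show ?case
      by (intro exI[of _ "\<lambda>x h. f' x h + g' x h"] conjI allI has_derivative_add f' g' real_polynomial_add)
  next
    case (mult f g)
    then obtain f' g' where f': "\<And>x. (f has_derivative f' x) (at x)" "real_polynomial_function (\<lambda>z. f' (fst z) (snd z))"
      and g': "\<And>x. (g has_derivative g' x) (at x)" "real_polynomial_function (\<lambda>z. g' (fst z) (snd z))" by blast
    have fst: "real_polynomial_function (\<lambda>z::'c \<times> 'c. q (fst z))" if "real_polynomial_function q" for q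
      using real_polynomial_function_compose[OF polynomial_function_bounded_linear[OF bounded_linear_fst] that]
      by (simp add: o_def)
    show ?case
      by (intro exI[of _ "\<lambda>x h. f x * g' x h + f' x h * g x"] conjI allI has_derivative_mult f' g'
          real_polynomial_add real_polynomial_mult fst mult)
  qed
  then show ?thesis using that by blast
qed

lemma continuous_on_real_polynomial: "real_polynomial_function p \<Longrightarrow> continuous_on S p"
  using continuous_on_polymonial_function real_polynomial_function_eq by blast

lemma Ck_on_open_polynomial_function:
  fixes f :: "'a::euclidean_space \<Rightarrow> 'b::euclidean_space"
  shows "polynomial_function f \<Longrightarrow> Ck_on_open k UNIV f"
proof (induction k arbitrary: f)
  case 0
  then show ?case by (simp add: continuous_on_polymonial_function)
next
  case (Suc k)
  have comp: "real_polynomial_function (\<lambda>x. f x \<bullet> b)" if "b \<in> Basis" for b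
    using Suc.prems that by (simp add: polynomial_function_iff_Basis_inner)
  have "\<forall>b\<in>Basis. \<exists>p'. (\<forall>x. ((\<lambda>x. f x \<bullet> b) has_derivative p' x) (at x)) \<and> real_polynomial_function (\<lambda>z. p' (fst z) (snd z))"
  proof
    fix b :: 'b assume "b \<in> Basis"
    from real_polynomial_function_has_derivative[OF comp[OF this]]
    show "\<exists>p'. (\<forall>x. ((\<lambda>x. f x \<bullet> b) has_derivative p' x) (at x)) \<and> real_polynomial_function (\<lambda>z. p' (fst z) (snd z))"
      by blast
  qed
  from bchoice[OF this] obtain p' where p': "\<And>b x. b \<in> Basis \<Longrightarrow> ((\<lambda>x. f x \<bullet> b) has_derivative p' b x) (at x)"
    "\<And>b. b \<in> Basis \<Longrightarrow> real_polynomial_function (\<lambda>z. p' b (fst z) (snd z))"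
    by blast
  have d: "(f has_derivative (\<lambda>v. \<Sum>b\<in>Basis. p' b x v *\<^sub>R b)) (at x)" for x
  proof -
    have "((\<lambda>x. \<Sum>b\<in>Basis. (f x \<bullet> b) *\<^sub>R b) has_derivative (\<lambda>v. \<Sum>b\<in>Basis. p' b x v *\<^sub>R b)) (at x)"
      by (intro has_derivative_sum has_derivative_scaleR_left p')
    then show ?thesis by (simp add: euclidean_representation)
  qed
  have fd: "frechet_derivative f (at x) v = (\<Sum>b\<in>Basis. p' b x v *\<^sub>R b)" for x v
    by (simp add: frechet_derivative_at[OF d, symmetric])
  have "polynomial_function (\<lambda>x. frechet_derivative f (at x) v)" for v
  proof -
    have "real_polynomial_function (\<lambda>x. p' b x v)" if b: "b \<in> Basis" for b
    proof -
      have "polynomial_function (\<lambda>x::'a. (x, v))"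
      proof -
        have "(\<lambda>x::'a. (x, v)) = (\<lambda>x. (x, 0) + (0, v))" by auto
        moreover have "polynomial_function (\<lambda>x::'a. (x, 0::'a) + (0, v))"
          by (intro polynomial_function_add polynomial_function_const polynomial_function_bounded_linear
              bounded_linear_Pair bounded_linear_ident bounded_linear_zero)
        ultimately show ?thesis by simp
      qed
      from real_polynomial_function_compose[OF this p'(2)[OF b]] show ?thesis by (simp add: o_def)
    qed
    then show ?thesis
      unfolding fd
      by (intro polynomial_function_sum polynomial_function_mult polynomial_function_const)
        (auto simp: real_polynomial_function_eq)
  qed
  then show ?case using Suc.IH d by (auto simp: differentiable_def)
qed

lemma smooth_on_polynomial_function:
  "polynomial_function Q \<Longrightarrow> (\<And>x. x \<in> S \<Longrightarrow> f x = Q x) \<Longrightarrow> smooth_on S f"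
  unfolding smooth_on_def by (intro exI[of _ UNIV] exI[of _ Q]) (auto intro: Ck_on_open_polynomial_function)

text \<open>
  The integral over the unit tangent sphere at \<open>x\<close> of a homogeneous polynomial \<open>m\<close> is a constant multiple of
  the integral of \<open>m (proj_perp x y)\<close> over the fixed sphere, which shows that it is a polynomial in \<open>x\<close>.
\<close>

definition homogeneous_poly :: "nat \<Rightarrow> ('a::euclidean_space \<Rightarrow> real) \<Rightarrow> bool" where
  "homogeneous_poly d m \<longleftrightarrow> real_polynomial_function m \<and> (\<forall>s w. m (s *\<^sub>R w) = s ^ d * m w)"

text \<open>Sums of products whose second factor is homogeneous: in this form the second variable
  can be integrated out term by term, each term having a definite degree.\<close>

inductive separated_poly :: "('b::euclidean_space \<times> 'a::euclidean_space \<Rightarrow> real) \<Rightarrow> bool" where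
  mono: "real_polynomial_function a \<Longrightarrow> homogeneous_poly d m \<Longrightarrow> separated_poly (\<lambda>z. a (fst z) * m (snd z))"
| add: "separated_poly p \<Longrightarrow> separated_poly q \<Longrightarrow> separated_poly (\<lambda>z. p z + q z)"

lemma separated_poly_mult:
  assumes "separated_poly p" "separated_poly q"
  shows "separated_poly (\<lambda>z. p z * q z)"
  using assms
proof (induction rule: separated_poly.induct)
  case (mono a d m)
  from mono(3) show ?case
  proof (induction rule: separated_poly.induct)
    case (mono a' d' m')
    have "real_polynomial_function (\<lambda>x. a x * a' x)" by (intro real_polynomial_mult mono \<open>real_polynomial_function a\<close>)
    moreover have "homogeneous_poly (d + d') (\<lambda>w. m w * m' w)"
      using mono \<open>homogeneous_poly d m\<close>
      by (auto simp: homogeneous_poly_def power_add intro: real_polynomial_mult)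
    ultimately have "separated_poly (\<lambda>z. (a (fst z) * a' (fst z)) * (m (snd z) * m' (snd z)))"
      by (rule separated_poly.mono)
    then show ?case by (simp add: mult_ac)
  next
    case (add p q)
    then show ?case using separated_poly.add[OF add.IH] by (simp add: algebra_simps)
  qed
next
  case (add p q)
  then show ?case using separated_poly.add[OF add.IH] by (simp add: algebra_simps)
qed

text \<open>A linear form is the sum of its restrictions to the two factors, which have degree 0 and
  1 in the second variable; sums and products preserve the form.\<close>

lemma separated_poly_polynomial:
  "real_polynomial_function p \<Longrightarrow> separated_poly p"
proof (induction rule: real_polynomial_function.induct)
  case (linear f)
  have 1: "bounded_linear (\<lambda>x. f (x, 0))" "bounded_linear (\<lambda>w. f (0, w))"
    by (intro bounded_linear_compose[OF linear] bounded_linear_Pair bounded_linear_ident bounded_linear_zero)+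
  have "separated_poly (\<lambda>z. f (fst z, 0) * 1)"
    by (rule separated_poly.mono[where d=0])
      (auto intro: real_polynomial_linear 1 real_polynomial_const simp: homogeneous_poly_def)
  moreover have "separated_poly (\<lambda>z. 1 * f (0, snd z))"
    using linear_scale[OF bounded_linear.linear[OF linear], of _ "(0, _)"]
    by (intro separated_poly.mono[where d=1 and a="\<lambda>_. 1"])
      (auto intro: real_polynomial_linear 1 real_polynomial_const simp: homogeneous_poly_def)
  ultimately have "separated_poly (\<lambda>z. f (fst z, 0) * 1 + 1 * f (0, snd z))" by (rule separated_poly.add)
  moreover have "f (fst z, 0) * 1 + 1 * f (0, snd z) = f z" for z
    using linear_add[OF bounded_linear.linear[OF linear], of "(fst z, 0)" "(0, snd z)"] by simp
  ultimately show ?case by simp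
next
  case (const c)
  show ?case
    using separated_poly.mono[of "\<lambda>_. c" 0 "\<lambda>_. 1"]
    by (auto simp: homogeneous_poly_def intro: real_polynomial_const)
qed (auto intro: separated_poly.add separated_poly_mult)

lemma polynomial_integral_parameter:
  fixes p :: "'b::euclidean_space \<times> 'a::euclidean_space \<Rightarrow> real"
  assumes "real_polynomial_function p" and M: "finite_measure M" "sets M = sets borel"
    and K: "compact K" "AE y in M. y \<in> K"
  shows "real_polynomial_function (\<lambda>x. \<integral>y. p (x, y) \<partial>M)"
    "\<And>x. integrable M (\<lambda>y. p (x, y))"
proof -
  interpret finite_measure M by fact
  have int: "integrable M q" if "continuous_on UNIV q" for q :: "'a \<Rightarrow> real"
  proof -
    have "compact (q ` K)" by (rule compact_continuous_image[OF continuous_on_subset[OF that] K(1)]) simp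
    then obtain C where "\<And>y. y \<in> K \<Longrightarrow> norm (q y) \<le> C"
      by (metis bounded_iff compact_imp_bounded imageI)
    then show ?thesis
      using borel_measurable_continuous_onI[OF that]
      by (intro integrable_const_bound[where B=C] eventually_mono[OF K(2)]) (auto simp: measurable_cong_sets[OF M(2) refl])
  qed
  show i: "integrable M (\<lambda>y. p (x, y))" for x
    by (rule int) (intro continuous_on_compose2[OF continuous_on_real_polynomial[OF assms(1), of UNIV]] continuous_intros subset_UNIV)
  have "separated_poly p \<Longrightarrow> (\<forall>x. integrable M (\<lambda>y. p (x, y))) \<and> real_polynomial_function (\<lambda>x. \<integral>y. p (x, y) \<partial>M)"
  proof (induction rule: separated_poly.induct)
    case (mono a d m)
    then have "integrable M m" by (intro int continuous_on_real_polynomial) (simp add: homogeneous_poly_def)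
    then show ?case
      using mono by (auto intro: real_polynomial_mult real_polynomial_const)
  next
    case (add p q)
    then show ?case by (auto intro: real_polynomial_add)
  qed
  then show "real_polynomial_function (\<lambda>x. \<integral>y. p (x, y) \<partial>M)"
    using separated_poly_polynomial[OF assms(1)] by simp
qed

lemma proj_perp_frame: "(x, w) \<in> frames \<Longrightarrow> proj_perp x (c *\<^sub>R x + s *\<^sub>R w) = s *\<^sub>R w"
  by (auto simp: frames_def proj_perp_def inner_add_left inner_commute[of w x] norm_eq_1)

text \<open>In polar coordinates around x the projection of y is sin r w, so homogeneity pulls out
  sin r to the power d and the radial integral separates. It does not involve x or m, whence the
  order of the quantifiers.\<close>

lemma integral_homogeneous_tangV:
  assumes dim: "DIM('a::euclidean_space) \<ge> 2"
  shows "\<exists>c. \<forall>(m :: 'a \<Rightarrow> real) x. homogeneous_poly d m \<longrightarrow> norm x = 1 \<longrightarrow>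
    (\<integral>w. m w \<partial>tangV x) = c * (\<integral>y. m (proj_perp x y) \<partial>sphV)"
proof -
  define S :: "real \<Rightarrow> ennreal" where "S r = indicator {0<..<pi} r * ennreal (sin r ^ (DIM('a) - 2) * sin r ^ d)" for r
  have [measurable]: "S \<in> borel_measurable borel" unfolding S_def by measurable
  define c where "c = (\<integral>\<^sup>+r. S r \<partial>lborel)"
  have "c \<le> (\<integral>\<^sup>+r. indicator {0..pi} r \<partial>lborel)"
    unfolding c_def S_def
  proof (rule nn_integral_mono)
    fix r
    have "sin r ^ (DIM('a) - 2) * sin r ^ d \<le> 1" if "0 < r" "r < pi"
      unfolding power_add[symmetric] using that sin_gt_zero[of r] by (intro power_le_one) auto
    then show "indicator {0<..<pi} r * ennreal (sin r ^ (DIM('a) - 2) * sin r ^ d) \<le> indicator {0..pi} r"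
      by (auto simp: indicator_def ennreal_le_1)
  qed
  then have cfin: "c < \<infinity>" by (simp add: le_less_trans[OF _ ennreal_less_top])
  have c0: "c \<noteq> 0"
  proof
    assume "c = 0"
    then have "AE r in lborel. S r = 0" unfolding c_def by (subst (asm) nn_integral_0_iff_AE) auto
    moreover have "S r \<noteq> 0" if "r \<in> {0<..<pi}" for r
      using that sin_gt_zero[of r] by (auto simp: S_def)
    ultimately have "AE r in lborel. r \<notin> {0<..<pi}" by (auto elim!: eventually_mono)
    then have "{0<..<pi} \<in> null_sets lborel" by (subst AE_iff_null_sets) auto
    then show False by (simp add: null_sets_def)
  qed
  have pos: "(\<integral>\<^sup>+y. ennreal (m (proj_perp x y)) \<partial>sphV) = c * (\<integral>\<^sup>+w. ennreal (m w) \<partial>tangV x)"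
    if [measurable]: "m \<in> borel_measurable borel" and m0: "\<And>w. m w \<ge> 0" and hom: "\<And>s w. s \<ge> 0 \<Longrightarrow> m (s *\<^sub>R w) = s ^ d * m w"
      and x: "norm x = 1" for m and x :: 'a
  proof -
    have "(\<integral>\<^sup>+y. ennreal (m (proj_perp x y)) \<partial>sphV) =
      (\<integral>\<^sup>+r. indicator {0<..<pi} r * ennreal (sin r ^ (DIM('a) - 2)) * (\<integral>\<^sup>+w. ennreal (m (proj_perp x (cos r *\<^sub>R x + sin r *\<^sub>R w))) \<partial>tangV x) \<partial>lborel)"
      by (rule nn_integral_sphV_polar[OF dim x]) measurable
    also have "\<dots> = (\<integral>\<^sup>+r. S r * (\<integral>\<^sup>+w. ennreal (m w) \<partial>tangV x) \<partial>lborel)"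
    proof (rule nn_integral_cong)
      fix r
      show "indicator {0<..<pi} r * ennreal (sin r ^ (DIM('a) - 2)) * (\<integral>\<^sup>+w. ennreal (m (proj_perp x (cos r *\<^sub>R x + sin r *\<^sub>R w))) \<partial>tangV x)
        = S r * (\<integral>\<^sup>+w. ennreal (m w) \<partial>tangV x)"
      proof (cases "r \<in> {0<..<pi}")
        case True
        then have sp: "sin r > 0" by (auto intro: sin_gt_zero)
        have "(\<integral>\<^sup>+w. ennreal (m (proj_perp x (cos r *\<^sub>R x + sin r *\<^sub>R w))) \<partial>tangV x) = (\<integral>\<^sup>+w. ennreal (sin r ^ d) * ennreal (m w) \<partial>tangV x)"
          using sp by (intro nn_integral_cong_AE eventually_mono[OF AE_tangV_frames[OF x]])
            (simp add: proj_perp_frame hom ennreal_mult m0)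
        also have "\<dots> = ennreal (sin r ^ d) * (\<integral>\<^sup>+w. ennreal (m w) \<partial>tangV x)"
          by (rule nn_integral_cmult) measurable
        finally show ?thesis using sp by (simp add: S_def ennreal_mult mult.assoc)
      qed (simp add: S_def)
    qed
    also have "\<dots> = c * (\<integral>\<^sup>+w. ennreal (m w) \<partial>tangV x)"
      unfolding c_def by (rule nn_integral_multc) measurable
    finally show ?thesis .
  qed
  show ?thesis
  proof (intro exI[of _ "1 / enn2real c"] allI impI)
    fix m :: "'a \<Rightarrow> real" and x :: 'a
    assume m: "homogeneous_poly d m" and x: "norm x = 1"
    have cm: "continuous_on A m" for A using m by (intro continuous_on_real_polynomial) (simp add: homogeneous_poly_def)
    have [measurable]: "m \<in> borel_measurable borel" by (rule borel_measurable_continuous_onI) (rule cm)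
    have hom: "m (s *\<^sub>R w) = s ^ d * m w" for s w using m by (simp add: homogeneous_poly_def)
    interpret t: finite_measure "tangV x" by (rule finite_measure_tangV[OF x])
    have "compact (m ` cball 0 1)" by (intro compact_continuous_image cm compact_cball)
    then obtain C where C: "\<And>w. w \<in> cball 0 1 \<Longrightarrow> norm (m w) \<le> C"
      by (metis bounded_iff compact_imp_bounded imageI)
    have int: "integrable (tangV x) m"
      by (rule t.integrable_const_bound[where B=C]) (use C in \<open>auto intro!: eventually_mono[OF AE_tangV[OF x]]\<close>)
    define r where "r = enn2real c"
    have r: "c = ennreal r" "r > 0"
      using cfin c0 by (auto simp: r_def enn2real_positive_iff less_top zero_less_iff_neq_zero)
    \<comment> \<open>Positive and negative part of m are homogeneous for nonnegative scalars only,
      which is why \<open>pos\<close> asks for no more.\<close>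
    have P: "enn2real (\<integral>\<^sup>+y. ennreal (u (proj_perp x y)) \<partial>sphV) = r * enn2real (\<integral>\<^sup>+w. ennreal (u w) \<partial>tangV x)"
      if "u = (\<lambda>w. max 0 (m w)) \<or> u = (\<lambda>w. max 0 (- m w))" for u
    proof -
      have "u \<in> borel_measurable borel" using that by auto
      moreover have "u w \<ge> 0" for w using that by auto
      moreover have "u (s *\<^sub>R w) = s ^ d * u w" if s: "s \<ge> 0" for s w
      proof -
        have e: "max 0 (s ^ d * b) = s ^ d * max 0 b" for b
          using zero_le_power[OF s, of d] by (simp add: max_mult_distrib_left)
        show ?thesis using \<open>u = _ \<or> u = _\<close>
        proof
          assume "u = (\<lambda>w. max 0 (m w))"
          then show ?thesis using e[of "m w"] by (simp add: hom)
        next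
          assume "u = (\<lambda>w. max 0 (- m w))"
          then show ?thesis using e[of "- m w"] by (simp add: hom)
        qed
      qed
      ultimately show ?thesis using pos[of u x] x r by (simp add: enn2real_mult)
    qed
    have e: "(\<integral>y. g y \<partial>L) = enn2real (\<integral>\<^sup>+y. ennreal (max 0 (g y)) \<partial>L) - enn2real (\<integral>\<^sup>+y. ennreal (max 0 (- g y)) \<partial>L)"
      if "integrable L g" for g :: "'a \<Rightarrow> real" and L
      using real_lebesgue_integral_def[OF that] by (simp add: ennreal_max_0)
    interpret s: finite_measure "sphV :: 'a measure" by (rule finite_measure_sphV)
    have int2: "integrable sphV (\<lambda>y. m (proj_perp x y))"
    proof (rule s.integrable_const_bound[where B=C])
      have "norm (proj_perp x y) \<le> 1" if "norm y = 1" for y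
      proof -
        have "proj_perp x y \<bullet> proj_perp x y = 1 - (y \<bullet> x)\<^sup>2"
          using x that by (simp add: proj_perp_def inner_diff_left inner_diff_right norm_eq_1 inner_commute power2_eq_square)
        then have "(norm (proj_perp x y))\<^sup>2 = 1 - (y \<bullet> x)\<^sup>2" by (simp add: power2_norm_eq_inner)
        then have "(norm (proj_perp x y))\<^sup>2 \<le> 1" by simp
        then show ?thesis by (simp add: abs_square_le_1)
      qed
      then show "AE y in sphV. norm (m (proj_perp x y)) \<le> C"
        by (intro eventually_mono[OF AE_sphV] C) auto
    qed measurable
    have "(\<integral>y. m (proj_perp x y) \<partial>sphV) = r * (\<integral>w. m w \<partial>tangV x)"
      using P[of "\<lambda>w. max 0 (m w)"] P[of "\<lambda>w. max 0 (- m w)"]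
      by (simp add: e[OF int] e[OF int2] right_diff_distrib)
    then show "(\<integral>w. m w \<partial>tangV x) = 1 / enn2real c * (\<integral>y. m (proj_perp x y) \<partial>sphV)"
      using r by (simp add: r_def[symmetric])
  qed
qed

section \<open>Mean fields of functions on the unit tangent bundle\<close>

definition mean_field :: "('a::euclidean_space \<times> 'a \<Rightarrow> real) \<Rightarrow> 'a \<Rightarrow> 'a" where
  "mean_field \<eta> x = (\<integral>w. \<eta> (x, w) *\<^sub>R w \<partial>tangV x)"

lemma integrable_tangV_continuous:
  fixes f :: "'a::euclidean_space \<Rightarrow> 'b::euclidean_space"
  assumes x: "norm x = 1" and f: "continuous_on UNIV f"
  shows "integrable (tangV x) f"
proof -
  interpret t: finite_measure "tangV x" by (rule finite_measure_tangV[OF x])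
  have "compact (f ` cball 0 1)" by (intro compact_continuous_image continuous_on_subset[OF f] compact_cball) auto
  then obtain C where C: "\<And>w. w \<in> cball 0 1 \<Longrightarrow> norm (f w) \<le> C"
    by (metis bounded_iff compact_imp_bounded imageI)
  show ?thesis
    using borel_measurable_continuous_onI[OF f]
    by (intro t.integrable_const_bound[where B=C]) (use C in \<open>auto intro!: eventually_mono[OF AE_tangV[OF x]]\<close>)
qed

text \<open>Smoothness is defined through extensions to a neighbourhood, and here the extension is a
  polynomial Q on the whole space, obtained coordinate by coordinate.\<close>

lemma mean_field_polynomial:
  fixes \<eta> :: "'a::euclidean_space \<times> 'a \<Rightarrow> real"
  assumes dim: "DIM('a) \<ge> 2" and \<eta>: "real_polynomial_function \<eta>"
  obtains Q where "polynomial_function Q" "\<And>x. norm x = 1 \<Longrightarrow> mean_field \<eta> x = Q x"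
proof -
  have mono_lem: "\<exists>q. real_polynomial_function q \<and> (\<forall>x. norm x = 1 \<longrightarrow> (\<integral>w. m w \<partial>tangV x) = q x)"
    if m: "homogeneous_poly d m" for d and m :: "'a \<Rightarrow> real"
  proof -
    obtain c where c: "\<And>(m :: 'a \<Rightarrow> real) x. homogeneous_poly d m \<Longrightarrow> norm x = 1 \<Longrightarrow>
      (\<integral>w. m w \<partial>tangV x) = c * (\<integral>y. m (proj_perp x y) \<partial>sphV)"
      using integral_homogeneous_tangV[OF dim, of d] by blast
    have "polynomial_function (\<lambda>z::'a \<times> 'a. proj_perp (fst z) (snd z))"
      unfolding proj_perp_def
      by (intro polynomial_function_diff polynomial_function_mult polynomial_function_bounded_linear
          bounded_linear_fst bounded_linear_snd real_polynomial_inner[unfolded real_polynomial_function_eq])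
    then have "real_polynomial_function (\<lambda>z. m (proj_perp (fst z) (snd z)))"
      using real_polynomial_function_compose m by (fastforce simp: homogeneous_poly_def o_def)
    from polynomial_integral_parameter(1)[OF this finite_measure_sphV sets_sphV compact_sphere[of 0 1]]
    have "real_polynomial_function (\<lambda>x. \<integral>y. m (proj_perp x y) \<partial>sphV)"
      using AE_sphV by simp
    then have "real_polynomial_function (\<lambda>x. c * (\<integral>y. m (proj_perp x y) \<partial>sphV))"
      by (intro real_polynomial_mult real_polynomial_const)
    then show ?thesis using c[OF m] by blast
  qed
  have "separated_poly p \<Longrightarrow> (\<exists>q. real_polynomial_function q \<and> (\<forall>x. norm x = 1 \<longrightarrow> (\<integral>w. p (x, w) * (w \<bullet> b) \<partial>tangV x) = q x)) \<and> continuous_on UNIV p"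
    for b :: 'a and p :: "'a \<times> 'a \<Rightarrow> real"
  proof (induction rule: separated_poly.induct)
    case (mono a d m)
    \<comment> \<open>Taking the component along b multiplies m by a linear form, which raises the
      degree by one.\<close>
    have "homogeneous_poly (Suc d) (\<lambda>w. m w * (w \<bullet> b))"
      using mono(2) real_polynomial_mult[of m "\<lambda>w. w \<bullet> b"] real_polynomial_linear[OF bounded_linear_inner_left, of b]
      by (auto simp: homogeneous_poly_def)
    then obtain q where q: "real_polynomial_function q" "\<And>x. norm x = 1 \<Longrightarrow> (\<integral>w. m w * (w \<bullet> b) \<partial>tangV x) = q x"
      using mono_lem[of "Suc d"] mono by blast
    then have "real_polynomial_function (\<lambda>x. a x * q x)" using mono(1) by (intro real_polynomial_mult)
    moreover have "(\<integral>w. (a (fst (x, w)) * m (snd (x, w))) * (w \<bullet> b) \<partial>tangV x) = a x * q x" if "norm x = 1" for x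
      using q(2)[OF that] by (simp add: mult.assoc)
    moreover have "continuous_on UNIV (\<lambda>z. a (fst z) * m (snd z))"
      using mono by (intro continuous_intros continuous_on_compose2[OF continuous_on_real_polynomial[of a UNIV]]
         continuous_on_compose2[OF continuous_on_real_polynomial[of m UNIV]]) (auto simp: homogeneous_poly_def)
    ultimately show ?case by blast
  next
    case (add p q)
    then obtain f g where f: "real_polynomial_function f" "\<And>x. norm x = 1 \<Longrightarrow> (\<integral>w. p (x, w) * (w \<bullet> b) \<partial>tangV x) = f x"
      and g: "real_polynomial_function g" "\<And>x. norm x = 1 \<Longrightarrow> (\<integral>w. q (x, w) * (w \<bullet> b) \<partial>tangV x) = g x"
      and c: "continuous_on UNIV p" "continuous_on UNIV q" by blast
    have "(\<integral>w. (p (x, w) + q (x, w)) * (w \<bullet> b) \<partial>tangV x) = f x + g x" if x: "norm x = 1" for x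
    proof -
      have "integrable (tangV x) (\<lambda>w. p (x, w) * (w \<bullet> b))" "integrable (tangV x) (\<lambda>w. q (x, w) * (w \<bullet> b))"
        by (intro integrable_tangV_continuous[OF x] continuous_intros continuous_on_compose2[OF c(1)] continuous_on_compose2[OF c(2)] subset_UNIV)+
      then show ?thesis using f(2)[OF x] g(2)[OF x] by (simp add: distrib_right)
    qed
    then show ?case using f g c by (blast intro: real_polynomial_add continuous_on_add)
  qed
  then have "\<forall>b::'a. \<exists>q. real_polynomial_function q \<and> (\<forall>x. norm x = 1 \<longrightarrow> (\<integral>w. \<eta> (x, w) * (w \<bullet> b) \<partial>tangV x) = q x)"
    using separated_poly_polynomial[OF \<eta>] by blast
  then obtain q where q: "\<And>b::'a. real_polynomial_function (q b)" "\<And>b x. norm x = 1 \<Longrightarrow> (\<integral>w. \<eta> (x, w) * (w \<bullet> b) \<partial>tangV x) = q b x"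
    by metis
  show ?thesis
  proof (rule that[of "\<lambda>x. \<Sum>b\<in>Basis. q b x *\<^sub>R b"])
    show "polynomial_function (\<lambda>x. \<Sum>b\<in>Basis. q b x *\<^sub>R b)"
      using q(1) by (intro polynomial_function_sum polynomial_function_mult polynomial_function_const)
        (auto simp: real_polynomial_function_eq)
    fix x :: 'a assume x: "norm x = 1"
    have i: "integrable (tangV x) (\<lambda>w. \<eta> (x, w) *\<^sub>R w)"
      by (intro integrable_tangV_continuous[OF x] continuous_intros continuous_on_compose2[OF continuous_on_real_polynomial[OF \<eta>, of UNIV]] subset_UNIV)
    have "mean_field \<eta> x \<bullet> b = q b x" for b
      unfolding mean_field_def using i q(2)[OF x, of b] by (simp flip: integral_inner_left)
    then show "mean_field \<eta> x = (\<Sum>b\<in>Basis. q b x *\<^sub>R b)"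
      by (metis (no_types, lifting) euclidean_representation sum.cong)
  qed
qed

subsection \<open>The divergence of a mean field\<close>

lemma integral_abs_tangV:
  fixes x e :: "'a::euclidean_space"
  assumes "DIM('a) \<ge> 3" "norm x = 1" "norm e = 1" "x \<bullet> e = 0"
  shows "(\<integral>w. \<bar>w \<bullet> e\<bar> \<partial>tangV x) = abs_mean TYPE('a)"
  by (subst integral_eq_nn_integral) (auto simp: nn_integral_abs_tangV[OF assms] abs_mean_def)

lemma abs_mean_pos: "DIM('a::euclidean_space) \<ge> 3 \<Longrightarrow> abs_mean TYPE('a) > 0"
  by (simp add: abs_mean_def)

lemma borel_measurable_tangV: "continuous_on UNIV f \<Longrightarrow> f \<in> borel_measurable (tangV x)"
  by (subst measurable_cong_sets[OF sets_tangV refl]) (rule borel_measurable_continuous_onI)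

context
  fixes \<eta> :: "'a::euclidean_space \<times> 'a \<Rightarrow> real"
  assumes \<eta>: "continuous_on UNIV \<eta>"
begin

lemma continuous_on_slice: "continuous_on UNIV (\<lambda>w. \<eta> (x, w))"
  by (intro continuous_on_compose2[OF \<eta>] continuous_intros subset_UNIV)

lemma integrable_mean_field: "norm x = 1 \<Longrightarrow> integrable (tangV x) (\<lambda>w. \<eta> (x, w) *\<^sub>R w)"
  by (intro integrable_tangV_continuous continuous_intros continuous_on_slice)

lemma mean_field_inner: "norm x = 1 \<Longrightarrow> mean_field \<eta> x \<bullet> v = (\<integral>w. \<eta> (x, w) * (w \<bullet> v) \<partial>tangV x)"
  unfolding mean_field_def using integrable_mean_field by (simp flip: integral_inner_left)

lemma mean_field_tangent: "norm x = 1 \<Longrightarrow> mean_field \<eta> x \<in> tangent_space x"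
proof -
  assume x: "norm x = 1"
  have "mean_field \<eta> x \<bullet> x = (\<integral>w. 0 \<partial>tangV x)"
    unfolding mean_field_inner[OF x]
    by (intro integral_cong_AE eventually_mono[OF AE_tangV[OF x]])
      (auto simp: inner_commute intro!: borel_measurable_integrable integrable_tangV_continuous[OF x] continuous_intros continuous_on_slice)
  then show ?thesis by (simp add: tangent_space_def inner_commute)
qed

text \<open>Pair the field with the unit vector e in its own direction: this gives the norm as the
  integral of \<eta> times w \<bullet> e. The field is tangent, so e is orthogonal to x as the value
  of the mean requires.\<close>

lemma norm_mean_field_le:
  assumes dim: "DIM('a) \<ge> 3" and x: "norm x = 1" and b: "\<And>p. p \<in> frames \<Longrightarrow> \<bar>\<eta> p\<bar> \<le> 1"
  shows "norm (mean_field \<eta> x) \<le> abs_mean TYPE('a)"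
proof (cases "mean_field \<eta> x = 0")
  case True
  then show ?thesis using abs_mean_pos[OF dim] by simp
next
  case False
  define e where "e = sgn (mean_field \<eta> x)"
  have e: "norm e = 1" "x \<bullet> e = 0"
    using False mean_field_tangent[OF x] by (auto simp: e_def norm_sgn tangent_space_def sgn_div_norm)
  have "norm (mean_field \<eta> x) = mean_field \<eta> x \<bullet> e"
    using False by (simp add: e_def sgn_div_norm dot_square_norm power2_eq_square)
  also have "\<dots> = (\<integral>w. \<eta> (x, w) * (w \<bullet> e) \<partial>tangV x)" by (rule mean_field_inner[OF x])
  also have "\<dots> \<le> (\<integral>w. \<bar>w \<bullet> e\<bar> \<partial>tangV x)"
  proof (rule integral_mono_AE)
    show "AE w in tangV x. \<eta> (x, w) * (w \<bullet> e) \<le> \<bar>w \<bullet> e\<bar>"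
      using AE_tangV_frames[OF x]
    proof eventually_elim
      fix w assume "(x, w) \<in> frames"
      then have "\<bar>\<eta> (x, w) * (w \<bullet> e)\<bar> \<le> 1 * \<bar>w \<bullet> e\<bar>"
        unfolding abs_mult by (intro mult_right_mono b) auto
      then show "\<eta> (x, w) * (w \<bullet> e) \<le> \<bar>w \<bullet> e\<bar>" by simp
    qed
  qed (intro integrable_tangV_continuous[OF x] continuous_intros continuous_on_slice)+
  also have "\<dots> = abs_mean TYPE('a)" by (rule integral_abs_tangV[OF dim x e])
  finally show ?thesis .
qed

end

lemma sphere_exp_unit: "norm b = 1 \<Longrightarrow> sphere_exp x (t *\<^sub>R b) = cos t *\<^sub>R x + sin t *\<^sub>R b"
  by (cases "t = 0"; cases "t > 0") (auto simp: sphere_exp_def sgn_div_norm)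

text \<open>
  Rotating the plane of \<open>x\<close> and \<open>b\<close> by the angle \<open>t\<close> carries the unit tangent sphere at \<open>x\<close> along the geodesic, so
  that the derivative of a mean field along it can be taken under the integral over a fixed sphere.
\<close>

definition plane_rot :: "'a::euclidean_space \<Rightarrow> 'a \<Rightarrow> real \<Rightarrow> 'a \<Rightarrow> 'a" where
  "plane_rot x b t z = z + ((cos t - 1) * (z \<bullet> x) - sin t * (z \<bullet> b)) *\<^sub>R x + (sin t * (z \<bullet> x) + (cos t - 1) * (z \<bullet> b)) *\<^sub>R b"

definition plane_rot' :: "'a::euclidean_space \<Rightarrow> 'a \<Rightarrow> real \<Rightarrow> 'a \<Rightarrow> 'a" where
  "plane_rot' x b t z = (- sin t * (z \<bullet> x) - cos t * (z \<bullet> b)) *\<^sub>R x + (cos t * (z \<bullet> x) - sin t * (z \<bullet> b)) *\<^sub>R b"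

lemma plane_rot_derivative:
  "((\<lambda>t. plane_rot x b t z) has_vector_derivative plane_rot' x b t z) (at t)"
  unfolding plane_rot_def plane_rot'_def
  by (auto intro!: derivative_eq_intros simp: algebra_simps)

lemma orthogonal_plane_rot:
  assumes x: "norm x = 1" and b: "norm b = 1" and xb: "x \<bullet> b = 0"
  shows "orthogonal_transformation (plane_rot x b t)"
  unfolding orthogonal_transformation_def
proof (intro conjI allI)
  show "linear (plane_rot x b t)"
    by (rule linearI) (auto simp: plane_rot_def inner_add_left algebra_simps)
  fix v w
  have *: "x \<bullet> x = 1" "b \<bullet> b = 1" "b \<bullet> x = 0" "x \<bullet> b = 0" using assms by (auto simp: norm_eq_1 inner_commute)
  define c s where "c = cos t" and "s = sin t"
  have cs: "c * c + s * s = 1" using sin_cos_squared_add3[of t] by (simp add: c_def s_def)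
  define vx vb wx wb where "vx = v \<bullet> x" "vb = v \<bullet> b" "wx = w \<bullet> x" "wb = w \<bullet> b"
  have sym: "x \<bullet> w = wx" "b \<bullet> w = wb" "v \<bullet> x = vx" "v \<bullet> b = vb" "w \<bullet> x = wx" "w \<bullet> b = wb"
    by (simp_all add: vx_vb_wx_wb_def inner_commute)
  define A B A' B' where "A = (c - 1) * vx - s * vb" "B = s * vx + (c - 1) * vb" "A' = (c - 1) * wx - s * wb" "B' = s * wx + (c - 1) * wb"
  have "plane_rot x b t v \<bullet> plane_rot x b t w = v \<bullet> w + (A' * vx + B' * vb) + (A * wx + B * wb) + (A * A' + B * B')"
    unfolding plane_rot_def c_def[symmetric] s_def[symmetric] sym A_B_A'_B'_def[symmetric]
    by (simp add: inner_add_left inner_add_right * sym algebra_simps)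
  moreover have "(A' * vx + B' * vb) + (A * wx + B * wb) + (A * A' + B * B') = (c * c + s * s - 1) * (vx * wx + vb * wb)"
    unfolding A_B_A'_B'_def by (simp add: algebra_simps)
  moreover have "(c * c + s * s - 1) * (vx * wx + vb * wb) = 0" by (simp add: cs)
  ultimately show "plane_rot x b t v \<bullet> plane_rot x b t w = v \<bullet> w" by linarith
qed

lemma plane_rot_self:
  assumes "norm x = 1" "x \<bullet> b = 0"
  shows "plane_rot x b t x = cos t *\<^sub>R x + sin t *\<^sub>R b"
  using assms by (simp add: plane_rot_def norm_eq_1 algebra_simps)

lemma plane_rot_frames:
  assumes "norm x = 1" "norm b = 1" "x \<bullet> b = 0" "(x, w) \<in> frames"
  shows "(plane_rot x b t x, plane_rot x b t w) \<in> frames"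
  using assms orthogonal_plane_rot[OF assms(1-3), of t]
  by (auto simp: frames_def orthogonal_transformation_norm orthogonal_transformation_inner)

lemma norm_plane_rot':
  assumes "norm x = 1" "norm b = 1" "norm z \<le> 1"
  shows "norm (plane_rot' x b t z) \<le> 4"
proof -
  have zx: "\<bar>z \<bullet> x\<bar> \<le> 1" "\<bar>z \<bullet> b\<bar> \<le> 1"
    using assms Cauchy_Schwarz_ineq2[of z x] Cauchy_Schwarz_ineq2[of z b] by auto
  have p: "\<bar>a * c\<bar> \<le> 1" if "\<bar>a\<bar> \<le> 1" "\<bar>c\<bar> \<le> 1" for a c :: real
    using that by (simp add: abs_mult mult_le_one)
  have "norm (plane_rot' x b t z) \<le> \<bar>- sin t * (z \<bullet> x) - cos t * (z \<bullet> b)\<bar> + \<bar>cos t * (z \<bullet> x) - sin t * (z \<bullet> b)\<bar>"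
    unfolding plane_rot'_def using assms by (intro order_trans[OF norm_triangle_ineq]) simp
  also have "\<dots> \<le> 4"
  proof -
    have "\<bar>- a - c\<bar> + \<bar>d - e\<bar> \<le> 4" if "\<bar>a\<bar> \<le> 1" "\<bar>c\<bar> \<le> 1" "\<bar>d\<bar> \<le> 1" "\<bar>e\<bar> \<le> 1" for a c d e :: real
      using that by linarith
    from this[OF p[OF abs_sin_le_one[of t] zx(1)] p[OF abs_cos_le_one[of t] zx(2)]
      p[OF abs_cos_le_one[of t] zx(1)] p[OF abs_sin_le_one[of t] zx(2)]]
    show ?thesis by simp
  qed
  finally show ?thesis .
qed

lemma bounded_derivative_frames:
  fixes \<eta>' :: "'a::euclidean_space \<times> 'a \<Rightarrow> 'a \<times> 'a \<Rightarrow> real"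
  assumes "continuous_on UNIV (\<lambda>z. \<eta>' (fst z) (snd z))"
  obtains C where "\<And>p h. p \<in> frames \<Longrightarrow> norm h \<le> r \<Longrightarrow> \<bar>\<eta>' p h\<bar> \<le> C"
proof -
  have "compact ((\<lambda>z. \<eta>' (fst z) (snd z)) ` (frames \<times> cball 0 r))"
    by (intro compact_continuous_image continuous_on_subset[OF assms] compact_Times compact_frames compact_cball) auto
  then obtain C where C: "\<forall>v \<in> (\<lambda>z. \<eta>' (fst z) (snd z)) ` (frames \<times> cball 0 r). norm v \<le> C"
    by (auto dest!: compact_imp_bounded simp: bounded_iff)
  show ?thesis
  proof (rule that)
    fix p h :: "'a \<times> 'a" assume "p \<in> frames" "norm h \<le> r"
    then have "(p, h) \<in> frames \<times> cball 0 r" by simp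
    then show "\<bar>\<eta>' p h\<bar> \<le> C" using C by force
  qed
qed

lemma integral_distr_tangV_orthogonal:
  fixes f :: "'a::euclidean_space \<Rightarrow> 'a" and g :: "'a \<Rightarrow> 'b::euclidean_space"
  assumes f: "orthogonal_transformation f" and [measurable]: "g \<in> borel_measurable borel"
  shows "(\<integral>w. g w \<partial>tangV (f x)) = (\<integral>w. g (f w) \<partial>tangV x)"
proof -
  have [measurable]: "f \<in> borel_measurable borel" by (rule orthogonal_transformation_measurable[OF f])
  show ?thesis unfolding tangV_orthogonal[OF f] by (rule integral_distr) measurable
qed

context
  fixes \<eta> :: "'a::euclidean_space \<times> 'a \<Rightarrow> real" and \<eta>' :: "'a \<times> 'a \<Rightarrow> 'a \<times> 'a \<Rightarrow> real"
  assumes D: "\<And>z. (\<eta> has_derivative \<eta>' z) (at z)"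
    and \<eta>': "continuous_on UNIV (\<lambda>z. \<eta>' (fst z) (snd z))"
begin

lemma continuous_eta: "continuous_on UNIV \<eta>"
  using D by (intro continuous_at_imp_continuous_on ballI) (auto intro: has_derivative_continuous)

lemma linear_eta': "linear (\<eta>' z)"
  using D[of z] has_derivative_linear by blast

lemma mean_field_curve_derivative:
  assumes x: "norm x = 1" and b: "norm b = 1" and xb: "x \<bullet> b = 0"
  shows "((\<lambda>t. mean_field \<eta> (cos t *\<^sub>R x + sin t *\<^sub>R b)) has_vector_derivative
      (\<integral>w. \<eta>' (x, w) (b, - (w \<bullet> b) *\<^sub>R x) *\<^sub>R w + \<eta> (x, w) *\<^sub>R (- (w \<bullet> b) *\<^sub>R x) \<partial>tangV x)) (at 0)"
proof -
  let ?R = "plane_rot x b" and ?R' = "plane_rot' x b"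
  define f where "f t w = \<eta> (?R t x, ?R t w) *\<^sub>R ?R t w" for t w
  define f' where "f' t w = \<eta>' (?R t x, ?R t w) (?R' t x, ?R' t w) *\<^sub>R ?R t w + \<eta> (?R t x, ?R t w) *\<^sub>R ?R' t w" for t w
  have cR: "continuous_on UNIV (?R t)" "continuous_on UNIV (?R' t)" for t
    unfolding plane_rot_def plane_rot'_def by (intro continuous_intros)+
  have eq: "mean_field \<eta> (cos t *\<^sub>R x + sin t *\<^sub>R b) = (\<integral>w. f t w \<partial>tangV x)" for t
    unfolding plane_rot_self[OF x xb, symmetric] mean_field_def f_def
    by (rule integral_distr_tangV_orthogonal[OF orthogonal_plane_rot[OF assms]])
      (intro borel_measurable_continuous_onI continuous_intros continuous_on_compose2[OF continuous_eta] subset_UNIV)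
  \<comment> \<open>The velocity of the moved pair has norm at most 8, as each of its components has
    norm at most 4 by \<open>norm_plane_rot'\<close>.\<close>
  obtain C where C: "\<And>p h. p \<in> frames \<Longrightarrow> norm h \<le> 8 \<Longrightarrow> \<bar>\<eta>' p h\<bar> \<le> C"
    using bounded_derivative_frames[OF \<eta>'] by blast
  have "compact (\<eta> ` frames)" by (intro compact_continuous_image compact_frames continuous_on_subset[OF continuous_eta]) auto
  then obtain E where E: "\<And>p. p \<in> frames \<Longrightarrow> \<bar>\<eta> p\<bar> \<le> E"
    by (metis bounded_iff compact_imp_bounded imageI real_norm_def)
  have "((\<lambda>t. \<integral>w. f t w \<partial>tangV x) has_vector_derivative (\<integral>w. f' 0 w \<partial>tangV x)) (at 0)"
  proof (rule has_vector_derivative_integral[where S="{w. (x, w) \<in> frames}" and C="C + E * 4"])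
    show "finite_measure (tangV x)" by (rule finite_measure_tangV[OF x])
    show "AE w in tangV x. w \<in> {w. (x, w) \<in> frames}" using AE_tangV_frames[OF x] by simp
    show "integrable (tangV x) (f t)" for t
      unfolding f_def by (intro integrable_tangV_continuous[OF x] continuous_intros continuous_on_compose2[OF continuous_eta] cR subset_UNIV)
    have "continuous_on UNIV (\<lambda>w. \<eta>' (fst ((?R 0 x, ?R 0 w), (?R' 0 x, ?R' 0 w))) (snd ((?R 0 x, ?R 0 w), (?R' 0 x, ?R' 0 w))))"
      by (rule continuous_on_compose2[OF \<eta>']) (auto intro!: continuous_intros cR)
    then have "continuous_on UNIV (f' 0)"
      unfolding f'_def by (intro continuous_intros continuous_on_compose2[OF continuous_eta] cR subset_UNIV) simp
    then show "f' 0 \<in> borel_measurable (tangV x)"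
      by (rule borel_measurable_tangV)
    fix t w assume "w \<in> {w. (x, w) \<in> frames}"
    then have fr: "(x, w) \<in> frames" by simp
    then have w: "norm w = 1" by (auto simp: frames_def)
    have rf: "(?R t x, ?R t w) \<in> frames" by (rule plane_rot_frames[OF assms fr])
    have rw: "norm (?R t w) = 1" using orthogonal_plane_rot[OF assms] w by (simp add: orthogonal_transformation_norm)
    have pr: "((\<lambda>t. (?R t x, ?R t w)) has_vector_derivative (?R' t x, ?R' t w)) (at t)"
      by (intro has_vector_derivative_Pair plane_rot_derivative)
    have "((\<lambda>t. \<eta> (?R t x, ?R t w)) has_vector_derivative \<eta>' (?R t x, ?R t w) (?R' t x, ?R' t w)) (at t)"
      using vector_derivative_diff_chain_within[OF pr has_derivative_at_withinI[OF D]]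
      by (simp add: o_def)
    then have "((\<lambda>t. f t w) has_vector_derivative (\<eta> (?R t x, ?R t w) *\<^sub>R ?R' t w + \<eta>' (?R t x, ?R t w) (?R' t x, ?R' t w) *\<^sub>R ?R t w)) (at t)"
      unfolding f_def
      by (intro has_vector_derivative_scaleR plane_rot_derivative) (simp add: has_real_derivative_iff_has_vector_derivative)
    then show "((\<lambda>t. f t w) has_vector_derivative f' t w) (at t)"
      by (simp add: f'_def add.commute)
    have "norm (?R' t x, ?R' t w) \<le> norm (?R' t x) + norm (?R' t w)"
      by (simp add: norm_Pair sqrt_sum_squares_le_sum)
    also have "\<dots> \<le> 8" using norm_plane_rot'[OF x b, of x t] norm_plane_rot'[OF x b, of w t] x w by simp
    finally have "\<bar>\<eta>' (?R t x, ?R t w) (?R' t x, ?R' t w)\<bar> \<le> C" by (rule C[OF rf])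
    moreover have "\<bar>\<eta> (?R t x, ?R t w)\<bar> * norm (?R' t w) \<le> E * 4"
      using E[OF rf] norm_plane_rot'[OF x b, of w t] w by (intro mult_mono) auto
    moreover have "norm (f' t w) \<le> \<bar>\<eta>' (?R t x, ?R t w) (?R' t x, ?R' t w)\<bar> + \<bar>\<eta> (?R t x, ?R t w)\<bar> * norm (?R' t w)"
      unfolding f'_def using rw by (intro order_trans[OF norm_triangle_ineq]) simp
    ultimately show "norm (f' t w) \<le> C + E * 4" by linarith
  qed
  also have "(\<integral>w. f' 0 w \<partial>tangV x) = (\<integral>w. \<eta>' (x, w) (b, - (w \<bullet> b) *\<^sub>R x) *\<^sub>R w + \<eta> (x, w) *\<^sub>R (- (w \<bullet> b) *\<^sub>R x) \<partial>tangV x)"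
  proof (rule integral_cong_AE)
    have "continuous_on UNIV (\<lambda>w. \<eta>' (fst ((?R 0 x, ?R 0 w), (?R' 0 x, ?R' 0 w))) (snd ((?R 0 x, ?R 0 w), (?R' 0 x, ?R' 0 w))))"
      by (rule continuous_on_compose2[OF \<eta>']) (auto intro!: continuous_intros cR)
    then have "continuous_on UNIV (f' 0)"
      unfolding f'_def by (intro continuous_intros continuous_on_compose2[OF continuous_eta] cR subset_UNIV) simp
    then show "f' 0 \<in> borel_measurable (tangV x)"
      by (rule borel_measurable_tangV)
    have "continuous_on UNIV (\<lambda>w. \<eta>' (fst ((x, w), (b, - (w \<bullet> b) *\<^sub>R x))) (snd ((x, w), (b, - (w \<bullet> b) *\<^sub>R x))))"
      by (rule continuous_on_compose2[OF \<eta>']) (auto intro!: continuous_intros)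
    then have "continuous_on UNIV (\<lambda>w. \<eta>' (x, w) (b, - (w \<bullet> b) *\<^sub>R x) *\<^sub>R w + \<eta> (x, w) *\<^sub>R (- (w \<bullet> b) *\<^sub>R x))"
      by (intro continuous_intros continuous_on_compose2[OF continuous_eta] subset_UNIV) simp
    then show "(\<lambda>w. \<eta>' (x, w) (b, - (w \<bullet> b) *\<^sub>R x) *\<^sub>R w + \<eta> (x, w) *\<^sub>R (- (w \<bullet> b) *\<^sub>R x)) \<in> borel_measurable (tangV x)"
      by (rule borel_measurable_tangV)
    show "AE w in tangV x. f' 0 w = \<eta>' (x, w) (b, - (w \<bullet> b) *\<^sub>R x) *\<^sub>R w + \<eta> (x, w) *\<^sub>R (- (w \<bullet> b) *\<^sub>R x)"
      using AE_tangV_frames[OF x]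
    proof eventually_elim
      fix w assume "(x, w) \<in> frames"
      then have "w \<bullet> x = 0" by (simp add: frames_def inner_commute)
      \<comment> \<open>The derivative of the rotation at time 0 sends x to b and b to -x; as w is
        orthogonal to x, only its b-component moves.\<close>
      then have "?R' 0 x = b" "?R' 0 w = - (w \<bullet> b) *\<^sub>R x"
        using x xb by (simp_all add: plane_rot'_def norm_eq_1)
      moreover have "?R 0 z = z" for z by (simp add: plane_rot_def)
      ultimately show "f' 0 w = \<eta>' (x, w) (b, - (w \<bullet> b) *\<^sub>R x) *\<^sub>R w + \<eta> (x, w) *\<^sub>R (- (w \<bullet> b) *\<^sub>R x)"
        by (simp only: f'_def)
    qed
  qed
  finally show ?thesis unfolding eq .
qed

text \<open>The vector \<open>(w, -x)\<close> generates the geodesic flow at \<open>(x, w)\<close>.\<close>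

lemma divergence_mean_field:
  assumes x: "norm x = 1"
  shows "divergence (mean_field \<eta>) x = (\<integral>w. \<eta>' (x, w) (w, - x) \<partial>tangV x)"
proof -
  define B where "B = orthonormal_basis_of (tangent_space x)"
  have B: "orthonormal B" "span B = tangent_space x" "B \<subseteq> tangent_space x"
    using orthonormal_basis_of[OF subspace_tangent_space, of x] by (auto simp: B_def)
  define h where "h b w = \<eta>' (x, w) (b, - (w \<bullet> b) *\<^sub>R x)" for b w
  have ch: "continuous_on UNIV (h b)" for b
  proof -
    have "continuous_on UNIV (\<lambda>w. \<eta>' (fst ((x, w), (b, - (w \<bullet> b) *\<^sub>R x))) (snd ((x, w), (b, - (w \<bullet> b) *\<^sub>R x))))"
      by (rule continuous_on_compose2[OF \<eta>']) (auto intro!: continuous_intros)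
    then show ?thesis by (simp add: h_def[abs_def])
  qed
  have cov: "cov_deriv (mean_field \<eta>) x b \<bullet> b = (\<integral>w. h b w * (w \<bullet> b) \<partial>tangV x)" if "b \<in> B" for b
  proof -
    have b: "norm b = 1" "x \<bullet> b = 0" "b \<bullet> x = 0" using that B by (auto simp: orthonormal_def tangent_space_def inner_commute)
    define V where "V = (\<integral>w. h b w *\<^sub>R w + \<eta> (x, w) *\<^sub>R (- (w \<bullet> b) *\<^sub>R x) \<partial>tangV x)"
    have "vector_derivative (\<lambda>t. mean_field \<eta> (sphere_exp x (t *\<^sub>R b))) (at 0) = V"
      unfolding sphere_exp_unit[OF b(1)] V_def h_def
      by (rule vector_derivative_at[OF mean_field_curve_derivative[OF x b(1,2)]])
    \<comment> \<open>Both the projection in \<open>cov_deriv\<close> and the second summand of V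
      are multiples of x and vanish against b.\<close>
    then have "cov_deriv (mean_field \<eta>) x b \<bullet> b = V \<bullet> b"
      using b by (simp add: cov_deriv_def inner_diff_left)
    also have "\<dots> = (\<integral>w. (h b w *\<^sub>R w + \<eta> (x, w) *\<^sub>R (- (w \<bullet> b) *\<^sub>R x)) \<bullet> b \<partial>tangV x)"
      unfolding V_def
      by (rule integral_inner_left[symmetric])
        (intro impI integrable_tangV_continuous[OF x] continuous_intros ch continuous_on_compose2[OF continuous_eta] subset_UNIV)
    also have "\<dots> = (\<integral>w. h b w * (w \<bullet> b) \<partial>tangV x)"
      using b by (simp add: inner_add_left inner_diff_left)
    finally show ?thesis .
  qed
  have "divergence (mean_field \<eta>) x = (\<Sum>b\<in>B. \<integral>w. h b w * (w \<bullet> b) \<partial>tangV x)"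
    by (simp add: divergence_def B_def[symmetric] cov)
  also have "\<dots> = (\<integral>w. (\<Sum>b\<in>B. h b w * (w \<bullet> b)) \<partial>tangV x)"
    by (rule Bochner_Integration.integral_sum[symmetric])
      (intro integrable_tangV_continuous[OF x] continuous_intros ch)
  also have "\<dots> = (\<integral>w. \<eta>' (x, w) (w, - x) \<partial>tangV x)"
  proof (rule integral_cong_AE)
    have "continuous_on UNIV (\<lambda>w. \<Sum>b\<in>B. h b w * (w \<bullet> b))" by (intro continuous_intros ch)
    then show "(\<lambda>w. \<Sum>b\<in>B. h b w * (w \<bullet> b)) \<in> borel_measurable (tangV x)"
      by (rule borel_measurable_tangV)
    have "continuous_on UNIV (\<lambda>w. \<eta>' (fst ((x, w), (w, - x))) (snd ((x, w), (w, - x))))"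
      by (rule continuous_on_compose2[OF \<eta>']) (auto intro!: continuous_intros)
    then have "continuous_on UNIV (\<lambda>w. \<eta>' (x, w) (w, - x))" by simp
    then show "(\<lambda>w. \<eta>' (x, w) (w, - x)) \<in> borel_measurable (tangV x)"
      by (rule borel_measurable_tangV)
    show "AE w in tangV x. (\<Sum>b\<in>B. h b w * (w \<bullet> b)) = \<eta>' (x, w) (w, - x)"
      using AE_tangV[OF x]
    proof eventually_elim
      fix w assume w: "norm w = 1 \<and> x \<bullet> w = 0"
      then have wB: "w \<in> span B" by (simp add: B tangent_space_def)
      have ex: "(\<Sum>b\<in>B. (w \<bullet> b) *\<^sub>R b) = w"
        using orthonormal_basis_expand[of B w] B wB by (simp add: orthonormal_def)
      have "(\<Sum>b\<in>B. (w \<bullet> b) * (w \<bullet> b)) = w \<bullet> (\<Sum>b\<in>B. (w \<bullet> b) *\<^sub>R b)" by (simp add: inner_sum_right)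
      then have sq: "(\<Sum>b\<in>B. (w \<bullet> b) * (w \<bullet> b)) = 1" using w by (simp add: ex norm_eq_1)
      \<comment> \<open>By linearity the coefficients w \<bullet> b move into the direction; the
        directions then add up to the generator because w is a unit vector in the span of B.\<close>
      have "(\<Sum>b\<in>B. h b w * (w \<bullet> b)) = (\<Sum>b\<in>B. \<eta>' (x, w) ((w \<bullet> b) *\<^sub>R (b, - (w \<bullet> b) *\<^sub>R x)))"
        unfolding h_def linear_scale[OF linear_eta'] by (simp add: mult.commute)
      also have "\<dots> = \<eta>' (x, w) (\<Sum>b\<in>B. (w \<bullet> b) *\<^sub>R (b, - (w \<bullet> b) *\<^sub>R x))"
        by (rule linear_sum[OF linear_eta', symmetric])
      also have "(\<Sum>b\<in>B. (w \<bullet> b) *\<^sub>R (b, - (w \<bullet> b) *\<^sub>R x)) = (w, - x)"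
      proof -
        have "(\<Sum>b\<in>B. (w \<bullet> b) *\<^sub>R (b, - (w \<bullet> b) *\<^sub>R x)) = ((\<Sum>b\<in>B. (w \<bullet> b) *\<^sub>R b), (\<Sum>b\<in>B. (w \<bullet> b) *\<^sub>R - (w \<bullet> b) *\<^sub>R x))"
          by (simp add: sum_prod)
        also have "(\<Sum>b\<in>B. (w \<bullet> b) *\<^sub>R - (w \<bullet> b) *\<^sub>R x) = - ((\<Sum>b\<in>B. (w \<bullet> b) * (w \<bullet> b)) *\<^sub>R x)"
          by (simp add: scaleR_sum_left sum_negf)
        finally show ?thesis by (simp add: ex sq)
      qed
      finally show "(\<Sum>b\<in>B. h b w * (w \<bullet> b)) = \<eta>' (x, w) (w, - x)" .
    qed
  qed
  finally show ?thesis .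
qed

end

lemma smooth_vector_field_mean_field:
  fixes \<eta> :: "'a::euclidean_space \<times> 'a \<Rightarrow> real"
  assumes "DIM('a) \<ge> 2" and "real_polynomial_function \<eta>"
  shows "smooth_vector_field (mean_field \<eta>)"
proof -
  obtain Q where "polynomial_function Q" "\<And>x. norm x = 1 \<Longrightarrow> mean_field \<eta> x = Q x"
    using mean_field_polynomial[OF assms] by blast
  then have "smooth_on unit_sphere (mean_field \<eta>)"
    by (intro smooth_on_polynomial_function[of Q]) auto
  then show ?thesis
    using mean_field_tangent[OF continuous_on_real_polynomial[OF assms(2)]] by (auto simp: smooth_vector_field_def)
qed

subsection \<open>The divergence of a smooth vector field\<close>

lemma sphere_exp_mem: "norm x = 1 \<Longrightarrow> norm b = 1 \<Longrightarrow> x \<bullet> b = 0 \<Longrightarrow> norm (sphere_exp x (t *\<^sub>R b)) = 1"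
proof -
  assume *: "norm x = 1" "norm b = 1" "x \<bullet> b = 0"
  then have "(x, b) \<in> frames" by (simp add: frames_def)
  then have "geo_flow t (x, b) \<in> frames" by (rule geo_flow_frames)
  then show ?thesis using * by (simp add: sphere_exp_unit geo_flow_def frames_def)
qed

lemma smooth_on_curve:
  fixes X :: "'a::euclidean_space \<Rightarrow> 'a"
  assumes "smooth_on unit_sphere X"
  obtains X' :: "'a \<Rightarrow> 'a \<Rightarrow> 'a" where "continuous_on unit_sphere X"
    "\<And>x. linear (X' x)" "\<And>v. continuous_on unit_sphere (\<lambda>x. X' x v)"
    "\<And>x b. norm x = 1 \<Longrightarrow> norm b = 1 \<Longrightarrow> x \<bullet> b = 0 \<Longrightarrow>
       ((\<lambda>t. X (sphere_exp x (t *\<^sub>R b))) has_vector_derivative X' x b) (at 0)"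
proof -
  obtain U g where U: "open U" "unit_sphere \<subseteq> U" "\<And>k. Ck_on_open k U g" and g: "\<And>x. x \<in> unit_sphere \<Longrightarrow> g x = X x"
    using assms unfolding smooth_on_def by blast
  have d: "g differentiable (at x)" if "x \<in> U" for x using U(3)[of 1] that by simp
  have c: "continuous_on U (\<lambda>x. frechet_derivative g (at x) v)" for v using U(3)[of 1] by simp
  \<comment> \<open>The ambient derivative of a smooth extension; the value 0 outside U keeps it
    linear at every point.\<close>
  define X' where "X' x v = (if x \<in> U then frechet_derivative g (at x) v else 0)" for x v
  have gd: "(g has_derivative X' x) (at x)" if "x \<in> U" for x
    using d[OF that] that by (simp add: X'_def[abs_def] frechet_derivative_works)
  show ?thesis
  proof (rule that[of X'])
    show "continuous_on unit_sphere X"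
      using U(2) U(3)[of 0] g by (metis Ck_on_open.simps(1) continuous_on_cong continuous_on_subset)
    show "linear (X' x)" for x
      using gd[of x] has_derivative_linear by (cases "x \<in> U") (auto simp: X'_def[abs_def] linear_zero)
    show "continuous_on unit_sphere (\<lambda>x. X' x v)" for v
      using U(2) by (intro continuous_on_eq[OF continuous_on_subset[OF c[of v] U(2)]]) (auto simp: X'_def)
    fix x b :: 'a assume xb: "norm x = 1" "norm b = 1" "x \<bullet> b = 0"
    have "((\<lambda>t. cos t *\<^sub>R x + sin t *\<^sub>R b) has_vector_derivative b) (at 0)"
      by (auto intro!: derivative_eq_intros)
    then have a: "((\<lambda>t. sphere_exp x (t *\<^sub>R b)) has_vector_derivative b) (at 0)"
      by (simp add: sphere_exp_unit[OF xb(2)])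
    have c: "(g has_derivative X' x) (at (sphere_exp x (0 *\<^sub>R b)) within range (\<lambda>t. sphere_exp x (t *\<^sub>R b)))"
    proof -
      have "sphere_exp x (0 *\<^sub>R b) = x" by (simp add: sphere_exp_def)
      moreover have "(g has_derivative X' x) (at x)" using U(2) xb(1) by (intro gd) auto
      ultimately show ?thesis by (simp only: has_derivative_at_withinI)
    qed
    have "((g \<circ> (\<lambda>t. sphere_exp x (t *\<^sub>R b))) has_vector_derivative X' x b) (at 0)"
      by (rule vector_derivative_diff_chain_within[OF a c])
    then show "((\<lambda>t. X (sphere_exp x (t *\<^sub>R b))) has_vector_derivative X' x b) (at 0)"
      using g sphere_exp_mem[OF xb] by (simp add: o_def)
  qed
qed

lemma divergence_eq_curve:
  assumes x: "norm x = 1" and X': "\<And>b. norm b = 1 \<Longrightarrow> x \<bullet> b = 0 \<Longrightarrow>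
       ((\<lambda>t. X (sphere_exp x (t *\<^sub>R b))) has_vector_derivative X' b) (at 0)"
  shows "divergence X x = (\<Sum>b\<in>orthonormal_basis_of (tangent_space x). X' b \<bullet> b)"
  unfolding divergence_def
proof (rule sum.cong)
  fix b assume "b \<in> orthonormal_basis_of (tangent_space x)"
  then have b: "norm b = 1" "x \<bullet> b = 0" 
    using orthonormal_basis_of[OF subspace_tangent_space, of x] by (auto simp: orthonormal_def tangent_space_def)
  then have "vector_derivative (\<lambda>t. X (sphere_exp x (t *\<^sub>R b))) (at 0) = X' b"
    using X' vector_derivative_at by blast
  then show "cov_deriv X x b \<bullet> b = X' b \<bullet> b" using b by (simp add: cov_deriv_def Let_def inner_diff_left)
qed simp

text \<open>For continuity the chosen tangent basis is an obstacle, as it may jump with x. The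
  tangential trace is therefore rewritten as the ambient trace minus the entry in direction x, both
  in the fixed \<open>Basis\<close>.\<close>

lemma divergence_smooth:
  fixes X Y :: "'a::euclidean_space \<Rightarrow> 'a"
  assumes X: "smooth_on unit_sphere X" and Y: "smooth_on unit_sphere Y"
  shows "norm x = 1 \<Longrightarrow> divergence (\<lambda>x. a *\<^sub>R X x + c *\<^sub>R Y x) x = a * divergence X x + c * divergence Y x"
    "continuous_on unit_sphere (divergence X)"
proof -
  obtain X' where X': "\<And>x. linear (X' x)" "\<And>v. continuous_on unit_sphere (\<lambda>x. X' x v)"
    "\<And>x b. norm x = 1 \<Longrightarrow> norm b = 1 \<Longrightarrow> x \<bullet> b = 0 \<Longrightarrow>
       ((\<lambda>t. X (sphere_exp x (t *\<^sub>R b))) has_vector_derivative X' x b) (at 0)"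
    using smooth_on_curve[OF X] by metis
  obtain Y' where Y': "\<And>x b. norm x = 1 \<Longrightarrow> norm b = 1 \<Longrightarrow> x \<bullet> b = 0 \<Longrightarrow>
       ((\<lambda>t. Y (sphere_exp x (t *\<^sub>R b))) has_vector_derivative Y' x b) (at 0)"
    using smooth_on_curve[OF Y] by metis
  show "divergence (\<lambda>x. a *\<^sub>R X x + c *\<^sub>R Y x) x = a * divergence X x + c * divergence Y x" if x: "norm x = 1"
  proof -
    have "divergence (\<lambda>x. a *\<^sub>R X x + c *\<^sub>R Y x) x =
       (\<Sum>b\<in>orthonormal_basis_of (tangent_space x). (a *\<^sub>R X' x b + c *\<^sub>R Y' x b) \<bullet> b)"
      by (intro divergence_eq_curve x has_vector_derivative_add
        bounded_linear.has_vector_derivative[OF bounded_linear_scaleR_right] X'(3) Y')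
    also have "\<dots> = a * divergence X x + c * divergence Y x"
      by (simp add: divergence_eq_curve[OF x X'(3)[OF x]] divergence_eq_curve[OF x Y'[OF x]]
        inner_add_left sum.distrib sum_distrib_left)
    finally show ?thesis .
  qed
  have div: "divergence X x = (\<Sum>e\<in>Basis. X' x e \<bullet> e) - (\<Sum>e\<in>Basis. (x \<bullet> e) * (X' x e \<bullet> x))" if x: "norm x = 1" for x
  proof -
    let ?B = "orthonormal_basis_of (tangent_space x)"
    note B = orthonormal_basis_of[OF subspace_tangent_space, of x]
    note xB = orthonormal_insert_tangent[OF x B(1,2)]
    \<comment> \<open>Independence of the trace from the orthonormal basis: expand b in
      \<open>Basis\<close> and exchange the sums.\<close>
    have tr: "(\<Sum>b\<in>insert x ?B. X' x b \<bullet> b) = (\<Sum>e\<in>Basis. X' x e \<bullet> e)"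
    proof -
      have ex: "(\<Sum>b\<in>insert x ?B. (v \<bullet> b) *\<^sub>R b) = v" for v
        by (rule orthonormal_basis_expand) (use xB in \<open>auto simp: orthonormal_def\<close>)
      have "(\<Sum>b\<in>insert x ?B. X' x b \<bullet> b) = (\<Sum>b\<in>insert x ?B. X' x (\<Sum>e\<in>Basis. (b \<bullet> e) *\<^sub>R e) \<bullet> b)"
        by (simp add: euclidean_representation)
      also have "\<dots> = (\<Sum>b\<in>insert x ?B. \<Sum>e\<in>Basis. (b \<bullet> e) * (X' x e \<bullet> b))"
        by (simp only: linear_sum[OF X'(1)] linear_scale[OF X'(1)] inner_sum_left inner_scaleR_left)
      also have "\<dots> = (\<Sum>e\<in>Basis. \<Sum>b\<in>insert x ?B. (b \<bullet> e) * (X' x e \<bullet> b))" by (rule sum.swap)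
      also have "\<dots> = (\<Sum>e\<in>Basis. X' x e \<bullet> (\<Sum>b\<in>insert x ?B. (e \<bullet> b) *\<^sub>R b))"
        by (simp only: inner_sum_right inner_scaleR_right inner_commute[of _ e for e])
      finally show ?thesis unfolding ex .
    qed
    have "X' x x = (\<Sum>e\<in>Basis. (x \<bullet> e) *\<^sub>R X' x e)"
      using linear_sum[OF X'(1), of x "\<lambda>e. (x \<bullet> e) *\<^sub>R e" Basis]
      by (simp add: linear_scale[OF X'(1)] euclidean_representation)
    then have "X' x x \<bullet> x = (\<Sum>e\<in>Basis. (x \<bullet> e) * (X' x e \<bullet> x))" by (simp add: inner_sum_left)
    moreover have "(\<Sum>b\<in>insert x ?B. X' x b \<bullet> b) = X' x x \<bullet> x + (\<Sum>b\<in>?B. X' x b \<bullet> b)"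
      using xB B(1) by (simp add: orthonormal_def)
    ultimately show ?thesis using tr divergence_eq_curve[OF x X'(3)[OF x]] by simp
  qed
  have "continuous_on unit_sphere (\<lambda>x. (\<Sum>e\<in>Basis. X' x e \<bullet> e) - (\<Sum>e\<in>Basis. (x \<bullet> e) * (X' x e \<bullet> x)))"
    by (intro continuous_intros X'(2))
  then show "continuous_on unit_sphere (divergence X)"
    by (rule continuous_on_eq) (simp add: div)
qed

lemma smooth_on_imp_continuous_on:
  assumes "smooth_on S f"
  shows "continuous_on S f"
proof -
  obtain U g where Ug: "S \<subseteq> U" "\<And>k. Ck_on_open k U g" "\<And>x. x \<in> S \<Longrightarrow> g x = f x"
    using assms unfolding smooth_on_def by blast
  have "continuous_on S g" using Ug(2)[of 0] Ug(1) by (auto intro: continuous_on_subset)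
  then show ?thesis using Ug(3) by (simp cong: continuous_on_cong)
qed

lemma Ck_on_open_lincomb:
  fixes f g :: "'a::euclidean_space \<Rightarrow> 'b::euclidean_space"
  assumes U: "open U"
  shows "Ck_on_open k U f \<Longrightarrow> Ck_on_open k U g \<Longrightarrow> Ck_on_open k U (\<lambda>x. a *\<^sub>R f x + c *\<^sub>R g x)"
proof (induction k arbitrary: f g)
  case 0
  then show ?case by (auto intro!: continuous_intros)
next
  case (Suc k)
  have f: "f differentiable (at x)" and g: "g differentiable (at x)" if "x \<in> U" for x using Suc.prems that by auto
  have hd: "((\<lambda>x. a *\<^sub>R f x + c *\<^sub>R g x) has_derivative
      (\<lambda>v. a *\<^sub>R frechet_derivative f (at x) v + c *\<^sub>R frechet_derivative g (at x) v)) (at x)" if "x \<in> U" for x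
    using f[OF that] g[OF that] unfolding frechet_derivative_works
    by (intro has_derivative_add has_derivative_scaleR_right)
  have fd: "frechet_derivative (\<lambda>x. a *\<^sub>R f x + c *\<^sub>R g x) (at x) v =
     a *\<^sub>R frechet_derivative f (at x) v + c *\<^sub>R frechet_derivative g (at x) v" if "x \<in> U" for x v
    by (simp add: frechet_derivative_at[OF hd[OF that], symmetric])
  \<comment> \<open>The formula for the derivative of the combination holds only at points of U.
    Since U is open, derivatives of all orders there depend only on the values in U.\<close>
  have cong: "Ck_on_open k U p = Ck_on_open k U q" if "\<And>x. x \<in> U \<Longrightarrow> p x = q x" for p q :: "'a \<Rightarrow> 'b" and k
    using that
  proof (induction k arbitrary: p q)
    case 0
    then show ?case by (simp cong: continuous_on_cong)
  next
    case (Suc k)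
    have "(p has_derivative D) (at x) \<longleftrightarrow> (q has_derivative D) (at x)" if "x \<in> U" for x D
    proof
      assume "(p has_derivative D) (at x)"
      then show "(q has_derivative D) (at x)"
        by (rule has_derivative_transform_within_open[OF _ U that]) (rule Suc.prems)
    next
      assume "(q has_derivative D) (at x)"
      then show "(p has_derivative D) (at x)"
        by (rule has_derivative_transform_within_open[OF _ U that]) (rule Suc.prems[symmetric])
    qed
    then have "p differentiable (at x) \<longleftrightarrow> q differentiable (at x)" "frechet_derivative p (at x) = frechet_derivative q (at x)"
      if "x \<in> U" for x using that by (simp_all add: differentiable_def frechet_derivative_def)
    moreover have "Ck_on_open k U (\<lambda>x. frechet_derivative p (at x) v) = Ck_on_open k U (\<lambda>x. frechet_derivative q (at x) v)" for v
      by (rule Suc.IH) (use calculation(2) in auto)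
    ultimately show ?case by simp
  qed
  have "Ck_on_open k U (\<lambda>x. a *\<^sub>R frechet_derivative f (at x) v + c *\<^sub>R frechet_derivative g (at x) v)" for v
    using Suc by simp
  then have "Ck_on_open k U (\<lambda>x. frechet_derivative (\<lambda>x. a *\<^sub>R f x + c *\<^sub>R g x) (at x) v)" for v
    by (subst cong[OF fd]) auto
  then show ?case using hd by (auto simp: differentiable_def)
qed

lemma Ck_on_open_subset: "Ck_on_open k U f \<Longrightarrow> W \<subseteq> U \<Longrightarrow> Ck_on_open k W f"
  by (induction k arbitrary: f) (auto intro: continuous_on_subset)

lemma smooth_vector_field_lincomb:
  assumes "smooth_vector_field X" "smooth_vector_field Y"
  shows "smooth_vector_field (\<lambda>x. a *\<^sub>R X x + c *\<^sub>R Y x)"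
proof -
  obtain U g where U: "open U" "unit_sphere \<subseteq> U" "\<And>k. Ck_on_open k U g" "\<And>x. x \<in> unit_sphere \<Longrightarrow> g x = X x"
    using assms(1) unfolding smooth_vector_field_def smooth_on_def by blast
  obtain W h where W: "open W" "unit_sphere \<subseteq> W" "\<And>k. Ck_on_open k W h" "\<And>x. x \<in> unit_sphere \<Longrightarrow> h x = Y x"
    using assms(2) unfolding smooth_vector_field_def smooth_on_def by blast
  have "smooth_on unit_sphere (\<lambda>x. a *\<^sub>R X x + c *\<^sub>R Y x)"
    unfolding smooth_on_def
    using U(1,2,4) W(1,2,4)
    by (intro exI[of _ "U \<inter> W"] exI[of _ "\<lambda>x. a *\<^sub>R g x + c *\<^sub>R h x"] conjI allI Ck_on_open_lincomb
        Ck_on_open_subset[OF U(3) Int_lower1] Ck_on_open_subset[OF W(3) Int_lower2]) auto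
  then show ?thesis
    using assms by (auto simp: smooth_vector_field_def tangent_space_def inner_add_right)
qed

subsection \<open>Duality with polynomials\<close>

text \<open>The ideal test function is the sign of h. Inner regularity gives compact sets inside the
  regions of positive and negative h, a Urysohn function takes the values 1 and -1 on them, and
  Stone-Weierstrass replaces it by a polynomial on K.\<close>

lemma L1_norm_le_polynomial_duality:
  fixes M :: "'b::euclidean_space measure" and h :: "'b \<Rightarrow> real"
  assumes M: "finite_measure M" "sets M = sets borel" and K: "compact K" "AE x in M. x \<in> K"
    and h [measurable]: "h \<in> borel_measurable borel" and H: "\<And>x. \<bar>h x\<bar> \<le> H"
    and dual: "\<And>\<eta>. real_polynomial_function \<eta> \<Longrightarrow> (\<And>x. x \<in> K \<Longrightarrow> \<bar>\<eta> x\<bar> \<le> 1) \<Longrightarrow> (\<integral>x. h x * \<eta> x \<partial>M) \<le> C"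
  shows "(\<integral>x. \<bar>h x\<bar> \<partial>M) \<le> C"
proof (rule field_le_epsilon)
  interpret finite_measure M by fact
  note [measurable_cong] = M(2)
  have sp: "space M = UNIV" using sets_eq_imp_space_eq[OF M(2)] by simp
  fix \<epsilon> :: real assume \<epsilon>: "\<epsilon> > 0"
  have H0: "H \<ge> 0" using H[of undefined] by linarith
  define m where "m = measure M UNIV"
  \<comment> \<open>The accumulated error is at most 4 H d + 2 H m d, which this choice keeps below
    \<epsilon>.\<close>
  define d where "d = \<epsilon> / (4 * (H + 1) * (m + 1))"
  have m0: "m \<ge> 0" by (simp add: m_def)
  have d: "d > 0" using \<epsilon> H0 m0 by (simp add: d_def)
  have inner: "\<exists>L. compact L \<and> L \<subseteq> A \<and> measure M (A - L) \<le> d" if A: "A \<in> sets borel" for A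
  proof -
    have SUP: "emeasure M A = (SUP L\<in>{L. L \<subseteq> A \<and> compact L}. emeasure M L)"
      by (rule inner_regular) (use M A in \<open>auto simp: sp\<close>)
    have "\<exists>L. L \<subseteq> A \<and> compact L \<and> measure M A \<le> measure M L + d"
    proof (rule ccontr)
      assume "\<not> ?thesis"
      then have less: "measure M L \<le> measure M A - d" if "L \<subseteq> A" "compact L" for L using that by force
      have "measure M A - d \<ge> 0" using less[of "{}"] by simp
      have "emeasure M A \<le> ennreal (measure M A - d)"
        unfolding SUP using less by (intro SUP_least) (auto simp: emeasure_eq_measure intro!: ennreal_leI)
      then show False using d \<open>measure M A - d \<ge> 0\<close> by (simp add: emeasure_eq_measure)
    qed
    then obtain L where L: "L \<subseteq> A" "compact L" "measure M A \<le> measure M L + d" by blast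
    have Ls: "L \<in> sets M" using L(2) M(2) by (simp add: borel_compact)
    have "measure M (A - L) = measure M A - measure M L"
      using A L(1) Ls M(2) by (intro finite_measure_Diff) auto
    then show ?thesis using L by (intro exI[of _ L]) auto
  qed
  have P: "{x. h x > 0} \<in> sets borel" and N: "{x. h x < 0} \<in> sets borel" by measurable
  obtain L1 where L1: "compact L1" "L1 \<subseteq> {x. h x > 0}" "measure M ({x. h x > 0} - L1) \<le> d" using inner[OF P] by blast
  obtain L2 where L2: "compact L2" "L2 \<subseteq> {x. h x < 0}" "measure M ({x. h x < 0} - L2) \<le> d" using inner[OF N] by blast
  have [measurable]: "L1 \<in> sets borel" "L2 \<in> sets borel" using L1 L2 by (auto simp: borel_compact)
  have dis: "L1 \<inter> L2 = {}" using L1(2) L2(2) by force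
  obtain f :: "'b \<Rightarrow> real" where f: "continuous_on UNIV f" "\<And>x. f x \<in> closed_segment 1 (-1)"
    "\<And>x. x \<in> L1 \<Longrightarrow> f x = 1" "\<And>x. x \<in> L2 \<Longrightarrow> f x = -1"
    using Urysohn[OF compact_imp_closed[OF L1(1)] compact_imp_closed[OF L2(1)] dis, where a=1 and b="-1"] by metis
  have f1: "\<bar>f x\<bar> \<le> 1" for x using f(2)[of x] by (auto simp: closed_segment_eq_real_ivl)
  have [measurable]: "f \<in> borel_measurable borel" using f(1) by (rule borel_measurable_continuous_onI)
  obtain q where q: "real_polynomial_function q" "\<And>x. x \<in> K \<Longrightarrow> \<bar>f x - q x\<bar> < d"
    using Stone_Weierstrass_real_polynomial_function[OF K(1) continuous_on_subset[OF f(1)] d] by auto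
  \<comment> \<open>On K the approximating polynomial is bounded by 1 + d only; the rescaling
    restores the bound 1 at the cost of another d.\<close>
  define \<eta> where "\<eta> x = q x * (1 / (1 + d))" for x
  have pol: "real_polynomial_function \<eta>"
    unfolding \<eta>_def by (intro real_polynomial_mult q real_polynomial_const)
  have \<eta>1: "\<bar>\<eta> x\<bar> \<le> 1" if "x \<in> K" for x
  proof -
    have "\<bar>q x\<bar> \<le> 1 + d" using q(2)[OF that] f1[of x] by linarith
    then show ?thesis using d by (simp add: \<eta>_def abs_mult)
  qed
  have \<eta>f: "\<bar>\<eta> x - f x\<bar> \<le> 2 * d" if "x \<in> K" for x
  proof -
    have "(1 + d) * (\<eta> x - f x) = (q x - f x) - d * f x" using d by (simp add: \<eta>_def field_simps)
    moreover have "\<bar>d * f x\<bar> \<le> d" using f1[of x] d by (simp add: abs_mult)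
    ultimately have "\<bar>(1 + d) * (\<eta> x - f x)\<bar> \<le> 2 * d" using q(2)[OF that] by linarith
    then have "(1 + d) * \<bar>\<eta> x - f x\<bar> \<le> 2 * d" using d by (simp add: abs_mult)
    moreover have "1 * \<bar>\<eta> x - f x\<bar> \<le> (1 + d) * \<bar>\<eta> x - f x\<bar>" using d by (intro mult_right_mono) auto
    ultimately have "1 * \<bar>\<eta> x - f x\<bar> \<le> 2 * d" by (rule order_trans[rotated])
    then show ?thesis by simp
  qed
  have [measurable]: "\<eta> \<in> borel_measurable borel"
    by (rule borel_measurable_continuous_onI[OF continuous_on_real_polynomial[OF pol]])
  \<comment> \<open>The points of nonzero h missed by both compact sets; on them the sign may be
    wrong by as much as 2.\<close>
  define R where "R = ({x. h x > 0} - L1) \<union> ({x. h x < 0} - L2)"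
  have [measurable]: "R \<in> sets borel" unfolding R_def by measurable
  have "measure M R \<le> measure M ({x. h x > 0} - L1) + measure M ({x. h x < 0} - L2)"
    unfolding R_def by (intro measure_Un_le) (auto simp: M(2))
  then have R: "measure M R \<le> 2 * d" using L1(3) L2(3) by linarith
  have int: "integrable M (\<lambda>x. \<bar>h x\<bar>)" by (rule integrable_const_bound[where B=H]) (use H in auto)
  have int2: "integrable M (\<lambda>x. h x * \<eta> x)"
  proof (rule integrable_const_bound[where B=H])
    show "AE x in M. norm (h x * \<eta> x) \<le> H"
    proof (rule eventually_mono[OF K(2)])
      fix x assume "x \<in> K"
      then have "\<bar>h x\<bar> * \<bar>\<eta> x\<bar> \<le> H * 1" using H H0 \<eta>1 by (intro mult_mono) auto
      then show "norm (h x * \<eta> x) \<le> H" by (simp add: abs_mult)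
    qed
  qed measurable
  have int3: "integrable M (\<lambda>x. h x * \<eta> x + 2 * H * indicator R x + 2 * d * H)"
    by (intro Bochner_Integration.integrable_add int2) (auto simp: M(2) emeasure_eq_measure)
  have "(\<integral>x. \<bar>h x\<bar> \<partial>M) \<le> (\<integral>x. h x * \<eta> x + 2 * H * indicator R x + 2 * d * H \<partial>M)"
  proof (rule integral_mono_AE[OF int int3])
    show "AE x in M. \<bar>h x\<bar> \<le> h x * \<eta> x + 2 * H * indicator R x + 2 * d * H"
    proof (rule eventually_mono[OF K(2)])
      fix x assume x: "x \<in> K"
      have "\<bar>h x * (\<eta> x - f x)\<bar> \<le> H * (2 * d)"
        unfolding abs_mult using H[of x] \<eta>f[OF x] H0 by (intro mult_mono) auto
      then have 1: "h x * f x \<le> h x * \<eta> x + 2 * d * H" by (simp add: algebra_simps abs_le_iff)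
      have "\<bar>h x\<bar> \<le> h x * f x + 2 * H * indicator R x"
      proof (cases "x \<in> R")
        case True
        have "\<bar>h x * f x\<bar> \<le> H * 1" unfolding abs_mult using H[of x] f1[of x] H0 by (intro mult_mono) auto
        then show ?thesis using True H[of x] by simp
      next
        case False
        then consider "h x = 0" | "x \<in> L1" | "x \<in> L2" by (force simp: R_def)
        then show ?thesis
          using f(3,4)[of x] L1(2) L2(2) False by cases auto
      qed
      then show "\<bar>h x\<bar> \<le> h x * \<eta> x + 2 * H * indicator R x + 2 * d * H" using 1 by linarith
    qed
  qed
  also have "\<dots> = (\<integral>x. h x * \<eta> x \<partial>M) + 2 * H * measure M R + 2 * d * H * m"
    using int2 by (simp add: M(2) m_def sp emeasure_eq_measure)
  also have "\<dots> \<le> C + 2 * H * (2 * d) + 2 * d * H * m"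
  proof -
    have "2 * H * measure M R \<le> 2 * H * (2 * d)" using R H0 by (intro mult_left_mono) auto
    then show ?thesis using dual[OF pol \<eta>1] by linarith
  qed
  also have "\<dots> \<le> C + \<epsilon>"
  proof -
    have "2 * H * (2 * d) + 2 * d * H * m \<le> 4 * (H + 1) * (m + 1) * d"
      using d H0 m0 by (simp add: algebra_simps)
    also have "\<dots> = \<epsilon>" using H0 m0 by (simp add: d_def)
    finally show ?thesis by simp
  qed
  finally show "(\<integral>x. \<bar>h x\<bar> \<partial>M) \<le> C + \<epsilon>" .
qed

subsection \<open>Difference quotients along the geodesic flow\<close>

lemma geo_flow_bounded_linear: "bounded_linear (geo_flow t)"
proof -
  have "linear (geo_flow t :: 'a \<times> 'a \<Rightarrow> 'a \<times> 'a)"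
    by (rule linearI) (auto simp: geo_flow_def algebra_simps)
  then show ?thesis by (simp add: linear_conv_bounded_linear)
qed

lemma compact_abs_bound:
  fixes f :: "'b::topological_space \<Rightarrow> real"
  assumes "compact K" "continuous_on K f"
  obtains C where "\<And>x. x \<in> K \<Longrightarrow> \<bar>f x\<bar> \<le> C"
proof -
  have "bounded (f ` K)" using assms by (intro compact_imp_bounded compact_continuous_image)
  then show ?thesis using that unfolding bounded_iff by auto
qed

text \<open>The generator of the geodesic flow, a rotation by a right angle in the plane of the
  pair; it commutes with the flow.\<close>

definition quarter_turn :: "'a::euclidean_space \<times> 'a \<Rightarrow> 'a \<times> 'a" where
  "quarter_turn p = (snd p, - fst p)"

lemma geo_flow_quarter_turn: "geo_flow t (quarter_turn p) = quarter_turn (geo_flow t p)"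
  by (simp add: geo_flow_def quarter_turn_def)

lemma geo_flow_derivative:
  "((\<lambda>t. geo_flow (- t) p) has_vector_derivative - quarter_turn (geo_flow (- t) p)) (at t)"
proof -
  have "((\<lambda>t. (cos (- t) *\<^sub>R fst p + sin (- t) *\<^sub>R snd p, cos (- t) *\<^sub>R snd p - sin (- t) *\<^sub>R fst p)) has_vector_derivative
     (- (cos t *\<^sub>R snd p) - sin t *\<^sub>R fst p, cos t *\<^sub>R fst p - sin t *\<^sub>R snd p)) (at t)"
    by (intro has_vector_derivative_Pair) (auto intro!: derivative_eq_intros simp: algebra_simps)
  then show ?thesis by (simp add: geo_flow_def quarter_turn_def)
qed

lemma norm_quarter_turn: "p \<in> frames \<Longrightarrow> norm (quarter_turn p) \<le> 2"
  by (auto simp: frames_def quarter_turn_def norm_Pair intro!: real_le_lsqrt)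

definition div_pairing :: "'a::euclidean_space set \<Rightarrow> ('a \<Rightarrow> 'a) \<Rightarrow> real" where
  "div_pairing A X = (\<integral>x. indicator A x * divergence X x \<partial>sphV)"

definition flow_diff :: "'a::euclidean_space set \<Rightarrow> real \<Rightarrow> real" where
  "flow_diff A r = (\<integral>p. \<bar>indicator A (fst (geo_flow r p)) - indicator A (fst p)\<bar> \<partial>frameV)"

lemma smooth_vector_field_zero: "smooth_vector_field (\<lambda>x::'a::euclidean_space. 0)"
  unfolding smooth_vector_field_def
  by (auto intro!: smooth_on_polynomial_function[of "\<lambda>_. 0"] simp: tangent_space_def)

context
  fixes A :: "'a::euclidean_space set" and V :: real
  assumes dim: "DIM('a) \<ge> 3" and A [measurable]: "A \<in> sets borel"
    and A_sub: "A \<subseteq> unit_sphere" and var_le: "\<And>X. smooth_vector_field X \<Longrightarrow> (\<And>x. x \<in> unit_sphere \<Longrightarrow> norm (X x) \<le> 1) \<Longrightarrow>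
      (\<integral>x. indicator A x * divergence X x \<partial>sphV) \<le> V"
begin

lemma dim2: "DIM('a) \<ge> 2" using dim by simp

lemma A_sphere: "x \<in> A \<Longrightarrow> norm x = 1"
  using A_sub by auto

lemma indicator_divergence_cong:
  "(\<And>x. norm x = 1 \<Longrightarrow> f x = g x) \<Longrightarrow> (\<lambda>x. indicator A x * f x) = (\<lambda>x. indicator A x * (g x :: real))"
  by (auto simp: indicator_def A_sphere)

lemma integrable_divergence:
  assumes X: "smooth_vector_field X"
  shows "integrable sphV (\<lambda>x. indicator A x * divergence X x)"
proof -
  interpret s: finite_measure "sphV :: 'a measure" by (rule finite_measure_sphV)
  have c: "continuous_on unit_sphere (divergence X)" using X divergence_smooth(2)[of X X] by (simp add: smooth_vector_field_def)
  \<comment> \<open>The divergence is known to be continuous on the sphere only. The truncation is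
    Borel on the whole space and agrees with it on A.\<close>
  define D where "D x = indicator unit_sphere x *\<^sub>R divergence X x" for x
  have D [measurable]: "D \<in> borel_measurable borel"
    unfolding D_def using c by (intro borel_measurable_continuous_on_indicator) auto
  obtain C where C: "\<And>x. x \<in> unit_sphere \<Longrightarrow> \<bar>divergence X x\<bar> \<le> C"
    using compact_abs_bound[OF compact_sphere c] by blast
  have "integrable sphV (\<lambda>x. indicator A x * D x)"
  proof (rule s.integrable_const_bound[where B="max C 0"])
    show "AE x in sphV. norm (indicator A x * D x) \<le> max C 0"
      by (rule eventually_mono[OF AE_sphV]) (use C in \<open>auto simp: D_def indicator_def le_max_iff_disj\<close>)
  qed measurable
  then show ?thesis
    by (subst indicator_divergence_cong[of _ D]) (auto simp: D_def)
qed

lemma div_pairing_lincomb: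
  assumes X: "smooth_vector_field X" and Y: "smooth_vector_field Y"
  shows "div_pairing A (\<lambda>x. a *\<^sub>R X x + c *\<^sub>R Y x) = a * div_pairing A X + c * div_pairing A Y"
proof -
  have "(\<lambda>x. indicator A x * divergence (\<lambda>x. a *\<^sub>R X x + c *\<^sub>R Y x) x) =
    (\<lambda>x. indicator A x * (a * divergence X x + c * divergence Y x))"
    using X Y by (intro indicator_divergence_cong divergence_smooth(1)) (auto simp: smooth_vector_field_def)
  also have "\<dots> = (\<lambda>x. a * (indicator A x * divergence X x) + c * (indicator A x * divergence Y x))"
    by (auto simp: algebra_simps)
  finally show ?thesis
    using integrable_divergence[OF X] integrable_divergence[OF Y] by (simp add: div_pairing_def)
qed

lemma div_pairing_scale: "smooth_vector_field X \<Longrightarrow> div_pairing A (\<lambda>x. a *\<^sub>R X x) = a * div_pairing A X"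
  using div_pairing_lincomb[of X X a 0] by simp

lemma smooth_vector_field_scale: "smooth_vector_field X \<Longrightarrow> smooth_vector_field (\<lambda>x. a *\<^sub>R X x)" for X :: "'a \<Rightarrow> 'a"
  using smooth_vector_field_lincomb[of X X a 0] by simp

lemma V_nonneg: "V \<ge> 0"
  using var_le[OF smooth_vector_field_zero] div_pairing_scale[OF smooth_vector_field_zero, of 0] by (simp add: div_pairing_def)

lemma div_pairing_le:
  assumes X: "smooth_vector_field X" and m: "m > 0" "\<And>x. norm x = 1 \<Longrightarrow> norm (X x) \<le> m"
  shows "\<bar>div_pairing A X\<bar> \<le> m * V"
proof -
  have b: "norm ((s / m) *\<^sub>R X x) \<le> 1" if "\<bar>s\<bar> = 1" "norm x = 1" for s x
    using m(1) m(2)[OF that(2)] that(1) by (simp add: divide_le_eq)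
  have "div_pairing A (\<lambda>x. (1 / m) *\<^sub>R X x) \<le> V" "div_pairing A (\<lambda>x. (- 1 / m) *\<^sub>R X x) \<le> V"
    unfolding div_pairing_def
    using b[of 1] b[of "-1"] by (intro var_le smooth_vector_field_scale X; force)+
  note this[unfolded div_pairing_scale[OF X]]
  then show ?thesis
    using m(1) by (simp add: abs_le_iff field_simps)
qed

lemma real_polynomial_geo_flow:
  fixes \<eta> :: "'a \<times> 'a \<Rightarrow> real"
  assumes "real_polynomial_function \<eta>"
  shows "real_polynomial_function (\<lambda>p. \<eta> (geo_flow t p))"
  using real_polynomial_function_compose[OF polynomial_function_bounded_linear[OF geo_flow_bounded_linear] assms]
  by (simp add: o_def)

text \<open>The generator commutes with the linear flow, so the derivative at time t is the
  generator applied to \<eta> composed with \<open>geo_flow (- t)\<close>, whose fibre integral is a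
  divergence. The minus sign stems from flowing backwards.\<close>

lemma flow_derivative:
  assumes \<eta>: "real_polynomial_function \<eta>"
  shows "((\<lambda>t. \<integral>p. indicator A (fst p) * \<eta> (geo_flow (- t) p) \<partial>frameV) has_vector_derivative
     - div_pairing A (mean_field (\<lambda>p. \<eta> (geo_flow (- t) p)))) (at t)"
proof -
  obtain \<eta>' where D: "\<And>z. (\<eta> has_derivative \<eta>' z) (at z)" and pol: "real_polynomial_function (\<lambda>z. \<eta>' (fst z) (snd z))"
    using real_polynomial_function_has_derivative[OF \<eta>] by blast
  have c\<eta>': "continuous_on UNIV (\<lambda>z. \<eta>' (fst z) (snd z))" by (rule continuous_on_real_polynomial[OF pol])
  have c\<eta>: "continuous_on UNIV \<eta>" by (rule continuous_on_real_polynomial[OF \<eta>])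
  have lin: "linear (\<eta>' z)" for z using D[of z] has_derivative_linear by blast
  interpret fv: finite_measure "frameV :: ('a \<times> 'a) measure" by (rule finite_measure_frameV[OF dim2])
  define f where "f t p = indicator A (fst p) * \<eta> (geo_flow (- t) p)" for t p
  define f' where "f' t p = indicator A (fst p) * \<eta>' (geo_flow (- t) p) (- quarter_turn (geo_flow (- t) p))" for t p
  obtain C where C: "\<And>p h. p \<in> frames \<Longrightarrow> norm h \<le> 2 \<Longrightarrow> \<bar>\<eta>' p h\<bar> \<le> C"
    using bounded_derivative_frames[OF c\<eta>'] by blast
  obtain E where E: "\<And>p. p \<in> frames \<Longrightarrow> \<bar>\<eta> p\<bar> \<le> E"
    using compact_abs_bound[OF compact_frames continuous_on_subset[OF c\<eta> subset_UNIV]] by blast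
  have [measurable]: "(\<lambda>p. \<eta> (geo_flow t p)) \<in> borel_measurable borel" for t
    by (rule borel_measurable_continuous_onI[OF continuous_on_real_polynomial[OF real_polynomial_geo_flow[OF \<eta>]]])
  have [measurable]: "(\<lambda>p. \<eta>' (geo_flow t p) (- quarter_turn (geo_flow t p))) \<in> borel_measurable borel" for t
  proof (rule borel_measurable_continuous_onI)
    have "continuous_on UNIV (\<lambda>p::'a \<times> 'a. \<eta>' (fst (geo_flow t p, - quarter_turn (geo_flow t p))) (snd (geo_flow t p, - quarter_turn (geo_flow t p))))"
      unfolding quarter_turn_def
      by (rule continuous_on_compose2[OF c\<eta>']) (auto intro!: continuous_intros continuous_on_geo_flow)
    then show "continuous_on UNIV (\<lambda>p. \<eta>' (geo_flow t p) (- quarter_turn (geo_flow t p)))" by simp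
  qed
  have f'm [measurable]: "f' t \<in> borel_measurable borel" for t unfolding f'_def by measurable
  have f'C: "\<bar>f' t p\<bar> \<le> max C 0" if p: "p \<in> frames" for t p
    using C[OF geo_flow_frames[OF p], of "- quarter_turn (geo_flow (- t) p)" "- t"] norm_quarter_turn[OF geo_flow_frames[OF p], of "- t"]
    by (auto simp: f'_def indicator_def le_max_iff_disj)
  have "((\<lambda>t. \<integral>p. f t p \<partial>frameV) has_vector_derivative (\<integral>p. f' t p \<partial>frameV)) (at t)"
  proof (rule has_vector_derivative_integral[where S=frames and C="max C 0"])
    show "finite_measure (frameV :: ('a \<times> 'a) measure)" by (rule finite_measure_frameV[OF dim2])
    show "AE p in frameV. p \<in> (frames :: ('a \<times> 'a) set)" by (rule AE_frameV)
    show "integrable frameV (f t)" for t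
    proof (rule fv.integrable_const_bound[where B="max E 0"])
      show "AE p in frameV. norm (f t p) \<le> max E 0"
      proof (rule eventually_mono[OF AE_frameV])
        fix p :: "'a \<times> 'a" assume "p \<in> frames"
        from E[OF geo_flow_frames[OF this, of "- t"]] show "norm (f t p) \<le> max E 0"
          by (auto simp: f_def indicator_def le_max_iff_disj)
      qed
    qed (unfold f_def, measurable)
    show "f' t \<in> borel_measurable frameV" by simp
    fix t and p :: "'a \<times> 'a" assume p: "p \<in> frames"
    show "norm (f' t p) \<le> max C 0" using f'C[OF p] by simp
    have "((\<lambda>t. \<eta> (geo_flow (- t) p)) has_vector_derivative \<eta>' (geo_flow (- t) p) (- quarter_turn (geo_flow (- t) p))) (at t)"
      using vector_derivative_diff_chain_within[OF geo_flow_derivative[where p=p and t=t] has_derivative_at_withinI[OF D]]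
      by (simp add: o_def)
    then show "((\<lambda>t. f t p) has_vector_derivative f' t p) (at t)"
      unfolding f_def f'_def by (rule bounded_linear.has_vector_derivative[OF bounded_linear_mult_right])
  qed
  also have "(\<integral>p. f' t p \<partial>frameV) = - div_pairing A (mean_field (\<lambda>p. \<eta> (geo_flow (- t) p)))"
  proof -
    define \<zeta> where "\<zeta> p = \<eta> (geo_flow (- t) p)" for p
    define \<zeta>' where "\<zeta>' p h = \<eta>' (geo_flow (- t) p) (geo_flow (- t) h)" for p h
    have D\<zeta>: "(\<zeta> has_derivative \<zeta>' p) (at p)" for p
      unfolding \<zeta>_def[abs_def] \<zeta>'_def[abs_def]
      by (rule has_derivative_compose[OF bounded_linear_imp_has_derivative[OF geo_flow_bounded_linear] D])
    have c\<zeta>': "continuous_on UNIV (\<lambda>z. \<zeta>' (fst z) (snd z))"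
    proof -
      have g: "continuous_on UNIV (geo_flow (- t) :: 'a \<times> 'a \<Rightarrow> _)" by (rule continuous_on_geo_flow)
      have "continuous_on UNIV (\<lambda>z. \<eta>' (fst (geo_flow (- t) (fst z), geo_flow (- t) (snd z))) (snd (geo_flow (- t) (fst z), geo_flow (- t) (snd z))))"
        by (rule continuous_on_compose2[OF c\<eta>'])
          (auto intro!: continuous_intros continuous_on_compose2[OF g])
      then show ?thesis by (simp add: \<zeta>'_def)
    qed
    have "(\<integral>p. f' t p \<partial>frameV) = (\<integral>x. (\<integral>w. f' t (x, w) \<partial>tangV x) \<partial>sphV)"
      by (rule integral_frameV_bounded(2)[OF dim2 f'm f'C])
    also have "\<dots> = (\<integral>x. - (indicator A x * divergence (mean_field \<zeta>) x) \<partial>sphV)"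
    proof (rule arg_cong[where f="integral\<^sup>L sphV"], rule ext)
      fix x
      show "(\<integral>w. f' t (x, w) \<partial>tangV x) = - (indicator A x * divergence (mean_field \<zeta>) x)"
      proof (cases "x \<in> A")
        case True
        then have x: "norm x = 1" by (rule A_sphere)
        have "f' t (x, w) = - \<zeta>' (x, w) (w, - x)" for w
        proof -
          have "quarter_turn (x, w) = (w, - x)" by (simp add: quarter_turn_def)
          then have "quarter_turn (geo_flow (- t) (x, w)) = geo_flow (- t) (w, - x)"
            by (metis geo_flow_quarter_turn)
          then show ?thesis using True by (simp add: f'_def \<zeta>'_def linear_neg[OF lin])
        qed
        then show ?thesis
          using True divergence_mean_field[OF D\<zeta> c\<zeta>' x] by simp
      qed (simp add: f'_def)
    qed
    finally show ?thesis by (simp add: div_pairing_def \<zeta>_def[abs_def])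
  qed
  finally show ?thesis by (simp add: f_def)
qed

text \<open>The flow preserves \<open>frames\<close>, so the composed polynomial is still bounded by
  1 there and the estimate is uniform in t.\<close>

lemma flow_pairing_le:
  assumes \<eta>: "real_polynomial_function \<eta>" and b: "\<And>p. p \<in> frames \<Longrightarrow> \<bar>\<eta> p\<bar> \<le> 1"
  shows "\<bar>div_pairing A (mean_field (\<lambda>p. \<eta> (geo_flow t p)))\<bar> \<le> abs_mean TYPE('a) * V"
proof -
  have pol: "real_polynomial_function (\<lambda>p. \<eta> (geo_flow t p))" by (rule real_polynomial_geo_flow[OF \<eta>])
  show ?thesis
    by (intro div_pairing_le smooth_vector_field_mean_field[OF dim2 pol] abs_mean_pos dim
        norm_mean_field_le[OF continuous_on_real_polynomial[OF pol] dim] b geo_flow_frames)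
qed

lemma integral_flow_shift:
  fixes \<eta> :: "'a \<times> 'a \<Rightarrow> real"
  assumes \<eta>: "continuous_on UNIV \<eta>"
  shows "(\<integral>p. indicator A (fst p) * \<eta> (geo_flow (- r) p) \<partial>frameV) = (\<integral>p. indicator A (fst (geo_flow r p)) * \<eta> p \<partial>(frameV :: ('a \<times> 'a) measure))"
proof -
  have [measurable]: "\<eta> \<in> borel_measurable borel" by (rule borel_measurable_continuous_onI[OF \<eta>])
  have "(\<integral>p. indicator A (fst p) * \<eta> (geo_flow (- r) p) \<partial>frameV) =
     (\<integral>p. indicator A (fst p) * \<eta> (geo_flow (- r) p) \<partial>distr frameV borel (geo_flow r))"
    by (simp add: frameV_geo_flow[OF dim2])
  also have "\<dots> = (\<integral>p. indicator A (fst (geo_flow r p)) * \<eta> (geo_flow (- r) (geo_flow r p)) \<partial>frameV)"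
    by (rule integral_distr[where f="\<lambda>p. indicator A (fst p) * \<eta> (geo_flow (- r) p)" and g="geo_flow r"]) measurable
  finally show ?thesis by (simp add: geo_flow_add)
qed

lemma integrable_frameV_mult:
  assumes g: "g \<in> borel_measurable borel" "\<And>p. \<bar>g p\<bar> \<le> (1::real)" and \<eta>: "continuous_on UNIV \<eta>"
  shows "integrable frameV (\<lambda>p::'a \<times> 'a. g p * \<eta> p)"
proof -
  interpret fv: finite_measure "frameV :: ('a \<times> 'a) measure" by (rule finite_measure_frameV[OF dim2])
  have [measurable]: "\<eta> \<in> borel_measurable borel" "g \<in> borel_measurable borel" 
    by (rule borel_measurable_continuous_onI[OF \<eta>], rule g)
  obtain E where E: "\<And>p. p \<in> frames \<Longrightarrow> \<bar>\<eta> p\<bar> \<le> E"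
    using compact_abs_bound[OF compact_frames continuous_on_subset[OF \<eta> subset_UNIV]] by blast
  show ?thesis
  proof (rule fv.integrable_const_bound[where B=E])
    show "AE p in frameV. norm (g p * \<eta> p) \<le> E"
    proof (rule eventually_mono[OF AE_frameV])
      fix p :: "'a \<times> 'a" assume "p \<in> frames"
      then have "\<bar>g p\<bar> * \<bar>\<eta> p\<bar> \<le> 1 * E" using E g by (intro mult_mono) auto
      then show "norm (g p * \<eta> p) \<le> E" by (simp add: abs_mult)
    qed
  qed measurable
qed

lemma flow_diff_pairing:
  assumes \<eta>: "real_polynomial_function \<eta>"
  shows "(\<integral>p. (indicator A (fst (geo_flow r p)) - indicator A (fst p)) * \<eta> p \<partial>frameV) =
    (\<integral>p. indicator A (fst p) * \<eta> (geo_flow (- r) p) \<partial>frameV) - (\<integral>p. indicator A (fst p) * \<eta> (geo_flow (- 0) p) \<partial>(frameV :: ('a \<times> 'a) measure))"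
proof -
  have c: "continuous_on UNIV \<eta>" by (rule continuous_on_real_polynomial[OF \<eta>])
  have "integrable frameV (\<lambda>p. indicator A (fst (geo_flow r p)) * \<eta> p)" "integrable frameV (\<lambda>p. indicator A (fst p) * \<eta> p)"
    by (intro integrable_frameV_mult c; measurable; simp add: indicator_def)+
  then show ?thesis
    unfolding integral_flow_shift[OF c] by (simp add: left_diff_distrib)
qed

lemma flow_diff_le: "flow_diff A r \<le> abs_mean TYPE('a) * V * \<bar>r\<bar>"
  unfolding flow_diff_def
proof (rule L1_norm_le_polynomial_duality[where K=frames and H=1])
  show "finite_measure (frameV :: ('a \<times> 'a) measure)" by (rule finite_measure_frameV[OF dim2])
  show "AE p in frameV. p \<in> (frames :: ('a \<times> 'a) set)" by (rule AE_frameV)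
  show "(\<lambda>p. indicator A (fst (geo_flow r p)) - indicator A (fst p) :: real) \<in> borel_measurable borel" by measurable
  fix \<eta> :: "'a \<times> 'a \<Rightarrow> real"
  assume \<eta>: "real_polynomial_function \<eta>" and b: "\<And>p. p \<in> frames \<Longrightarrow> \<bar>\<eta> p\<bar> \<le> 1"
  \<comment> \<open>By invariance under the flow the pairing with \<eta> is G r - G 0, so a bound on
    the derivative of G at all times suffices.\<close>
  define G where "G t = (\<integral>p. indicator A (fst p) * \<eta> (geo_flow (- t) p) \<partial>(frameV :: ('a \<times> 'a) measure))" for t
  have "norm (G r - G 0) \<le> abs_mean TYPE('a) * V * norm (r - 0)"
  proof (rule differentiable_bound[where S=UNIV and f'="\<lambda>t h. h *\<^sub>R - div_pairing A (mean_field (\<lambda>p. \<eta> (geo_flow (- t) p)))"])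
    show "(G has_derivative (\<lambda>h. h *\<^sub>R - div_pairing A (mean_field (\<lambda>p. \<eta> (geo_flow (- t) p))))) (at t within UNIV)" for t
      using flow_derivative[OF \<eta>, of t] by (simp add: has_vector_derivative_def G_def[abs_def])
    show "onorm (\<lambda>h. h *\<^sub>R - div_pairing A (mean_field (\<lambda>p. \<eta> (geo_flow (- t) p)))) \<le> abs_mean TYPE('a) * V" for t
    proof (rule onorm_le)
      fix h :: real
      have "\<bar>h\<bar> * \<bar>div_pairing A (mean_field (\<lambda>p. \<eta> (geo_flow (- t) p)))\<bar> \<le> \<bar>h\<bar> * (abs_mean TYPE('a) * V)"
        by (intro mult_left_mono flow_pairing_le \<eta> b) auto
      then show "norm (h *\<^sub>R - div_pairing A (mean_field (\<lambda>p. \<eta> (geo_flow (- t) p)))) \<le> abs_mean TYPE('a) * V * norm h"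
        by (simp add: abs_mult mult.commute)
    qed
  qed auto
  then show "(\<integral>p. (indicator A (fst (geo_flow r p)) - indicator A (fst p)) * \<eta> p \<partial>frameV) \<le> abs_mean TYPE('a) * V * \<bar>r\<bar>"
    unfolding flow_diff_pairing[OF \<eta>] G_def by (simp add: abs_le_iff)
qed (auto simp: compact_frames indicator_def)

end

subsection \<open>Approximation of vector fields by mean fields\<close>

text \<open>
  The clamp of \<open>(w \<bullet> y) / \<delta>\<close> replaces the sign of \<open>w \<bullet> y\<close> so as to depend continuously on \<open>w\<close> and \<open>y\<close>.
\<close>

lemma clamp_mult_bounds:
  assumes "\<delta> > (0::real)"
  shows "0 \<le> \<bar>t\<bar> - max (-1) (min 1 (t / \<delta>)) * t" "\<bar>t\<bar> - max (-1) (min 1 (t / \<delta>)) * t \<le> \<delta>"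
proof -
  consider "t \<ge> \<delta>" | "t \<le> - \<delta>" | "\<bar>t\<bar> < \<delta>" by linarith
  then have "0 \<le> \<bar>t\<bar> - max (-1) (min 1 (t / \<delta>)) * t \<and> \<bar>t\<bar> - max (-1) (min 1 (t / \<delta>)) * t \<le> \<delta>"
  proof cases
    case 1
    then have "max (-1) (min 1 (t / \<delta>)) = 1" using assms by (simp add: min_def max_def le_divide_eq)
    then show ?thesis using 1 assms by simp
  next
    case 2
    then have "t / \<delta> \<le> -1" using assms by (simp add: divide_le_eq)
    then have "max (-1) (min 1 (t / \<delta>)) = -1" by simp
    then show ?thesis using 2 assms by simp
  next
    case 3
    then have "-1 < t / \<delta>" "t / \<delta> < 1" using assms by (auto simp: less_divide_eq divide_less_eq)
    then have e: "max (-1) (min 1 (t / \<delta>)) = t / \<delta>" by simp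
    have "t / \<delta> * t = \<bar>t\<bar> * (\<bar>t\<bar> / \<delta>)" by (simp add: abs_mult_self_eq)
    also have "\<dots> \<le> \<bar>t\<bar> * 1" using 3 assms by (intro mult_left_mono) (auto simp: divide_le_eq)
    finally have "t / \<delta> * t \<le> \<bar>t\<bar>" by simp
    moreover have "t / \<delta> * t \<ge> 0" using assms by (simp add: zero_le_divide_iff)
    ultimately show ?thesis using 3 unfolding e by linarith
  qed
  then show "0 \<le> \<bar>t\<bar> - max (-1) (min 1 (t / \<delta>)) * t" "\<bar>t\<bar> - max (-1) (min 1 (t / \<delta>)) * t \<le> \<delta>" by auto
qed

text \<open>Symmetry under reflections fixing x and e forces the mean to be a multiple of e. The
  coefficient falls short of \<open>abs_mean\<close> by the integral of the clamp error, which lies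
  between 0 and \<delta> at every w.\<close>

lemma mean_clamp_unit:
  fixes x e :: "'a::euclidean_space"
  assumes dim: "DIM('a) \<ge> 3" and x: "norm x = 1" and e: "norm e = 1" "x \<bullet> e = 0" and \<delta>: "\<delta> > 0"
  shows "norm ((\<integral>w. max (-1) (min 1 ((w \<bullet> e) / \<delta>)) *\<^sub>R w \<partial>tangV x) - abs_mean TYPE('a) *\<^sub>R e) \<le> \<delta> * sigma (DIM('a) - 2)"
proof -
  define \<psi> where "\<psi> t = max (-1) (min 1 (t / \<delta>))" for t :: real
  have c\<psi>: "continuous_on UNIV \<psi>" unfolding \<psi>_def by (intro continuous_intros) (use \<delta> in auto)
  have c: "continuous_on UNIV (\<lambda>w. \<psi> (w \<bullet> e))" by (intro continuous_on_compose2[OF c\<psi>] continuous_intros) auto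
  define X where "X = (\<integral>w. \<psi> (w \<bullet> e) *\<^sub>R w \<partial>tangV x)"
  have int: "integrable (tangV x) (\<lambda>w. \<psi> (w \<bullet> e) *\<^sub>R w)"
    by (intro integrable_tangV_continuous[OF x] continuous_intros c)
  have inner: "X \<bullet> v = (\<integral>w. \<psi> (w \<bullet> e) * (w \<bullet> v) \<partial>tangV x)" for v
    unfolding X_def using int by (simp flip: integral_inner_left)
  have "X \<bullet> x = (\<integral>w. 0 \<partial>tangV x)"
    unfolding inner
  proof (rule integral_cong_AE)
    show "(\<lambda>w. \<psi> (w \<bullet> e) * (w \<bullet> x)) \<in> borel_measurable (tangV x)"
      by (intro borel_measurable_tangV continuous_intros c)
    show "AE w in tangV x. \<psi> (w \<bullet> e) * (w \<bullet> x) = 0"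
      by (rule eventually_mono[OF AE_tangV[OF x]]) (simp add: inner_commute)
  qed simp
  then have Xx: "X \<bullet> x = 0" by simp
  \<comment> \<open>The reflection taking z to -z fixes x and e, hence preserves the measure and the
    weight, while it reverses w \<bullet> z.\<close>
  have ortho: "X \<bullet> z = 0" if z: "x \<bullet> z = 0" "e \<bullet> z = 0" for z
  proof -
    obtain f where f: "orthogonal_transformation f" "f z = - z" "\<And>v. v \<bullet> z = v \<bullet> (- z) \<Longrightarrow> f v = v"
      using reflection_exists[of z "- z"] by auto
    have fx: "f x = x" "f e = e" using f(3) z by auto
    have fe: "f w \<bullet> e = w \<bullet> e" for w using orthogonal_transformation_inner[OF f(1), of w e] fx by simp
    have fz: "f w \<bullet> z = - (w \<bullet> z)" for w using orthogonal_transformation_inner[OF f(1), of w z] f(2) by simp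
    have "(\<integral>w. \<psi> (w \<bullet> e) * (w \<bullet> z) \<partial>tangV (f x)) = (\<integral>w. \<psi> (f w \<bullet> e) * (f w \<bullet> z) \<partial>tangV x)"
      by (rule integral_distr_tangV_orthogonal[OF f(1)])
        (intro borel_measurable_continuous_onI continuous_intros c)
    then have "X \<bullet> z = - (X \<bullet> z)" by (simp add: inner fx fe fz)
    then show ?thesis by simp
  qed
  \<comment> \<open>The part of X orthogonal to e; it is orthogonal to X itself by
    \<open>ortho\<close>, hence zero.\<close>
  define z where "z = X - (X \<bullet> e) *\<^sub>R e"
  have z: "x \<bullet> z = 0" "e \<bullet> z = 0"
    using Xx e by (auto simp: z_def inner_diff_right inner_commute norm_eq_1)
  have "z \<bullet> z = X \<bullet> z - (X \<bullet> e) * (e \<bullet> z)" by (simp add: z_def[of ] inner_diff_left)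
  then have "z \<bullet> z = 0" using ortho[OF z] z by simp
  then have X: "X = (X \<bullet> e) *\<^sub>R e" by (simp add: z_def)
  interpret t: finite_measure "tangV x" by (rule finite_measure_tangV[OF x])
  have i1: "integrable (tangV x) (\<lambda>w. \<bar>w \<bullet> e\<bar>)" "integrable (tangV x) (\<lambda>w. \<psi> (w \<bullet> e) * (w \<bullet> e))"
    by (intro integrable_tangV_continuous[OF x] continuous_intros c)+
  have diff: "abs_mean TYPE('a) - X \<bullet> e = (\<integral>w. \<bar>w \<bullet> e\<bar> - \<psi> (w \<bullet> e) * (w \<bullet> e) \<partial>tangV x)"
    unfolding inner integral_abs_tangV[OF dim x e, symmetric] using i1 by simp
  have "abs_mean TYPE('a) - X \<bullet> e \<ge> 0"
    unfolding diff \<psi>_def by (intro integral_nonneg_AE AE_I2 clamp_mult_bounds(1) \<delta>)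
  moreover have "abs_mean TYPE('a) - X \<bullet> e \<le> (\<integral>w. \<delta> \<partial>tangV x)"
    unfolding diff by (rule integral_mono) (use i1 clamp_mult_bounds(2)[OF \<delta>] in \<open>auto simp: \<psi>_def\<close>)
  ultimately have *: "\<bar>X \<bullet> e - abs_mean TYPE('a)\<bar> \<le> \<delta> * sigma (DIM('a) - 2)"
    using dim by (simp add: measure_tangV[OF x] mult.commute)
  have "X - abs_mean TYPE('a) *\<^sub>R e = (X \<bullet> e - abs_mean TYPE('a)) *\<^sub>R e"
    by (subst X) (simp add: scaleR_diff_left)
  then have "norm (X - abs_mean TYPE('a) *\<^sub>R e) = \<bar>X \<bullet> e - abs_mean TYPE('a)\<bar>" using e by simp
  then show ?thesis using * by (simp add: X_def \<psi>_def)
qed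

lemma mean_clamp:
  fixes x y :: "'a::euclidean_space"
  assumes dim: "DIM('a) \<ge> 3" and x: "norm x = 1" and y: "x \<bullet> y = 0" "norm y \<le> 1" and \<delta>: "\<delta> > 0"
  shows "norm ((\<integral>w. (norm y * max (-1) (min 1 ((w \<bullet> sgn y) / \<delta>))) *\<^sub>R w \<partial>tangV x) - abs_mean TYPE('a) *\<^sub>R y) \<le> \<delta> * sigma (DIM('a) - 2)"
proof (cases "y = 0")
  case True
  then show ?thesis using \<delta> by (simp add: sigma_def)
next
  case False
  have e: "norm (sgn y) = 1" "x \<bullet> sgn y = 0" using False y by (auto simp: norm_sgn sgn_div_norm)
  have "(\<integral>w. (norm y * max (-1) (min 1 ((w \<bullet> sgn y) / \<delta>))) *\<^sub>R w \<partial>tangV x) - abs_mean TYPE('a) *\<^sub>R y =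
    norm y *\<^sub>R ((\<integral>w. max (-1) (min 1 ((w \<bullet> sgn y) / \<delta>)) *\<^sub>R w \<partial>tangV x) - abs_mean TYPE('a) *\<^sub>R sgn y)"
  proof -
    have "(\<integral>w. (norm y * max (-1) (min 1 ((w \<bullet> sgn y) / \<delta>))) *\<^sub>R w \<partial>tangV x) =
        norm y *\<^sub>R (\<integral>w. max (-1) (min 1 ((w \<bullet> sgn y) / \<delta>)) *\<^sub>R w \<partial>tangV x)"
      by (simp flip: scaleR_scaleR)
    moreover have "abs_mean TYPE('a) *\<^sub>R y = norm y *\<^sub>R (abs_mean TYPE('a) *\<^sub>R sgn y)"
      using False by (simp add: sgn_div_norm)
    ultimately show ?thesis by (simp only: scaleR_diff_right)
  qed
  then have "norm ((\<integral>w. (norm y * max (-1) (min 1 ((w \<bullet> sgn y) / \<delta>))) *\<^sub>R w \<partial>tangV x) - abs_mean TYPE('a) *\<^sub>R y) =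
    norm y * norm ((\<integral>w. max (-1) (min 1 ((w \<bullet> sgn y) / \<delta>)) *\<^sub>R w \<partial>tangV x) - abs_mean TYPE('a) *\<^sub>R sgn y)"
    by simp
  also have "\<dots> \<le> 1 * (\<delta> * sigma (DIM('a) - 2))"
    by (intro mult_mono mean_clamp_unit dim x e \<delta> y) auto
  finally show ?thesis by simp
qed

text \<open>The autocorrelation function of a Borel set as a single integral over frames, a form to
  which invariance under the flow applies.\<close>

definition frame_corr :: "'a::euclidean_space set \<Rightarrow> real \<Rightarrow> real" where
  "frame_corr A r = (\<integral>p. indicator A (fst p) * indicator A (fst (geo_flow r p)) \<partial>frameV) / sigma (DIM('a) - 2)"

lemma sigma_pos: "sigma n > 0"
  by (simp add: sigma_def)

context
  fixes A :: "'a::euclidean_space set" and V :: real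
  assumes dim: "DIM('a) \<ge> 3" and A [measurable]: "A \<in> sets borel" and A_sub: "A \<subseteq> unit_sphere"
    and var_le: "\<And>X. smooth_vector_field X \<Longrightarrow> (\<And>x. x \<in> unit_sphere \<Longrightarrow> norm (X x) \<le> 1) \<Longrightarrow>
      (\<integral>x. indicator A x * divergence X x \<partial>sphV) \<le> V"
    and var_attained: "\<And>e. e > 0 \<Longrightarrow> \<exists>X. smooth_vector_field X \<and> (\<forall>x\<in>unit_sphere. norm (X x) \<le> 1) \<and>
      V - e \<le> (\<integral>x. indicator A x * divergence X x \<partial>sphV)"
begin

lemma mean_field_approx:
  fixes Y :: "'a \<Rightarrow> 'a"
  assumes Y: "smooth_vector_field Y" and Y1: "\<And>x. norm x = 1 \<Longrightarrow> norm (Y x) \<le> 1" and d: "d > 0"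
  obtains \<eta> where "real_polynomial_function \<eta>" "\<And>p. p \<in> frames \<Longrightarrow> \<bar>\<eta> p\<bar> \<le> 1"
    "\<And>x. norm x = 1 \<Longrightarrow> norm (mean_field \<eta> x - abs_mean TYPE('a) *\<^sub>R Y x) \<le> d"
proof -
  let ?s = "sigma (DIM('a) - 2)"
  have s: "?s > 0" by (rule sigma_pos)
  have Yc: "continuous_on unit_sphere Y" using Y smooth_on_imp_continuous_on by (auto simp: smooth_vector_field_def)
  have Yt: "x \<bullet> Y x = 0" if "norm x = 1" for x
    using Y that by (auto simp: smooth_vector_field_def tangent_space_def)
  \<comment> \<open>The tolerance d is shared equally: the clamp costs \<delta> times the fibre
    mass, the polynomial 2 k times the fibre mass, and each of these is d / 2.\<close>
  define \<delta> where "\<delta> = d / (2 * ?s)"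
  define k where "k = d / (4 * ?s)"
  have \<delta>: "\<delta> > 0" and k: "k > 0" using d s by (auto simp: \<delta>_def k_def)
  \<comment> \<open>The direction \<open>sgn (Y x)\<close> is discontinuous at zeros of Y. With the
    norm of Y moved inside the clamp the function is continuous there as well, and \<open>eq\<close>
    identifies it with the scaled clamp.\<close>
  define \<eta>0 where "\<eta>0 p = max (- norm (Y (fst p))) (min (norm (Y (fst p))) ((snd p \<bullet> Y (fst p)) / \<delta>))" for p
  have eq: "\<eta>0 (x, w) = norm (Y x) * max (-1) (min 1 ((w \<bullet> sgn (Y x)) / \<delta>))" for x w
  proof (cases "Y x = 0")
    case False
    define a where "a = (w \<bullet> sgn (Y x)) / \<delta>"
    have "norm (Y x) * a = (w \<bullet> Y x) / \<delta>" using False by (simp add: a_def sgn_div_norm)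
    moreover have "norm (Y x) * max (-1) (min 1 a) = max (norm (Y x) * (-1)) (min (norm (Y x) * 1) (norm (Y x) * a))"
      by (simp only: max_mult_distrib_left min_mult_distrib_left norm_ge_zero if_True)
    ultimately show ?thesis by (simp add: \<eta>0_def a_def[symmetric])
  qed (simp add: \<eta>0_def)
  have c0: "continuous_on frames \<eta>0"
  proof -
    have "continuous_on frames (\<lambda>p. Y (fst p))"
      by (rule continuous_on_compose2[OF Yc continuous_on_fst[OF continuous_on_id]]) (auto simp: frames_def)
    then show ?thesis unfolding \<eta>0_def[abs_def] by (intro continuous_intros) (use \<delta> in auto)
  qed
  have b0: "\<bar>\<eta>0 p\<bar> \<le> 1" if "p \<in> frames" for p
  proof -
    have "norm (Y (fst p)) \<le> 1" using that by (intro Y1) (auto simp: frames_def)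
    moreover have "\<bar>max (- a) (min a t)\<bar> \<le> 1" if "0 \<le> a" "a \<le> 1" for a t :: real using that by auto
    ultimately show ?thesis unfolding \<eta>0_def by simp
  qed
  obtain q where q: "real_polynomial_function q" "\<And>p. p \<in> frames \<Longrightarrow> \<bar>\<eta>0 p - q p\<bar> < k"
    using Stone_Weierstrass_real_polynomial_function[OF compact_frames c0 k] by auto
  define \<eta> where "\<eta> p = q p * (1 / (1 + k))" for p
  have pol: "real_polynomial_function \<eta>"
    unfolding \<eta>_def by (intro real_polynomial_mult q real_polynomial_const)
  have \<eta>1: "\<bar>\<eta> p\<bar> \<le> 1" if "p \<in> frames" for p
  proof -
    have "\<bar>q p\<bar> \<le> 1 + k" using q(2)[OF that] b0[OF that] by linarith
    then show ?thesis using k by (simp add: \<eta>_def abs_mult)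
  qed
  have \<eta>\<eta>: "\<bar>\<eta> p - \<eta>0 p\<bar> \<le> 2 * k" if p: "p \<in> frames" for p
  proof -
    have "(1 + k) * (\<eta> p - \<eta>0 p) = (q p - \<eta>0 p) - k * \<eta>0 p" using k by (simp add: \<eta>_def field_simps)
    moreover have "\<bar>k * \<eta>0 p\<bar> \<le> k" using b0[OF p] k by (simp add: abs_mult)
    ultimately have "\<bar>(1 + k) * (\<eta> p - \<eta>0 p)\<bar> \<le> 2 * k" using q(2)[OF p] by linarith
    then have "(1 + k) * \<bar>\<eta> p - \<eta>0 p\<bar> \<le> 2 * k" using k by (simp add: abs_mult)
    moreover have "1 * \<bar>\<eta> p - \<eta>0 p\<bar> \<le> (1 + k) * \<bar>\<eta> p - \<eta>0 p\<bar>" using k by (intro mult_right_mono) auto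
    ultimately have "1 * \<bar>\<eta> p - \<eta>0 p\<bar> \<le> 2 * k" by (rule order_trans[rotated])
    then show ?thesis by simp
  qed
  show ?thesis
  proof (rule that[OF pol \<eta>1])
    fix x :: 'a assume x: "norm x = 1"
    interpret t: finite_measure "tangV x" by (rule finite_measure_tangV[OF x])
    have c1: "continuous_on UNIV (\<lambda>w. \<eta> (x, w))"
      by (intro continuous_on_compose2[OF continuous_on_real_polynomial[OF pol, of UNIV]] continuous_intros subset_UNIV)
    have c2: "continuous_on UNIV (\<lambda>w. \<eta>0 (x, w))"
      unfolding \<eta>0_def by (intro continuous_intros) (use \<delta> in auto)
    have i: "integrable (tangV x) (\<lambda>w. \<eta> (x, w) *\<^sub>R w)" "integrable (tangV x) (\<lambda>w. \<eta>0 (x, w) *\<^sub>R w)"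
      "integrable (tangV x) (\<lambda>w. norm ((\<eta> (x, w) - \<eta>0 (x, w)) *\<^sub>R w))"
      by (intro integrable_tangV_continuous[OF x] continuous_intros c1 c2)+
    have "mean_field \<eta> x - (\<integral>w. \<eta>0 (x, w) *\<^sub>R w \<partial>tangV x) = (\<integral>w. (\<eta> (x, w) - \<eta>0 (x, w)) *\<^sub>R w \<partial>tangV x)"
      using i by (simp add: mean_field_def scaleR_diff_left)
    also have "norm \<dots> \<le> (\<integral>w. norm ((\<eta> (x, w) - \<eta>0 (x, w)) *\<^sub>R w) \<partial>tangV x)"
      by (rule integral_norm_bound)
    also have "\<dots> \<le> (\<integral>w. 2 * k \<partial>tangV x)"
    proof (rule integral_mono_AE[OF i(3)])
      show "AE w in tangV x. norm ((\<eta> (x, w) - \<eta>0 (x, w)) *\<^sub>R w) \<le> 2 * k"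
        by (rule eventually_mono[OF AE_tangV_frames[OF x]]) (use \<eta>\<eta> in \<open>auto simp: frames_def\<close>)
    qed simp
    also have "\<dots> = d / 2" using s dim by (simp add: measure_tangV[OF x] k_def)
    finally have 1: "norm (mean_field \<eta> x - (\<integral>w. \<eta>0 (x, w) *\<^sub>R w \<partial>tangV x)) \<le> d / 2" .
    have "norm ((\<integral>w. \<eta>0 (x, w) *\<^sub>R w \<partial>tangV x) - abs_mean TYPE('a) *\<^sub>R Y x) \<le> \<delta> * ?s"
      unfolding eq by (rule mean_clamp[OF dim x Yt[OF x] Y1[OF x] \<delta>])
    also have "\<delta> * ?s = d / 2" using s by (simp add: \<delta>_def)
    finally show "norm (mean_field \<eta> x - abs_mean TYPE('a) *\<^sub>R Y x) \<le> d"
      using 1 norm_triangle_ineq[of "mean_field \<eta> x - (\<integral>w. \<eta>0 (x, w) *\<^sub>R w \<partial>tangV x)"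
        "(\<integral>w. \<eta>0 (x, w) *\<^sub>R w \<partial>tangV x) - abs_mean TYPE('a) *\<^sub>R Y x"] by simp
  qed
qed

text \<open>Here a single test polynomial suffices: its mean field is close to
  \<open>abs_mean\<close> times an almost optimal field, and differentiability at time 0 alone
  controls small r.\<close>

lemma flow_diff_lower:
  assumes e: "e > 0"
  shows "\<forall>\<^sub>F r in at_right 0. r * (abs_mean TYPE('a) * V - e) \<le> flow_diff A r"
proof -
  let ?c = "abs_mean TYPE('a)"
  have c: "?c > 0" by (rule abs_mean_pos[OF dim])
  have V: "V \<ge> 0" by (rule V_nonneg[OF dim A A_sub var_le])
  have dim2: "DIM('a) \<ge> 2" using dim by simp
  interpret fv: finite_measure "frameV :: ('a \<times> 'a) measure" by (rule finite_measure_frameV[OF dim2])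
  \<comment> \<open>The defect of Y and the approximation of its multiple cost e / 4 each; the
    remaining e / 2 is left for the difference quotient.\<close>
  define e1 where "e1 = e / (4 * ?c)"
  define d where "d = e / (4 * (V + 1))"
  have e1: "e1 > 0" and d: "d > 0" using e c V by (auto simp: e1_def d_def)
  obtain Y where Y: "smooth_vector_field Y" "\<forall>x\<in>unit_sphere. norm (Y x) \<le> 1" "V - e1 \<le> div_pairing A Y"
    using var_attained[OF e1] unfolding div_pairing_def by blast
  obtain \<eta> where \<eta>: "real_polynomial_function \<eta>" "\<And>p. p \<in> frames \<Longrightarrow> \<bar>\<eta> p\<bar> \<le> 1"
    "\<And>x. norm x = 1 \<Longrightarrow> norm (mean_field \<eta> x - ?c *\<^sub>R Y x) \<le> d"
    using mean_field_approx[OF Y(1) _ d] Y(2) by auto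
  have X: "smooth_vector_field (mean_field \<eta>)" by (rule smooth_vector_field_mean_field[OF dim2 \<eta>(1)])
  define b where "b = div_pairing A (mean_field \<eta>)"
  have "\<bar>div_pairing A (\<lambda>x. 1 *\<^sub>R mean_field \<eta> x + (- ?c) *\<^sub>R Y x)\<bar> \<le> d * V"
    using \<eta>(3) by (intro div_pairing_le[OF dim A A_sub var_le] smooth_vector_field_lincomb X Y d) auto
  also have "div_pairing A (\<lambda>x. 1 *\<^sub>R mean_field \<eta> x + (- ?c) *\<^sub>R Y x) = b - ?c * div_pairing A Y"
    using div_pairing_lincomb[OF dim A A_sub var_le X Y(1), of 1 "- ?c"] by (simp add: b_def)
  finally have "\<bar>b - ?c * div_pairing A Y\<bar> \<le> d * V" .
  moreover have "?c * (V - e1) \<le> ?c * div_pairing A Y" using Y(3) c by simp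
  moreover have "?c * e1 = e / 4" using c by (simp add: e1_def)
  moreover have "d * V \<le> e / 4" using V e by (simp add: d_def field_simps)
  ultimately have b: "b \<ge> ?c * V - e / 2" by (simp add: algebra_simps abs_le_iff)
  define G where "G t = (\<integral>p. indicator A (fst p) * \<eta> (geo_flow (- t) p) \<partial>(frameV :: ('a \<times> 'a) measure))" for t
  have "(G has_vector_derivative - b) (at 0)"
    using flow_derivative[OF dim A A_sub var_le \<eta>(1), of 0] by (simp add: G_def[abs_def] b_def)
  then have "(G has_real_derivative - b) (at_right 0)"
    by (simp add: has_real_derivative_iff_has_vector_derivative has_vector_derivative_at_within)
  then have "((\<lambda>r. (G r - G 0) / r) \<longlongrightarrow> - b) (at_right 0)"
    by (simp add: has_field_derivative_iff)
  then have "\<forall>\<^sub>F r in at_right 0. (G r - G 0) / r < - b + e / 2"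
    by (rule order_tendstoD) (use e in simp)
  moreover have "\<forall>\<^sub>F r in at_right (0::real). r > 0" by (rule eventually_at_right_less)
  ultimately show ?thesis
  proof eventually_elim
    fix r :: real assume "(G r - G 0) / r < - b + e / 2" and r: "r > 0"
    then have "G r - G 0 < r * (- b + e / 2)" by (simp add: divide_less_eq mult.commute)
    moreover have "r * (- b + e / 2) \<le> r * (- (?c * V - e))" using b r by (intro mult_left_mono) auto
    ultimately have 1: "r * (?c * V - e) \<le> G 0 - G r" by (simp add: algebra_simps)
    have "G 0 - G r = (\<integral>p. - ((indicator A (fst (geo_flow r p)) - indicator A (fst p)) * \<eta> p) \<partial>frameV)"
      using flow_diff_pairing[OF dim A A_sub var_le \<eta>(1), of r] by (simp add: G_def)
    also have "\<dots> \<le> flow_diff A r"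
      unfolding flow_diff_def
    proof (rule integral_mono_AE)
      have c\<eta>: "continuous_on UNIV \<eta>" by (rule continuous_on_real_polynomial[OF \<eta>(1)])
      have "integrable frameV (\<lambda>p. (indicator A (fst (geo_flow r p)) - indicator A (fst p)) * \<eta> p)"
        by (rule integrable_frameV_mult[OF dim A A_sub var_le _ _ c\<eta>]) (measurable, auto simp: indicator_def)
      then show "integrable frameV (\<lambda>p. - ((indicator A (fst (geo_flow r p)) - indicator A (fst p)) * \<eta> p))" by simp
      show "integrable frameV (\<lambda>p. \<bar>indicator A (fst (geo_flow r p)) - indicator A (fst p)\<bar> :: real)"
        by (rule fv.integrable_const_bound[where B=1]) (auto simp: indicator_def)
      show "AE p in frameV. - ((indicator A (fst (geo_flow r p)) - indicator A (fst p)) * \<eta> p) \<le> \<bar>indicator A (fst (geo_flow r p)) - indicator A (fst p)\<bar>"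
      proof (rule eventually_mono[OF AE_frameV])
        fix p :: "'a \<times> 'a" assume "p \<in> frames"
        then have "\<bar>\<eta> p\<bar> \<le> 1" by (rule \<eta>(2))
        then show "- ((indicator A (fst (geo_flow r p)) - indicator A (fst p)) * \<eta> p) \<le> \<bar>indicator A (fst (geo_flow r p)) - indicator A (fst p)\<bar>"
          by (auto simp: indicator_def)
      qed
    qed
    finally show "r * (?c * V - e) \<le> flow_diff A r" using 1 by linarith
  qed
qed

lemma flow_diff_limit: "((\<lambda>r. flow_diff A r / r) \<longlongrightarrow> abs_mean TYPE('a) * V) (at_right 0)"
proof (rule tendstoI)
  fix e :: real assume e: "e > 0"
  have "\<forall>\<^sub>F r in at_right 0. r * (abs_mean TYPE('a) * V - e / 2) \<le> flow_diff A r"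
    using e by (intro flow_diff_lower) simp
  moreover have "\<forall>\<^sub>F r in at_right (0::real). r > 0" by (rule eventually_at_right_less)
  ultimately show "\<forall>\<^sub>F r in at_right 0. dist (flow_diff A r / r) (abs_mean TYPE('a) * V) < e"
  proof eventually_elim
    fix r :: real assume lo: "r * (abs_mean TYPE('a) * V - e / 2) \<le> flow_diff A r" and r: "r > 0"
    have "flow_diff A r \<le> abs_mean TYPE('a) * V * r"
      using flow_diff_le[OF dim A A_sub var_le, of r] r by simp
    then have "flow_diff A r / r \<le> abs_mean TYPE('a) * V" using r by (simp add: divide_le_eq)
    moreover have "abs_mean TYPE('a) * V - e / 2 \<le> flow_diff A r / r" using lo r by (simp add: le_divide_eq mult.commute)
    ultimately show "dist (flow_diff A r / r) (abs_mean TYPE('a) * V) < e" using e by (simp add: dist_real_def)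
  qed
qed

lemma integrable_frameV_indicator:
  "integrable (frameV :: ('a \<times> 'a) measure) (\<lambda>p. indicator A (fst (geo_flow r p)) :: real)"
  "integrable (frameV :: ('a \<times> 'a) measure) (\<lambda>p. indicator A (fst (geo_flow r p)) * indicator A (fst (geo_flow s p)) :: real)"
proof -
  interpret fv: finite_measure "frameV :: ('a \<times> 'a) measure" by (rule finite_measure_frameV) (use dim in simp)
  show "integrable (frameV :: ('a \<times> 'a) measure) (\<lambda>p. indicator A (fst (geo_flow r p)) :: real)"
    by (rule fv.integrable_const_bound[where B=1]) (auto simp: indicator_def)
  show "integrable (frameV :: ('a \<times> 'a) measure) (\<lambda>p. indicator A (fst (geo_flow r p)) * indicator A (fst (geo_flow s p)) :: real)"
    by (rule fv.integrable_const_bound[where B=1]) (auto simp: indicator_def)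
qed

lemma integral_frameV_flow:
  fixes F :: "'a \<times> 'a \<Rightarrow> real"
  assumes [measurable]: "F \<in> borel_measurable borel"
  shows "(\<integral>p. F (geo_flow r p) \<partial>frameV) = (\<integral>p. F p \<partial>frameV)"
proof -
  have "(\<integral>p. F p \<partial>frameV) = (\<integral>p. F p \<partial>distr frameV borel (geo_flow r))"
    using frameV_geo_flow[where 'a='a, of r] dim by simp
  also have "\<dots> = (\<integral>p. F (geo_flow r p) \<partial>frameV)"
    by (rule integral_distr) measurable
  finally show ?thesis ..
qed

text \<open>For values a, b in {0, 1} the distance \<bar>a - b\<bar> is a + b - 2 a b, and
  invariance under the flow equates the integrals of the first two terms.\<close>

lemma flow_diff_frame_corr: "flow_diff A r = 2 * sigma (DIM('a) - 2) * (frame_corr A 0 - frame_corr A r)"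
proof -
  have i: "integrable (frameV :: ('a \<times> 'a) measure) (\<lambda>p. indicator A (fst p) :: real)"
    "integrable (frameV :: ('a \<times> 'a) measure) (\<lambda>p. indicator A (fst p) * indicator A (fst (geo_flow r p)) :: real)"
    using integrable_frameV_indicator(1)[of 0] integrable_frameV_indicator(2)[of 0 r] by simp_all
  have "flow_diff A r = (\<integral>p. indicator A (fst (geo_flow r p)) + indicator A (fst p) - 2 * (indicator A (fst p) * indicator A (fst (geo_flow r p))) \<partial>frameV)"
    unfolding flow_diff_def by (intro Bochner_Integration.integral_cong refl) (auto simp: indicator_def)
  also have "\<dots> = (\<integral>p. indicator A (fst (geo_flow r p)) \<partial>frameV) + (\<integral>p. indicator A (fst p) \<partial>frameV) - 2 * (\<integral>p. indicator A (fst p) * indicator A (fst (geo_flow r p)) \<partial>frameV)"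
    using i integrable_frameV_indicator(1)[of r] by simp
  also have "(\<integral>p. indicator A (fst (geo_flow r p)) \<partial>frameV) = (\<integral>p. indicator A (fst p) \<partial>(frameV :: ('a \<times> 'a) measure) :: real)"
    by (rule integral_frameV_flow[where F="\<lambda>p. indicator A (fst p)"]) measurable
  also have "(\<integral>p. indicator A (fst p) \<partial>(frameV :: ('a \<times> 'a) measure)) = (\<integral>p. indicator A (fst p) * indicator A (fst (geo_flow 0 p)) \<partial>(frameV :: ('a \<times> 'a) measure) :: real)"
    by (intro Bochner_Integration.integral_cong refl) (auto simp: indicator_def)
  finally show ?thesis
    unfolding frame_corr_def diff_divide_distrib[symmetric] using sigma_pos[of "DIM('a) - 2"] by simp
qed

text \<open>Dropping the indicator at the starting point leaves the difference between times r and
  s. Invariance moves time s to 0, and the estimate for \<open>flow_diff\<close> applies to r -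
  s.\<close>

lemma frame_corr_lipschitz:
  "\<bar>frame_corr A r - frame_corr A s\<bar> \<le> abs_mean TYPE('a) * V / sigma (DIM('a) - 2) * \<bar>r - s\<bar>"
proof -
  let ?u = "\<lambda>t p. indicator A (fst (geo_flow t p)) :: real"
  have i: "integrable (frameV :: ('a \<times> 'a) measure) (\<lambda>p. indicator A (fst p) * ?u t p)" for t
    using integrable_frameV_indicator(2)[of 0 t] by simp
  have "(\<integral>p. indicator A (fst p) * ?u r p \<partial>frameV) - (\<integral>p. indicator A (fst p) * ?u s p \<partial>frameV) =
      (\<integral>p. indicator A (fst p) * ?u r p - indicator A (fst p) * ?u s p \<partial>frameV)"
    using i by simp
  also have "\<bar>\<dots>\<bar> \<le> (\<integral>p. \<bar>indicator A (fst p) * ?u r p - indicator A (fst p) * ?u s p\<bar> \<partial>frameV)"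
    by (rule integral_abs_bound)
  also have "\<dots> \<le> (\<integral>p. \<bar>?u r p - ?u s p\<bar> \<partial>frameV)"
    using i integrable_frameV_indicator(1) by (intro integral_mono) (auto simp: indicator_def)
  also have "\<dots> = (\<integral>p. \<bar>?u (r - s) (geo_flow s p) - indicator A (fst (geo_flow s p))\<bar> \<partial>frameV)"
    by (simp add: geo_flow_add)
  also have "\<dots> = (\<integral>p. \<bar>?u (r - s) p - indicator A (fst p)\<bar> \<partial>frameV)"
    by (rule integral_frameV_flow[where F="\<lambda>p. \<bar>?u (r - s) p - indicator A (fst p)\<bar>"]) measurable
  also have "\<dots> = flow_diff A (r - s)" by (simp add: flow_diff_def)
  also have "\<dots> \<le> abs_mean TYPE('a) * V * \<bar>r - s\<bar>" by (rule flow_diff_le[OF dim A A_sub var_le])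
  finally have "\<bar>(\<integral>p. indicator A (fst p) * ?u r p \<partial>frameV) - (\<integral>p. indicator A (fst p) * ?u s p \<partial>frameV)\<bar> / sigma (DIM('a) - 2)
     \<le> abs_mean TYPE('a) * V * \<bar>r - s\<bar> / sigma (DIM('a) - 2)"
    using sigma_pos[of "DIM('a) - 2"] by (intro divide_right_mono) auto
  then show ?thesis
    using sigma_pos[of "DIM('a) - 2"] by (simp add: frame_corr_def abs_divide flip: diff_divide_distrib)
qed

lemma frame_corr_derivative:
  "(frame_corr A has_vector_derivative - (abs_mean TYPE('a) * V / (2 * sigma (DIM('a) - 2)))) (at_right 0)"
proof -
  let ?s = "sigma (DIM('a) - 2)"
  have s: "?s > 0" by (rule sigma_pos)
  have "((\<lambda>r. - (flow_diff A r / r) / (2 * ?s)) \<longlongrightarrow> - (abs_mean TYPE('a) * V) / (2 * ?s)) (at_right 0)"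
    using s by (intro tendsto_intros flow_diff_limit) simp
  moreover have "- (flow_diff A r / r) / (2 * ?s) = (frame_corr A r - frame_corr A 0) / (r - 0)" for r
  proof -
    have "flow_diff A r / (2 * ?s) = frame_corr A 0 - frame_corr A r" using s by (simp add: flow_diff_frame_corr)
    moreover have "- (flow_diff A r / r) / (2 * ?s) = - (flow_diff A r / (2 * ?s)) / r" by simp
    ultimately show ?thesis by (simp only: minus_diff_eq diff_0_right)
  qed
  ultimately have "(frame_corr A has_real_derivative - (abs_mean TYPE('a) * V) / (2 * ?s)) (at_right 0)"
    by (simp add: has_field_derivative_iff)
  then show ?thesis by (simp add: has_real_derivative_iff_has_vector_derivative)
qed

end

subsection \<open>Lipschitz functions on the real line\<close>

text \<open>On A the measure \<alpha> is at most p times \<beta>, yet arbitrarily small balls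
  through the exceptional points show a ratio above q. Disjoint such balls inside an open U with
  \<alpha>(U - A) \<le> e cover these points up to a negligible set by Vitali; their union W
  satisfies q \<beta>(W) \<le> p \<beta>(W \<inter> A) + e, so \<beta>(W \<inter> A) is at most e /
  (q - p). Both measures are kept general because their roles are exchanged in the second
  application.\<close>

lemma negligible_density_points:
  fixes \<alpha> \<beta> :: "real measure"
  assumes sa [measurable_cong]: "sets \<alpha> = sets borel" and sb [measurable_cong]: "sets \<beta> = sets borel"
    and fa: "emeasure \<alpha> {-R..R} < \<infinity>" and fb: "emeasure \<beta> {-R..R} < \<infinity>"
    and null: "\<And>T. T \<in> sets borel \<Longrightarrow> emeasure \<beta> T = 0 \<Longrightarrow> negligible T"
    and A [measurable]: "A \<in> sets borel" and AR: "A \<subseteq> {-R<..<R}" and p: "0 \<le> p" "p < q"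
    and le: "\<And>S. S \<in> sets borel \<Longrightarrow> S \<subseteq> A \<Longrightarrow> emeasure \<alpha> S \<le> ennreal p * emeasure \<beta> S"
  shows "negligible {x \<in> A. \<forall>d>0. \<exists>c r. 0 < r \<and> r < d \<and> x \<in> cball c r \<and> ennreal q * emeasure \<beta> (cball c r) < emeasure \<alpha> (cball c r)}"
    (is "negligible ?N")
proof -
  have spa: "space \<alpha> = UNIV" using sets_eq_imp_space_eq[OF sa] by simp
  have meas: "emeasure \<alpha> S < \<infinity>" "emeasure \<beta> S < \<infinity>" if "S \<subseteq> {-R..R}" for S
    using emeasure_mono[OF that, of \<alpha>] emeasure_mono[OF that, of \<beta>] fa fb by (auto simp: sa sb intro: le_less_trans)
  have step: "\<exists>W. W \<in> sets borel \<and> negligible (?N - W) \<and> emeasure \<beta> (W \<inter> A) \<le> ennreal (e / (q - p))" if e: "e > 0" for e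
  proof -
    \<comment> \<open>Outer regularity is available for finite measures, hence the restriction to a
      bounded interval.\<close>
    define \<alpha>' where "\<alpha>' = density \<alpha> (indicator {-R<..<R})"
    have sa': "sets \<alpha>' = sets borel" by (simp add: \<alpha>'_def sa)
    have em: "emeasure \<alpha>' S = emeasure \<alpha> ({-R<..<R} \<inter> S)" if "S \<in> sets borel" for S
      unfolding \<alpha>'_def using that by (intro emeasure_restricted) (auto simp: sa)
    have fin': "emeasure \<alpha>' (space \<alpha>') \<noteq> \<infinity>"
      using em[of UNIV] meas(1)[of "{-R<..<R}"] by (simp add: \<alpha>'_def spa less_top subset_iff)
    have "emeasure \<alpha>' A = (INF U\<in>{U. A \<subseteq> U \<and> open U}. emeasure \<alpha>' U)"
      by (rule outer_regular) (use sa' fin' A in auto)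
    moreover have "A \<subseteq> {-R..R}" using AR by auto
    then have fA: "emeasure \<alpha>' A < \<infinity>" using em[OF A] meas(1)[of A] AR by (simp add: Int_absorb1)
    then obtain a where "emeasure \<alpha>' A = ennreal a" "a \<ge> 0" by (metis ennreal_cases infinity_ennreal_def less_irrefl)
    then have "emeasure \<alpha>' A < emeasure \<alpha>' A + ennreal e"
      using e by (simp add: ennreal_plus[symmetric] ennreal_less_iff del: ennreal_plus)
    ultimately have "(INF U\<in>{U. A \<subseteq> U \<and> open U}. emeasure \<alpha>' U) < emeasure \<alpha>' A + ennreal e" by simp
    then obtain U0 where U0: "A \<subseteq> U0" "open U0" "emeasure \<alpha>' U0 < emeasure \<alpha>' A + ennreal e"
      by (auto simp: INF_less_iff)
    define U where "U = U0 \<inter> {-R<..<R}"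
    have U: "open U" "A \<subseteq> U" "U \<subseteq> {-R<..<R}" using U0 AR by (auto simp: U_def)
    have [measurable]: "U \<in> sets borel" using U(1) by simp
    have "emeasure \<alpha> U < emeasure \<alpha> A + ennreal e"
      using U0(3) em[of U0] em[OF A] U0(2) AR by (simp add: U_def Int_commute Int_absorb1 Int_absorb2)
    moreover have "emeasure \<alpha> U = emeasure \<alpha> A + emeasure \<alpha> (U - A)"
      using U(2) by (subst plus_emeasure) (auto simp: sa Un_absorb1)
    ultimately have UA: "emeasure \<alpha> (U - A) \<le> ennreal e"
      by (simp add: ennreal_add_left_cancel_less less_imp_le)
    define K where "K = {i :: real \<times> real. 0 < snd i \<and> cball (fst i) (snd i) \<subseteq> U \<and>
       ennreal q * emeasure \<beta> (cball (fst i) (snd i)) < emeasure \<alpha> (cball (fst i) (snd i))}"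
    obtain C where C: "countable C" "C \<subseteq> K" "pairwise (\<lambda>i j. disjnt (cball (fst i) (snd i)) (cball (fst j) (snd j))) C"
      "negligible (?N - (\<Union>i\<in>C. cball (fst i) (snd i)))"
    proof (rule Vitali_covering_theorem_cballs[of K snd ?N fst])
      show "0 < snd i" if "i \<in> K" for i using that by (auto simp: K_def)
      fix x d :: real assume x: "x \<in> ?N" and d: "0 < d"
      have "x \<in> U" using x U(2) by auto
      then obtain h where h: "h > 0" "cball x h \<subseteq> U" using U(1) open_contains_cball by blast
      obtain c r where cr: "0 < r" "r < min d (h / 2)" "x \<in> cball c r" "ennreal q * emeasure \<beta> (cball c r) < emeasure \<alpha> (cball c r)"
      proof -
        have "0 < min d (h / 2)" using d h(1) by simp
        then show thesis using x that by blast
      qed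
      have "cball c r \<subseteq> cball x h"
      proof
        fix y assume "y \<in> cball c r"
        then show "y \<in> cball x h" using cr(2,3) by (auto simp: dist_real_def)
      qed
      then show "\<exists>i. i \<in> K \<and> x \<in> cball (fst i) (snd i) \<and> snd i < d"
        using cr h by (intro exI[of _ "(c, r)"]) (auto simp: K_def)
    qed auto
    define W where "W = (\<Union>i\<in>C. cball (fst i) (snd i))"
    have W [measurable]: "W \<in> sets borel" unfolding W_def using C(1) by (intro sets.countable_UN'') auto
    have WU: "W \<subseteq> U" using C(2) by (auto simp: W_def K_def)
    have dis: "disjoint_family_on (\<lambda>i. cball (fst i) (snd i)) C"
      using C(3) by (auto simp: disjoint_family_on_def pairwise_def disjnt_def)
    have sum\<alpha>: "emeasure \<alpha> W = (\<integral>\<^sup>+i. emeasure \<alpha> (cball (fst i) (snd i)) \<partial>count_space C)"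
      unfolding W_def by (rule emeasure_UN_countable) (auto simp: sa C(1) dis)
    have sum\<beta>: "emeasure \<beta> W = (\<integral>\<^sup>+i. emeasure \<beta> (cball (fst i) (snd i)) \<partial>count_space C)"
      unfolding W_def by (rule emeasure_UN_countable) (auto simp: sb C(1) dis)
    have "ennreal q * emeasure \<beta> W = (\<integral>\<^sup>+i. ennreal q * emeasure \<beta> (cball (fst i) (snd i)) \<partial>count_space C)"
      unfolding sum\<beta> by (rule nn_integral_cmult[symmetric]) simp
    also have "\<dots> \<le> emeasure \<alpha> W"
      unfolding sum\<alpha> using C(2) by (intro nn_integral_mono) (auto simp: K_def intro: less_imp_le)
    also have "\<dots> \<le> emeasure \<alpha> (W \<inter> A) + emeasure \<alpha> (U - A)"
      using WU by (intro order_trans[OF emeasure_mono emeasure_subadditive]) (auto simp: sa)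
    also have "\<dots> \<le> ennreal p * emeasure \<beta> (W \<inter> A) + ennreal e"
      by (intro add_mono le UA) auto
    finally have main: "ennreal q * emeasure \<beta> W \<le> ennreal p * emeasure \<beta> (W \<inter> A) + ennreal e" .
    have "emeasure \<beta> (W \<inter> A) \<le> emeasure \<beta> W" by (rule emeasure_mono) (auto simp: sb)
    then have "ennreal q * emeasure \<beta> (W \<inter> A) \<le> ennreal q * emeasure \<beta> W" by (rule mult_left_mono) simp
    with main have m2: "ennreal q * emeasure \<beta> (W \<inter> A) \<le> ennreal p * emeasure \<beta> (W \<inter> A) + ennreal e" by simp
    have "W \<inter> A \<subseteq> {-R..R}" using AR by auto
    then obtain b where b: "emeasure \<beta> (W \<inter> A) = ennreal b" "b \<ge> 0"
      using meas(2) by (metis ennreal_cases infinity_ennreal_def less_irrefl)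
    have "q * b \<le> p * b + e"
      using m2 p e b(2) unfolding b(1) by (simp add: ennreal_mult[symmetric] ennreal_plus[symmetric] del: ennreal_plus)
    then have "b \<le> e / (q - p)" using p by (simp add: field_simps)
    then show ?thesis using W C(4) by (intro exI[of _ W]) (auto simp: W_def[symmetric] b(1) intro: ennreal_leI)
  qed
  \<comment> \<open>With errors 1/(n + 1) the sets W n meet within A in a \<beta>-null set, and an
    exceptional point outside this intersection lies outside some W n.\<close>
  have "\<exists>W. \<forall>n::nat. W n \<in> sets borel \<and> negligible (?N - W n) \<and> emeasure \<beta> (W n \<inter> A) \<le> ennreal ((1 / real (Suc n)) / (q - p))"
    by (intro choice allI step) simp
  then obtain W where W: "\<And>n. W n \<in> sets borel" "\<And>n. negligible (?N - W n)"
    "\<And>n. emeasure \<beta> (W n \<inter> A) \<le> ennreal ((1 / real (Suc n)) / (q - p))" by blast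
  note [measurable] = W(1)
  have "emeasure \<beta> (\<Inter>n. W n \<inter> A) \<le> ennreal ((1 / real (Suc n)) / (q - p))" for n
    by (rule order_trans[OF emeasure_mono W(3)[of n]]) (auto simp: sb)
  moreover have "(\<lambda>n. ennreal ((1 / real (Suc n)) / (q - p))) \<longlonglongrightarrow> ennreal (0 / (q - p))"
    by (intro tendsto_ennrealI tendsto_divide tendsto_const LIMSEQ_Suc[OF lim_1_over_n]) (use p in auto)
  ultimately have "emeasure \<beta> (\<Inter>n. W n \<inter> A) \<le> ennreal (0 / (q - p))"
    by (intro LIMSEQ_le_const) auto
  then have "negligible (\<Inter>n. W n \<inter> A)" by (intro null) auto
  moreover have "negligible (\<Union>n. ?N - W n)" by (rule negligible_countable_Union) (use W(2) in auto)
  ultimately have "negligible ((\<Inter>n. W n \<inter> A) \<union> (\<Union>n. ?N - W n))" by (rule negligible_Un)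
  then show ?thesis by (rule negligible_subset) auto
qed

text \<open>
  The density \<open>g\<close> is that of the image of Lebesgue measure under the inverse of \<open>\<phi>\<close>; a Vitali covering shows
  that \<open>\<phi>\<close> is differentiable with derivative \<open>g\<close> almost everywhere.
\<close>

lemma increasing_bilipschitz_AE_derivative:
  fixes \<phi> :: "real \<Rightarrow> real"
  assumes lo: "\<And>x y. x \<le> y \<Longrightarrow> y - x \<le> \<phi> y - \<phi> x" and hi: "\<And>x y. x \<le> y \<Longrightarrow> \<phi> y - \<phi> x \<le> H * (y - x)"
  obtains g :: "real \<Rightarrow> ennreal" where "g \<in> borel_measurable borel"
    "\<And>a b. a \<le> b \<Longrightarrow> (\<integral>\<^sup>+x. g x * indicator {a..b} x \<partial>lborel) = ennreal (\<phi> b - \<phi> a)"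
    "AE x in lborel. g x < \<infinity> \<and> (\<phi> has_real_derivative enn2real (g x)) (at x)"
proof -
  have H: "H \<ge> 1" using lo[of 0 1] hi[of 0 1] by simp
  have lip: "\<bar>\<phi> x - \<phi> y\<bar> \<le> H * \<bar>x - y\<bar>" for x y
    using hi[of x y] hi[of y x] lo[of x y] lo[of y x] by (cases "x \<le> y") auto
  have mono: "strict_mono \<phi>"
  proof (rule strict_monoI)
    fix x y :: real assume "x < y" then show "\<phi> x < \<phi> y" using lo[of x y] by simp
  qed
  then have inj: "inj \<phi>" by (rule strict_mono_imp_inj_on)
  have cont: "continuous_on UNIV \<phi>"
  proof (rule lipschitz_on_continuous_on)
    show "H-lipschitz_on UNIV \<phi>" using lip H by (auto simp: lipschitz_on_def dist_real_def)
  qed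
  have surj: "\<exists>x. \<phi> x = y" for y
  proof -
    define b where "b = \<bar>y\<bar> + \<bar>\<phi> 0\<bar>"
    have "b \<ge> 0" by (simp add: b_def)
    then have "\<phi> (- b) \<le> \<phi> 0 - b" "\<phi> 0 + b \<le> \<phi> b" using lo[of "- b" 0] lo[of 0 b] by auto
    moreover have "\<phi> 0 - b \<le> y" "y \<le> \<phi> 0 + b" unfolding b_def by linarith+
    ultimately have "\<phi> (- b) \<le> y" "y \<le> \<phi> b" by linarith+
    then show ?thesis using IVT'[of \<phi> "- b" y b] continuous_on_subset[OF cont] by (auto simp: b_def)
  qed
  define \<psi> where "\<psi> = inv \<phi>"
  have \<phi>\<psi>: "\<phi> (\<psi> y) = y" for y using surj by (simp add: \<psi>_def f_inv_into_f image_iff) (metis f_inv_into_f rangeI)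
  have \<psi>\<phi>: "\<psi> (\<phi> x) = x" for x by (simp add: \<psi>_def inj)
  have \<psi>lip: "\<bar>\<psi> x - \<psi> y\<bar> \<le> \<bar>x - y\<bar>" for x y
    using lo[of "\<psi> x" "\<psi> y"] lo[of "\<psi> y" "\<psi> x"] by (cases "\<psi> x \<le> \<psi> y") (auto simp: \<phi>\<psi>)
  have "continuous_on UNIV \<psi>"
  proof (rule lipschitz_on_continuous_on)
    show "1-lipschitz_on UNIV \<psi>" using \<psi>lip by (auto simp: lipschitz_on_def dist_real_def)
  qed
  then have [measurable]: "\<psi> \<in> borel_measurable borel" by (rule borel_measurable_continuous_onI)
  \<comment> \<open>Preimages under \<psi> are images under \<phi>, so \<mu> assigns to an interval
    the increment of \<phi> over it.\<close>
  define \<mu> where "\<mu> = distr lborel borel \<psi>"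
  have sm [measurable_cong]: "sets \<mu> = sets borel" by (simp add: \<mu>_def)
  have em: "emeasure \<mu> S = emeasure lborel (\<psi> -` S)" if "S \<in> sets borel" for S
    using that by (simp add: \<mu>_def emeasure_distr)
  have vim: "\<psi> -` S = \<phi> ` S" for S using \<phi>\<psi> \<psi>\<phi> by (auto intro!: image_eqI[where x="\<psi> _"]) 
  have iv: "emeasure \<mu> {a..b} = ennreal (\<phi> b - \<phi> a)" if "a \<le> b" for a b
  proof -
    have "\<psi> -` {a..b} = {\<phi> a..\<phi> b}"
    proof (intro set_eqI iffI)
      fix y assume "y \<in> \<psi> -` {a..b}"
      then have "a \<le> \<psi> y" "\<psi> y \<le> b" by auto
      then show "y \<in> {\<phi> a..\<phi> b}" using strict_mono_less_eq[OF mono] \<phi>\<psi> by (metis atLeastAtMost_iff)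
    next
      fix y assume "y \<in> {\<phi> a..\<phi> b}"
      then show "y \<in> \<psi> -` {a..b}" using strict_mono_less_eq[OF mono] \<phi>\<psi> by (metis atLeastAtMost_iff vimageI)
    qed
    then show ?thesis using em[of "{a..b}"] strict_mono_less_eq[OF mono, of a b] that by simp
  qed
  have lipneg: "negligible (f ` S)" if "negligible S" "\<And>x y. \<bar>f x - f y\<bar> \<le> B * \<bar>x - y\<bar>" for f :: "real \<Rightarrow> real" and S B
    by (rule negligible_locally_Lipschitz_image[OF _ that(1)])
      (use that(2) in \<open>auto intro!: exI[of _ UNIV] exI[of _ B]\<close>)
  have ac: "absolutely_continuous lborel \<mu>"
    unfolding absolutely_continuous_def
  proof
    fix S :: "real set" assume S: "S \<in> null_sets lborel"
    then have Sb: "S \<in> sets borel" by (auto simp: null_sets_def)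
    have "negligible S" using S by (simp add: negligible_iff_null_sets null_sets_completionI)
    then have "negligible (\<phi> ` S)" by (rule lipneg) (rule lip)
    then have "negligible (\<psi> -` S)" by (simp add: vim)
    moreover have "\<psi> -` S \<in> sets borel" using measurable_sets[of \<psi> borel borel S] Sb by simp
    ultimately have "emeasure lborel (\<psi> -` S) = 0"
      by (simp add: negligible_iff_null_sets null_sets_def)
    then show "S \<in> null_sets \<mu>" using Sb by (auto intro!: null_setsI simp: em sm)
  qed
  have null\<mu>: "negligible T" if T: "T \<in> sets borel" "emeasure \<mu> T = 0" for T
  proof -
    have "\<psi> -` T \<in> null_sets lborel" using T measurable_sets[of \<psi> borel borel T] by (auto intro!: null_setsI simp: em)
    then have "negligible (\<psi> -` T)" by (simp add: negligible_iff_null_sets null_sets_completionI)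
    then have "negligible (\<psi> ` (\<psi> -` T))" by (rule lipneg[where B=1]) (use \<psi>lip in simp)
    moreover have "\<psi> ` (\<psi> -` T) = T" using \<psi>\<phi> by (metis surj_image_vimage_eq surj_def)
    ultimately show ?thesis by simp
  qed
  obtain g where g [measurable]: "g \<in> borel_measurable lborel" and dens: "density lborel g = \<mu>"
    using sigma_finite_measure.Radon_Nikodym[OF sigma_finite_lborel ac] by (auto simp: sm)
  have gb [measurable]: "g \<in> borel_measurable borel" using g by simp
  have int: "emeasure \<mu> S = (\<integral>\<^sup>+x. g x * indicator S x \<partial>lborel)" if "S \<in> sets borel" for S
    using that by (subst dens[symmetric], subst emeasure_density) auto
  have fin: "emeasure \<mu> {-R..R} < \<infinity>" for R using iv[of "- R" R] by (cases "- R \<le> R") auto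
  have finl: "emeasure lborel {-R..R} < \<infinity>" for R :: real by (rule emeasure_lborel_Icc_eq[THEN ssubst]) auto
  \<comment> \<open>The bad points: density below p although small intervals show slopes above q. In
    \<open>dn\<close> the density exceeds q although small intervals show slopes below p, written
    with 1 / p so that the measures exchange their roles.\<close>
  define up where "up R p q = {x \<in> {x. g x < ennreal p} \<inter> {-R<..<R}. \<forall>d>0. \<exists>c r. 0 < r \<and> r < d \<and> x \<in> cball c r \<and> ennreal q * emeasure lborel (cball c r) < emeasure \<mu> (cball c r)}" for R p q
  define dn where "dn R p q = {x \<in> {x. ennreal q < g x} \<inter> {-R<..<R}. \<forall>d>0. \<exists>c r. 0 < r \<and> r < d \<and> x \<in> cball c r \<and> ennreal (1 / p) * emeasure \<mu> (cball c r) < emeasure lborel (cball c r)}" for R p q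
  have up: "negligible (up R p q)" if "0 \<le> p" "p < q" for R p q
    unfolding up_def
  proof (rule negligible_density_points)
    fix S assume S [measurable]: "S \<in> sets borel" and sub: "S \<subseteq> {x. g x < ennreal p} \<inter> {-R<..<R}"
    have "emeasure \<mu> S \<le> (\<integral>\<^sup>+x. ennreal p * indicator S x \<partial>lborel)"
      unfolding int[OF S] using sub by (intro nn_integral_mono) (auto simp: indicator_def intro: less_imp_le)
    then show "emeasure \<mu> S \<le> ennreal p * emeasure lborel S" by (simp add: nn_integral_cmult_indicator)
  qed (use that fin finl in \<open>auto simp: sm negligible_iff_null_sets intro!: null_sets_completionI null_setsI\<close>)
  have dn: "negligible (dn R p q)" if "0 < p" "p < q" for R p q
    unfolding dn_def
  proof (rule negligible_density_points)
    fix S assume S [measurable]: "S \<in> sets borel" and sub: "S \<subseteq> {x. ennreal q < g x} \<inter> {-R<..<R}"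
    have "ennreal q * emeasure lborel S = (\<integral>\<^sup>+x. ennreal q * indicator S x \<partial>lborel)" by (simp add: nn_integral_cmult_indicator)
    also have "\<dots> \<le> emeasure \<mu> S"
      unfolding int[OF S] using sub by (intro nn_integral_mono) (auto simp: indicator_def intro: less_imp_le)
    finally have "ennreal (1 / q) * (ennreal q * emeasure lborel S) \<le> ennreal (1 / q) * emeasure \<mu> S" by (rule mult_left_mono) simp
    then show "emeasure lborel S \<le> ennreal (1 / q) * emeasure \<mu> S"
      using that by (simp add: mult.assoc[symmetric] ennreal_mult[symmetric])
  next
    show "1 / q < 1 / p" using that by (simp add: frac_less2)
  qed (use that fin finl null\<mu> in \<open>auto simp: sm\<close>)
  have slope: "(\<phi> y - \<phi> x) / (y - x) \<ge> 0" for x y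
    using lo[of x y] lo[of y x] by (cases "x \<le> y") (auto simp: zero_le_divide_iff)
  \<comment> \<open>The interval with endpoints x and y is a ball around the midpoint. This is why
    the covering result speaks of balls containing x instead of balls centred at x.\<close>
  have ball: "\<exists>c r. 0 < r \<and> r < d \<and> x \<in> cball c r \<and> emeasure lborel (cball c r) = ennreal \<bar>y - x\<bar> \<and> emeasure \<mu> (cball c r) = ennreal ((\<phi> y - \<phi> x) / (y - x) * \<bar>y - x\<bar>)"
    if y: "y \<noteq> x" "\<bar>y - x\<bar> < d" for x y d
  proof -
    define c r where "c = (x + y) / 2" and "r = \<bar>y - x\<bar> / 2"
    have cb: "cball c r = {min x y..max x y}" by (auto simp: c_def r_def cball_eq_atLeastAtMost min_def max_def abs_if field_simps)
    have "emeasure \<mu> (cball c r) = ennreal (\<phi> (max x y) - \<phi> (min x y))" unfolding cb by (rule iv) simp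
    also have "\<phi> (max x y) - \<phi> (min x y) = (\<phi> y - \<phi> x) / (y - x) * \<bar>y - x\<bar>"
      using y(1) by (cases "x \<le> y") (auto simp: field_simps)
    finally have "emeasure \<mu> (cball c r) = ennreal ((\<phi> y - \<phi> x) / (y - x) * \<bar>y - x\<bar>)" .
    moreover have "emeasure lborel (cball c r) = ennreal \<bar>y - x\<bar>" unfolding cb by (cases "x \<le> y") auto
    moreover have "x \<in> cball c r" unfolding cb by simp
    ultimately show ?thesis using y by (intro exI[of _ c] exI[of _ r]) (auto simp: r_def)
  qed
  have "AE x in lborel. g x \<noteq> \<infinity>"
  proof -
    have "sigma_finite_measure \<mu>"
    proof
      show "\<exists>A. countable A \<and> A \<subseteq> sets \<mu> \<and> \<Union>A = space \<mu> \<and> (\<forall>a\<in>A. emeasure \<mu> a \<noteq> \<infinity>)"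
      proof (intro exI[of _ "range (\<lambda>n. {- real n..real n})"] conjI ballI)
        have "\<exists>n. x \<in> {- real n..real n}" for x
          using real_arch_simple[of "\<bar>x\<bar>"] by (simp add: abs_le_iff) (metis minus_le_iff)
        then show "\<Union>(range (\<lambda>n. {- real n..real n})) = space \<mu>" unfolding \<mu>_def by auto
        show "emeasure \<mu> a \<noteq> \<infinity>" if "a \<in> range (\<lambda>n. {- real n..real n})" for a using that fin by (auto simp: less_top)
      qed (auto simp: sm)
    qed
    then show ?thesis using sigma_finite_measure.sigma_finite_iff_density_finite[OF sigma_finite_lborel g] dens by simp
  qed
  moreover have "AE x in lborel. \<forall>n::nat. \<forall>p::rat. \<forall>q::rat. 0 \<le> p \<longrightarrow> p < q \<longrightarrow> x \<notin> up (real n) (of_rat p) (of_rat q)"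
  proof -
    have "AE x in lebesgue. x \<notin> up (real n) (of_rat p) (of_rat q)" if "0 \<le> p" "p < q" for n :: nat and p q :: rat
      using up[of "of_rat p" "of_rat q" "real n"] that by (intro AE_not_in) (simp add: negligible_iff_null_sets of_rat_less)
    then have "AE x in lebesgue. \<forall>n::nat. \<forall>p::rat. \<forall>q::rat. 0 \<le> p \<longrightarrow> p < q \<longrightarrow> x \<notin> up (real n) (of_rat p) (of_rat q)"
      unfolding AE_all_countable by auto
    then show ?thesis by (simp add: AE_completion_iff)
  qed
  moreover have "AE x in lborel. \<forall>n::nat. \<forall>p::rat. \<forall>q::rat. 0 < p \<longrightarrow> p < q \<longrightarrow> x \<notin> dn (real n) (of_rat p) (of_rat q)"
  proof -
    have "AE x in lebesgue. x \<notin> dn (real n) (of_rat p) (of_rat q)" if "0 < p" "p < q" for n :: nat and p q :: rat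
      using dn[of "of_rat p" "of_rat q" "real n"] that by (intro AE_not_in) (simp add: negligible_iff_null_sets of_rat_less)
    then have "AE x in lebesgue. \<forall>n::nat. \<forall>p::rat. \<forall>q::rat. 0 < p \<longrightarrow> p < q \<longrightarrow> x \<notin> dn (real n) (of_rat p) (of_rat q)"
      unfolding AE_all_countable by auto
    then show ?thesis by (simp add: AE_completion_iff)
  qed
  ultimately have AE: "AE x in lborel. g x < \<infinity> \<and> (\<phi> has_real_derivative enn2real (g x)) (at x)"
  proof eventually_elim
    fix x assume gx: "g x \<noteq> \<infinity>"
      and u: "\<forall>n::nat. \<forall>p::rat. \<forall>q::rat. 0 \<le> p \<longrightarrow> p < q \<longrightarrow> x \<notin> up (real n) (of_rat p) (of_rat q)"
      and l: "\<forall>n::nat. \<forall>p::rat. \<forall>q::rat. 0 < p \<longrightarrow> p < q \<longrightarrow> x \<notin> dn (real n) (of_rat p) (of_rat q)"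
    define \<gamma> where "\<gamma> = enn2real (g x)"
    have \<gamma>: "g x = ennreal \<gamma>" "\<gamma> \<ge> 0" using gx by (auto simp: \<gamma>_def less_top)
    obtain n :: nat where n: "x \<in> {- real n<..<real n}"
    proof -
      obtain n where "\<bar>x\<bar> < real n" using reals_Archimedean2 by blast
      then show thesis by (intro that[of n]) auto
    qed
    have "((\<lambda>y. (\<phi> y - \<phi> x) / (y - x)) \<longlongrightarrow> \<gamma>) (at x)"
    proof (rule tendstoI)
      fix e :: real assume e: "e > 0"
      obtain p where p: "\<gamma> < of_rat p" "of_rat p < \<gamma> + e" using of_rat_dense[of \<gamma> "\<gamma> + e"] e by auto
      obtain q where q: "of_rat p < (of_rat q :: real)" "of_rat q < \<gamma> + e" using of_rat_dense[OF p(2)] by auto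
      have "0 < (of_rat p :: real)" using p(1) \<gamma>(2) by linarith
      then have p0: "0 \<le> p" by simp
      have "p < q" using q(1) by (simp add: of_rat_less)
      then have "x \<notin> up (real n) (of_rat p) (of_rat q)" using u p0 by blast
      moreover have "g x < ennreal (of_rat p)" using p(1) \<gamma> by (simp add: ennreal_less_iff)
      ultimately obtain d1 where d1: "d1 > 0" "\<And>c r. 0 < r \<Longrightarrow> r < d1 \<Longrightarrow> x \<in> cball c r \<Longrightarrow> \<not> ennreal (of_rat q) * emeasure lborel (cball c r) < emeasure \<mu> (cball c r)"
        using n by (auto simp: up_def)
      have upper: "(\<phi> y - \<phi> x) / (y - x) < \<gamma> + e" if y: "y \<noteq> x" "\<bar>y - x\<bar> < d1" for y
      proof -
        obtain c r where cr: "0 < r" "r < d1" "x \<in> cball c r" "emeasure lborel (cball c r) = ennreal \<bar>y - x\<bar>"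
          "emeasure \<mu> (cball c r) = ennreal ((\<phi> y - \<phi> x) / (y - x) * \<bar>y - x\<bar>)" using ball[OF y] by blast
        have "ennreal ((\<phi> y - \<phi> x) / (y - x) * \<bar>y - x\<bar>) \<le> ennreal (of_rat q) * ennreal \<bar>y - x\<bar>"
          using d1(2)[OF cr(1-3)] by (simp add: cr not_less)
        moreover have q0: "(of_rat q :: real) \<ge> 0" using q(1) p(1) \<gamma>(2) by linarith
        ultimately have "(\<phi> y - \<phi> x) / (y - x) * \<bar>y - x\<bar> \<le> of_rat q * \<bar>y - x\<bar>"
          by (simp add: ennreal_mult[symmetric] ennreal_le_iff)
        then have "(\<phi> y - \<phi> x) / (y - x) \<le> of_rat q" using y(1) by (subst (asm) mult_le_cancel_right_pos) auto
        then show ?thesis using q(2) by simp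
      qed
      have "\<exists>d2>0. \<forall>y. y \<noteq> x \<longrightarrow> \<bar>y - x\<bar> < d2 \<longrightarrow> \<gamma> - e < (\<phi> y - \<phi> x) / (y - x)"
      \<comment> \<open>A negative lower bound holds since slopes are nonnegative. Otherwise the
        rationals below \<gamma> can be chosen positive, as the reciprocal in \<open>dn\<close>
        demands.\<close>
      proof (cases "\<gamma> - e < 0")
        case True
        have "\<gamma> - e < (\<phi> y - \<phi> x) / (y - x)" for y by (rule less_le_trans[OF True slope])
        then show ?thesis by (intro exI[of _ 1]) auto
      next
        case False
        obtain b where b: "\<gamma> - e < of_rat b" "of_rat b < \<gamma>" using of_rat_dense[of "\<gamma> - e" \<gamma>] e by auto
        obtain a where a: "\<gamma> - e < of_rat a" "of_rat a < (of_rat b :: real)" using of_rat_dense[OF b(1)] by auto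
        have a0: "0 < (of_rat a :: real)" using a(1) False by linarith
        then have "0 < a" "a < b" using a by (simp_all add: of_rat_less)
        then have "x \<notin> dn (real n) (of_rat a) (of_rat b)" using l by blast
        moreover have "ennreal (of_rat b) < g x" using b(2) a0 a(2) \<gamma>(2) unfolding \<gamma>(1) by (intro ennreal_lessI) linarith+
        ultimately obtain d2 where d2: "d2 > 0" "\<And>c r. 0 < r \<Longrightarrow> r < d2 \<Longrightarrow> x \<in> cball c r \<Longrightarrow> \<not> ennreal (1 / of_rat a) * emeasure \<mu> (cball c r) < emeasure lborel (cball c r)"
          using n by (auto simp: dn_def)
        have "\<gamma> - e < (\<phi> y - \<phi> x) / (y - x)" if y: "y \<noteq> x" "\<bar>y - x\<bar> < d2" for y
        proof -
          obtain c r where cr: "0 < r" "r < d2" "x \<in> cball c r" "emeasure lborel (cball c r) = ennreal \<bar>y - x\<bar>"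
            "emeasure \<mu> (cball c r) = ennreal ((\<phi> y - \<phi> x) / (y - x) * \<bar>y - x\<bar>)" using ball[OF y] by blast
          have q0: "(\<phi> y - \<phi> x) / (y - x) * \<bar>y - x\<bar> \<ge> 0" by (intro mult_nonneg_nonneg slope) simp
          have "ennreal \<bar>y - x\<bar> \<le> ennreal (1 / of_rat a) * ennreal ((\<phi> y - \<phi> x) / (y - x) * \<bar>y - x\<bar>)"
            using d2(2)[OF cr(1-3)] by (simp only: cr not_less)
          also have "\<dots> = ennreal (1 / of_rat a * ((\<phi> y - \<phi> x) / (y - x) * \<bar>y - x\<bar>))"
            using a0 q0 by (intro ennreal_mult[symmetric]) auto
          finally have "\<bar>y - x\<bar> \<le> 1 / of_rat a * ((\<phi> y - \<phi> x) / (y - x) * \<bar>y - x\<bar>)"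
            by (subst (asm) ennreal_le_iff[OF mult_nonneg_nonneg[OF _ q0]]) (use a0 in auto)
          then have "1 * \<bar>y - x\<bar> \<le> (1 / of_rat a * ((\<phi> y - \<phi> x) / (y - x))) * \<bar>y - x\<bar>" by (simp only: mult.assoc mult_1)
          then have "1 \<le> 1 / of_rat a * ((\<phi> y - \<phi> x) / (y - x))" using y(1) by (subst (asm) mult_le_cancel_right_pos) auto
          moreover have "a \<le> X" if "1 \<le> 1 / a * X" "0 < a" for a X :: real using that by (simp add: field_simps)
          ultimately have "of_rat a \<le> (\<phi> y - \<phi> x) / (y - x)" using a0 by blast
          then show ?thesis using a(1) by simp
        qed
        then show ?thesis using d2(1) by blast
      qed
      then obtain d2 where d2: "d2 > 0" "\<And>y. y \<noteq> x \<Longrightarrow> \<bar>y - x\<bar> < d2 \<Longrightarrow> \<gamma> - e < (\<phi> y - \<phi> x) / (y - x)" by blast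
      show "\<forall>\<^sub>F y in at x. dist ((\<phi> y - \<phi> x) / (y - x)) \<gamma> < e"
        unfolding eventually_at
      proof (intro exI[of _ "min d1 d2"] conjI ballI impI)
        fix y assume "y \<noteq> x \<and> dist y x < min d1 d2"
        then have "y \<noteq> x" "\<bar>y - x\<bar> < d1" "\<bar>y - x\<bar> < d2" by (auto simp: dist_real_def)
        then show "dist ((\<phi> y - \<phi> x) / (y - x)) \<gamma> < e" using upper[of y] d2(2)[of y] by (simp add: dist_real_def abs_less_iff)
      qed (use d1 d2 in auto)
    qed
    then show "g x < \<infinity> \<and> (\<phi> has_real_derivative enn2real (g x)) (at x)"
      using gx by (simp add: has_field_derivative_iff \<gamma>_def less_top)
  qed
  show ?thesis
  proof (rule that[OF gb _ AE])
    fix a b :: real assume "a \<le> b"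
    then show "(\<integral>\<^sup>+x. g x * indicator {a..b} x \<partial>lborel) = ennreal (\<phi> b - \<phi> a)" using int[of "{a..b}"] iv by simp
  qed
qed

text \<open>Adding (L + 1) x turns F into an increasing function with slopes between 1 and 2 L + 1;
  the linear part is removed again from density and derivative.\<close>

theorem lipschitz_AE_derivative:
  fixes F :: "real \<Rightarrow> real"
  assumes lip: "\<And>x y. \<bar>F x - F y\<bar> \<le> L * \<bar>x - y\<bar>"
  obtains g :: "real \<Rightarrow> real" where "g \<in> borel_measurable borel" "\<And>x. \<bar>g x\<bar> \<le> L"
    "\<And>a b. a \<le> b \<Longrightarrow> (LINT x|lborel. indicator {a..b} x * g x) = F b - F a"
    "AE x in lborel. (F has_real_derivative g x) (at x)"
proof -
  have L: "L \<ge> 0" using lip[of 1 0] by (simp add: order_trans[OF abs_ge_zero])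
  define \<phi> where "\<phi> x = F x + (L + 1) * x" for x
  have "\<exists>g :: real \<Rightarrow> ennreal. g \<in> borel_measurable borel \<and>
    (\<forall>a b. a \<le> b \<longrightarrow> (\<integral>\<^sup>+x. g x * indicator {a..b} x \<partial>lborel) = ennreal (\<phi> b - \<phi> a)) \<and>
    (AE x in lborel. g x < \<infinity> \<and> (\<phi> has_real_derivative enn2real (g x)) (at x))"
  proof (rule increasing_bilipschitz_AE_derivative[of \<phi> "2 * L + 1"])
    show "y - x \<le> \<phi> y - \<phi> x" "\<phi> y - \<phi> x \<le> (2 * L + 1) * (y - x)" if "x \<le> y" for x y
      using lip[of y x] that by (auto simp: \<phi>_def abs_le_iff algebra_simps)
  qed blast
  then obtain g where g [measurable]: "g \<in> borel_measurable borel"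
    and gi: "\<And>a b. a \<le> b \<Longrightarrow> (\<integral>\<^sup>+x. g x * indicator {a..b} x \<partial>lborel) = ennreal (\<phi> b - \<phi> a)"
    and gd: "AE x in lborel. g x < \<infinity> \<and> (\<phi> has_real_derivative enn2real (g x)) (at x)" by blast
  define h0 where "h0 x = enn2real (g x) - (L + 1)" for x
  \<comment> \<open>The density is determined almost everywhere only; clamping makes the bound L
    hold at every point and changes nothing where F is differentiable with derivative h0.\<close>
  define h where "h x = max (- L) (min L (h0 x))" for x
  have [measurable]: "h0 \<in> borel_measurable borel" "h \<in> borel_measurable borel" unfolding h_def h0_def by measurable
  have hd: "AE x in lborel. g x < \<infinity> \<and> h x = h0 x \<and> (F has_real_derivative h x) (at x)"
    using gd
  proof eventually_elim
    fix x assume x: "g x < \<infinity> \<and> (\<phi> has_real_derivative enn2real (g x)) (at x)"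
    have "((\<lambda>x. \<phi> x - (L + 1) * x) has_real_derivative enn2real (g x) - (L + 1)) (at x)"
      using x by (auto intro!: derivative_eq_intros)
    then have d: "(F has_real_derivative h0 x) (at x)" by (simp add: \<phi>_def h0_def)
    then have lim: "((\<lambda>y. \<bar>(F y - F x) / (y - x)\<bar>) \<longlongrightarrow> \<bar>h0 x\<bar>) (at x)"
      by (intro tendsto_rabs) (simp add: has_field_derivative_iff)
    have "\<bar>h0 x\<bar> \<le> L"
    proof (rule tendsto_upperbound[OF lim])
      show "\<forall>\<^sub>F y in at x. \<bar>(F y - F x) / (y - x)\<bar> \<le> L"
        unfolding eventually_at_filter using lip by (auto simp: abs_divide divide_le_eq intro!: always_eventually)
    qed simp
    then have "h x = h0 x" by (auto simp: h_def)
    then show "g x < \<infinity> \<and> h x = h0 x \<and> (F has_real_derivative h x) (at x)" using d x by simp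
  qed
  show ?thesis
  proof (rule that[of h])
    show "\<bar>h x\<bar> \<le> L" for x using L by (auto simp: h_def)
    show "AE x in lborel. (F has_real_derivative h x) (at x)" by (rule eventually_mono[OF hd]) blast
    fix a b :: real assume ab: "a \<le> b"
    have "(LINT x|lborel. indicator {a..b} x * (h x + (L + 1))) = \<phi> b - \<phi> a"
    proof -
      have "(LINT x|lborel. indicator {a..b} x * (h x + (L + 1))) = enn2real (\<integral>\<^sup>+x. ennreal (indicator {a..b} x * (h x + (L + 1))) \<partial>lborel)"
        by (rule integral_eq_nn_integral) (use L in \<open>auto simp: h_def\<close>)
      also have "(\<integral>\<^sup>+x. ennreal (indicator {a..b} x * (h x + (L + 1))) \<partial>lborel) = (\<integral>\<^sup>+x. g x * indicator {a..b} x \<partial>lborel)"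
        by (intro nn_integral_cong_AE eventually_mono[OF hd]) (auto simp: h0_def indicator_def)
      also have "\<dots> = ennreal (\<phi> b - \<phi> a)" by (rule gi[OF ab])
      also have "enn2real \<dots> = \<phi> b - \<phi> a"
        using lip[of b a] ab by (intro enn2real_ennreal) (auto simp: \<phi>_def abs_le_iff algebra_simps)
      finally show ?thesis .
    qed
    moreover have "(LINT x|lborel. indicator {a..b} x * (h x + (L + 1))) = (LINT x|lborel. indicator {a..b} x * h x) + (L + 1) * (b - a)"
    proof -
      have i: "integrable lborel (\<lambda>x. indicator {a..b} x * h x)"
      proof (rule Bochner_Integration.integrable_bound[of _ "\<lambda>x. L * indicator {a..b} x"])
        show "integrable lborel (\<lambda>x. L * indicator {a..b} x :: real)" using ab by (intro integrable_mult_right integrable_real_indicator) auto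
        show "AE x in lborel. norm (indicator {a..b} x * h x) \<le> norm (L * indicator {a..b} x)"
          using L by (intro AE_I2) (auto simp: h_def indicator_def)
      qed simp
      have "(LINT x|lborel. indicator {a..b} x * (h x + (L + 1))) = (LINT x|lborel. indicator {a..b} x * h x + (L + 1) * indicator {a..b} x)"
        by (simp add: algebra_simps)
      also have "\<dots> = (LINT x|lborel. indicator {a..b} x * h x) + (LINT x|lborel. (L + 1) * indicator {a..b} x)"
        by (rule Bochner_Integration.integral_add[OF i]) (use ab in auto)
      finally show ?thesis using ab by simp
    qed
    ultimately show "(LINT x|lborel. indicator {a..b} x * h x) = F b - F a" by (simp add: \<phi>_def algebra_simps)
  qed simp
qed

subsection \<open>Completed measures\<close>

lemma borel_measurable_completion_AE:
  fixes f g :: "'b \<Rightarrow> 'c::topological_space"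
  assumes g: "g \<in> borel_measurable M" and eq: "AE x in completion M. f x = g x"
  shows "f \<in> borel_measurable (completion M)"
proof (rule measurableI)
  fix B :: "'c set" assume B: "B \<in> sets borel"
  show "f -` B \<inter> space (completion M) \<in> sets (completion M)"
  proof (rule completion.in_sets_AE)
    show "AE x in completion M. (x \<in> g -` B \<inter> space M) = (x \<in> f -` B \<inter> space (completion M))"
      using eq by eventually_elim auto
    show "g -` B \<inter> space M \<in> sets (completion M)" using measurable_sets[OF g B] by simp
  qed simp
qed simp

lemma integral_completion_AE:
  fixes f g :: "'b \<Rightarrow> 'c::{banach, second_countable_topology}"
  assumes g: "g \<in> borel_measurable M" and eq: "AE x in completion M. f x = g x"
  shows "integral\<^sup>L (completion M) f = integral\<^sup>L M g" "integrable (completion M) f \<longleftrightarrow> integrable M g"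
  using integral_cong_AE[OF borel_measurable_completion_AE[OF g eq] measurable_completion[OF g] eq] integral_completion[OF g]
    integrable_cong_AE[OF borel_measurable_completion_AE[OF g eq] measurable_completion[OF g] eq] integrable_completion[OF g]
  by auto

text \<open>Passage from a completed surface measure to its Borel counterpart M. Only the comparison
  function g has to be Borel; f merely agrees with it almost everywhere, as happens for expressions
  in \<Omega>.\<close>

lemma surface_measure_AE:
  fixes f g :: "'a::euclidean_space \<Rightarrow> 'c::{banach, second_countable_topology}"
  assumes V: "subspace V" and M: "onb_sphere (orthonormal_basis_of V) = M"
  shows "AE x in M. P x \<Longrightarrow> AE x in surface_measure V. P x \<and> x \<in> V \<inter> unit_sphere"
    "g \<in> borel_measurable borel \<Longrightarrow> AE x in surface_measure V. f x = g x \<Longrightarrow> integral\<^sup>L (surface_measure V) f = integral\<^sup>L M g"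
    "g \<in> borel_measurable borel \<Longrightarrow> AE x in surface_measure V. f x = g x \<Longrightarrow> integrable (surface_measure V) f \<longleftrightarrow> integrable M g"
proof -
  note d = distr_pre_surface[OF V, unfolded M]
  show "AE x in surface_measure V. P x \<and> x \<in> V \<inter> unit_sphere" if "AE x in M. P x"
  proof -
    have "AE x in pre_surface V. P x"
      by (rule AE_distrD[where f="\<lambda>w. w" and M'=borel]) (unfold d, use that in \<open>auto intro: measurable_pre_surface\<close>)
    then have "AE x in pre_surface V. P x \<and> x \<in> V \<inter> unit_sphere"
      using AE_space[of "pre_surface V"] by eventually_elim (auto simp: space_pre_surface)
    then show ?thesis unfolding surface_measure_eq by (rule AE_completion)
  qed
  assume g: "g \<in> borel_measurable borel" and eq: "AE x in surface_measure V. f x = g x"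
  note c = integral_completion_AE[OF measurable_pre_surface[OF g] eq[unfolded surface_measure_eq], folded surface_measure_eq]
  show "integral\<^sup>L (surface_measure V) f = integral\<^sup>L M g"
    unfolding c(1) d[symmetric] by (rule integral_distr[symmetric]) (auto simp: g intro: measurable_pre_surface)
  show "integrable (surface_measure V) f \<longleftrightarrow> integrable M g"
    unfolding c(2) d[symmetric] by (rule integrable_distr_eq[symmetric]) (auto simp: g intro: measurable_pre_surface)
qed

lemmas sphere_vol_AE = surface_measure_AE[OF subspace_UNIV sphV_onb, folded sphere_vol_def]
lemmas unit_tangent_vol_AE =
  surface_measure_AE[OF subspace_tangent_space tangV_onb, folded unit_tangent_vol_def]

lemma space_sphere_vol [simp]: "space (sphere_vol :: 'a::euclidean_space measure) = unit_sphere"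
  by (simp add: sphere_vol_def surface_measure_eq space_pre_surface)

lemma measurable_sphere_vol:
  "f \<in> borel \<rightarrow>\<^sub>M N \<Longrightarrow> f \<in> (sphere_vol :: 'a::euclidean_space measure) \<rightarrow>\<^sub>M N"
  unfolding sphere_vol_def surface_measure_eq
  by (intro measurable_completion) (subst measurable_cong_sets[OF sets_pre_surface refl], rule measurable_restrict_space1)

lemma distr_sphere_vol: "distr (sphere_vol :: 'a::euclidean_space measure) borel (\<lambda>x. x) = sphV"
  unfolding sphere_vol_def surface_measure_eq
  using distr_pre_surface[OF subspace_UNIV, where 'a='a] by (simp add: distr_completion measurable_pre_surface sphV_onb)

text \<open>The exceptional set N is itself Borel and kept explicit, so that it can be pulled back
  along the flow and to products.\<close>

lemma sets_sphere_vol_borel: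
  fixes \<Omega> :: "'a::euclidean_space set"
  assumes "\<Omega> \<in> sets sphere_vol"
  obtains A N where "A \<in> sets borel" "A \<subseteq> unit_sphere" "N \<in> sets borel" "AE x in sphV. x \<notin> N"
    "\<And>x. x \<notin> N \<Longrightarrow> x \<in> \<Omega> \<longleftrightarrow> x \<in> A"
proof -
  have b: "S \<in> sets borel \<and> S \<subseteq> unit_sphere" if "S \<in> sets (pre_surface UNIV)" for S :: "'a set"
    using that by (simp add: sets_pre_surface sets_restrict_space_iff)
  obtain S N' N where SN: "\<Omega> = S \<union> N'" "N' \<subseteq> N" "N \<in> null_sets (pre_surface UNIV)" "S \<in> sets (pre_surface UNIV)"
    using assms unfolding sphere_vol_def surface_measure_eq by (elim sets_completionE)
  have N: "N \<in> sets borel" "N \<subseteq> unit_sphere" using b[of N] SN(3) by auto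
  have "emeasure sphV N = emeasure (pre_surface UNIV) N"
    using N
    by (subst sphV_onb[symmetric], subst distr_pre_surface[symmetric]) (auto simp: emeasure_distr measurable_pre_surface space_pre_surface Int_absorb2)
  then have "N \<in> null_sets sphV" using SN(3) N by (auto simp: null_sets_def)
  then have "AE x in sphV. x \<notin> N" by (rule AE_not_in)
  then show thesis using that[of S N] b[OF SN(4)] N SN(1,2) by blast
qed

subsection \<open>Passing to a Borel representative\<close>

text \<open>The frames over N are null, and by invariance so are those which the flow carries over N
  at time r; disintegration yields the claim. It guarantees that \<Omega> and A agree at the
  endpoints of geodesics, too.\<close>

lemma AE_sphV_flow:
  fixes N :: "'a::euclidean_space set"
  assumes dim: "DIM('a) \<ge> 2" and N [measurable]: "N \<in> sets borel" and null: "AE x in sphV. x \<notin> N"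
  shows "AE x in sphV. AE w in tangV x. cos r *\<^sub>R x + sin r *\<^sub>R w \<notin> N"
proof -
  have "(\<integral>\<^sup>+p. indicator N (fst p) \<partial>frameV) = (\<integral>\<^sup>+x. \<integral>\<^sup>+w. indicator N (fst (x, w)) \<partial>tangV x \<partial>sphV)"
    by (rule nn_integral_frameV) measurable
  also have "\<dots> = (\<integral>\<^sup>+x. 0 \<partial>(sphV :: 'a measure))"
    by (intro nn_integral_cong_AE eventually_mono[OF null]) simp
  finally have "(\<integral>\<^sup>+p. indicator N (fst p) \<partial>frameV) = 0" by simp
  then have "AE p in frameV. (indicator N (fst p) :: ennreal) = 0"
    by (subst (asm) nn_integral_0_iff_AE) auto
  then have "AE p in distr frameV borel (geo_flow r). (indicator N (fst p) :: ennreal) = 0"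
    unfolding frameV_geo_flow[OF dim] .
  then have "AE p in frameV. (indicator N (fst (geo_flow r p)) :: ennreal) = 0"
    by (rule AE_distrD[rotated]) simp
  then have "(\<integral>\<^sup>+p. indicator N (fst (geo_flow r p)) \<partial>frameV) = 0"
    by (subst nn_integral_0_iff_AE) auto
  also have "(\<integral>\<^sup>+p. indicator N (fst (geo_flow r p)) \<partial>frameV) =
      (\<integral>\<^sup>+x. \<integral>\<^sup>+w. indicator N (fst (geo_flow r (x, w))) \<partial>tangV x \<partial>sphV)"
    by (rule nn_integral_frameV) measurable
  finally have i0: "(\<integral>\<^sup>+x. \<integral>\<^sup>+w. indicator N (fst (geo_flow r (x, w))) \<partial>tangV x \<partial>sphV) = 0" .
  have [measurable]: "(\<lambda>x. \<integral>\<^sup>+w. indicator N (fst (geo_flow r (x, w))) \<partial>tangV x) \<in> borel_measurable borel"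
    by (rule borel_measurable_nn_integral_tangV[where F="\<lambda>p. indicator N (fst (geo_flow r p))"]) (unfold borel_prod, measurable)
  have "AE x in sphV. (\<integral>\<^sup>+w. indicator N (fst (geo_flow r (x, w))) \<partial>tangV x) = 0"
    using i0 by (subst (asm) nn_integral_0_iff_AE) auto
  then show ?thesis
  proof eventually_elim
    fix x assume "(\<integral>\<^sup>+w. indicator N (fst (geo_flow r (x, w))) \<partial>tangV x) = 0"
    then have "AE w in tangV x. (indicator N (fst (geo_flow r (x, w))) :: ennreal) = 0"
      by (subst (asm) nn_integral_0_iff_AE) (auto simp: fst_geo_flow)
    then show "AE w in tangV x. cos r *\<^sub>R x + sin r *\<^sub>R w \<notin> N"
      by eventually_elim (auto simp: fst_geo_flow indicator_def split: if_splits)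
  qed
qed

context
  fixes \<Omega> A N :: "'a::euclidean_space set"
  assumes dim: "DIM('a) \<ge> 3" and A [measurable]: "A \<in> sets borel" and A_sub: "A \<subseteq> unit_sphere"
    and N [measurable]: "N \<in> sets borel" and null: "AE x in sphV. x \<notin> N" and \<Omega>A: "\<And>x. x \<notin> N \<Longrightarrow> x \<in> \<Omega> \<longleftrightarrow> x \<in> A"
begin

lemma autocorrelation_eq_frame_corr:
  assumes n: "DIM('a) = n + 1"
  shows "autocorrelation n \<Omega> = frame_corr A"
proof
  fix r
  have dim2: "DIM('a) \<ge> 2" using dim by simp
  let ?F = "\<lambda>p. indicator A (fst p) * indicator A (fst (geo_flow r p)) :: real"
  have "AE x in sphV. x \<notin> N \<and> (AE w in tangV x. cos r *\<^sub>R x + sin r *\<^sub>R w \<notin> N)"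
    using null AE_sphV_flow[OF dim2 N null, of r] by eventually_elim simp
  then have "AE x in sphere_vol. (x \<notin> N \<and> (AE w in tangV x. cos r *\<^sub>R x + sin r *\<^sub>R w \<notin> N)) \<and> x \<in> UNIV \<inter> unit_sphere"
    by (rule sphere_vol_AE(1))
  then have eq: "AE x in sphere_vol. 1 / sigma (n - 1) * (\<integral>w. indicator \<Omega> x * indicator \<Omega> (sphere_exp x (r *\<^sub>R w)) \<partial>unit_tangent_vol x) =
      1 / sigma (n - 1) * (\<integral>w. ?F (x, w) \<partial>tangV x)"
  proof eventually_elim
    fix x assume x: "(x \<notin> N \<and> (AE w in tangV x. cos r *\<^sub>R x + sin r *\<^sub>R w \<notin> N)) \<and> x \<in> UNIV \<inter> unit_sphere"
    then have x1: "norm x = 1" by simp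
    have "AE w in unit_tangent_vol x. cos r *\<^sub>R x + sin r *\<^sub>R w \<notin> N \<and> w \<in> tangent_space x \<inter> unit_sphere"
      using x by (intro unit_tangent_vol_AE(1)[OF x1]) simp
    then have "AE w in unit_tangent_vol x. indicator \<Omega> x * indicator \<Omega> (sphere_exp x (r *\<^sub>R w)) = ?F (x, w)"
      by (rule eventually_mono) (use x in \<open>auto simp: sphere_exp_unit fst_geo_flow \<Omega>A indicator_def\<close>)
    then have "(\<integral>w. indicator \<Omega> x * indicator \<Omega> (sphere_exp x (r *\<^sub>R w)) \<partial>unit_tangent_vol x) = (\<integral>w. ?F (x, w) \<partial>tangV x)"
      by (rule unit_tangent_vol_AE(2)[OF x1 _, rotated]) (unfold fst_geo_flow, measurable)
    then show "1 / sigma (n - 1) * (\<integral>w. indicator \<Omega> x * indicator \<Omega> (sphere_exp x (r *\<^sub>R w)) \<partial>unit_tangent_vol x) =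
      1 / sigma (n - 1) * (\<integral>w. ?F (x, w) \<partial>tangV x)" by simp
  qed
  have "autocorrelation n \<Omega> r = (\<integral>x. 1 / sigma (n - 1) * (\<integral>w. ?F (x, w) \<partial>tangV x) \<partial>sphV)"
    unfolding autocorrelation_def
    by (rule sphere_vol_AE(2)[OF _ eq]) (intro borel_measurable_times borel_measurable_const borel_measurable_integral_tangV, measurable)
  also have "\<dots> = 1 / sigma (n - 1) * (\<integral>p. ?F p \<partial>frameV)"
    by (subst integral_frameV(3)[OF dim2, where C=1]) (auto simp: indicator_def)
  finally show "autocorrelation n \<Omega> r = frame_corr A r" using n by (simp add: frame_corr_def)
qed

lemma variation_integral_borel:
  assumes X: "smooth_vector_field X"
  shows "(\<integral>x. indicator \<Omega> x * divergence X x \<partial>sphere_vol) = (\<integral>x. indicator A x * divergence X x \<partial>sphV)"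
proof (rule sphere_vol_AE(2))
  have "(\<lambda>x. indicator unit_sphere x *\<^sub>R divergence X x) \<in> borel_measurable borel"
    using X divergence_smooth(2)[of X X] by (intro borel_measurable_continuous_on_indicator) (auto simp: smooth_vector_field_def)
  then have "(\<lambda>x. indicator A x * (indicator unit_sphere x *\<^sub>R divergence X x)) \<in> borel_measurable borel" by simp
  also have "(\<lambda>x. indicator A x * (indicator unit_sphere x *\<^sub>R divergence X x)) = (\<lambda>x. indicator A x * divergence X x)"
    using A_sub by (auto simp: indicator_def fun_eq_iff)
  finally show "(\<lambda>x. indicator A x * divergence X x) \<in> borel_measurable borel" .
  show "AE x in sphere_vol. indicator \<Omega> x * divergence X x = indicator A x * divergence X x"
    by (rule eventually_mono[OF sphere_vol_AE(1)[OF null]]) (auto simp: \<Omega>A indicator_def)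
qed

lemma perimeter_attained:
  assumes fin: "finite_perimeter \<Omega>"
  shows "\<And>X. smooth_vector_field X \<Longrightarrow> (\<And>x. x \<in> unit_sphere \<Longrightarrow> norm (X x) \<le> 1) \<Longrightarrow>
      (\<integral>x. indicator A x * divergence X x \<partial>sphV) \<le> perimeter \<Omega>"
    "\<And>e. e > 0 \<Longrightarrow> \<exists>X. smooth_vector_field X \<and> (\<forall>x\<in>unit_sphere. norm (X x) \<le> 1) \<and>
      perimeter \<Omega> - e \<le> (\<integral>x. indicator A x * divergence X x \<partial>sphV)"
proof -
  have le: "ereal (\<integral>x. indicator A x * divergence X x \<partial>sphV) \<le> variation (indicator \<Omega>)"
    if "smooth_vector_field X" "\<And>x. x \<in> unit_sphere \<Longrightarrow> norm (X x) \<le> 1" for X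
    unfolding variation_def using that by (intro SUP_upper2[of X]) (auto simp: variation_integral_borel)
  have "variation (indicator \<Omega>) \<noteq> -\<infinity>" using le[OF smooth_vector_field_zero] by auto
  moreover have "variation (indicator \<Omega>) \<noteq> \<infinity>" using fin by (simp add: finite_perimeter_def)
  ultimately have V: "ereal (perimeter \<Omega>) = variation (indicator \<Omega>)"
    unfolding perimeter_def by (intro ereal_real') auto
  show "(\<integral>x. indicator A x * divergence X x \<partial>sphV) \<le> perimeter \<Omega>"
    if "smooth_vector_field X" "\<And>x. x \<in> unit_sphere \<Longrightarrow> norm (X x) \<le> 1" for X
    using le[OF that] by (simp flip: V)
  fix e :: real assume "e > 0"
  then have "ereal (perimeter \<Omega> - e) < variation (indicator \<Omega>)" by (simp flip: V)
  then obtain X where "smooth_vector_field X" "\<forall>x\<in>unit_sphere. norm (X x) \<le> 1"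
    "perimeter \<Omega> - e < (\<integral>x. indicator \<Omega> x * divergence X x \<partial>sphere_vol)"
    unfolding variation_def less_SUP_iff by auto
  then show "\<exists>X. smooth_vector_field X \<and> (\<forall>x\<in>unit_sphere. norm (X x) \<le> 1) \<and>
      perimeter \<Omega> - e \<le> (\<integral>x. indicator A x * divergence X x \<partial>sphV)"
    by (auto simp: variation_integral_borel intro!: exI[of _ X])
qed

end

subsection \<open>The kernel in polar coordinates\<close>

lemma geodesic_dist_self: "norm x = 1 \<Longrightarrow> geodesic_dist x x = 0"
  by (simp add: geodesic_dist_def norm_eq_1)

lemma geodesic_dist_commute: "geodesic_dist x y = geodesic_dist y x"
  by (simp add: geodesic_dist_def inner_commute)

lemma geodesic_dist_range:
  assumes "norm x = 1" "norm y = 1" "x \<noteq> y"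
  shows "0 < geodesic_dist x y" "geodesic_dist x y \<le> pi"
proof -
  have b: "\<bar>x \<bullet> y\<bar> \<le> 1" using Cauchy_Schwarz_ineq2[of x y] assms by simp
  have "x \<bullet> y \<noteq> 1"
  proof
    assume "x \<bullet> y = 1"
    then have "(norm (x - y))\<^sup>2 = 0"
      using assms by (simp add: power2_norm_eq_inner inner_diff norm_eq_1 inner_commute)
    then show False using assms(3) by simp
  qed
  then have "x \<bullet> y < 1" using b by simp
  then show "0 < geodesic_dist x y" "geodesic_dist x y \<le> pi"
    using b arccos_less_arccos[of "x \<bullet> y" 1] unfolding geodesic_dist_def by (auto intro: arccos_ubound)
qed

lemma frames_nonempty:
  assumes "DIM('a::euclidean_space) \<ge> 2"
  obtains x w :: "'a::euclidean_space" where "(x, w) \<in> frames"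
proof -
  obtain x :: 'a where x: "norm x = 1" using vector_choose_size[of 1] by auto
  obtain z where "z \<noteq> 0" "orthogonal x z" using orthogonal_to_vector_exists[OF assms, of x] by blast
  then have "(x, sgn z) \<in> frames" using x by (simp add: frames_def norm_sgn sgn_div_norm orthogonal_def)
  then show thesis by (rule that)
qed

context
  fixes K :: "'a::euclidean_space \<Rightarrow> 'a \<Rightarrow> real" and \<kappa> :: "real \<Rightarrow> real" and \<epsilon> :: real
  assumes dim: "DIM('a) \<ge> 3" and K: "helmholtz_kernel \<epsilon> K"
    and K\<kappa>: "\<And>x y. x \<in> unit_sphere \<Longrightarrow> y \<in> unit_sphere \<Longrightarrow> x \<noteq> y \<Longrightarrow> K x y = \<kappa> (geodesic_dist x y)"
begin

text \<open>The profile is accessible only through K. Along a great circle issuing from x the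
  distance to x is the parameter, so smoothness of K off the diagonal makes the profile continuous
  between 0 and pi.\<close>

lemma profile_measurable: "(\<lambda>r. indicator {0<..<pi} r * \<kappa> r) \<in> borel_measurable borel"
proof -
  have dim2: "DIM('a) \<ge> 2" using dim by simp
  obtain x w :: 'a where xw: "(x, w) \<in> frames" using frames_nonempty[OF dim2] .
  then have x1: "norm x = 1" by (simp add: frames_def)
  let ?c = "\<lambda>r. cos r *\<^sub>R x + sin r *\<^sub>R w"
  have c1: "norm (?c r) = 1" for r using geo_flow_frames[OF xw, of r] by (simp add: geo_flow_def frames_def)
  have gd: "geodesic_dist (?c r) x = r" if "0 < r" "r < pi" for r
    using geodesic_dist_frame(2)[OF xw] that by simp
  have ne: "?c r \<noteq> x" if "0 < r" "r < pi" for r using gd[OF that] geodesic_dist_self[OF x1] that by auto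
  have "continuous_on {(x, y). x \<in> unit_sphere \<and> y \<in> unit_sphere \<and> x \<noteq> y} (\<lambda>(x, y). K x y)"
    using K unfolding helmholtz_kernel_def by (intro smooth_on_imp_continuous_on) blast
  then have "continuous_on {0<..<pi} (\<lambda>r. (\<lambda>(x, y). K x y) (?c r, x))"
    by (rule continuous_on_compose2) (use c1 x1 ne in \<open>auto intro!: continuous_intros\<close>)
  moreover have "K (?c r) x = \<kappa> r" if "r \<in> {0<..<pi}" for r
    using K\<kappa>[of "?c r" x] c1 x1 ne gd that by auto
  ultimately have "continuous_on {0<..<pi} \<kappa>"
    by (subst continuous_on_cong[OF refl, of _ _ "\<lambda>r. K (?c r) x"]) auto
  then have "(\<lambda>r. indicator {0<..<pi} r *\<^sub>R \<kappa> r) \<in> borel_measurable borel"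
    by (intro borel_measurable_continuous_on_indicator) auto
  then show ?thesis by simp
qed

lemma AE_geodesic_dist:
  fixes y :: 'a
  assumes y: "norm y = 1"
  shows "AE x in sphV. 0 < geodesic_dist y x \<and> geodesic_dist y x < pi"
proof -
  have dim2: "DIM('a) \<ge> 2" using dim by simp
  have "AE r in density lborel (\<lambda>r. indicator {0<..<pi} r * ennreal (sigma (DIM('a) - 2) * sin r ^ (DIM('a) - 2))). 0 < r \<and> r < pi"
    by (subst AE_density) (auto simp: indicator_def)
  then have "AE r in distr sphV borel (geodesic_dist y). 0 < r \<and> r < pi"
    unfolding distr_geodesic_dist[OF dim2 y] .
  then show ?thesis by (rule AE_distrD[rotated]) measurable
qed

text \<open>Almost every x has distance strictly between 0 and pi from y, where K is the profile of
  the distance. Integrability is transferred as well, which makes the profile integrable against the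
  radial density.\<close>

lemma integral_sphere_vol_profile:
  assumes y: "norm y = 1" and [measurable]: "(h :: real \<Rightarrow> real) \<in> borel_measurable borel"
  shows "(\<integral>x. h (geodesic_dist x y) * K x y \<partial>sphere_vol) =
      sigma (DIM('a) - 2) * (\<integral>r. h r * (indicator {0<..<pi} r * (\<kappa> r * sin r ^ (DIM('a) - 2))) \<partial>lborel)"
    "integrable sphere_vol (\<lambda>x. h (geodesic_dist x y) * K x y) \<longleftrightarrow>
      integrable lborel (\<lambda>r. h r * (indicator {0<..<pi} r * (\<kappa> r * sin r ^ (DIM('a) - 2))))"
proof -
  note profile_measurable [measurable]
  let ?k = "\<lambda>r. h r * (indicator {0<..<pi} r * \<kappa> r)"
  let ?m = "DIM('a) - 2"
  have eq: "AE x in sphere_vol. h (geodesic_dist x y) * K x y = ?k (geodesic_dist y x)"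
  proof (rule eventually_mono[OF sphere_vol_AE(1)[OF AE_geodesic_dist[OF y]]])
    fix x assume x: "(0 < geodesic_dist y x \<and> geodesic_dist y x < pi) \<and> x \<in> UNIV \<inter> unit_sphere"
    then have "x \<noteq> y" using geodesic_dist_self[OF y] by auto
    then show "h (geodesic_dist x y) * K x y = ?k (geodesic_dist y x)"
      using x y K\<kappa>[of x y] by (simp add: geodesic_dist_commute[of x y])
  qed
  let ?d = "\<lambda>r. indicator {0<..<pi} r * (sigma ?m * sin r ^ ?m) :: real"
  have nn: "?d r \<ge> 0" for r using sigma_pos[of ?m] by (auto simp: indicator_def sin_gt_zero intro!: mult_nonneg_nonneg less_imp_le)
  have distr: "distr sphV borel (geodesic_dist y) = density lborel (\<lambda>r. ennreal (?d r))"
    by (subst distr_geodesic_dist) (use dim y in \<open>auto intro!: density_cong simp: indicator_def\<close>)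
  have e: "?d r *\<^sub>R ?k r = sigma ?m * (h r * (indicator {0<..<pi} r * (\<kappa> r * sin r ^ ?m)))" for r
    by (simp add: indicator_def)
  have "(\<integral>x. h (geodesic_dist x y) * K x y \<partial>sphere_vol) = (\<integral>x. ?k (geodesic_dist y x) \<partial>sphV)"
    by (rule sphere_vol_AE(2)[OF _ eq]) measurable
  also have "\<dots> = (\<integral>r. ?k r \<partial>distr sphV borel (geodesic_dist y))" by (rule integral_distr[symmetric]) measurable
  also have "\<dots> = (\<integral>r. ?d r *\<^sub>R ?k r \<partial>lborel)" unfolding distr by (rule integral_density) (use nn in auto)
  finally show "(\<integral>x. h (geodesic_dist x y) * K x y \<partial>sphere_vol) =
      sigma ?m * (\<integral>r. h r * (indicator {0<..<pi} r * (\<kappa> r * sin r ^ ?m)) \<partial>lborel)"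
    unfolding e by simp
  have "integrable sphere_vol (\<lambda>x. h (geodesic_dist x y) * K x y) \<longleftrightarrow> integrable sphV (\<lambda>x. ?k (geodesic_dist y x))"
    by (rule sphere_vol_AE(3)[OF _ eq]) measurable
  also have "\<dots> \<longleftrightarrow> integrable (distr sphV borel (geodesic_dist y)) ?k" by (rule integrable_distr_eq[symmetric]) measurable
  also have "\<dots> \<longleftrightarrow> integrable lborel (\<lambda>r. ?d r *\<^sub>R ?k r)" unfolding distr by (rule integrable_density) (use nn in auto)
  finally show "integrable sphere_vol (\<lambda>x. h (geodesic_dist x y) * K x y) \<longleftrightarrow>
      integrable lborel (\<lambda>r. h r * (indicator {0<..<pi} r * (\<kappa> r * sin r ^ ?m)))"
    unfolding e using sigma_pos[of ?m] by simp
qed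

lemma integrable_profile: "integrable lborel (\<lambda>r. indicator {0<..<pi} r * (\<kappa> r * sin r ^ (DIM('a) - 2)))"
proof -
  obtain y :: 'a where y: "norm y = 1" using vector_choose_size[of 1] by auto
  then have "integrable sphere_vol (\<lambda>x. K x y)" using K by (simp add: helmholtz_kernel_def)
  then show ?thesis using integral_sphere_vol_profile(2)[OF y, of "\<lambda>_. 1"] by simp
qed

lemma inverse_gamma_eps:
  "1 / gamma_eps n \<epsilon> K = k_const n * (sigma (DIM('a) - 2) / \<epsilon> *
     (\<integral>r. r * (indicator {0<..<pi} r * (\<kappa> r * sin r ^ (DIM('a) - 2))) \<partial>lborel))"
proof -
  define y where "y = (SOME y :: 'a. y \<in> unit_sphere)"
  obtain z :: 'a where "norm z = 1" using vector_choose_size[of 1] by auto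
  then have "\<exists>y :: 'a. y \<in> unit_sphere" by (intro exI[of _ z]) simp
  then have "y \<in> unit_sphere" unfolding y_def by (rule someI_ex)
  then have y: "norm y = 1" by simp
  have "(\<integral>x. geodesic_dist x y / \<epsilon> * K x y \<partial>sphere_vol) = (\<integral>x. geodesic_dist x y * K x y \<partial>sphere_vol) / \<epsilon>"
    by simp
  also have "\<dots> = sigma (DIM('a) - 2) / \<epsilon> * (\<integral>r. r * (indicator {0<..<pi} r * (\<kappa> r * sin r ^ (DIM('a) - 2))) \<partial>lborel)"
    by (subst integral_sphere_vol_profile(1)[OF y, of "\<lambda>r. r"]) simp_all
  finally show ?thesis by (simp only: gamma_eps_def Let_def y_def[symmetric] div_by_1 divide_divide_eq_right mult_1)
qed

text \<open>In polar coordinates a pair of points becomes a frame and a time; the kernel depends on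
  the time alone, and the frames at a fixed time contribute \<open>flow_diff\<close>.\<close>

lemma energy_double_integral:
  assumes \<Omega>: "\<Omega> \<in> sets sphere_vol" and A [measurable]: "A \<in> sets borel"
    and N [measurable]: "N \<in> sets borel" and null: "AE x in sphV. x \<notin> N" and \<Omega>A: "\<And>x. x \<notin> N \<Longrightarrow> x \<in> \<Omega> \<longleftrightarrow> x \<in> A"
  shows "(\<integral>(x, y). K x y * \<bar>indicator \<Omega> x - indicator \<Omega> y\<bar> \<partial>(sphere_vol \<Otimes>\<^sub>M sphere_vol)) =
    (\<integral>r. indicator {0<..<pi} r * (\<kappa> r * sin r ^ (DIM('a) - 2)) * flow_diff A r \<partial>lborel)"
proof -
  note profile_measurable [measurable] \<Omega> [measurable]
  have dim2: "DIM('a) \<ge> 2" using dim by simp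
  let ?m = "DIM('a) - 2"
  let ?w = "\<lambda>r. indicator {0<..<pi} r * (\<kappa> r * sin r ^ ?m)"
  \<comment> \<open>The product measure is not complete, so the integrand has to be Borel at antipodal points, too.\<close>
  define k where "k r = indicator {0<..<pi} r * \<kappa> r + indicator {pi} r * \<kappa> pi" for r
  have [measurable]: "k \<in> borel_measurable borel" unfolding k_def by measurable
  have k: "k r = \<kappa> r" if "0 < r" "r \<le> pi" for r using that by (auto simp: k_def indicator_def)
  interpret S: finite_measure "sphV :: 'a measure" by (rule finite_measure_sphV)
  interpret F: finite_measure "frameV :: ('a \<times> 'a) measure" by (rule finite_measure_frameV[OF dim2])
  interpret LF: pair_sigma_finite lborel "frameV :: ('a \<times> 'a) measure" ..
  let ?P = "(sphere_vol :: 'a measure) \<Otimes>\<^sub>M (sphere_vol :: 'a measure)"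
  have id [measurable]: "(\<lambda>x. x) \<in> (sphere_vol :: 'a measure) \<rightarrow>\<^sub>M borel" by (rule measurable_sphere_vol) simp
  have m1 [measurable]: "(\<lambda>p. fst p) \<in> ?P \<rightarrow>\<^sub>M borel" "(\<lambda>p. snd p) \<in> ?P \<rightarrow>\<^sub>M borel"
    using measurable_compose[OF measurable_fst id] measurable_compose[OF measurable_snd id] by auto
  have idP: "(\<lambda>(x, y). (x, y)) \<in> ?P \<rightarrow>\<^sub>M borel \<Otimes>\<^sub>M borel"
    unfolding case_prod_unfold by (intro measurable_Pair m1)
  \<comment> \<open>The identity forgets the sets added by completing the factors, so its image of
    the product measure is the product of the Borel measures.\<close>
  have D: "(sphV :: 'a measure) \<Otimes>\<^sub>M (sphV :: 'a measure) = distr ?P (borel \<Otimes>\<^sub>M borel) (\<lambda>(x, y). (x, y))"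
    using pair_measure_distr[OF id id] by (simp add: distr_sphere_vol S.sigma_finite_measure_axioms)
  let ?f = "\<lambda>x y. k (geodesic_dist x y) * \<bar>indicator A x - indicator A y\<bar> :: real"
  have sLF: "sets (lborel \<Otimes>\<^sub>M (frameV :: ('a \<times> 'a) measure)) = sets (borel \<Otimes>\<^sub>M borel)"
    by (intro sets_pair_measure_cong) auto
  have [measurable]: "(\<lambda>q. fst q) \<in> borel_measurable (lborel \<Otimes>\<^sub>M (frameV :: ('a \<times> 'a) measure))"
    "(\<lambda>q. fst (snd q)) \<in> borel_measurable (lborel \<Otimes>\<^sub>M (frameV :: ('a \<times> 'a) measure))"
    "(\<lambda>q. fst (geo_flow (fst q) (snd q))) \<in> borel_measurable (lborel \<Otimes>\<^sub>M (frameV :: ('a \<times> 'a) measure))"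
    unfolding measurable_cong_sets[OF sLF refl] by measurable
  have "(\<lambda>r. (indicator {0<..<pi} r * \<kappa> r) * sin r ^ ?m) \<in> borel_measurable borel" by measurable
  then have [measurable]: "?w \<in> borel_measurable borel" by (simp only: mult.assoc)
  have nullp: "AE p in (sphV :: 'a measure) \<Otimes>\<^sub>M (sphV :: 'a measure). fst p \<notin> N \<and> snd p \<notin> N"
  proof -
    have "N \<in> null_sets sphV" using null by (simp add: AE_iff_null_sets)
    then have "N \<times> UNIV \<in> null_sets (sphV \<Otimes>\<^sub>M (sphV :: 'a measure))" "UNIV \<times> N \<in> null_sets ((sphV :: 'a measure) \<Otimes>\<^sub>M sphV)"
      by (auto simp: null_sets_def S.emeasure_pair_measure_Times)
    then have "AE p in (sphV :: 'a measure) \<Otimes>\<^sub>M (sphV :: 'a measure). p \<notin> N \<times> UNIV \<and> p \<notin> UNIV \<times> N"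
      by (auto dest!: AE_not_in)
    then show ?thesis by eventually_elim auto
  qed
  have nullP: "AE p in ?P. fst p \<notin> N \<and> snd p \<notin> N"
    using AE_distrD[OF idP nullp[unfolded D]] by (simp add: case_prod_unfold)
  have "(\<integral>(x, y). K x y * \<bar>indicator \<Omega> x - indicator \<Omega> y\<bar> \<partial>?P) =
      (\<integral>p. k (geodesic_dist (fst p) (snd p)) * \<bar>indicator \<Omega> (fst p) - indicator \<Omega> (snd p)\<bar> \<partial>?P)"
  proof (rule Bochner_Integration.integral_cong[OF refl])
    \<comment> \<open>On the diagonal both sides vanish with the difference of the indicators; off
      it the distance lies in (0, pi], where k is the profile.\<close>
    fix p assume "p \<in> space ?P"
    then have "norm (fst p) = 1" "norm (snd p) = 1" by (auto simp: space_pair_measure)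
    then show "(case p of (x, y) \<Rightarrow> K x y * \<bar>indicator \<Omega> x - indicator \<Omega> y\<bar>) =
      k (geodesic_dist (fst p) (snd p)) * \<bar>indicator \<Omega> (fst p) - indicator \<Omega> (snd p)\<bar>"
      using geodesic_dist_range[of "fst p" "snd p"] k K\<kappa>[of "fst p" "snd p"]
      by (cases "fst p = snd p") (auto simp: case_prod_unfold)
  qed
  also have "\<dots> = (\<integral>p. ?f (fst p) (snd p) \<partial>?P)"
  proof (rule integral_cong_AE)
    show "AE p in ?P. k (geodesic_dist (fst p) (snd p)) * \<bar>indicator \<Omega> (fst p) - indicator \<Omega> (snd p)\<bar> = ?f (fst p) (snd p)"
      by (rule eventually_mono[OF nullP]) (auto simp: \<Omega>A indicator_def)
  qed measurable
  also have "\<dots> = (\<integral>p. ?f (fst p) (snd p) \<partial>((sphV :: 'a measure) \<Otimes>\<^sub>M (sphV :: 'a measure)))"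
    unfolding D by (subst integral_distr[OF idP]) (auto simp: case_prod_unfold)
  also have "\<dots> = (\<integral>q. ?f (fst (snd q)) (fst (geo_flow (fst q) (snd q))) \<partial>density (lborel \<Otimes>\<^sub>M frameV)
      (\<lambda>q. ennreal (indicator {0<..<pi} (fst q) * sin (fst q) ^ ?m)))"
    unfolding sphV_pair_polar[OF dim2]
    by (subst integral_distr, measurable) (intro arg_cong2[where f="integral\<^sup>L"] arg_cong2[where f=density] refl, auto simp: indicator_def)
  also have "\<dots> = (\<integral>q. (indicator {0<..<pi} (fst q) * sin (fst q) ^ ?m) *\<^sub>R ?f (fst (snd q)) (fst (geo_flow (fst q) (snd q))) \<partial>(lborel \<Otimes>\<^sub>M frameV))"
    by (rule integral_density) (measurable, auto simp: indicator_def sin_gt_zero intro!: less_imp_le)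
  also have "\<dots> = (\<integral>q. ?w (fst q) * \<bar>indicator A (fst (geo_flow (fst q) (snd q))) - indicator A (fst (snd q))\<bar> \<partial>(lborel \<Otimes>\<^sub>M frameV))"
    (is "_ = (\<integral>q. ?g q \<partial>_)")
  proof (rule integral_cong_AE)
    have "- frames \<in> null_sets (frameV :: ('a \<times> 'a) measure)" using AE_frameV by (simp add: AE_iff_null_sets)
    then have "UNIV \<times> - frames \<in> null_sets (lborel \<Otimes>\<^sub>M (frameV :: ('a \<times> 'a) measure))"
      by (auto simp: null_sets_def F.emeasure_pair_measure_Times)
    then have "AE q in lborel \<Otimes>\<^sub>M (frameV :: ('a \<times> 'a) measure). q \<notin> UNIV \<times> - frames" by (rule AE_not_in)
    then show "AE q in lborel \<Otimes>\<^sub>M frameV. (indicator {0<..<pi} (fst q) * sin (fst q) ^ ?m) *\<^sub>R ?f (fst (snd q)) (fst (geo_flow (fst q) (snd q))) = ?g q"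
    proof eventually_elim
      fix q :: "real \<times> ('a \<times> 'a)" assume "q \<notin> UNIV \<times> - frames"
      then obtain r x w where q: "q = (r, x, w)" "(x, w) \<in> frames" by (cases q) auto
      show "(indicator {0<..<pi} (fst q) * sin (fst q) ^ ?m) *\<^sub>R ?f (fst (snd q)) (fst (geo_flow (fst q) (snd q))) = ?g q"
        using geodesic_dist_frame(1)[OF q(2), of r] k[of r]
        by (auto simp: q(1) fst_geo_flow indicator_def)
    qed
  qed measurable
  also have "\<dots> = (\<integral>r. (\<integral>p. ?g (r, p) \<partial>frameV) \<partial>lborel)"
  proof (rule LF.integral_fst'[symmetric])
    show "integrable (lborel \<Otimes>\<^sub>M frameV) ?g"
    proof (rule Bochner_Integration.integrable_bound)
      show "integrable (lborel \<Otimes>\<^sub>M (frameV :: ('a \<times> 'a) measure)) (\<lambda>q. ?w (fst q))"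
        using LF.Fubini_integrable[of "\<lambda>q. ?w (fst q)"] integrable_profile by simp
      show "AE q in lborel \<Otimes>\<^sub>M frameV. norm (?g q) \<le> norm (?w (fst q))"
        by (intro AE_I2) (auto simp: indicator_def abs_mult)
    qed measurable
  qed
  also have "\<dots> = (\<integral>r. ?w r * flow_diff A r \<partial>lborel)"
    by (simp add: flow_diff_def)
  finally show ?thesis .
qed

end

subsection \<open>The energy formula\<close>

lemma borel_measurable_indicator_greaterThan [measurable (raw)]:
  fixes f g :: "'b \<Rightarrow> real"
  assumes f: "f \<in> borel_measurable M" and g: "g \<in> borel_measurable M"
  shows "(\<lambda>x. indicator {f x<..} (g x) :: real) \<in> borel_measurable M"
proof -
  have "(\<lambda>x. indicator {w \<in> space M. f w < g w} x :: real) \<in> borel_measurable M"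
    by (intro borel_measurable_indicator borel_measurable_less f g)
  then show ?thesis by (rule measurable_cong[THEN iffD1, rotated]) (auto simp: indicator_def)
qed

text \<open>Integration by parts in the form of Fubini on the triangle 0 < r < s < b. It avoids
  boundary terms, which would be delicate since the tail of w is only integrated against a bounded
  h.\<close>

lemma lborel_primitive_swap:
  fixes w h :: "real \<Rightarrow> real"
  assumes w: "integrable lborel w" and w0: "\<And>s. s \<notin> {0<..<b} \<Longrightarrow> w s = 0"
    and h [measurable]: "h \<in> borel_measurable borel" and B: "\<And>r. \<bar>h r\<bar> \<le> B"
  shows "(\<integral>r. indicator {0<..<b} r * ((\<integral>s. indicator {r<..} s * w s \<partial>lborel) * h r) \<partial>lborel) =
    (\<integral>s. w s * (\<integral>r. indicator {0..s} r * h r \<partial>lborel) \<partial>lborel)"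
proof -
  have [measurable]: "w \<in> borel_measurable borel" using borel_measurable_integrable[OF w] by simp
  have B0: "B \<ge> 0" using B[of 0] by simp
  let ?F = "\<lambda>r s. indicator {0<..<b} r * indicator {r<..} s * (w s * h r)"
  have int: "integrable (lborel \<Otimes>\<^sub>M lborel) (case_prod ?F)"
  proof (rule Bochner_Integration.integrable_bound)
    show "integrable (lborel \<Otimes>\<^sub>M lborel) (\<lambda>p. (indicator {0..b} (fst p) * B) * w (snd p))"
    proof (rule lborel_pair.Fubini_integrable)
      have "integrable lborel (\<lambda>r. B * (\<integral>s. \<bar>w s\<bar> \<partial>lborel) * indicator {0..b} r)"
        by (intro integrable_mult_right integrable_real_indicator) (auto simp: emeasure_lborel_Icc_eq)
      then show "integrable lborel (\<lambda>r. \<integral>s. norm ((indicator {0..b} (fst (r, s)) * B) * w (snd (r, s))) \<partial>lborel)"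
        using B0 by (simp add: abs_mult mult_ac)
    qed (use w in auto)
    show "case_prod ?F \<in> borel_measurable (lborel \<Otimes>\<^sub>M lborel)" unfolding case_prod_unfold by measurable
    show "AE p in lborel \<Otimes>\<^sub>M lborel. norm (case_prod ?F p) \<le> norm ((indicator {0..b} (fst p) * B) * w (snd p))"
      using B B0 by (intro AE_I2) (auto simp: case_prod_unfold indicator_def abs_mult mult.commute intro!: mult_left_mono mult_right_mono)
  qed
  have "(\<integral>r. indicator {0<..<b} r * ((\<integral>s. indicator {r<..} s * w s \<partial>lborel) * h r) \<partial>lborel) = (\<integral>r. (\<integral>s. ?F r s \<partial>lborel) \<partial>lborel)"
  proof (intro Bochner_Integration.integral_cong refl)
    fix r
    have "(\<integral>s. ?F r s \<partial>lborel) = (\<integral>s. (indicator {0<..<b} r * h r) * (indicator {r<..} s * w s) \<partial>lborel)"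
      by (intro Bochner_Integration.integral_cong refl) (simp only: mult_ac)
    also have "\<dots> = (indicator {0<..<b} r * h r) * (\<integral>s. indicator {r<..} s * w s \<partial>lborel)"
      by (rule integral_mult_right_zero)
    finally show "indicator {0<..<b} r * ((\<integral>s. indicator {r<..} s * w s \<partial>lborel) * h r) = (\<integral>s. ?F r s \<partial>lborel)"
      by (simp only: mult_ac)
  qed
  also have "\<dots> = (\<integral>s. (\<integral>r. ?F r s \<partial>lborel) \<partial>lborel)" by (rule lborel_pair.Fubini_integral[OF int, symmetric])
  also have "\<dots> = (\<integral>s. w s * (\<integral>r. indicator {0..s} r * h r \<partial>lborel) \<partial>lborel)"
  proof (intro Bochner_Integration.integral_cong refl)
    fix s
    show "(\<integral>r. ?F r s \<partial>lborel) = w s * (\<integral>r. indicator {0..s} r * h r \<partial>lborel)"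
    proof (cases "s \<in> {0<..<b}")
      case True
      \<comment> \<open>The integrands differ at most at r = 0 and r = s.\<close>
      have "(\<integral>r. ?F r s \<partial>lborel) = (\<integral>r. w s * (indicator {0..s} r * h r) \<partial>lborel)"
      proof (rule integral_cong_AE)
        show "AE r in lborel. ?F r s = w s * (indicator {0..s} r * h r)"
          using AE_lborel_singleton[of 0] AE_lborel_singleton[of s]
          by eventually_elim (use True in \<open>auto simp: indicator_def\<close>)
        show "(\<lambda>r. ?F r s) \<in> borel_measurable lborel" by measurable
      qed measurable
      then show ?thesis by simp
    qed (simp add: w0)
  qed
  finally show ?thesis .
qed

theorem lemma5p7:
  fixes n :: nat
    and \<gamma> \<epsilon> :: real
    and \<Omega> :: "'a::euclidean_space set"
    and K :: "'a \<Rightarrow> 'a \<Rightarrow> real"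
    and \<kappa> :: "real \<Rightarrow> real"
  assumes "n \<ge> 2"
    and "DIM('a) = n + 1"
    and "\<gamma> > 0"
    and "\<epsilon> > 0"
    and "finite_perimeter \<Omega>"
    and "helmholtz_kernel \<epsilon> K"
    and "\<And>x y. x \<in> unit_sphere \<Longrightarrow> y \<in> unit_sphere \<Longrightarrow> x \<noteq> y \<Longrightarrow> K x y = \<kappa> (geodesic_dist x y)"
  shows "energy \<gamma> \<epsilon> K \<Omega> =
    (1 - \<gamma> / gamma_eps n \<epsilon> K) * perimeter \<Omega> +
    2 * \<gamma> * (LINT r:{0<..<pi}|lebesgue. integrated_kernel n \<epsilon> \<kappa> r *
      (deriv (autocorrelation n \<Omega>) r - vector_derivative (autocorrelation n \<Omega>) (at_right 0)))"
proof -
  have dim: "DIM('a) \<ge> 3" and dim1: "DIM('a) - 2 = n - 1" using assms(1,2) by auto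
  have \<Omega>: "\<Omega> \<in> sets sphere_vol" using assms(5) by (simp add: finite_perimeter_def)
  obtain A N where A: "A \<in> sets borel" "A \<subseteq> unit_sphere" and N: "N \<in> sets borel" "AE x in sphV. x \<notin> N"
    "\<And>x. x \<notin> N \<Longrightarrow> x \<in> \<Omega> \<longleftrightarrow> x \<in> A"
    using sets_sphere_vol_borel[OF \<Omega>] by metis
  define V where "V = perimeter \<Omega>"
  note var = perimeter_attained[OF dim A N assms(5), folded V_def]
  define c where "c = frame_corr A"
  define \<sigma> where "\<sigma> = sigma (n - 1)"
  define w where "w r = indicator {0<..<pi} r * (\<kappa> r * sin r ^ (n - 1))" for r
  \<comment> \<open>The value of -c'(0): half of \<open>abs_mean\<close> times the perimeter,
    divided by \<open>sigma (n - 1)\<close>.\<close>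
  define b where "b = k_const n * V / 2"
  have \<sigma>: "\<sigma> > 0" "k_const n * \<sigma> = abs_mean TYPE('a)"
    using k_const_sigma[OF assms(2,1)] by (auto simp: \<sigma>_def)
  have ac: "autocorrelation n \<Omega> = c"
    unfolding c_def by (rule autocorrelation_eq_frame_corr[OF dim A N assms(2)])
  define L where "L = abs_mean TYPE('a) * V / \<sigma>"
  have lip: "\<bar>c r - c s\<bar> \<le> L * \<bar>r - s\<bar>" for r s
    unfolding c_def L_def \<sigma>_def dim1[symmetric] by (rule frame_corr_lipschitz[OF dim A var])
  have "(c has_vector_derivative - (abs_mean TYPE('a) * V / (2 * \<sigma>))) (at_right 0)"
    unfolding c_def \<sigma>_def dim1[symmetric] by (rule frame_corr_derivative[OF dim A var])
  moreover have "abs_mean TYPE('a) * V / (2 * \<sigma>) = b" using \<sigma>(1) unfolding b_def \<sigma>(2)[symmetric] by simp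
  ultimately have "(c has_vector_derivative - b) (at_right 0)" by simp
  then have c0: "vector_derivative c (at_right 0) = - b"
    by (rule vector_derivative_within[rotated]) simp
  obtain g where g [measurable]: "g \<in> borel_measurable borel" and gL: "\<And>x. \<bar>g x\<bar> \<le> L"
    and gi: "\<And>a b. a \<le> b \<Longrightarrow> (LINT x|lborel. indicator {a..b} x * g x) = c b - c a"
    and gd: "AE x in lborel. (c has_real_derivative g x) (at x)"
    by (rule lipschitz_AE_derivative[OF lip]) (rule that)
  have L: "L \<ge> 0" using order_trans[OF abs_ge_zero gL] .
  have w: "integrable lborel w" unfolding w_def dim1[symmetric] by (rule integrable_profile[OF dim assms(6,7)])
  have [measurable]: "w \<in> borel_measurable borel" using borel_measurable_integrable[OF w] by simp
  \<comment> \<open>The tail of the radial weight; as w vanishes from pi on, \<sigma> / \<epsilon>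
    times W is the integrated kernel.\<close>
  define W where "W r = (\<integral>s. indicator {r<..} s * w s \<partial>lborel)" for r
  have [measurable]: "W \<in> borel_measurable borel"
    unfolding W_def by measurable
  have \<Phi>: "integrated_kernel n \<epsilon> \<kappa> r = \<sigma> / \<epsilon> * W r" if "r \<in> {0<..<pi}" for r
  proof -
    have "(LINT s:{r<..<pi}|lebesgue. \<kappa> s * sin s ^ (n - 1)) = (\<integral>s. indicator {r<..} s * w s \<partial>lebesgue)"
      unfolding set_lebesgue_integral_def using that
      by (intro Bochner_Integration.integral_cong refl) (auto simp: w_def indicator_def)
    also have "\<dots> = W r" unfolding W_def by (rule integral_completion) measurable
    finally show ?thesis by (simp add: integrated_kernel_def \<sigma>_def)
  qed
  \<comment> \<open>Almost everywhere this is c'(r) - c'(0), with the bounded Borel representative g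
    in place of the derivative.\<close>
  define h where "h r = g r + b" for r
  have [measurable]: "h \<in> borel_measurable borel" unfolding h_def by measurable
  have "(LINT r:{0<..<pi}|lebesgue. integrated_kernel n \<epsilon> \<kappa> r * (deriv c r - vector_derivative c (at_right 0))) =
      (\<integral>r. \<sigma> / \<epsilon> * (indicator {0<..<pi} r * (W r * h r)) \<partial>lborel)"
    unfolding set_lebesgue_integral_def
  proof (rule integral_completion_AE)
    show "AE r in lebesgue. indicator {0<..<pi} r *\<^sub>R (integrated_kernel n \<epsilon> \<kappa> r * (deriv c r - vector_derivative c (at_right 0))) =
        \<sigma> / \<epsilon> * (indicator {0<..<pi} r * (W r * h r))"
      by (rule eventually_mono[OF AE_completion[OF gd]])
        (auto simp: indicator_def \<Phi> c0 h_def dest: DERIV_imp_deriv)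
  qed measurable
  also have "\<dots> = \<sigma> / \<epsilon> * (\<integral>r. indicator {0<..<pi} r * (W r * h r) \<partial>lborel)" by simp
  also have "(\<integral>r. indicator {0<..<pi} r * (W r * h r) \<partial>lborel) = (\<integral>s. w s * (\<integral>r. indicator {0..s} r * h r \<partial>lborel) \<partial>lborel)"
    unfolding W_def
  proof (rule lborel_primitive_swap[OF w])
    show "\<bar>h r\<bar> \<le> L + \<bar>b\<bar>" for r using gL[of r] by (simp add: h_def)
  qed (auto simp: w_def)
  also have "\<dots> = (\<integral>s. w s * (c s - c 0) + b * (s * w s) \<partial>lborel)"
  proof (intro Bochner_Integration.integral_cong refl)
    fix s
    have "(\<integral>r. indicator {0..s} r * h r \<partial>lborel) = c s - c 0 + b * s" if s: "0 \<le> s"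
    proof -
      have i: "integrable lborel (\<lambda>r. L * indicator {0..s} r)" "integrable lborel (\<lambda>r. indicator {0..s} r * b)"
        using s by (intro integrable_mult_right integrable_mult_left integrable_real_indicator; simp)+
      have "integrable lborel (\<lambda>r. indicator {0..s} r * g r)"
        by (rule Bochner_Integration.integrable_bound[OF i(1)]) (auto simp: indicator_def abs_mult intro!: AE_I2 order_trans[OF gL] abs_ge_self)
      then have "(\<integral>r. indicator {0..s} r * h r \<partial>lborel) = (\<integral>r. indicator {0..s} r * g r \<partial>lborel) + (\<integral>r. indicator {0..s} r * b \<partial>lborel)"
        using i(2) by (simp add: h_def distrib_left)
      then show ?thesis using gi[OF s] s by simp
    qed
    moreover have "w s = 0" if "\<not> 0 \<le> s" using that by (simp add: w_def)
    ultimately show "w s * (\<integral>r. indicator {0..s} r * h r \<partial>lborel) = w s * (c s - c 0) + b * (s * w s)"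
      by (cases "0 \<le> s") (simp_all add: distrib_left mult_ac)
  qed
  \<comment> \<open>Splitting needs integrability of both parts: the Lipschitz bound controls c s -
    c 0 by L * pi on the support of w, and s is at most pi there.\<close>
  also have "\<dots> = (\<integral>s. w s * (c s - c 0) \<partial>lborel) + b * (\<integral>s. s * w s \<partial>lborel)"
  proof -
    have "integrable lborel (\<lambda>s. (L * pi) * w s)" using w by simp
    then have "integrable lborel (\<lambda>s. w s * (c s - c 0))"
    proof (rule Bochner_Integration.integrable_bound)
      have "c \<in> borel_measurable borel"
      proof (intro borel_measurable_continuous_onI lipschitz_on_continuous_on)
        show "(L)-lipschitz_on UNIV c"
          using lip L by (auto simp: lipschitz_on_def dist_real_def)
      qed
      then show "(\<lambda>s. w s * (c s - c 0)) \<in> borel_measurable lborel" by simp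
      have "\<bar>w s\<bar> * \<bar>c s - c 0\<bar> \<le> (L * pi) * \<bar>w s\<bar>" for s
      proof (cases "s \<in> {0<..<pi}")
        case True
        then have "\<bar>c s - c 0\<bar> \<le> L * pi" using L by (intro order_trans[OF lip] mult_left_mono) auto
        then show ?thesis by (subst mult.commute) (rule mult_right_mono, simp_all)
      qed (simp add: w_def)
      then show "AE s in lborel. norm (w s * (c s - c 0)) \<le> norm ((L * pi) * w s)"
        using L by (intro AE_I2) (simp add: abs_mult)
    qed
    moreover have "integrable lborel (\<lambda>s. pi * w s)" using w by simp
    then have "integrable lborel (\<lambda>s. s * w s)"
    proof (rule Bochner_Integration.integrable_bound)
      show "AE s in lborel. norm (s * w s) \<le> norm (pi * w s)"
        by (intro AE_I2) (auto simp: w_def indicator_def abs_mult intro!: mult_right_mono)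
    qed simp
    ultimately show ?thesis by simp
  qed
  finally have rhs: "(LINT r:{0<..<pi}|lebesgue. integrated_kernel n \<epsilon> \<kappa> r * (deriv c r - vector_derivative c (at_right 0))) =
    \<sigma> / \<epsilon> * ((\<integral>s. w s * (c s - c 0) \<partial>lborel) + b * (\<integral>s. s * w s \<partial>lborel))" .
  have fd: "flow_diff A r = 2 * \<sigma> * (c 0 - c r)" for r
    unfolding c_def \<sigma>_def dim1[symmetric] by (rule flow_diff_frame_corr[OF dim A var])
  have "(\<integral>(x, y). K x y * \<bar>indicator \<Omega> x - indicator \<Omega> y\<bar> \<partial>(sphere_vol \<Otimes>\<^sub>M sphere_vol)) = (\<integral>r. w r * flow_diff A r \<partial>lborel)"
    unfolding w_def dim1[symmetric]
    by (rule energy_double_integral[OF dim assms(6) _ \<Omega> A(1) N(1,2)]) (fact assms(7), fact N(3))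
  also have "\<dots> = (\<integral>r. - 2 * \<sigma> * (w r * (c r - c 0)) \<partial>lborel)"
    by (intro Bochner_Integration.integral_cong refl) (simp add: fd algebra_simps)
  also have "\<dots> = - 2 * \<sigma> * (\<integral>s. w s * (c s - c 0) \<partial>lborel)" by simp
  finally have lhs: "energy \<gamma> \<epsilon> K \<Omega> = V + \<gamma> / \<epsilon> * (2 * \<sigma> * (\<integral>s. w s * (c s - c 0) \<partial>lborel))"
    by (simp add: energy_def V_def)
  have "\<gamma> / gamma_eps n \<epsilon> K = \<gamma> * (1 / gamma_eps n \<epsilon> K)" by simp
  also have "\<dots> = \<gamma> * (k_const n * (\<sigma> / \<epsilon> * (\<integral>s. s * w s \<partial>lborel)))"
    unfolding w_def \<sigma>_def dim1[symmetric]
    by (rule arg_cong[OF inverse_gamma_eps[OF dim assms(6)]]) (fact assms(7))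
  \<comment> \<open>The c-difference terms agree on both sides. The remaining term 2 \<gamma>
    \<sigma> / \<epsilon> * b times the integral of s w is \<gamma> / \<open>gamma_eps\<close> times
    the perimeter, since b is half of \<open>k_const n\<close> times the perimeter, and it cancels
    the correction in front.\<close>
  finally show ?thesis
    unfolding lhs ac rhs by (simp add: V_def[symmetric] b_def algebra_simps add_divide_distrib diff_divide_distrib)
qed

end
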